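(* Let $\Omega=\mathbb{R}^d$ with $1\le d\le3$, let $\lambda\in\mathbb{R}\setminus\{0\}$, and let $u_0\in H^2(\mathbb{R}^d)\cap L^2_2$. Let $u,u^\varepsilon\in L^\infty_{\rm loc}(\mathbb{R};H^2(\mathbb{R}^d)\cap L^2_2)$ be the (unique, global) solutions of $$ i\partial_t u+\Delta u=\lambda u\ln(|u|^2),\qquad i\partial_t u^\varepsilon+\Delta u^\varepsilon=\lambda u^\varepsilon\ln\big((\varepsilon+|u^\varepsilon|)^2\big)\quad\text{on }\mathbb{R}^d,\ t>0,$$ with $u(\cdot,0)=u^\varepsilon(\cdot,0)=u_0$. Then for any $T>0$ there are constants $C_1,C_2>0$ independent of $\varepsilon$ such that for all sufficiently small $\varepsilon>0$, $$\|u^\varepsilon-u\|_{L^\infty(0,T;L^2(\mathbb{R}^d))}\le C_1\varepsilon^{\frac{4}{4+d}},\qquad \|u^\varepsilon-u\|_{L^\infty(0,T;H^1(\mathbb{R}^d))}\le C_2\varepsilon^{\frac{2}{4+d}},$$ where $C_1$ depends on $d$, $|\lambda|$, $T$, $\|u_0\|_{L^2_2}$, and $C_2$ depends additionally on $\|u_0\|_{H^2(\mathbb{R}^d)}$.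
   Context: Functions are complex-valued; $z\ln(|z|^2)$ is understood as $0$ at $z=0$. $L^2_2:=\{v\in L^2(\mathbb{R}^d):\langle\mathbf{x}\rangle^2v\in L^2(\mathbb{R}^d)\}$ with $\langle\mathbf{x}\rangle:=\sqrt{1+|\mathbf{x}|^2}$ and norm $\|v\|_{L^2_2}:=\|\langle\mathbf{x}\rangle^2v\|_{L^2(\mathbb{R}^d)}$. *)

theory Defs
  imports "HOL-Probability.Essential_Supremum"
begin

section \<open>Smooth functions and test functions\<close>

definition dir_deriv :: "'a::real_normed_vector \<Rightarrow> ('a \<Rightarrow> complex) \<Rightarrow> 'a \<Rightarrow> complex" where
  "dir_deriv b f x = vector_derivative (\<lambda>s::real. f (x + s *\<^sub>R b)) (at 0)"

fun iter_deriv :: "'a::real_normed_vector list \<Rightarrow> ('a \<Rightarrow> complex) \<Rightarrow> 'a \<Rightarrow> complex" where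
  "iter_deriv [] f = f"
| "iter_deriv (b # bs) f = dir_deriv b (iter_deriv bs f)"

text \<open>Being infinitely differentiable: all iterated partial derivatives are (Frechet) differentiable
  everywhere, hence in particular continuous.\<close>

definition smooth :: "('a::euclidean_space \<Rightarrow> complex) \<Rightarrow> bool" where
  "smooth f \<longleftrightarrow> (\<forall>bs \<in> lists Basis. \<forall>x. iter_deriv bs f differentiable (at x))"

definition test_functions :: "'a::euclidean_space set \<Rightarrow> ('a \<Rightarrow> complex) set" where
  "test_functions U =
     {\<phi>. smooth \<phi> \<and> compact (closure {x. \<phi> x \<noteq> 0}) \<and> closure {x. \<phi> x \<noteq> 0} \<subseteq> U}"

section \<open>Lebesgue and Sobolev spaces on the whole space\<close>

text \<open>Elements of $L^2$ are represented by Borel functions; nothing below distinguishes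
  functions that are equal almost everywhere.\<close>

definition L2 :: "('a::euclidean_space \<Rightarrow> complex) set" where
  "L2 = {v \<in> borel_measurable lborel. integrable lborel (\<lambda>x. (cmod (v x))\<^sup>2)}"

definition L2_norm :: "('a::euclidean_space \<Rightarrow> complex) \<Rightarrow> real" where
  "L2_norm v = sqrt (\<integral>x. (cmod (v x))\<^sup>2 \<partial>lborel)"

definition has_weak_deriv ::
  "('a::euclidean_space \<Rightarrow> complex) \<Rightarrow> 'a list \<Rightarrow> ('a \<Rightarrow> complex) \<Rightarrow> bool" where
  "has_weak_deriv v bs g \<longleftrightarrow>
     (\<forall>\<phi> \<in> test_functions UNIV.
        (\<integral>x. v x * iter_deriv bs \<phi> x \<partial>lborel) = (-1) ^ length bs * (\<integral>x. g x * \<phi> x \<partial>lborel))"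

definition deriv_lists :: "nat \<Rightarrow> 'a::euclidean_space list set" where
  "deriv_lists k = {bs \<in> lists Basis. length bs \<le> k}"

definition Sobolev :: "nat \<Rightarrow> ('a::euclidean_space \<Rightarrow> complex) set" where
  "Sobolev k = {v \<in> L2. \<forall>bs \<in> deriv_lists k. \<exists>g \<in> L2. has_weak_deriv v bs g}"

text \<open>Meaningful only for functions with a weak derivative in $L^2$, which is unique almost
  everywhere.\<close>

definition weak_deriv ::
  "'a::euclidean_space list \<Rightarrow> ('a \<Rightarrow> complex) \<Rightarrow> 'a \<Rightarrow> complex" where
  "weak_deriv bs v = (SOME g. g \<in> L2 \<and> has_weak_deriv v bs g)"

text \<open>The sum over ordered lists of directions is
  $\|v\|_{H^k}^2 = \sum_{j \le k} \|D^j v\|_{L^2}^2$ with the Frobenius norm of the tensor $D^j v$.\<close>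

definition Sobolev_norm :: "nat \<Rightarrow> ('a::euclidean_space \<Rightarrow> complex) \<Rightarrow> real" where
  "Sobolev_norm k v = sqrt (\<Sum>bs \<in> deriv_lists k. (L2_norm (weak_deriv bs v))\<^sup>2)"

definition jbracket :: "'a::euclidean_space \<Rightarrow> real" where
  "jbracket x = sqrt (1 + (norm x)\<^sup>2)"

definition L22 :: "('a::euclidean_space \<Rightarrow> complex) set" where
  "L22 = {v \<in> L2. (\<lambda>x. of_real ((jbracket x)\<^sup>2) * v x) \<in> L2}"

definition L22_norm :: "('a::euclidean_space \<Rightarrow> complex) \<Rightarrow> real" where
  "L22_norm v = L2_norm (\<lambda>x. of_real ((jbracket x)\<^sup>2) * v x)"

section \<open>Functions of time with values in a function space\<close>

text \<open>The norm of $L^\infty(I; X)$, where \<open>X\<close> is a space of functions with norm \<open>N\<close>.\<close>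

definition Linf_norm ::
  "real set \<Rightarrow> 'v set \<Rightarrow> ('v \<Rightarrow> real) \<Rightarrow> (real \<Rightarrow> 'v) \<Rightarrow> ereal" where
  "Linf_norm I X N w =
     (if (AE t in lebesgue_on I. w t \<in> X)
      then esssup (lebesgue_on I) (\<lambda>t. ereal (N (w t))) else \<infinity>)"

text \<open>$u \in L^\infty_{loc}(R; H^2 \cap L^2_2)$. As the space is separable, measurability of
  a function with values in it is joint measurability in time and space.\<close>

definition Linf_loc_H2_L22 :: "(real \<Rightarrow> 'a::euclidean_space \<Rightarrow> complex) \<Rightarrow> bool" where
  "Linf_loc_H2_L22 u \<longleftrightarrow>
     (\<lambda>(t, x). u t x) \<in> borel_measurable borel \<and>
     (\<forall>T>0. Linf_norm {-T<..<T} (Sobolev 2 \<inter> L22) (\<lambda>v. Sobolev_norm 2 v + L22_norm v) u < \<infinity>)"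

definition continuous_into_L2 :: "real set \<Rightarrow> (real \<Rightarrow> 'a::euclidean_space \<Rightarrow> complex) \<Rightarrow> bool" where
  "continuous_into_L2 I u \<longleftrightarrow>
     (\<forall>t\<in>I. u t \<in> L2) \<and>
     (\<forall>t\<in>I. ((\<lambda>s. L2_norm (\<lambda>x. u s x - u t x)) \<longlongrightarrow> 0) (at t within I))"

section \<open>Nonlinear Schroedinger equations with logarithmic nonlinearity\<close>

text \<open>Since \<open>ln 0 = 0\<close>, the first function vanishes at 0 as it should.\<close>

definition log_nonlin :: "real \<Rightarrow> complex \<Rightarrow> complex" where
  "log_nonlin lam z = of_real lam * z * of_real (ln ((cmod z)\<^sup>2))"

definition reg_log_nonlin :: "real \<Rightarrow> real \<Rightarrow> complex \<Rightarrow> complex" where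
  "reg_log_nonlin lam \<epsilon> z = of_real lam * z * of_real (ln ((\<epsilon> + cmod z)\<^sup>2))"

definition dt :: "(real \<times> 'a::euclidean_space \<Rightarrow> complex) \<Rightarrow> real \<times> 'a \<Rightarrow> complex" where
  "dt \<psi> = dir_deriv (1, 0) \<psi>"

definition Laplacian_x :: "(real \<times> 'a::euclidean_space \<Rightarrow> complex) \<Rightarrow> real \<times> 'a \<Rightarrow> complex" where
  "Laplacian_x \<psi> z = (\<Sum>b\<in>Basis. iter_deriv [(0, b), (0, b)] \<psi> z)"

text \<open>$i \partial_t u + \Delta u = F(u)$ for positive times, in the sense of distributions.\<close>

definition solves_NLS ::
  "(complex \<Rightarrow> complex) \<Rightarrow> (real \<Rightarrow> 'a::euclidean_space \<Rightarrow> complex) \<Rightarrow> bool" where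
  "solves_NLS F u \<longleftrightarrow>
     (\<forall>\<psi> \<in> test_functions ({0<..} \<times> UNIV).
        (\<integral>(t, x). u t x * (- \<i> * dt \<psi> (t, x) + Laplacian_x \<psi> (t, x)) \<partial>lborel)
        = (\<integral>(t, x). F (u t x) * \<psi> (t, x) \<partial>lborel))"

text \<open>Solutions in $L^\infty_{loc}(R; H^2 \cap L^2_2)$ of the initial value problem. By the
  equation, such a solution has $\partial_t u \in L^\infty_{loc}([0,\infty); L^2)$ and is, after modification on
  a null set of times, continuous with values in $L^2$; the initial condition refers to
  this continuous representative.\<close>

definition NLS_solution ::
  "(complex \<Rightarrow> complex) \<Rightarrow> ('a::euclidean_space \<Rightarrow> complex) \<Rightarrow> (real \<Rightarrow> 'a \<Rightarrow> complex) \<Rightarrow> bool" where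
  "NLS_solution F u0 u \<longleftrightarrow>
     Linf_loc_H2_L22 u \<and> continuous_into_L2 {0..} u \<and> solves_NLS F u \<and>
     (AE x in lborel. u 0 x = u0 x)"

end

theory Submission
  imports Defs "HOL-Computational_Algebra.Polynomial" "HOL-Real_Asymp.Real_Asymp"
begin

text \<open>Write \<open>F\<^sub>\<epsilon>\<close> for the nonlinearity \<open>reg_log_nonlin lam \<epsilon>\<close>, so that \<open>F\<^sub>0\<close> is the logarithmic one
  (\<open>log_nonlin_eq\<close>), \<open>u\<close> for the solution with \<open>F\<^sub>0\<close>, \<open>v\<close> for the one with \<open>F\<^sub>\<epsilon>\<close>, and \<open>d\<close> for the dimension.
  The difference \<open>e = v - u\<close> solves a Schroedinger equation with the right-hand side
  \<open>(F\<^sub>\<epsilon> v - F\<^sub>\<epsilon> u) + (F\<^sub>\<epsilon> u - F\<^sub>0 u)\<close> and the initial value zero.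

  The estimate in \<open>L2\<close> is an energy estimate. Although \<open>F\<^sub>\<epsilon>\<close> has a Lipschitz constant of size
  \<open>ln (1 / \<epsilon>)\<close>, only the imaginary part of \<open>(F\<^sub>\<epsilon> v - F\<^sub>\<epsilon> u) * cnj (v - u)\<close> enters, and it is bounded by
  \<open>2 * \<bar>lam\<bar> * (cmod (v - u))\<^sup>2\<close> (\<open>reg_log_nonlin_Im\<close>). By Gronwall's lemma the error is controlled by the source
  \<open>F\<^sub>\<epsilon> u - F\<^sub>0 u\<close>, which depends on \<open>u\<close> alone. It is at most of size \<open>\<epsilon>\<close>, and also at most of size
  \<open>sqrt (\<epsilon> * cmod u)\<close>. The first bound is used in a ball of radius \<open>R\<close>, the second one together with the weighted
  norm outside; the squares contribute \<open>\<epsilon>\<^sup>2 * R ^ d\<close> and \<open>R powr (- 4)\<close>, which balance for \<open>R = \<epsilon> powr (- 2 / (4 + d))\<close>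
  and give the rate \<open>\<epsilon> powr (4 / (4 + d))\<close>. Since the weighted norm of the fixed function \<open>u\<close> outside
  of large balls tends to zero, the source is even \<open>o\<close> of this rate (\<open>regularisation_error_small\<close>). The range of
  admissible \<open>\<epsilon>\<close> may depend on the solutions, and therefore any positive constants will do.

  For the gradient the equation is tested with \<open>e\<close> itself at a fixed time, so that
  \<open>\<parallel>\<nabla>e\<parallel>\<^sup>2 \<le> (\<parallel>\<partial>\<^sub>t e\<parallel> + \<parallel>F\<^sub>\<epsilon> v - F\<^sub>0 u\<parallel>) * \<parallel>e\<parallel>\<close>; bounding the first factor yields half of the rate. Since the norms of \<open>v\<close> in \<open>H\<^sup>2\<close>
  may depend on \<open>\<epsilon>\<close>, the bound for \<open>\<partial>\<^sub>t e\<close> comes from the stability of the regularised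
  equation under shifts in time (\<open>difference_time_Lipschitz\<close>). In \<open>F\<^sub>\<epsilon> v - F\<^sub>\<epsilon> u\<close> there is a term
  \<open>ln (1 / \<epsilon>) * e\<close>, harmless by the rate in \<open>L2\<close>, and there are terms of the form \<open>z * ln (1 + 2 * z)\<close>
  with \<open>z = cmod u\<close> and \<open>z = cmod e\<close>, which a logarithmic Sobolev inequality (\<open>log_Sobolev\<close>) bounds linearly by the
  gradient. This leads to \<open>\<parallel>\<nabla>e\<parallel>\<^sup>2 \<le> (a + b * \<parallel>\<nabla>e\<parallel>) * \<parallel>e\<parallel>\<close> and hence to \<open>\<parallel>\<nabla>e\<parallel>\<^sup>2 = O(\<parallel>e\<parallel>)\<close> (\<open>grad_square_error\<close>).

  Solutions satisfy the equation only in the sense of distributions. Testing with products of a function of time and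
  one of space turns it into an integrated form (\<open>evolves_if_solves_NLS\<close>). The energy identity is
  proved for convolutions with even kernels, for which the Laplacian drops out by symmetry, and carried over to the limit; the
  convergence is quantified by the Lipschitz dependence on translations that weak derivatives entail.\<close>

section \<open>The space of square integrable functions\<close>

lemma L2_measurable [measurable_dest]: "f \<in> L2 \<Longrightarrow> f \<in> borel_measurable borel"
  by (simp add: L2_def)

lemma L2_integrable: "f \<in> L2 \<Longrightarrow> integrable lborel (\<lambda>x. (cmod (f x))\<^sup>2)"
  by (simp add: L2_def)

lemma L2_norm_nonneg [simp]: "0 \<le> L2_norm f"
  by (simp add: L2_norm_def)

lemma L2_norm_square: "(L2_norm f)\<^sup>2 = (\<integral>x. (cmod (f x))\<^sup>2 \<partial>lborel)"
  by (simp add: L2_norm_def)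

lemma L2_norm_nn_integral:
  assumes "f \<in> L2"
  shows "(\<integral>\<^sup>+x. (ennreal (cmod (f x)))\<^sup>2 \<partial>lborel) = ennreal ((L2_norm f)\<^sup>2)"
  using nn_integral_eq_integral[OF L2_integrable[OF assms]]
  by (simp add: L2_norm_square ennreal_power)

lemma L2I_nn_integral:
  assumes "f \<in> borel_measurable borel"
    and "(\<integral>\<^sup>+x. (ennreal (cmod (f x)))\<^sup>2 \<partial>lborel) \<le> ennreal (c\<^sup>2)" and "0 \<le> c"
  shows "f \<in> L2" "L2_norm f \<le> c"
proof -
  have int: "integrable lborel (\<lambda>x. (cmod (f x))\<^sup>2)"
  proof (rule integrableI_bounded)
    show "(\<integral>\<^sup>+ x. ennreal (norm ((cmod (f x))\<^sup>2)) \<partial>lborel) < \<infinity>"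
      using assms(2) by (auto simp: ennreal_power intro: le_less_trans)
  qed (use assms(1) in measurable)
  then show L2: "f \<in> L2"
    using assms(1) by (simp add: L2_def)
  have "ennreal ((L2_norm f)\<^sup>2) \<le> ennreal (c\<^sup>2)"
    using assms(2) L2_norm_nn_integral[OF L2] by simp
  then show "L2_norm f \<le> c"
    using assms(3) by (simp add: ennreal_le_iff power2_le_iff_abs_le)
qed

lemma L2I_square_bound:
  assumes "f \<in> borel_measurable borel"
    and "integrable lborel g" and "AE x in lborel. (cmod (f x))\<^sup>2 \<le> g x"
  shows "f \<in> L2" "(L2_norm f)\<^sup>2 \<le> (\<integral>x. g x \<partial>lborel)"
proof -
  have int: "integrable lborel (\<lambda>x. (cmod (f x))\<^sup>2)"
    by (rule Bochner_Integration.integrable_bound[OF assms(2)])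
       (use assms in \<open>auto elim!: eventually_mono\<close>)
  then show "f \<in> L2"
    using assms(1) by (simp add: L2_def)
  show "(L2_norm f)\<^sup>2 \<le> (\<integral>x. g x \<partial>lborel)"
    unfolding L2_norm_square by (rule integral_mono_AE[OF int assms(2,3)])
qed

lemma L2I_bound:
  assumes "f \<in> borel_measurable borel" "g \<in> L2" "AE x in lborel. cmod (f x) \<le> cmod (g x)"
  shows "f \<in> L2" "L2_norm f \<le> L2_norm g"
proof -
  have *: "AE x in lborel. (cmod (f x))\<^sup>2 \<le> (cmod (g x))\<^sup>2"
    using assms(3) by (auto elim!: eventually_mono intro: power_mono)
  show "f \<in> L2"
    by (rule L2I_square_bound[OF assms(1) L2_integrable[OF assms(2)] *])
  have "(L2_norm f)\<^sup>2 \<le> (L2_norm g)\<^sup>2"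
    using L2I_square_bound(2)[OF assms(1) L2_integrable[OF assms(2)] *]
    by (simp add: L2_norm_square)
  then show "L2_norm f \<le> L2_norm g"
    by (simp add: power2_le_iff_abs_le)
qed

lemma L2_norm_cong_AE:
  assumes "f \<in> borel_measurable borel" "g \<in> borel_measurable borel" "AE x in lborel. f x = g x"
  shows "L2_norm f = L2_norm g"
  unfolding L2_norm_def using assms(3)
  by (intro arg_cong[where f=sqrt] integral_cong_AE) (use assms in auto)

lemma L2_zero [simp]: "(\<lambda>x. 0) \<in> L2" "L2_norm (\<lambda>x. 0) = 0"
  by (simp_all add: L2_def L2_norm_def)

lemma L2_scale [intro]:
  assumes "f \<in> L2" shows "(\<lambda>x. c * f x) \<in> L2"
  using assms by (auto simp: L2_def norm_mult power_mult_distrib)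

lemma L2_norm_scale: "L2_norm (\<lambda>x. c * f x) = cmod c * L2_norm f"
  by (simp add: L2_norm_def norm_mult power_mult_distrib real_sqrt_mult)

lemma cnj_measurable [measurable]: "cnj \<in> borel_measurable borel"
  by (intro borel_measurable_continuous_onI continuous_on_cnj continuous_on_id)

lemma L2_cnj [intro]: "f \<in> L2 \<Longrightarrow> (\<lambda>x. cnj (f x)) \<in> L2"
  by (auto simp: L2_def intro!: borel_measurable_continuous_on[OF continuous_on_cnj])

lemma L2_norm_cnj [simp]: "L2_norm (\<lambda>x. cnj (f x)) = L2_norm f"
  by (simp add: L2_norm_def)

lemma L2_uminus [intro]: "f \<in> L2 \<Longrightarrow> (\<lambda>x. - f x) \<in> L2"
  by (auto simp: L2_def)

lemma L2_add [intro]: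
  assumes "f \<in> L2" "g \<in> L2" shows "(\<lambda>x. f x + g x) \<in> L2"
proof (rule L2I_square_bound)
  show "AE x in lborel. (cmod (f x + g x))\<^sup>2 \<le> 2 * (cmod (f x))\<^sup>2 + 2 * (cmod (g x))\<^sup>2"
  proof (rule AE_I2)
    fix x
    have "(cmod (f x + g x))\<^sup>2 \<le> (cmod (f x) + cmod (g x))\<^sup>2"
      by (intro power_mono norm_triangle_ineq) auto
    also have "\<dots> \<le> 2 * (cmod (f x))\<^sup>2 + 2 * (cmod (g x))\<^sup>2"
      using sum_squares_bound[of "cmod (f x)" "cmod (g x)"] by (simp add: power2_sum)
    finally show "(cmod (f x + g x))\<^sup>2 \<le> 2 * (cmod (f x))\<^sup>2 + 2 * (cmod (g x))\<^sup>2" .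
  qed
qed (use assms in \<open>auto simp: L2_def\<close>)

lemma L2_diff [intro]:
  assumes "f \<in> L2" "g \<in> L2" shows "(\<lambda>x. f x - g x) \<in> L2"
  using L2_add[OF assms(1) L2_uminus[OF assms(2)]] by simp

lemma L2_sum [intro]:
  assumes "\<And>i. i \<in> I \<Longrightarrow> f i \<in> L2" shows "(\<lambda>x. \<Sum>i\<in>I. f i x) \<in> L2"
  using assms by (induction I rule: infinite_finite_induct) auto

definition pairing :: "('a::euclidean_space \<Rightarrow> complex) \<Rightarrow> ('a \<Rightarrow> complex) \<Rightarrow> complex" where
  "pairing f g = (\<integral>x. f x * g x \<partial>lborel)"

lemma ennreal_le_of_square_le:
  assumes "x\<^sup>2 \<le> (ennreal c)\<^sup>2" "0 \<le> c" shows "x \<le> ennreal c"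
proof (cases x)
  case (real r)
  then show ?thesis
    using assms by (simp add: ennreal_power ennreal_le_iff power2_le_iff_abs_le)
next
  case top
  then show ?thesis using assms by (simp add: ennreal_power top_unique)
qed

lemma nn_Cauchy_Schwarz:
  assumes "f \<in> L2" "g \<in> L2"
  shows "(\<integral>\<^sup>+x. ennreal (cmod (f x)) * ennreal (cmod (g x)) \<partial>lborel) \<le> ennreal (L2_norm f * L2_norm g)"
proof -
  note [measurable] = L2_measurable[OF assms(1)] L2_measurable[OF assms(2)]
  have "(\<integral>\<^sup>+x. ennreal (cmod (f x)) * ennreal (cmod (g x)) \<partial>lborel)\<^sup>2
      \<le> (\<integral>\<^sup>+x. (ennreal (cmod (f x)))\<^sup>2 \<partial>lborel) * (\<integral>\<^sup>+x. (ennreal (cmod (g x)))\<^sup>2 \<partial>lborel)"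
    by (rule Cauchy_Schwarz_nn_integral) measurable
  also have "\<dots> = (ennreal (L2_norm f * L2_norm g))\<^sup>2"
    unfolding L2_norm_nn_integral[OF assms(1)] L2_norm_nn_integral[OF assms(2)]
    by (simp add: ennreal_mult'[symmetric] ennreal_power power_mult_distrib)
  finally show ?thesis
    by (rule ennreal_le_of_square_le) simp
qed


lemma integrable_mult_L2:
  assumes "f \<in> L2" "g \<in> L2"
  shows "integrable lborel (\<lambda>x. f x * g x)" "(\<integral>x. cmod (f x * g x) \<partial>lborel) \<le> L2_norm f * L2_norm g"
proof -
  note [measurable] = L2_measurable[OF assms(1)] L2_measurable[OF assms(2)]
  have *: "(\<integral>\<^sup>+x. ennreal (cmod (f x * g x)) \<partial>lborel) \<le> ennreal (L2_norm f * L2_norm g)"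
    using nn_Cauchy_Schwarz[OF assms] by (simp add: norm_mult ennreal_mult')
  show int: "integrable lborel (\<lambda>x. f x * g x)"
    by (rule integrableI_bounded) (use * in \<open>auto intro: le_less_trans\<close>)
  show "(\<integral>x. cmod (f x * g x) \<partial>lborel) \<le> L2_norm f * L2_norm g"
    using * nn_integral_eq_integral[OF integrable_norm[OF int]] by simp
qed

lemma pairing_Cauchy_Schwarz:
  assumes "f \<in> L2" "g \<in> L2"
  shows "cmod (pairing f g) \<le> L2_norm f * L2_norm g"
  unfolding pairing_def
  using integral_norm_bound[of lborel "\<lambda>x. f x * g x"] integrable_mult_L2(2)[OF assms] by linarith

lemma pairing_commute: "pairing f g = pairing g f"
  by (simp add: pairing_def mult.commute)

lemma pairing_add_left:
  assumes "f \<in> L2" "g \<in> L2" "h \<in> L2"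
  shows "pairing (\<lambda>x. f x + g x) h = pairing f h + pairing g h"
  unfolding pairing_def distrib_right
  by (rule Bochner_Integration.integral_add) (intro integrable_mult_L2 assms)+

lemma pairing_diff_left:
  assumes "f \<in> L2" "g \<in> L2" "h \<in> L2"
  shows "pairing (\<lambda>x. f x - g x) h = pairing f h - pairing g h"
  unfolding pairing_def left_diff_distrib
  by (rule Bochner_Integration.integral_diff) (intro integrable_mult_L2 assms)+

lemma pairing_scale_left: "pairing (\<lambda>x. c * f x) h = c * pairing f h"
  by (simp add: pairing_def mult.assoc)

lemma pairing_sum_left:
  assumes "\<And>i. i \<in> I \<Longrightarrow> f i \<in> L2" "h \<in> L2"
  shows "pairing (\<lambda>x. \<Sum>i\<in>I. f i x) h = (\<Sum>i\<in>I. pairing (f i) h)"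
  unfolding pairing_def sum_distrib_right
  by (rule Bochner_Integration.integral_sum) (intro integrable_mult_L2 assms)

lemma pairing_add_right:
  assumes "f \<in> L2" "g \<in> L2" "h \<in> L2"
  shows "pairing h (\<lambda>x. f x + g x) = pairing h f + pairing h g"
  using pairing_add_left[OF assms] by (simp add: pairing_commute)

lemma pairing_diff_right:
  assumes "f \<in> L2" "g \<in> L2" "h \<in> L2"
  shows "pairing h (\<lambda>x. f x - g x) = pairing h f - pairing h g"
  using pairing_diff_left[OF assms] by (simp add: pairing_commute)

lemma pairing_scale_right: "pairing h (\<lambda>x. c * f x) = c * pairing h f"
  using pairing_scale_left[of c f h] by (simp add: pairing_commute)

lemma cnj_pairing: "cnj (pairing f g) = pairing (\<lambda>x. cnj (f x)) (\<lambda>x. cnj (g x))"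
  using Bochner_Integration.integral_bounded_linear'[OF bounded_linear_cnj bounded_linear_cnj, of lborel "\<lambda>x. f x * g x"] by (simp add: pairing_def)

lemma pairing_cong_AE:
  assumes "f \<in> borel_measurable borel" "f' \<in> borel_measurable borel" "g \<in> borel_measurable borel"
    and "AE x in lborel. f x = f' x"
  shows "pairing f g = pairing f' g"
  unfolding pairing_def using assms(4)
  by (intro integral_cong_AE) (use assms in auto)

lemma pairing_cnj_self: "pairing f (\<lambda>x. cnj (f x)) = of_real ((L2_norm f)\<^sup>2)"
  unfolding pairing_def L2_norm_square by (simp add: complex_norm_square[symmetric] flip: integral_complex_of_real)

lemma L2_norm_add_square:
  assumes "f \<in> L2" "g \<in> L2"
  shows "(L2_norm (\<lambda>x. f x + g x))\<^sup>2 = (L2_norm f)\<^sup>2 + (L2_norm g)\<^sup>2 + 2 * Re (pairing f (\<lambda>x. cnj (g x)))"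
proof -
  have c: "(\<lambda>x. cnj (f x)) \<in> L2" "(\<lambda>x. cnj (g x)) \<in> L2" using assms by auto
  have "of_real ((L2_norm (\<lambda>x. f x + g x))\<^sup>2) =
     pairing f (\<lambda>x. cnj (f x)) + pairing f (\<lambda>x. cnj (g x)) + (pairing g (\<lambda>x. cnj (f x)) + pairing g (\<lambda>x. cnj (g x)))"
    unfolding pairing_cnj_self[symmetric] complex_cnj_add
    by (simp add: pairing_add_left pairing_add_right assms c L2_add)
  also have "pairing g (\<lambda>x. cnj (f x)) = cnj (pairing f (\<lambda>x. cnj (g x)))"
    by (simp add: cnj_pairing pairing_commute)
  finally show ?thesis
    by (simp add: pairing_cnj_self complex_eq_iff)
qed

lemma L2_norm_triangle:
  assumes "f \<in> L2" "g \<in> L2"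
  shows "L2_norm (\<lambda>x. f x + g x) \<le> L2_norm f + L2_norm g"
proof (rule power2_le_imp_le)
  have "Re (pairing f (\<lambda>x. cnj (g x))) \<le> L2_norm f * L2_norm g"
    using complex_Re_le_cmod[of "pairing f (\<lambda>x. cnj (g x))"] pairing_Cauchy_Schwarz[OF assms(1) L2_cnj[OF assms(2)]]
    by simp
  then show "(L2_norm (\<lambda>x. f x + g x))\<^sup>2 \<le> (L2_norm f + L2_norm g)\<^sup>2"
    unfolding L2_norm_add_square[OF assms] by (simp add: power2_sum)
qed simp

lemma L2_norm_uminus [simp]: "L2_norm (\<lambda>x. - f x) = L2_norm f"
  by (simp add: L2_norm_def)

lemma L2_norm_minus_commute: "L2_norm (\<lambda>x. f x - g x) = L2_norm (\<lambda>x. g x - f x)"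
  by (simp add: L2_norm_def norm_minus_commute)

lemma L2_norm_triangle_diff:
  assumes "f \<in> L2" "g \<in> L2"
  shows "L2_norm (\<lambda>x. f x - g x) \<le> L2_norm f + L2_norm g"
  using L2_norm_triangle[OF assms(1) L2_uminus[OF assms(2)]] by simp

lemma L2_norm_diff_triangle:
  assumes "f \<in> L2" "g \<in> L2" "h \<in> L2"
  shows "L2_norm (\<lambda>x. f x - h x) \<le> L2_norm (\<lambda>x. f x - g x) + L2_norm (\<lambda>x. g x - h x)"
  using L2_norm_triangle[OF L2_diff[OF assms(1,2)] L2_diff[OF assms(2,3)]] by simp

lemma L2_norm_reverse_triangle:
  assumes "f \<in> L2" "g \<in> L2"
  shows "\<bar>L2_norm f - L2_norm g\<bar> \<le> L2_norm (\<lambda>x. f x - g x)"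
  using L2_norm_triangle[OF L2_diff[OF assms] assms(2)] L2_norm_triangle[OF L2_diff[OF assms(2,1)] assms(1)]
    L2_norm_minus_commute[of f g] by simp

lemma L2_translate:
  assumes "f \<in> L2" shows "(\<lambda>x. f (x + y)) \<in> L2" "L2_norm (\<lambda>x. f (x + y)) = L2_norm f"
proof -
  note [measurable] = L2_measurable[OF assms]
  have *: "(\<integral>\<^sup>+x. (ennreal (cmod (f (x + y))))\<^sup>2 \<partial>lborel) = (\<integral>\<^sup>+x. (ennreal (cmod (f x)))\<^sup>2 \<partial>lborel)"
    by (subst (2) lborel_distr_plus[symmetric, of y]) (simp add: nn_integral_distr add.commute)
  show 1: "(\<lambda>x. f (x + y)) \<in> L2"
    by (rule L2I_nn_integral(1)[where c="L2_norm f"]) (simp_all add: * L2_norm_nn_integral[OF assms])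
  have "ennreal ((L2_norm (\<lambda>x. f (x + y)))\<^sup>2) = ennreal ((L2_norm f)\<^sup>2)"
    using * L2_norm_nn_integral[OF assms] L2_norm_nn_integral[OF 1] by simp
  then show "L2_norm (\<lambda>x. f (x + y)) = L2_norm f"
    by (simp add: power2_eq_iff_nonneg)
qed

lemma pairing_translate:
  assumes "f \<in> borel_measurable borel" "g \<in> borel_measurable borel"
  shows "pairing (\<lambda>x. f (x + y)) g = pairing f (\<lambda>x. g (x - y))"
proof -
  note [measurable] = assms
  show ?thesis unfolding pairing_def
    by (subst (2) lborel_distr_plus[symmetric, of y]) (simp add: integral_distr add.commute)
qed

text \<open>Minkowski's integral inequality: an \<open>L2\<close>-valued integral of a jointly measurable family is again in
  \<open>L2\<close>, its norm is at most the integral of the norms, and it may be computed weakly. It is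
  the common source of all estimates for convolutions, translations and time integrals. The square
  of the integral is written as a double integral over two parameters, and the Cauchy--Schwarz
  inequality is applied for each pair of them.\<close>

lemma Minkowski_integral:
  fixes H :: "'b::euclidean_space \<Rightarrow> 'a::euclidean_space \<Rightarrow> complex"
  assumes meas: "(\<lambda>(s, x). H s x) \<in> borel_measurable borel"
    and bound: "AE s in lborel. H s \<in> L2 \<and> L2_norm (H s) \<le> A s"
    and A: "integrable lborel A"
  shows "(\<lambda>x. \<integral>s. H s x \<partial>lborel) \<in> L2"
    and "L2_norm (\<lambda>x. \<integral>s. H s x \<partial>lborel) \<le> (\<integral>s. A s \<partial>lborel)"
    and "AE x in lborel. integrable lborel (\<lambda>s. H s x)"
    and "g \<in> L2 \<Longrightarrow> integrable lborel (\<lambda>(s, x). H s x * g x)"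
    and "g \<in> L2 \<Longrightarrow> integrable lborel (\<lambda>s. pairing (H s) g)"
    and "g \<in> L2 \<Longrightarrow> pairing (\<lambda>x. \<integral>s. H s x \<partial>lborel) g = (\<integral>s. pairing (H s) g \<partial>lborel)"
proof -
  have [measurable]: "(\<lambda>(s, x). H s x) \<in> borel_measurable (lborel \<Otimes>\<^sub>M lborel)"
    using meas by (simp add: lborel_prod)
  have [measurable]: "H s \<in> borel_measurable borel" for s
    using measurable_compose[OF measurable_Pair[OF measurable_const measurable_ident] meas[folded borel_prod], of s]
    by simp
  have [measurable]: "A \<in> borel_measurable borel" using A by auto
  define N where "N x = (\<integral>\<^sup>+s. ennreal (cmod (H s x)) \<partial>lborel)" for x
  have [measurable]: "N \<in> borel_measurable borel" unfolding N_def by measurable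
  have A0: "AE s in lborel. 0 \<le> A s"
    using bound by eventually_elim (use L2_norm_nonneg order_trans in blast)
  define I where "I = (\<integral>s. A s \<partial>lborel)"
  have I: "(\<integral>\<^sup>+s. ennreal (A s) \<partial>lborel) = ennreal I" "0 \<le> I"
    unfolding I_def using nn_integral_eq_integral[OF A A0] integral_nonneg_AE[OF A0] by auto
  have sq: "(N x)\<^sup>2 = (\<integral>\<^sup>+s. \<integral>\<^sup>+s'. ennreal (cmod (H s x)) * ennreal (cmod (H s' x)) \<partial>lborel \<partial>lborel)" for x
    by (simp add: nn_integral_cmult nn_integral_multc N_def power2_eq_square)
  have "(\<integral>\<^sup>+x. (N x)\<^sup>2 \<partial>lborel) =
      (\<integral>\<^sup>+s. \<integral>\<^sup>+x. \<integral>\<^sup>+s'. ennreal (cmod (H s x)) * ennreal (cmod (H s' x)) \<partial>lborel \<partial>lborel \<partial>lborel)"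
    unfolding sq by (rule lborel_pair.Fubini') measurable
  also have "\<dots> = (\<integral>\<^sup>+s. \<integral>\<^sup>+s'. \<integral>\<^sup>+x. ennreal (cmod (H s x)) * ennreal (cmod (H s' x)) \<partial>lborel \<partial>lborel \<partial>lborel)"
    by (intro nn_integral_cong lborel_pair.Fubini') measurable
  also have "\<dots> \<le> (\<integral>\<^sup>+s. \<integral>\<^sup>+s'. ennreal (A s) * ennreal (A s') \<partial>lborel \<partial>lborel)"
  proof (rule nn_integral_mono_AE, use bound in eventually_elim, rule nn_integral_mono_AE)
    fix s assume s: "H s \<in> L2 \<and> L2_norm (H s) \<le> A s"
    then have As: "0 \<le> A s" using L2_norm_nonneg order_trans by blast
    show "AE s' in lborel. (\<integral>\<^sup>+x. ennreal (cmod (H s x)) * ennreal (cmod (H s' x)) \<partial>lborel) \<le> ennreal (A s) * ennreal (A s')"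
      using bound
    proof eventually_elim
      fix s' assume s': "H s' \<in> L2 \<and> L2_norm (H s') \<le> A s'"
      have "L2_norm (H s) * L2_norm (H s') \<le> A s * A s'"
        using s s' As by (intro mult_mono) auto
      then show "(\<integral>\<^sup>+x. ennreal (cmod (H s x)) * ennreal (cmod (H s' x)) \<partial>lborel) \<le> ennreal (A s) * ennreal (A s')"
        using s s' As by (intro order_trans[OF nn_Cauchy_Schwarz]) (simp_all add: ennreal_mult'[symmetric] ennreal_leI)
    qed
  qed
  also have "\<dots> = ennreal (I\<^sup>2)"
    using I by (simp add: nn_integral_cmult nn_integral_multc power2_eq_square ennreal_mult)
  finally have N2: "(\<integral>\<^sup>+x. (N x)\<^sup>2 \<partial>lborel) \<le> ennreal (I\<^sup>2)" .
  have "(\<integral>\<^sup>+x. (N x)\<^sup>2 \<partial>lborel) \<noteq> \<infinity>"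
    using le_less_trans[OF N2, of "\<infinity>"] by auto
  then have "AE x in lborel. (N x)\<^sup>2 \<noteq> \<infinity>"
    by (intro nn_integral_PInf_AE) measurable
  then show 3: "AE x in lborel. integrable lborel (\<lambda>s. H s x)"
  proof eventually_elim
    fix x assume "(N x)\<^sup>2 \<noteq> \<infinity>"
    then have "N x \<noteq> \<infinity>" by (auto simp: power2_eq_square)
    then have "N x < \<infinity>" by (simp add: less_top)
    then show "integrable lborel (\<lambda>s. H s x)"
      unfolding N_def by (intro integrableI_bounded) measurable
  qed
  have le: "ennreal (cmod (\<integral>s. H s x \<partial>lborel)) \<le> N x" for x
  proof (cases "integrable lborel (\<lambda>s. H s x)")
    case True
    then show ?thesis unfolding N_def by (rule integral_norm_bound_ennreal)
  qed (simp add: not_integrable_integral_eq)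
  have "(\<integral>\<^sup>+x. (ennreal (cmod (\<integral>s. H s x \<partial>lborel)))\<^sup>2 \<partial>lborel) \<le> (\<integral>\<^sup>+x. (N x)\<^sup>2 \<partial>lborel)"
    by (intro nn_integral_mono power_mono le) auto
  then have 0: "(\<integral>\<^sup>+x. (ennreal (cmod (\<integral>s. H s x \<partial>lborel)))\<^sup>2 \<partial>lborel) \<le> ennreal (I\<^sup>2)"
    using N2 by (rule order_trans)
  have m: "(\<lambda>x. \<integral>s. H s x \<partial>lborel) \<in> borel_measurable borel" by measurable
  show "(\<lambda>x. \<integral>s. H s x \<partial>lborel) \<in> L2" "L2_norm (\<lambda>x. \<integral>s. H s x \<partial>lborel) \<le> (\<integral>s. A s \<partial>lborel)"
    using L2I_nn_integral[OF m 0 I(2)] by (auto simp: I_def)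
  assume g: "g \<in> L2"
  note [measurable] = L2_measurable[OF g]
  have "(\<integral>\<^sup>+z. ennreal (norm (case z of (s, x) \<Rightarrow> H s x * g x)) \<partial>(lborel \<Otimes>\<^sub>M lborel)) =
      (\<integral>\<^sup>+s. \<integral>\<^sup>+x. ennreal (cmod (H s x)) * ennreal (cmod (g x)) \<partial>lborel \<partial>lborel)"
    by (subst lborel.nn_integral_fst[symmetric]) (auto simp: norm_mult ennreal_mult')
  also have "\<dots> \<le> (\<integral>\<^sup>+s. ennreal (A s) * ennreal (L2_norm g) \<partial>lborel)"
  proof (rule nn_integral_mono_AE, use bound in eventually_elim)
    fix s assume s: "H s \<in> L2 \<and> L2_norm (H s) \<le> A s"
    then have "L2_norm (H s) * L2_norm g \<le> A s * L2_norm g"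
      by (intro mult_right_mono) auto
    then show "(\<integral>\<^sup>+x. ennreal (cmod (H s x)) * ennreal (cmod (g x)) \<partial>lborel) \<le> ennreal (A s) * ennreal (L2_norm g)"
      using s g by (intro order_trans[OF nn_Cauchy_Schwarz]) (simp_all add: ennreal_mult''[symmetric] ennreal_leI)
  qed
  also have "\<dots> = ennreal I * ennreal (L2_norm g)"
    using I by (simp add: nn_integral_multc)
  also have "\<dots> < \<infinity>" by (simp add: ennreal_mult_less_top)
  finally have int: "integrable (lborel \<Otimes>\<^sub>M lborel) (\<lambda>(s, x). H s x * g x)"
    by (intro integrableI_bounded) measurable
  then show "integrable lborel (\<lambda>(s, x). H s x * g x)" by (simp add: lborel_prod)
  show "integrable lborel (\<lambda>s. pairing (H s) g)"
    unfolding pairing_def using lborel_pair.integrable_fst[OF int] by simp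
  show "pairing (\<lambda>x. \<integral>s. H s x \<partial>lborel) g = (\<integral>s. pairing (H s) g \<partial>lborel)"
    unfolding pairing_def using lborel_pair.Fubini_integral[OF int] by simp
qed

section \<open>Smooth bump functions\<close>

text \<open>The functions that vanish for \<open>s \<le> 0\<close> and equal a polynomial in \<open>1 / s\<close> times \<open>exp (- 1 / s)\<close> for
  \<open>s > 0\<close>: a family containing the standard flat function and closed under differentiation.\<close>

definition flat :: "real poly \<Rightarrow> real \<Rightarrow> real" where
  "flat p s = (if s > 0 then poly p (1 / s) * exp (- (1 / s)) else 0)"

definition flat_deriv :: "real poly \<Rightarrow> real poly" where
  "flat_deriv p = [:0, 0, 1:] * (p - pderiv p)"

lemma flat_tendsto_0: "(flat p \<longlongrightarrow> 0) (at 0)"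
proof -
  have "((\<lambda>y. \<Sum>i\<le>degree p. coeff p i * (y ^ i / exp y)) \<longlongrightarrow> (\<Sum>i\<le>degree p. coeff p i * 0)) at_top"
    by (intro tendsto_intros tendsto_power_div_exp_0)
  then have "((\<lambda>y. poly p y * exp (- y)) \<longlongrightarrow> 0) at_top"
    by (simp add: poly_altdef sum_distrib_right exp_minus divide_inverse mult.assoc)
  then have "((\<lambda>s. poly p (1 / s) * exp (- (1 / s))) \<longlongrightarrow> 0) (at_right 0)"
    by (rule filterlim_compose) (simp add: filterlim_inverse_at_top_right divide_inverse)
  then have "(flat p \<longlongrightarrow> 0) (at_right 0)"
    by (rule Lim_transform_eventually)
       (use eventually_at_right_less[of 0] in eventually_elim, simp add: flat_def)
  moreover have "(flat p \<longlongrightarrow> 0) (at_left 0)"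
    by (rule tendsto_eventually) (use eventually_at_left_real[of "-1" 0] in \<open>auto elim!: eventually_mono simp: flat_def\<close>)
  ultimately show ?thesis by (simp add: filterlim_split_at)
qed

lemma flat_has_derivative: "(flat p has_real_derivative flat (flat_deriv p) s) (at s)"
proof -
  consider "s > 0" | "s < 0" | "s = 0" by linarith
  then show ?thesis
  proof cases
    case 1
    have "((\<lambda>s. poly p (1 / s) * exp (- (1 / s))) has_real_derivative flat (flat_deriv p) s) (at s)"
      using 1 by (auto intro!: derivative_eq_intros DERIV_chain2[OF poly_DERIV]
          simp: flat_def flat_deriv_def field_simps power2_eq_square)
    then show ?thesis
      by (rule has_field_derivative_transform_within_open[of _ _ _ "{0<..}"]) (use 1 in \<open>auto simp: flat_def\<close>)
  next
    case 2
    have "((\<lambda>s. 0) has_real_derivative flat (flat_deriv p) s) (at s)"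
      using 2 by (simp add: flat_def)
    then show ?thesis
      by (rule has_field_derivative_transform_within_open[of _ _ _ "{..<0}"]) (use 2 in \<open>auto simp: flat_def\<close>)
  next
    case 3
    have q: "flat ([:0, 1:] * p) h = (flat p (0 + h) - flat p 0) / h" for h
      by (simp add: flat_def)
    have "((\<lambda>h. (flat p (0 + h) - flat p 0) / h) \<longlongrightarrow> 0) (at 0)"
      using flat_tendsto_0[of "[:0, 1:] * p"] unfolding q .
    moreover have "flat (flat_deriv p) s = 0" using 3 by (simp add: flat_def)
    ultimately show ?thesis using 3 by (simp only: DERIV_def)
  qed
qed

lemma flat_1_bounds: "0 \<le> flat 1 s" "flat 1 s \<le> 1" "s > 0 \<Longrightarrow> 0 < flat 1 s" "s \<le> 0 \<Longrightarrow> flat 1 s = 0"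
  by (auto simp: flat_def)

lemma flat_1_tendsto_1:
  assumes "s > 0" shows "(\<lambda>n. flat 1 (real n * s)) \<longlonglongrightarrow> 1"
proof -
  have "(\<lambda>n. exp (- ((1 / s) * inverse (real n)))) \<longlonglongrightarrow> exp (- ((1 / s) * 0))"
    by (intro tendsto_intros lim_inverse_n)
  then have "(\<lambda>n. exp (- ((1 / s) * inverse (real n)))) \<longlonglongrightarrow> 1" by simp
  then show ?thesis
    by (rule Lim_transform_eventually)
       (use assms in \<open>auto simp: flat_def field_simps intro!: eventually_sequentiallyI[of 1]\<close>)
qed

text \<open>The algebra generated by the functions \<open>flat\<close> along affine forms is closed under all directional
  derivatives, so its members are smooth; the induction over products and sums is what makes
  the products of one-dimensional bumps below test functions.\<close>

inductive_set flat_algebra :: "('a::euclidean_space \<Rightarrow> complex) set" where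
  flat_algebra_const: "(\<lambda>x. c) \<in> flat_algebra"
| flat_algebra_atom: "(\<lambda>x. of_real (flat p (x \<bullet> v + \<beta>))) \<in> flat_algebra"
| flat_algebra_add: "\<phi> \<in> flat_algebra \<Longrightarrow> \<psi> \<in> flat_algebra \<Longrightarrow> (\<lambda>x. \<phi> x + \<psi> x) \<in> flat_algebra"
| flat_algebra_mult: "\<phi> \<in> flat_algebra \<Longrightarrow> \<psi> \<in> flat_algebra \<Longrightarrow> (\<lambda>x. \<phi> x * \<psi> x) \<in> flat_algebra"

lemma flat_algebra_prod:
  "(\<And>i. i \<in> I \<Longrightarrow> \<phi> i \<in> flat_algebra) \<Longrightarrow> (\<lambda>x. \<Prod>i\<in>I. \<phi> i x) \<in> flat_algebra"
  by (induction I rule: infinite_finite_induct) (auto intro: flat_algebra.intros)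

lemma flat_algebra_has_derivative:
  "\<phi> \<in> flat_algebra \<Longrightarrow>
    \<exists>D. (\<forall>x. (\<phi> has_derivative D x) (at x)) \<and> (\<forall>b. (\<lambda>x. D x b) \<in> flat_algebra)"
proof (induction rule: flat_algebra.induct)
  case (flat_algebra_const c)
  show ?case
    by (rule exI[of _ "\<lambda>x b. 0"]) (auto intro: flat_algebra.intros)
next
  case (flat_algebra_atom p v \<beta>)
  define D where "D x b = (of_real (flat (flat_deriv p) (x \<bullet> v + \<beta>)) * of_real (b \<bullet> v) :: complex)" for x b
  have "((\<lambda>x. complex_of_real (flat p (x \<bullet> v + \<beta>))) has_derivative D x) (at x)" for x
  proof -
    have 1: "((\<lambda>x. x \<bullet> v + \<beta>) has_derivative (\<lambda>b. b \<bullet> v)) (at x)"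
      by (auto intro!: derivative_eq_intros)
    have 2: "((\<lambda>x. flat p (x \<bullet> v + \<beta>)) has_derivative (\<lambda>b. flat (flat_deriv p) (x \<bullet> v + \<beta>) * (b \<bullet> v))) (at x)"
      using DERIV_compose_FDERIV[OF flat_has_derivative 1] by (simp add: mult.commute)
    show ?thesis
      using bounded_linear.has_derivative[OF bounded_linear_of_real 2] by (simp add: D_def[abs_def])
  qed
  moreover have "(\<lambda>x. D x b) \<in> flat_algebra" for b
    unfolding D_def by (intro flat_algebra.intros)
  ultimately show ?case by blast
next
  case (flat_algebra_add \<phi> \<psi>)
  then obtain D E where D: "\<forall>x. (\<phi> has_derivative D x) (at x)" "\<forall>b. (\<lambda>x. D x b) \<in> flat_algebra"
    and E: "\<forall>x. (\<psi> has_derivative E x) (at x)" "\<forall>b. (\<lambda>x. E x b) \<in> flat_algebra" by blast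
  show ?case
    by (rule exI[of _ "\<lambda>x b. D x b + E x b"])
       (use D E in \<open>auto intro!: has_derivative_add flat_algebra.intros\<close>)
next
  case (flat_algebra_mult \<phi> \<psi>)
  then obtain D E where D: "\<forall>x. (\<phi> has_derivative D x) (at x)" "\<forall>b. (\<lambda>x. D x b) \<in> flat_algebra"
    and E: "\<forall>x. (\<psi> has_derivative E x) (at x)" "\<forall>b. (\<lambda>x. E x b) \<in> flat_algebra" by blast
  show ?case
    by (rule exI[of _ "\<lambda>x b. \<phi> x * E x b + D x b * \<psi> x"])
       (use D E flat_algebra_mult in \<open>auto intro!: has_derivative_mult flat_algebra.intros\<close>)
qed

lemma dir_deriv_eq:
  assumes "(\<phi> has_derivative D) (at x)" shows "dir_deriv b \<phi> x = D b"
    and "((\<lambda>s. \<phi> (x + s *\<^sub>R b)) has_vector_derivative D b) (at 0)"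
proof -
  have 1: "((\<lambda>s. x + s *\<^sub>R b) has_derivative (\<lambda>s. s *\<^sub>R b)) (at 0)"
    by (auto intro!: derivative_eq_intros)
  have 2: "(\<phi> has_derivative D) (at (x + 0 *\<^sub>R b))" using assms by simp
  interpret D: bounded_linear D using assms by (rule has_derivative_bounded_linear)
  show *: "((\<lambda>s. \<phi> (x + s *\<^sub>R b)) has_vector_derivative D b) (at 0)"
    using has_derivative_compose[OF 1 2] by (simp add: has_vector_derivative_def D.scaleR)
  show "dir_deriv b \<phi> x = D b"
    unfolding dir_deriv_def using vector_derivative_at[OF *] .
qed

lemma flat_algebra_differentiable:
  assumes "\<phi> \<in> flat_algebra" shows "\<phi> differentiable (at x)"
  using flat_algebra_has_derivative[OF assms] by (auto simp: differentiable_def)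

lemma flat_algebra_dir_deriv:
  assumes "\<phi> \<in> flat_algebra" shows "dir_deriv b \<phi> \<in> flat_algebra"
proof -
  obtain D where D: "\<forall>x. (\<phi> has_derivative D x) (at x)" "\<forall>b. (\<lambda>x. D x b) \<in> flat_algebra"
    using flat_algebra_has_derivative[OF assms] by blast
  have "dir_deriv b \<phi> = (\<lambda>x. D x b)"
    using dir_deriv_eq(1) D(1) by blast
  then show ?thesis using D by simp
qed

lemma flat_algebra_iter_deriv: "\<phi> \<in> flat_algebra \<Longrightarrow> iter_deriv bs \<phi> \<in> flat_algebra"
  by (induction bs) (auto intro: flat_algebra_dir_deriv)

lemma flat_algebra_smooth: "\<phi> \<in> flat_algebra \<Longrightarrow> smooth \<phi>"
  by (auto simp: smooth_def intro: flat_algebra_differentiable flat_algebra_iter_deriv)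

lemma flat_algebra_continuous: "\<phi> \<in> flat_algebra \<Longrightarrow> continuous_on UNIV \<phi>"
  by (meson continuous_at_imp_continuous_on differentiable_imp_continuous_within flat_algebra_differentiable)

lemma flat_algebra_measurable: "\<phi> \<in> flat_algebra \<Longrightarrow> \<phi> \<in> borel_measurable borel"
  by (intro borel_measurable_continuous_onI flat_algebra_continuous)

lemma flat_algebra_fst: "\<theta> \<in> flat_algebra \<Longrightarrow> (\<lambda>z::'a::euclidean_space \<times> 'b::euclidean_space. \<theta> (fst z)) \<in> flat_algebra"
proof (induction rule: flat_algebra.induct)
  case (flat_algebra_atom p v \<beta>)
  have "(\<lambda>z::'a \<times> 'b. complex_of_real (flat p (fst z \<bullet> v + \<beta>))) = (\<lambda>z. of_real (flat p (z \<bullet> (v, 0) + \<beta>)))"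
    by (simp add: inner_prod_def)
  then show ?case by (simp only: flat_algebra.intros)
qed (auto intro: flat_algebra.intros)

lemma flat_algebra_snd: "\<theta> \<in> flat_algebra \<Longrightarrow> (\<lambda>z::'a::euclidean_space \<times> 'b::euclidean_space. \<theta> (snd z)) \<in> flat_algebra"
proof (induction rule: flat_algebra.induct)
  case (flat_algebra_atom p v \<beta>)
  have "(\<lambda>z::'a \<times> 'b. complex_of_real (flat p (snd z \<bullet> v + \<beta>))) = (\<lambda>z. of_real (flat p (z \<bullet> (0, v) + \<beta>)))"
    by (simp add: inner_prod_def)
  then show ?case by (simp only: flat_algebra.intros)
qed (auto intro: flat_algebra.intros)

lemma flat_algebra_translate: "\<phi> \<in> flat_algebra \<Longrightarrow> (\<lambda>x. \<phi> (x + y)) \<in> flat_algebra"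
proof (induction rule: flat_algebra.induct)
  case (flat_algebra_atom p v \<beta>)
  have "(\<lambda>x. complex_of_real (flat p ((x + y) \<bullet> v + \<beta>))) = (\<lambda>x. of_real (flat p (x \<bullet> v + (y \<bullet> v + \<beta>))))"
    by (simp add: inner_add_left add.assoc)
  then show ?case by (simp only: flat_algebra.intros)
qed (auto intro: flat_algebra.intros)

lemma dir_deriv_translate: "dir_deriv b (\<lambda>x. \<phi> (x + y)) = (\<lambda>x. dir_deriv b \<phi> (x + y))"
  by (simp add: dir_deriv_def fun_eq_iff algebra_simps)

lemma iter_deriv_translate: "iter_deriv bs (\<lambda>x. \<phi> (x + y)) = (\<lambda>x. iter_deriv bs \<phi> (x + y))"
  by (induction bs) (simp_all add: dir_deriv_translate)

text \<open>A set of explicit test functions that is closed under the operations needed below and yet rich enough to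
  determine functions in \<open>L2\<close>.\<close>

definition bumps :: "('a::euclidean_space \<Rightarrow> complex) set" where
  "bumps = {\<phi> \<in> flat_algebra. \<exists>a c. \<forall>x. x \<notin> cbox a c \<longrightarrow> \<phi> x = 0}"

lemma dir_deriv_zero_outside:
  assumes "closed S" "\<And>x. x \<notin> S \<Longrightarrow> \<phi> x = 0" "x \<notin> S"
  shows "dir_deriv b \<phi> x = 0"
proof -
  have "((\<lambda>_. 0) has_derivative (\<lambda>_. 0)) (at x)" by simp
  then have "(\<phi> has_derivative (\<lambda>_. 0)) (at x)"
    by (rule has_derivative_transform_within_open[of _ _ _ _ "- S"]) (use assms in \<open>auto simp: open_Compl\<close>)
  then show ?thesis by (rule dir_deriv_eq)
qed

lemma bumps_flat_algebra: "\<phi> \<in> bumps \<Longrightarrow> \<phi> \<in> flat_algebra"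
  by (simp add: bumps_def)

lemma bumps_dir_deriv: "\<phi> \<in> bumps \<Longrightarrow> dir_deriv b \<phi> \<in> bumps"
  using dir_deriv_zero_outside[OF closed_cbox] unfolding bumps_def
  by (smt (verit) flat_algebra_dir_deriv mem_Collect_eq)

lemma bumps_iter_deriv: "\<phi> \<in> bumps \<Longrightarrow> iter_deriv bs \<phi> \<in> bumps"
  by (induction bs) (auto intro: bumps_dir_deriv)

lemma bumps_translate: 
  assumes "\<phi> \<in> bumps" shows "(\<lambda>x. \<phi> (x + y)) \<in> bumps"
proof -
  obtain a c where ac: "\<And>x. x \<notin> cbox a c \<Longrightarrow> \<phi> x = 0" using assms by (auto simp: bumps_def)
  have "\<phi> (x + y) = 0" if "x \<notin> cbox (a - y) (c - y)" for x
    using that by (intro ac) (auto simp: mem_box algebra_simps)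
  then show ?thesis using assms flat_algebra_translate by (auto simp: bumps_def)
qed

lemma bumps_scale: "\<phi> \<in> bumps \<Longrightarrow> (\<lambda>x. c * \<phi> x) \<in> bumps"
  by (auto simp: bumps_def intro!: flat_algebra.intros)

lemma bumps_add:
  assumes "\<phi> \<in> bumps" "\<psi> \<in> bumps" shows "(\<lambda>x. \<phi> x + \<psi> x) \<in> bumps"
proof -
  obtain a c a' c' where ac: "\<And>x. x \<notin> cbox a c \<Longrightarrow> \<phi> x = 0" "\<And>x. x \<notin> cbox a' c' \<Longrightarrow> \<psi> x = 0"
    using assms by (auto simp: bumps_def)
  obtain a'' c'' where sub: "cbox a c \<union> cbox a' c' \<subseteq> cbox a'' c''"
    using bounded_subset_cbox_symmetric[of "cbox a c \<union> cbox a' c'"] by (metis bounded_Un bounded_cbox)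
  have "\<phi> x + \<psi> x = 0" if "x \<notin> cbox a'' c''" for x
  proof -
    have "x \<notin> cbox a c" "x \<notin> cbox a' c'" using sub that by blast+
    then show ?thesis by (simp add: ac)
  qed
  moreover have "(\<lambda>x. \<phi> x + \<psi> x) \<in> flat_algebra"
    using assms by (auto simp: bumps_def intro: flat_algebra.intros)
  ultimately show ?thesis unfolding bumps_def by blast
qed

lemma bumps_sum: "(\<And>i. i \<in> I \<Longrightarrow> \<phi> i \<in> bumps) \<Longrightarrow> (\<lambda>x. \<Sum>i\<in>I. \<phi> i x) \<in> bumps"
proof (induction I rule: infinite_finite_induct)
  case empty
  show ?case by (auto simp: bumps_def intro: flat_algebra.intros)
next
  case (infinite A)
  then show ?case by (auto simp: bumps_def intro: flat_algebra.intros)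
qed (auto intro: bumps_add)

lemma bumps_test_function: 
  assumes "\<phi> \<in> bumps" shows "\<phi> \<in> test_functions UNIV"
proof -
  obtain a c where ac: "\<And>x. x \<notin> cbox a c \<Longrightarrow> \<phi> x = 0" using assms by (auto simp: bumps_def)
  have "closure {x. \<phi> x \<noteq> 0} \<subseteq> cbox a c" using ac by (intro closure_minimal) auto
  then have "compact (closure {x. \<phi> x \<noteq> 0})"
    by (meson bounded_cbox bounded_subset closed_closure compact_eq_bounded_closed)
  then show ?thesis using assms by (simp add: test_functions_def flat_algebra_smooth bumps_def)
qed

lemma bumps_bounded:
  assumes "\<phi> \<in> bumps" obtains B where "B > 0" "\<And>x. cmod (\<phi> x) \<le> B"
proof -
  obtain a c where ac: "\<And>x. x \<notin> cbox a c \<Longrightarrow> \<phi> x = 0" using assms by (auto simp: bumps_def)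
  have "continuous_on UNIV \<phi>" using assms by (simp add: bumps_def flat_algebra_continuous)
  then have "bounded (\<phi> ` cbox a c)"
    by (meson compact_cbox compact_continuous_image compact_imp_bounded continuous_on_subset top_greatest)
  then obtain B where B: "B > 0" "\<And>x. x \<in> cbox a c \<Longrightarrow> cmod (\<phi> x) \<le> B" by (auto simp: bounded_pos)
  show ?thesis
    by (rule that[of B]) (use B ac in \<open>metis less_imp_le norm_zero\<close>)+
qed

lemma bumps_measurable [measurable_dest]: "\<phi> \<in> bumps \<Longrightarrow> \<phi> \<in> borel_measurable borel"
  by (simp add: bumps_def flat_algebra_measurable)

lemma bumps_integrable:
  assumes "\<phi> \<in> bumps" shows "integrable lborel \<phi>"
proof -
  obtain a c where ac: "\<And>x. x \<notin> cbox a c \<Longrightarrow> \<phi> x = 0" using assms by (auto simp: bumps_def)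
  obtain B where B: "\<And>x. cmod (\<phi> x) \<le> B" using bumps_bounded[OF assms] by blast
  have "integrable lborel (\<lambda>x. indicator (cbox a c) x *\<^sub>R B)"
    by (intro integrable_real_indicator integrable_scaleR_left) (auto simp: emeasure_lborel_cbox_eq)
  then show ?thesis
    by (rule Bochner_Integration.integrable_bound)
       (use assms B ac in \<open>auto simp: indicator_def intro!: AE_I2 order_trans[OF B] bumps_measurable\<close>)
qed

lemma bumps_L2:
  assumes "\<phi> \<in> bumps" shows "\<phi> \<in> L2"
proof -
  obtain B where B: "\<And>x. cmod (\<phi> x) \<le> B" using bumps_bounded[OF assms] by blast
  have "integrable lborel (\<lambda>x. B * cmod (\<phi> x))"
    using bumps_integrable[OF assms] by auto
  then show ?thesis
    by (rule L2I_square_bound(1)[rotated])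
       (use B assms in \<open>auto simp: power2_eq_square intro!: mult_right_mono bumps_measurable\<close>)
qed

definition box_bump :: "real \<Rightarrow> 'a::euclidean_space \<Rightarrow> 'a \<Rightarrow> 'a \<Rightarrow> real" where
  "box_bump k a c x = (\<Prod>b\<in>Basis. flat 1 (k * (x \<bullet> b - a \<bullet> b)) * flat 1 (k * (c \<bullet> b - x \<bullet> b)))"

lemma box_bump_nonneg: "0 \<le> box_bump k a c x"
  unfolding box_bump_def by (intro prod_nonneg ballI mult_nonneg_nonneg flat_1_bounds)

lemma box_bump_le_1: "box_bump k a c x \<le> 1"
  unfolding box_bump_def by (intro prod_le_1 conjI mult_nonneg_nonneg mult_le_one flat_1_bounds)

lemma box_bump_outside:
  assumes "k \<ge> 0" "x \<notin> box a c" shows "box_bump k a c x = 0"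
proof -
  obtain b where b: "b \<in> Basis" "x \<bullet> b \<le> a \<bullet> b \<or> c \<bullet> b \<le> x \<bullet> b"
    using assms by (auto simp: mem_box not_less)
  then have "flat 1 (k * (x \<bullet> b - a \<bullet> b)) * flat 1 (k * (c \<bullet> b - x \<bullet> b)) = 0"
    using assms(1) by (auto intro!: flat_1_bounds(4) mult_nonneg_nonpos)
  then show ?thesis unfolding box_bump_def using b(1) by (intro prod_zero) auto
qed

lemma box_bump_bumps:
  assumes "k \<ge> 0" shows "(\<lambda>x. of_real (box_bump k a c x)) \<in> bumps"
proof -
  have at: "(\<lambda>x. complex_of_real (flat 1 (k * (x \<bullet> b - a \<bullet> b)))) \<in> flat_algebra"
           "(\<lambda>x. complex_of_real (flat 1 (k * (c \<bullet> b - x \<bullet> b)))) \<in> flat_algebra" for b :: 'a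
  proof -
    have "(\<lambda>x. complex_of_real (flat 1 (k * (x \<bullet> b - a \<bullet> b)))) = (\<lambda>x. of_real (flat 1 (x \<bullet> (k *\<^sub>R b) + (- k * (a \<bullet> b)))))"
      "(\<lambda>x. complex_of_real (flat 1 (k * (c \<bullet> b - x \<bullet> b)))) = (\<lambda>x. of_real (flat 1 (x \<bullet> ((- k) *\<^sub>R b) + (k * (c \<bullet> b)))))"
      by (simp_all add: algebra_simps)
    then show "(\<lambda>x. complex_of_real (flat 1 (k * (x \<bullet> b - a \<bullet> b)))) \<in> flat_algebra"
           "(\<lambda>x. complex_of_real (flat 1 (k * (c \<bullet> b - x \<bullet> b)))) \<in> flat_algebra"
      by (simp_all only: flat_algebra.intros)
  qed
  have "(\<lambda>x. complex_of_real (box_bump k a c x)) \<in> flat_algebra"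
    unfolding box_bump_def of_real_prod of_real_mult by (intro flat_algebra_prod flat_algebra.intros at)
  moreover have "\<forall>x. x \<notin> cbox a c \<longrightarrow> complex_of_real (box_bump k a c x) = 0"
    using box_bump_outside[OF assms] box_subset_cbox[of a c] by (metis of_real_0 subsetD)
  ultimately show ?thesis unfolding bumps_def by blast
qed

lemma box_bump_measurable [measurable]: "k \<ge> 0 \<Longrightarrow> box_bump k a c \<in> borel_measurable borel"
  using borel_measurable_continuous_on[OF continuous_on_Re[OF continuous_on_id] bumps_measurable[OF box_bump_bumps[of k a c]]]
  by simp

lemma box_bump_tendsto_indicator: "(\<lambda>n. box_bump (real n) a c x) \<longlonglongrightarrow> indicator (box a c) x"
proof (cases "x \<in> box a c")
  case True
  have "(\<lambda>n. box_bump (real n) a c x) \<longlonglongrightarrow> (\<Prod>b\<in>(Basis::'a set). 1 * 1)"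
    unfolding box_bump_def
    by (intro tendsto_prod tendsto_mult flat_1_tendsto_1) (use True in \<open>auto simp: mem_box\<close>)
  then show ?thesis using True by simp
next
  case False
  then show ?thesis by (simp add: box_bump_outside)
qed

text \<open>The fundamental lemma of the calculus of variations. The bumps converge to the indicators of
  boxes, so the integral over every box vanishes, and Lebesgue's differentiation theorem applies.\<close>

lemma AE_zero_if_pairing_zero:
  fixes g :: "'a::euclidean_space \<Rightarrow> complex"
  assumes g: "g \<in> L2" and zero: "\<And>\<phi>. \<phi> \<in> bumps \<Longrightarrow> pairing g \<phi> = 0"
  shows "AE x in lborel. g x = 0"
proof -
  note [measurable] = L2_measurable[OF g]
  have L2_ind: "(\<lambda>x. complex_of_real (indicator (cbox a c) x)) \<in> L2" for a c :: 'a
  proof -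
    have "(\<lambda>x. (cmod (complex_of_real (indicator (cbox a c) x)))\<^sup>2) = indicator (cbox a c)"
      by (auto simp: indicator_def)
    then show ?thesis by (simp add: L2_def emeasure_lborel_cbox_eq)
  qed
  have int: "integrable lborel (\<lambda>x. indicator (cbox a c) x *\<^sub>R g x)" for a c :: 'a
    using integrable_mult_L2(1)[OF L2_ind g] by (simp add: scaleR_conv_of_real)
  have lim: "(\<integral>x. indicator (box a c) x *\<^sub>R g x \<partial>lborel) = 0" for a c :: 'a
  proof -
    have "(\<lambda>n. \<integral>x. g x * of_real (box_bump (real n) a c x) \<partial>lborel) \<longlonglongrightarrow> (\<integral>x. indicator (box a c) x *\<^sub>R g x \<partial>lborel)"
    proof (rule integral_dominated_convergence)
      show "integrable lborel (\<lambda>x. cmod (indicator (cbox a c) x *\<^sub>R g x))" using int by (rule integrable_norm)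
      show "AE x in lborel. (\<lambda>n. g x * of_real (box_bump (real n) a c x)) \<longlonglongrightarrow> indicator (box a c) x *\<^sub>R g x"
      proof (rule AE_I2)
        fix x
        have "(\<lambda>n. g x * of_real (box_bump (real n) a c x)) \<longlonglongrightarrow> g x * of_real (indicator (box a c) x)"
          by (intro tendsto_intros box_bump_tendsto_indicator)
        then show "(\<lambda>n. g x * of_real (box_bump (real n) a c x)) \<longlonglongrightarrow> indicator (box a c) x *\<^sub>R g x"
          by (simp add: scaleR_conv_of_real mult.commute)
      qed
      show "AE x in lborel. norm (g x * of_real (box_bump (real n) a c x)) \<le> cmod (indicator (cbox a c) x *\<^sub>R g x)" for n
      proof (rule AE_I2)
        fix x
        show "norm (g x * of_real (box_bump (real n) a c x)) \<le> cmod (indicator (cbox a c) x *\<^sub>R g x)"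
        proof (cases "x \<in> cbox a c")
          case True
          then show ?thesis
            using box_bump_nonneg[of n a c x] box_bump_le_1[of n a c x] by (simp add: norm_mult mult_left_le)
        next
          case False
          then have "x \<notin> box a c" using box_subset_cbox by blast
          then show ?thesis using False by (simp add: box_bump_outside)
        qed
      qed
    qed measurable
    moreover have "(\<integral>x. g x * of_real (box_bump (real n) a c x) \<partial>lborel) = 0" for n
      using zero[OF box_bump_bumps[of n a c]] by (simp add: pairing_def)
    ultimately show ?thesis by (simp add: LIMSEQ_const_iff)
  qed
  have on: "g integrable_on cbox a c" for a c :: 'a
    using set_borel_integral_eq_integral(1)[of "cbox a c" g] int[of a c] by (simp add: set_integrable_def)
  have zero_box: "integral (cbox a c) g = 0" for a c :: 'a
  proof -
    have "set_integrable lborel (box a c) g"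
      by (rule set_integrable_subset[of _ "cbox a c"]) (simp_all add: int set_integrable_def box_subset_cbox)
    then have "integral (box a c) g = 0"
      using set_borel_integral_eq_integral(2)[of "box a c" g] lim[of a c] by (simp add: set_lebesgue_integral_def)
    then show ?thesis by (simp add: integral_open_interval)
  qed
  obtain N where N: "negligible N" "\<And>x e. \<lbrakk>x \<notin> N; 0 < e\<rbrakk> \<Longrightarrow>
      \<exists>d>0. \<forall>h. 0 < h \<and> h < d \<longrightarrow> norm (integral (cbox x (x + h *\<^sub>R One)) g /\<^sub>R h ^ DIM('a) - g x) < e"
    by (rule integrable_ccontinuous_explicit[OF on]) blast
  have out: "g x = 0" if x: "x \<notin> N" for x
  proof (rule ccontr)
    assume "g x \<noteq> 0"
    then obtain d where d: "d > 0" "\<forall>h. 0 < h \<and> h < d \<longrightarrow> norm (integral (cbox x (x + h *\<^sub>R One)) g /\<^sub>R h ^ DIM('a) - g x) < norm (g x)"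
      using N(2)[OF x, of "norm (g x)"] by auto
    then have "norm (integral (cbox x (x + (d / 2) *\<^sub>R One)) g /\<^sub>R (d / 2) ^ DIM('a) - g x) < norm (g x)"
      by auto
    then show False by (simp add: zero_box)
  qed
  have E: "{x. g x \<noteq> 0} \<in> sets lborel" by measurable
  have "negligible {x. g x \<noteq> 0}" by (rule negligible_subset[OF N(1)]) (use out in auto)
  then have "{x. g x \<noteq> 0} \<in> null_sets lborel"
    using E by (simp add: negligible_iff_null_sets null_sets_completion_iff)
  then show ?thesis by (intro AE_I'[of "{x. g x \<noteq> 0}"]) auto
qed

lemma AE_eq_if_pairing_eq:
  assumes "f \<in> L2" "g \<in> L2" "\<And>\<phi>. \<phi> \<in> bumps \<Longrightarrow> pairing f \<phi> = pairing g \<phi>"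
  shows "AE x in lborel. f x = g x"
proof -
  have "AE x in lborel. f x - g x = 0"
  proof (rule AE_zero_if_pairing_zero)
    show "pairing (\<lambda>x. f x - g x) \<phi> = 0" if "\<phi> \<in> bumps" for \<phi>
      using assms(3)[OF that] by (simp add: pairing_diff_left assms(1,2) bumps_L2[OF that])
  qed (use assms in auto)
  then show ?thesis by eventually_elim simp
qed

section \<open>Weak derivatives and translations\<close>

text \<open>The integrands of time integrals are controlled on the interval only, so they are cut off outside before applying
  Minkowski's inequality.\<close>

lemma Minkowski_interval:
  fixes G :: "real \<Rightarrow> 'a::euclidean_space \<Rightarrow> complex"
  assumes meas: "(\<lambda>(s, x). G s x) \<in> borel_measurable borel"
    and bound: "AE s in lborel. s \<in> {a..c} \<longrightarrow> G s \<in> L2 \<and> L2_norm (G s) \<le> K" and ac: "a \<le> c" "0 \<le> K"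
  shows "(\<lambda>x. LINT s:{a..c}|lborel. G s x) \<in> L2"
    and "L2_norm (\<lambda>x. LINT s:{a..c}|lborel. G s x) \<le> (c - a) * K"
    and "AE x in lborel. set_integrable lborel {a..c} (\<lambda>s. G s x)"
    and "g \<in> L2 \<Longrightarrow> set_integrable lborel {a..c} (\<lambda>s. pairing (G s) g)"
    and "g \<in> L2 \<Longrightarrow> pairing (\<lambda>x. LINT s:{a..c}|lborel. G s x) g = (LINT s:{a..c}|lborel. pairing (G s) g)"
proof -
  define H where "H s x = indicator {a..c} s *\<^sub>R G s x" for s x
  have [measurable]: "(\<lambda>(s, x). G s x) \<in> borel_measurable (borel \<Otimes>\<^sub>M borel)" using meas by (simp add: borel_prod)
  have "(\<lambda>(s, x). H s x) \<in> borel_measurable (borel \<Otimes>\<^sub>M borel)"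
    unfolding H_def by measurable
  then have mH: "(\<lambda>(s, x). H s x) \<in> borel_measurable borel" by (simp add: borel_prod)
  have bH: "AE s in lborel. H s \<in> L2 \<and> L2_norm (H s) \<le> indicator {a..c} s *\<^sub>R K"
    using bound
  proof eventually_elim
    fix s assume "s \<in> {a..c} \<longrightarrow> G s \<in> L2 \<and> L2_norm (G s) \<le> K"
    then show "H s \<in> L2 \<and> L2_norm (H s) \<le> indicator {a..c} s *\<^sub>R K"
      unfolding H_def[abs_def] by (cases "s \<in> {a..c}") simp_all
  qed
  have iK: "integrable lborel (\<lambda>s. indicator {a..c} s *\<^sub>R K)"
    using ac by (intro integrable_scaleR_left integrable_real_indicator) simp_all
  have vK: "(\<integral>s. indicator {a..c} s *\<^sub>R K \<partial>lborel) = (c - a) * K"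
    using ac by simp
  have pH: "pairing (H s) g = indicator {a..c} s *\<^sub>R pairing (G s) g" for s
    by (auto simp: H_def indicator_def pairing_def)
  note M = Minkowski_integral[OF mH bH iK]
  have eq: "(\<lambda>x. LINT s:{a..c}|lborel. G s x) = (\<lambda>x. \<integral>s. H s x \<partial>lborel)"
    by (simp add: H_def set_lebesgue_integral_def)
  show "(\<lambda>x. LINT s:{a..c}|lborel. G s x) \<in> L2" unfolding eq by (rule M(1))
  show "L2_norm (\<lambda>x. LINT s:{a..c}|lborel. G s x) \<le> (c - a) * K" using M(2) unfolding eq vK .
  show "AE x in lborel. set_integrable lborel {a..c} (\<lambda>s. G s x)"
    using M(3) by (simp add: H_def set_integrable_def)
  assume g: "g \<in> L2"
  show "set_integrable lborel {a..c} (\<lambda>s. pairing (G s) g)"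
    using M(5)[OF g] by (simp add: pH set_integrable_def)
  show "pairing (\<lambda>x. LINT s:{a..c}|lborel. G s x) g = (LINT s:{a..c}|lborel. pairing (G s) g)"
    using M(6)[OF g] unfolding eq by (simp add: pH set_lebesgue_integral_def)
qed

lemma has_weak_deriv_pairing:
  assumes "has_weak_deriv v bs g" "\<phi> \<in> bumps"
  shows "pairing v (iter_deriv bs \<phi>) = (- 1) ^ length bs * pairing g \<phi>"
  using assms bumps_test_function by (auto simp: has_weak_deriv_def pairing_def)

lemma weak_deriv_unique:
  assumes "g \<in> L2" "g' \<in> L2" "has_weak_deriv v bs g" "has_weak_deriv v bs g'"
  shows "AE x in lborel. g x = g' x"
  by (rule AE_eq_if_pairing_eq[OF assms(1,2)])
     (use has_weak_deriv_pairing[OF assms(3)] has_weak_deriv_pairing[OF assms(4)] in auto)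

text \<open>The partial derivative in the form in which it is used: with bumps as test functions and within \<open>L2\<close>.\<close>

definition has_partial :: "('a::euclidean_space \<Rightarrow> complex) \<Rightarrow> 'a \<Rightarrow> ('a \<Rightarrow> complex) \<Rightarrow> bool" where
  "has_partial v b g \<longleftrightarrow> v \<in> L2 \<and> g \<in> L2 \<and> (\<forall>\<phi>\<in>bumps. pairing v (dir_deriv b \<phi>) = - pairing g \<phi>)"

lemma has_partialD:
  assumes "has_partial v b g"
  shows "v \<in> L2" "g \<in> L2" "\<phi> \<in> bumps \<Longrightarrow> pairing v (dir_deriv b \<phi>) = - pairing g \<phi>"
  using assms by (auto simp: has_partial_def)

lemma has_partial_of_weak_deriv:
  assumes "v \<in> L2" "g \<in> L2" "has_weak_deriv v [b] g"
  shows "has_partial v b g"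
  using has_weak_deriv_pairing[OF assms(3)] assms(1,2) by (auto simp: has_partial_def)

text \<open>A derivative of a bump is a bump, so testing \<open>g\<close> with \<open>dir_deriv b \<phi>\<close> amounts to testing \<open>v\<close> with the second derivative.\<close>

lemma has_partial_of_second_weak_deriv:
  assumes "has_partial v b g" "g2 \<in> L2" "has_weak_deriv v [b, b] g2"
  shows "has_partial g b g2"
  using has_weak_deriv_pairing[OF assms(3)] has_partialD(3)[OF assms(1) bumps_dir_deriv] assms(2) has_partialD(2)[OF assms(1)]
  by (auto simp: has_partial_def minus_equation_iff)

lemma bumps_increment:
  assumes "\<phi> \<in> bumps" "0 \<le> h"
  shows "\<phi> (x - h *\<^sub>R b) - \<phi> x = (LINT s:{0..h}|lborel. - dir_deriv b \<phi> (x - s *\<^sub>R b))"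
proof -
  have d: "((\<lambda>s. \<phi> (x - s *\<^sub>R b)) has_vector_derivative - dir_deriv b \<phi> (x - s *\<^sub>R b)) (at s within {0..h})" for s
  proof -
    obtain D where D: "\<And>x. (\<phi> has_derivative D x) (at x)"
      using flat_algebra_has_derivative[OF bumps_flat_algebra[OF assms(1)]] by blast
    have 1: "((\<lambda>s. x - s *\<^sub>R b) has_derivative (\<lambda>s. - s *\<^sub>R b)) (at s within {0..h})"
      by (auto intro!: derivative_eq_intros)
    have lin: "linear (D (x - s *\<^sub>R b))" by (rule bounded_linear.linear[OF has_derivative_bounded_linear[OF D]])
    have "((\<lambda>s. \<phi> (x - s *\<^sub>R b)) has_derivative (\<lambda>r. D (x - s *\<^sub>R b) (- r *\<^sub>R b))) (at s within {0..h})"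
      by (rule has_derivative_compose[OF 1 D])
    then show ?thesis
      by (simp add: has_vector_derivative_def dir_deriv_eq(1)[OF D] linear_neg[OF lin] linear_scale[OF lin])
  qed
  have c: "continuous_on UNIV (dir_deriv b \<phi>)"
    by (intro flat_algebra_continuous bumps_flat_algebra bumps_dir_deriv assms)
  have "continuous_on {0..h} (\<lambda>s. dir_deriv b \<phi> (x - s *\<^sub>R b))"
    by (rule continuous_on_compose2[OF c]) (auto intro!: continuous_intros)
  then have "continuous_on {0..h} (\<lambda>s. - dir_deriv b \<phi> (x - s *\<^sub>R b))"
    by (rule continuous_on_minus)
  then show ?thesis
    using integral_FTC_Icc[OF assms(2) d] by (simp add: set_lebesgue_integral_def)
qed

text \<open>The fundamental theorem of calculus for weak derivatives: both sides have the same pairing with every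
  bump, by shifting the translation to the bump and integrating its derivative.\<close>

lemma weak_deriv_increment:
  fixes v g :: "'a::euclidean_space \<Rightarrow> complex"
  assumes vg: "has_partial v b g" and h: "0 \<le> h"
  shows "AE x in lborel. v (x + h *\<^sub>R b) - v x = (LINT s:{0..h}|lborel. g (x + s *\<^sub>R b))"
proof (rule AE_eq_if_pairing_eq)
  have v: "v \<in> L2" and g: "g \<in> L2" using has_partialD[OF vg] by auto
  note [measurable] = L2_measurable[OF v] L2_measurable[OF g]
  have mG: "(\<lambda>(s, x). g (x + s *\<^sub>R b)) \<in> borel_measurable borel"
    unfolding borel_prod[symmetric] by measurable
  have bG: "AE s in lborel. s \<in> {0..h} \<longrightarrow> (\<lambda>x. g (x + s *\<^sub>R b)) \<in> L2 \<and> L2_norm (\<lambda>x. g (x + s *\<^sub>R b)) \<le> L2_norm g"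
    using L2_translate[OF g] by auto
  note G = Minkowski_interval[OF mG bG h L2_norm_nonneg]
  show "(\<lambda>x. v (x + h *\<^sub>R b) - v x) \<in> L2" by (intro L2_diff L2_translate v)
  show "(\<lambda>x. LINT s:{0..h}|lborel. g (x + s *\<^sub>R b)) \<in> L2" by (rule G(1))
  fix \<phi> :: "'a \<Rightarrow> complex" assume \<phi>: "\<phi> \<in> bumps"
  have tr: "(\<lambda>x. \<phi> (x - s *\<^sub>R b)) \<in> bumps" for s using bumps_translate[OF \<phi>, of "- (s *\<^sub>R b)"] by simp
  have d\<phi>: "dir_deriv b \<phi> \<in> bumps" by (rule bumps_dir_deriv[OF \<phi>])
  note [measurable] = bumps_measurable[OF \<phi>] bumps_measurable[OF d\<phi>]
  have mP: "(\<lambda>(s, x). - dir_deriv b \<phi> (x - s *\<^sub>R b)) \<in> borel_measurable borel"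
    unfolding borel_prod[symmetric] by measurable
  have bP: "AE s in lborel. s \<in> {0..h} \<longrightarrow> (\<lambda>x. - dir_deriv b \<phi> (x - s *\<^sub>R b)) \<in> L2
      \<and> L2_norm (\<lambda>x. - dir_deriv b \<phi> (x - s *\<^sub>R b)) \<le> L2_norm (dir_deriv b \<phi>)"
    using L2_translate[OF bumps_L2[OF d\<phi>], of "- (_ *\<^sub>R b)"]
    by (intro AE_I2 impI conjI L2_uminus) simp_all
  note P = Minkowski_interval[OF mP bP h L2_norm_nonneg]
  have key: "pairing (\<lambda>x. - dir_deriv b \<phi> (x - s *\<^sub>R b)) v = pairing (\<lambda>x. g (x + s *\<^sub>R b)) \<phi>" for s
  proof -
    have "pairing (\<lambda>x. - dir_deriv b \<phi> (x - s *\<^sub>R b)) v = - pairing v (dir_deriv b (\<lambda>x. \<phi> (x - s *\<^sub>R b)))"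
      using dir_deriv_translate[of b \<phi> "- (s *\<^sub>R b)"] pairing_scale_left[of "-1" _ v]
      by (simp add: pairing_commute[of v])
    also have "\<dots> = pairing g (\<lambda>x. \<phi> (x - s *\<^sub>R b))"
      using has_partialD(3)[OF vg tr[of s]] by simp
    finally show ?thesis by (simp add: pairing_translate)
  qed
  have "pairing (\<lambda>x. v (x + h *\<^sub>R b) - v x) \<phi> = pairing v (\<lambda>x. \<phi> (x - h *\<^sub>R b) - \<phi> x)"
    using v \<phi> tr by (simp add: pairing_diff_left pairing_diff_right L2_translate bumps_L2 pairing_translate)
  also have "\<dots> = pairing (\<lambda>x. LINT s:{0..h}|lborel. - dir_deriv b \<phi> (x - s *\<^sub>R b)) v"
    by (simp only: bumps_increment[OF \<phi> h] pairing_commute)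
  also have "\<dots> = pairing (\<lambda>x. LINT s:{0..h}|lborel. g (x + s *\<^sub>R b)) \<phi>"
    unfolding P(5)[OF v] G(5)[OF bumps_L2[OF \<phi>]] key ..
  finally show "pairing (\<lambda>x. v (x + h *\<^sub>R b) - v x) \<phi> = pairing (\<lambda>x. LINT s:{0..h}|lborel. g (x + s *\<^sub>R b)) \<phi>" .
qed

lemma set_integral_near_const:
  fixes F :: "real \<Rightarrow> complex"
  assumes "set_integrable lborel {a..c} F" "AE s in lborel. s \<in> {a..c} \<longrightarrow> cmod (F s - z) \<le> K" "a \<le> c"
  shows "cmod ((LINT s:{a..c}|lborel. F s) - of_real (c - a) * z) \<le> (c - a) * K"
proof -
  have iz: "set_integrable lborel {a..c} (\<lambda>s. z)"
    unfolding set_integrable_def using assms(3) by (intro integrable_scaleR_left integrable_real_indicator) simp_all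
  have z: "(LINT s:{a..c}|lborel. z) = of_real (c - a) * z"
    using assms(3) by (simp add: set_lebesgue_integral_def scaleR_conv_of_real)
  have d: "set_integrable lborel {a..c} (\<lambda>s. F s - z)" by (rule set_integral_diff(1)[OF assms(1) iz])
  have "(LINT s:{a..c}|lborel. F s) - of_real (c - a) * z = (LINT s:{a..c}|lborel. F s - z)"
    using set_integral_diff(2)[OF assms(1) iz] z by simp
  also have "cmod \<dots> \<le> (LINT s:{a..c}|lborel. cmod (F s - z))"
    by (rule set_integral_norm_bound[OF d])
  also have "\<dots> \<le> (\<integral>s. indicator {a..c} s *\<^sub>R K \<partial>lborel)"
    unfolding set_lebesgue_integral_def
  proof (rule integral_mono_AE)
    show "integrable lborel (\<lambda>s. indicator {a..c} s *\<^sub>R cmod (F s - z))"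
      using set_integrable_norm[OF d] by (simp add: set_integrable_def)
    show "integrable lborel (\<lambda>s. indicator {a..c} s *\<^sub>R K)"
      using assms(3) by (intro integrable_scaleR_left integrable_real_indicator) simp_all
    show "AE s in lborel. indicator {a..c} s *\<^sub>R cmod (F s - z) \<le> indicator {a..c} s *\<^sub>R K"
      using assms(2) by eventually_elim (auto simp: indicator_def)
  qed
  finally show ?thesis using assms(3) by simp
qed

lemma has_partial_translate_pos:
  assumes vg: "has_partial v b g" and h: "0 \<le> h"
  shows "L2_norm (\<lambda>x. v (x + h *\<^sub>R b) - v x) \<le> h * L2_norm g"
proof -
  note v = has_partialD(1)[OF vg] and g = has_partialD(2)[OF vg]
  note [measurable] = L2_measurable[OF v] L2_measurable[OF g]
  have mG: "(\<lambda>(s, x). g (x + s *\<^sub>R b)) \<in> borel_measurable borel"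
    unfolding borel_prod[symmetric] by measurable
  have bG: "AE s in lborel. s \<in> {0..h} \<longrightarrow> (\<lambda>x. g (x + s *\<^sub>R b)) \<in> L2 \<and> L2_norm (\<lambda>x. g (x + s *\<^sub>R b)) \<le> L2_norm g"
    using L2_translate[OF g] by auto
  note G = Minkowski_interval[OF mG bG h L2_norm_nonneg]
  have "L2_norm (\<lambda>x. v (x + h *\<^sub>R b) - v x) = L2_norm (\<lambda>x. LINT s:{0..h}|lborel. g (x + s *\<^sub>R b))"
    by (rule L2_norm_cong_AE[OF _ _ weak_deriv_increment[OF vg h]]) (use G(1) in measurable)
  then show ?thesis using G(2) by simp
qed

lemma has_partial_translate:
  assumes vg: "has_partial v b g"
  shows "L2_norm (\<lambda>x. v (x + h *\<^sub>R b) - v x) \<le> \<bar>h\<bar> * L2_norm g"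
proof (cases "0 \<le> h")
  case True
  then show ?thesis using has_partial_translate_pos[OF vg] by simp
next
  case False
  note v = has_partialD(1)[OF vg]
  have "L2_norm (\<lambda>x. v (x + h *\<^sub>R b) - v x) = L2_norm (\<lambda>x. v (x + (- h) *\<^sub>R b) - v x)"
    using L2_translate(2)[OF L2_diff[OF L2_translate(1)[OF v, of "h *\<^sub>R b"] v], of "(- h) *\<^sub>R b"]
    by (simp add: L2_norm_minus_commute[of v])
  then show ?thesis using has_partial_translate_pos[OF vg, of "- h"] False by simp
qed

text \<open>All that mollification needs to know about a function with weak derivatives of first order: it depends on
  translations in a Lipschitz way.\<close>

definition translation_Lipschitz :: "('a::euclidean_space \<Rightarrow> complex) \<Rightarrow> real \<Rightarrow> bool" where
  "translation_Lipschitz v M \<longleftrightarrow> v \<in> L2 \<and> (\<forall>y. L2_norm (\<lambda>x. v (x + y) - v x) \<le> norm y * M)"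

text \<open>A translation is performed one coordinate at a time.\<close>

lemma translation_Lipschitz_of_partials:
  fixes v :: "'a::euclidean_space \<Rightarrow> complex"
  assumes "\<And>b. b \<in> Basis \<Longrightarrow> has_partial v b (g b)"
  shows "translation_Lipschitz v (\<Sum>b\<in>Basis. L2_norm (g b))"
proof -
  obtain b0 :: 'a where "b0 \<in> Basis" using nonempty_Basis by blast
  then have v: "v \<in> L2" using has_partialD(1) assms by blast
  have "L2_norm (\<lambda>x. v (x + y) - v x) \<le> norm y * (\<Sum>b\<in>Basis. L2_norm (g b))" for y
  proof -
    have "L2_norm (\<lambda>x. v (x + (\<Sum>b\<in>B. (y \<bullet> b) *\<^sub>R b)) - v x) \<le> (\<Sum>b\<in>B. \<bar>y \<bullet> b\<bar> * L2_norm (g b))"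
      if "B \<subseteq> Basis" for B
      using finite_subset[OF that finite_Basis] that
    proof (induction B)
      case empty
      then show ?case by simp
    next
      case (insert b B)
      let ?s = "\<Sum>b\<in>B. (y \<bullet> b) *\<^sub>R b"
      have 1: "L2_norm (\<lambda>x. v (x + (y \<bullet> b) *\<^sub>R b + ?s) - v (x + (y \<bullet> b) *\<^sub>R b)) = L2_norm (\<lambda>x. v (x + ?s) - v x)"
        using L2_translate(2)[OF L2_diff[OF L2_translate(1)[OF v, of ?s] v], of "(y \<bullet> b) *\<^sub>R b"] by simp
      have "L2_norm (\<lambda>x. v (x + (y \<bullet> b) *\<^sub>R b + ?s) - v x)
          \<le> L2_norm (\<lambda>x. v (x + (y \<bullet> b) *\<^sub>R b + ?s) - v (x + (y \<bullet> b) *\<^sub>R b)) + L2_norm (\<lambda>x. v (x + (y \<bullet> b) *\<^sub>R b) - v x)"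
        unfolding add.assoc by (rule L2_norm_diff_triangle) (intro L2_translate v)+
      then show ?case
        using insert 1 has_partial_translate[OF assms[of b], of "y \<bullet> b"]
        by (simp add: add.assoc algebra_simps)
    qed
    from this[OF order_refl] have "L2_norm (\<lambda>x. v (x + y) - v x) \<le> (\<Sum>b\<in>Basis. \<bar>y \<bullet> b\<bar> * L2_norm (g b))"
      by (simp add: euclidean_representation)
    also have "\<dots> \<le> (\<Sum>b\<in>Basis. norm y * L2_norm (g b))"
      by (intro sum_mono mult_right_mono) (auto simp: Basis_le_norm)
    finally show ?thesis by (simp add: sum_distrib_left)
  qed
  then show ?thesis using v by (simp add: translation_Lipschitz_def)
qed

text \<open>The increment of \<open>v\<close> is the integral of translates of \<open>g\<close>, each of which differs from \<open>g\<close> by at most \<open>h * L2_norm g2\<close>.\<close>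

lemma difference_quotient_bound:
  assumes vg: "has_partial v b g" and gg: "has_partial g b g2" and h: "0 \<le> h"
  shows "L2_norm (\<lambda>x. v (x + h *\<^sub>R b) - v x - of_real h * g x) \<le> h\<^sup>2 * L2_norm g2"
proof -
  note v = has_partialD(1)[OF vg] and g = has_partialD(2)[OF vg]
  note [measurable] = L2_measurable[OF v] L2_measurable[OF g]
  have mG: "(\<lambda>(s, x). g (x + s *\<^sub>R b)) \<in> borel_measurable borel"
    unfolding borel_prod[symmetric] by measurable
  have bG: "AE s in lborel. s \<in> {0..h} \<longrightarrow> (\<lambda>x. g (x + s *\<^sub>R b)) \<in> L2 \<and> L2_norm (\<lambda>x. g (x + s *\<^sub>R b)) \<le> L2_norm g"
    using L2_translate[OF g] by auto
  note G = Minkowski_interval[OF mG bG h L2_norm_nonneg]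
  have mD: "(\<lambda>(s, x). g (x + s *\<^sub>R b) - g x) \<in> borel_measurable borel"
    unfolding borel_prod[symmetric] by measurable
  have bD: "AE s in lborel. s \<in> {0..h} \<longrightarrow> (\<lambda>x. g (x + s *\<^sub>R b) - g x) \<in> L2
      \<and> L2_norm (\<lambda>x. g (x + s *\<^sub>R b) - g x) \<le> h * L2_norm g2"
  proof (intro AE_I2 impI conjI)
    fix s assume s: "s \<in> {0..h}"
    show "(\<lambda>x. g (x + s *\<^sub>R b) - g x) \<in> L2" by (intro L2_diff L2_translate g)
    show "L2_norm (\<lambda>x. g (x + s *\<^sub>R b) - g x) \<le> h * L2_norm g2"
      using has_partial_translate[OF gg, of s] s mult_right_mono[of s h "L2_norm g2"] by simp
  qed
  have hK: "0 \<le> h * L2_norm g2" using h by simp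
  note D = Minkowski_interval[OF mD bD h hK]
  have "AE x in lborel. v (x + h *\<^sub>R b) - v x - of_real h * g x = (LINT s:{0..h}|lborel. g (x + s *\<^sub>R b) - g x)"
    using weak_deriv_increment[OF vg h] G(3)
  proof eventually_elim
    fix x assume a: "v (x + h *\<^sub>R b) - v x = (LINT s:{0..h}|lborel. g (x + s *\<^sub>R b))"
      and i: "set_integrable lborel {0..h} (\<lambda>s. g (x + s *\<^sub>R b))"
    have iz: "set_integrable lborel {0..h} (\<lambda>s. g x)"
      unfolding set_integrable_def using h by (intro integrable_scaleR_left integrable_real_indicator) simp_all
    have "(LINT s:{0..h}|lborel. g x) = of_real h * g x"
      using h by (simp add: set_lebesgue_integral_def scaleR_conv_of_real)
    then show "v (x + h *\<^sub>R b) - v x - of_real h * g x = (LINT s:{0..h}|lborel. g (x + s *\<^sub>R b) - g x)"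
      using a set_integral_diff(2)[OF i iz] by simp
  qed
  then have "L2_norm (\<lambda>x. v (x + h *\<^sub>R b) - v x - of_real h * g x) = L2_norm (\<lambda>x. LINT s:{0..h}|lborel. g (x + s *\<^sub>R b) - g x)"
    by (intro L2_norm_cong_AE) (use D(1) in measurable)
  then show ?thesis using D(2) by (simp add: power2_eq_square mult.assoc)
qed

text \<open>Integration by parts, obtained from difference quotients alone: they are antisymmetric by translation
  invariance, and the error terms are controlled by the second derivative.\<close>

lemma Green_partial:
  assumes wg: "has_partial w b g" and gg: "has_partial g b g2"
  shows "pairing g2 (\<lambda>x. cnj (w x)) = - of_real ((L2_norm g)\<^sup>2)"
proof -
  note w = has_partialD(1)[OF wg] and g = has_partialD(2)[OF wg] and g2 = has_partialD(2)[OF gg]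
  note [measurable] = L2_measurable[OF w] L2_measurable[OF g] L2_measurable[OF g2]
  define c where "c x = cnj (w x)" for x
  have c: "c \<in> L2" unfolding c_def[abs_def] using w by (rule L2_cnj)
  note [measurable] = L2_measurable[OF c]
  have cg: "(\<lambda>x. cnj (g x)) \<in> L2" using g by (rule L2_cnj)
  define z where "z = pairing g2 c + of_real ((L2_norm g)\<^sup>2)"
  have bound: "cmod z \<le> h * (3 * L2_norm g * L2_norm g2)" if h: "0 < h" for h
  proof -
    let ?g = "\<lambda>x. g (x + h *\<^sub>R b)" and ?c = "\<lambda>x. c (x + h *\<^sub>R b)"
    have h0: "0 \<le> h" using h by simp
    have g': "?g \<in> L2" and c': "?c \<in> L2" by (intro L2_translate g c)+
    have mG: "(\<lambda>(s, x). g2 (x + s *\<^sub>R b)) \<in> borel_measurable borel"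
      unfolding borel_prod[symmetric] by measurable
    have bG: "AE s in lborel. s \<in> {0..h} \<longrightarrow> (\<lambda>x. g2 (x + s *\<^sub>R b)) \<in> L2 \<and> L2_norm (\<lambda>x. g2 (x + s *\<^sub>R b)) \<le> L2_norm g2"
      using L2_translate[OF g2] by auto
    note G = Minkowski_interval[OF mG bG h0 L2_norm_nonneg]
    have near: "cmod (pairing (\<lambda>x. g2 (x + s *\<^sub>R b)) c - pairing g2 c) \<le> h * (L2_norm g * L2_norm g2)" if "s \<in> {0..h}" for s
    proof -
      have cs: "(\<lambda>x. c (x - s *\<^sub>R b)) \<in> L2" using L2_translate(1)[OF c, of "- (s *\<^sub>R b)"] by simp
      have n: "L2_norm (\<lambda>x. c (x - s *\<^sub>R b) - c x) \<le> s * L2_norm g"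
        using has_partial_translate[OF wg, of "- s"] that L2_norm_cnj[of "\<lambda>x. w (x - s *\<^sub>R b) - w x"]
        by (simp add: c_def)
      have "pairing (\<lambda>x. g2 (x + s *\<^sub>R b)) c - pairing g2 c = pairing g2 (\<lambda>x. c (x - s *\<^sub>R b) - c x)"
        by (simp add: pairing_translate pairing_diff_right g2 c cs)
      then have "cmod (pairing (\<lambda>x. g2 (x + s *\<^sub>R b)) c - pairing g2 c) \<le> L2_norm g2 * L2_norm (\<lambda>x. c (x - s *\<^sub>R b) - c x)"
        using pairing_Cauchy_Schwarz[OF g2 L2_diff[OF cs c]] by simp
      also have "\<dots> \<le> L2_norm g2 * (s * L2_norm g)" by (intro mult_left_mono n) simp
      also have "\<dots> \<le> L2_norm g2 * (h * L2_norm g)" using that by (intro mult_left_mono mult_right_mono) auto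
      finally show ?thesis by (simp add: algebra_simps)
    qed
    have "pairing (\<lambda>x. ?g x - g x) c = pairing (\<lambda>x. LINT s:{0..h}|lborel. g2 (x + s *\<^sub>R b)) c"
      by (rule pairing_cong_AE[OF _ _ _ weak_deriv_increment[OF gg h0]]) (use G(1) in measurable)
    also have "\<dots> = (LINT s:{0..h}|lborel. pairing (\<lambda>x. g2 (x + s *\<^sub>R b)) c)" by (rule G(5)[OF c])
    finally have "cmod (pairing (\<lambda>x. ?g x - g x) c - of_real (h - 0) * pairing g2 c) \<le> (h - 0) * (h * (L2_norm g * L2_norm g2))"
      using set_integral_near_const[OF G(4)[OF c] _ h0, of "pairing g2 c" "h * (L2_norm g * L2_norm g2)"] near by auto
    then have 1: "cmod (pairing (\<lambda>x. ?g x - g x) c - of_real h * pairing g2 c) \<le> h\<^sup>2 * (L2_norm g * L2_norm g2)"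
      by (simp add: power2_eq_square mult.assoc)
    define r where "r x = ?c x - c x - of_real h * cnj (g x)" for x
    have r: "r \<in> L2" unfolding r_def[abs_def] by (intro L2_diff L2_scale c c' cg)
    have "L2_norm r = L2_norm (\<lambda>x. w (x + h *\<^sub>R b) - w x - of_real h * g x)"
      using L2_norm_cnj[of "\<lambda>x. w (x + h *\<^sub>R b) - w x - of_real h * g x"] by (simp add: r_def[abs_def] c_def)
    then have rn: "L2_norm r \<le> h\<^sup>2 * L2_norm g2" using difference_quotient_bound[OF wg gg h0] by simp
    have "pairing (\<lambda>x. ?g x - g x) c = - pairing ?g (\<lambda>x. ?c x - c x)"
      using pairing_translate[of g ?c "h *\<^sub>R b"] by (simp add: pairing_diff_left pairing_diff_right g g' c c')
    also have "(\<lambda>x. ?c x - c x) = (\<lambda>x. r x + of_real h * cnj (g x))" by (simp add: r_def)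
    also have "pairing ?g (\<lambda>x. r x + of_real h * cnj (g x)) = pairing ?g r + of_real h * pairing ?g (\<lambda>x. cnj (g x))"
      by (simp add: pairing_add_right pairing_scale_right g' r cg L2_scale)
    also have "pairing ?g (\<lambda>x. cnj (g x)) = pairing (\<lambda>x. ?g x - g x) (\<lambda>x. cnj (g x)) + of_real ((L2_norm g)\<^sup>2)"
      by (simp add: pairing_diff_left g g' cg pairing_cnj_self)
    finally have 2: "pairing (\<lambda>x. ?g x - g x) c + of_real h * of_real ((L2_norm g)\<^sup>2)
        = - (pairing ?g r + of_real h * pairing (\<lambda>x. ?g x - g x) (\<lambda>x. cnj (g x)))"
      by (simp add: algebra_simps)
    have a: "cmod (pairing ?g r) \<le> L2_norm g * (h\<^sup>2 * L2_norm g2)"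
      using pairing_Cauchy_Schwarz[OF g' r] L2_translate(2)[OF g] rn mult_left_mono[OF rn L2_norm_nonneg[of g]] by (simp add: order_trans)
    have "cmod (pairing (\<lambda>x. ?g x - g x) (\<lambda>x. cnj (g x))) \<le> L2_norm (\<lambda>x. ?g x - g x) * L2_norm g"
      using pairing_Cauchy_Schwarz[OF L2_diff[OF g' g] cg] by simp
    also have "\<dots> \<le> (h * L2_norm g2) * L2_norm g"
      using has_partial_translate_pos[OF gg h0] by (intro mult_right_mono) auto
    finally have b: "cmod (of_real h * pairing (\<lambda>x. ?g x - g x) (\<lambda>x. cnj (g x))) \<le> h * ((h * L2_norm g2) * L2_norm g)"
      using h by (simp add: norm_mult)
    let ?p = "pairing (\<lambda>x. ?g x - g x) c"
    have hz: "of_real h * z = (?p + of_real h * of_real ((L2_norm g)\<^sup>2)) - (?p - of_real h * pairing g2 c)"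
      by (simp add: z_def algebra_simps)
    have "cmod (of_real h * z) \<le> cmod (?p + of_real h * of_real ((L2_norm g)\<^sup>2)) + cmod (?p - of_real h * pairing g2 c)"
      unfolding hz by (rule norm_triangle_ineq4)
    also have "\<dots> \<le> cmod (?p + of_real h * of_real ((L2_norm g)\<^sup>2)) + h\<^sup>2 * (L2_norm g * L2_norm g2)"
      using 1 by simp
    also have "cmod (pairing (\<lambda>x. ?g x - g x) c + of_real h * of_real ((L2_norm g)\<^sup>2)) \<le> 2 * (h\<^sup>2 * (L2_norm g * L2_norm g2))"
      unfolding 2 norm_minus_cancel
      using norm_triangle_ineq[of "pairing ?g r" "of_real h * pairing (\<lambda>x. ?g x - g x) (\<lambda>x. cnj (g x))"] a b
      by (simp add: power2_eq_square algebra_simps)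
    finally have "h * cmod z \<le> h * (h * (3 * L2_norm g * L2_norm g2))"
      using h by (simp add: norm_mult power2_eq_square algebra_simps)
    then show ?thesis using h by simp
  qed
  have "cmod z \<le> 0"
  proof (rule field_le_epsilon)
    fix e :: real assume e: "0 < e"
    define C where "C = 3 * L2_norm g * L2_norm g2"
    have C: "0 \<le> C" by (simp add: C_def)
    have "0 < e / (C + 1)" using e C by simp
    from bound[OF this] have "cmod z \<le> (e / (C + 1)) * C" by (simp only: C_def)
    also have "\<dots> \<le> e" using e C by (simp add: field_simps)
    finally show "cmod z \<le> 0 + e" by simp
  qed
  then show ?thesis by (simp add: z_def c_def[abs_def] eq_neg_iff_add_eq_0)
qed

section \<open>Mollification\<close>

text \<open>A superposition of translations; with a kernel evaluated at \<open>y - x\<close> it is the pairing with a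
  translated bump, which is how it enters the equation.\<close>

definition smear :: "('a::euclidean_space \<Rightarrow> complex) \<Rightarrow> ('a \<Rightarrow> complex) \<Rightarrow> 'a \<Rightarrow> complex" where
  "smear a f x = (\<integral>y. a y * f (x + y) \<partial>lborel)"

lemma smear_eq_pairing:
  assumes "a \<in> borel_measurable borel" "f \<in> borel_measurable borel"
  shows "smear a f x = pairing f (\<lambda>y. a (y - x))"
  using pairing_translate[OF assms(2,1), of x] by (simp add: smear_def pairing_def mult.commute add.commute)

lemma smear_Minkowski:
  assumes a: "a \<in> bumps" and f: "f \<in> L2"
  shows "smear a f \<in> L2" "L2_norm (smear a f) \<le> (\<integral>y. cmod (a y) \<partial>lborel) * L2_norm f"
    "g \<in> L2 \<Longrightarrow> integrable lborel (\<lambda>y. a y * pairing (\<lambda>x. f (x + y)) g)"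
    "g \<in> L2 \<Longrightarrow> pairing (smear a f) g = (\<integral>y. a y * pairing (\<lambda>x. f (x + y)) g \<partial>lborel)"
    "AE x in lborel. integrable lborel (\<lambda>y. a y * f (x + y))"
proof -
  note [measurable] = bumps_measurable[OF a] L2_measurable[OF f]
  have m: "(\<lambda>(y, x). a y * f (x + y)) \<in> borel_measurable borel"
    unfolding borel_prod[symmetric] by measurable
  have b: "AE y in lborel. (\<lambda>x. a y * f (x + y)) \<in> L2 \<and> L2_norm (\<lambda>x. a y * f (x + y)) \<le> cmod (a y) * L2_norm f"
    by (intro AE_I2 conjI L2_scale L2_translate f) (simp add: L2_norm_scale L2_translate[OF f])
  have i: "integrable lborel (\<lambda>y. cmod (a y) * L2_norm f)"
    using bumps_integrable[OF a] by simp
  note M = Minkowski_integral[OF m b i]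
  show "smear a f \<in> L2" "L2_norm (smear a f) \<le> (\<integral>y. cmod (a y) \<partial>lborel) * L2_norm f"
    "AE x in lborel. integrable lborel (\<lambda>y. a y * f (x + y))"
    using M(1,2,3) by (simp_all add: smear_def[abs_def])
  assume g: "g \<in> L2"
  show "integrable lborel (\<lambda>y. a y * pairing (\<lambda>x. f (x + y)) g)"
    "pairing (smear a f) g = (\<integral>y. a y * pairing (\<lambda>x. f (x + y)) g \<partial>lborel)"
    using M(5,6)[OF g] by (simp_all add: smear_def[abs_def] pairing_scale_left)
qed

text \<open>Real and even kernels: smearing with them is self-adjoint and commutes with complex conjugation.\<close>

definition symmetric_kernel :: "('a::euclidean_space \<Rightarrow> complex) \<Rightarrow> bool" where
  "symmetric_kernel a \<longleftrightarrow> a \<in> bumps \<and> (\<forall>x. a (- x) = a x) \<and> (\<forall>x. cnj (a x) = a x)"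

lemma lborel_integral_reflect:
  fixes F :: "'a::euclidean_space \<Rightarrow> complex"
  shows "(\<integral>y. F (- y) \<partial>lborel) = (\<integral>y. F y \<partial>lborel)"
proof (cases "F \<in> borel_measurable borel")
  case True
  note [measurable] = True
  have eq: "lborel = distr lborel borel (\<lambda>x::'a. - x)"
    using lborel_affine[of "-1" "0::'a"] by (simp add: density_1)
  have "(\<integral>y. F y \<partial>lborel) = (\<integral>y. F y \<partial>distr lborel borel (\<lambda>x::'a. - x))"
    by (rule arg_cong[OF eq])
  then show ?thesis by (simp add: integral_distr)
next
  case False
  have "(\<lambda>y. F (- y)) \<notin> borel_measurable borel"
  proof
    assume "(\<lambda>y. F (- y)) \<in> borel_measurable borel"
    from measurable_compose[OF borel_measurable_uminus[OF measurable_ident_sets[OF refl]] this] False show False by simp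
  qed
  then have "\<not> integrable lborel (\<lambda>y. F (- y))" "\<not> integrable lborel F"
    using False borel_measurable_integrable by fastforce+
  then show ?thesis by (simp add: not_integrable_integral_eq)
qed

lemma smear_adjoint:
  assumes a: "symmetric_kernel a" and f: "f \<in> L2" and g: "g \<in> L2"
  shows "pairing (smear a f) g = pairing f (smear a g)"
proof -
  have ab: "a \<in> bumps" and ev: "a (- x) = a x" for x using a by (auto simp: symmetric_kernel_def)
  have "pairing (smear a f) g = (\<integral>y. a y * pairing f (\<lambda>x. g (x - y)) \<partial>lborel)"
    by (simp add: smear_Minkowski(4)[OF ab f g] pairing_translate L2_measurable f g)
  also have "\<dots> = (\<integral>y. a y * pairing f (\<lambda>x. g (x + y)) \<partial>lborel)"
    using lborel_integral_reflect[of "\<lambda>y. a y * pairing f (\<lambda>x. g (x + y))"] by (simp add: ev)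
  also have "\<dots> = pairing (smear a g) f"
    using smear_Minkowski(4)[OF ab g f] by (simp only: pairing_commute[of _ f])
  finally show ?thesis by (simp only: pairing_commute[of _ f])
qed

lemma cnj_smear:
  assumes "symmetric_kernel a" shows "cnj (smear a f x) = smear a (\<lambda>x. cnj (f x)) x"
  using assms Bochner_Integration.integral_cnj[of lborel "\<lambda>y. a y * f (x + y)"]
  by (simp add: smear_def symmetric_kernel_def)

text \<open>The kernel of \<open>smear a\<close> composed with \<open>smear c\<close> depends on the difference of the variables through a real
  even function, so the quadratic form below is real. This replaces the symmetry of the Laplacian.\<close>

lemma smear_pairing_real:
  assumes a: "symmetric_kernel a" and c: "symmetric_kernel c" and f: "f \<in> L2"
  shows "Im (pairing (smear a f) (\<lambda>x. cnj (smear c f x))) = 0"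
proof -
  have ab: "a \<in> bumps" and cb: "c \<in> bumps" using a c by (auto simp: symmetric_kernel_def)
  have ra: "cnj (a x) = a x" "a (- x) = a x" and rc: "cnj (c x) = c x" "c (- x) = c x" for x
    using a c by (auto simp: symmetric_kernel_def)
  note [measurable] = L2_measurable[OF f]
  have cf: "(\<lambda>x. cnj (f x)) \<in> L2" using f by (rule L2_cnj)
  note [measurable] = L2_measurable[OF cf]
  define \<Gamma> where "\<Gamma> v = pairing (\<lambda>x. f (x + v)) (\<lambda>x. cnj (f x))" for v
  have shift: "pairing (\<lambda>x. f (x + y)) (\<lambda>x. cnj (f (x + z))) = \<Gamma> (y - z)" for y z
  proof -
    have m: "(\<lambda>x. f (x + (y - z))) \<in> borel_measurable borel" by measurable
    have m': "(\<lambda>x. cnj (f (x + z))) \<in> borel_measurable borel" by measurable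
    show ?thesis using pairing_translate[OF m m', of z] by (simp add: \<Gamma>_def algebra_simps)
  qed
  have cG: "cnj (\<Gamma> v) = \<Gamma> (- v)" for v
    using shift[of 0 v] by (simp add: \<Gamma>_def cnj_pairing pairing_commute)
  have inner: "pairing (\<lambda>x. f (x + y)) (\<lambda>x. cnj (smear c f x)) = (\<integral>z. c z * \<Gamma> (y - z) \<partial>lborel)" for y
  proof -
    have fy: "(\<lambda>x. f (x + y)) \<in> L2" by (rule L2_translate[OF f])
    have "pairing (\<lambda>x. f (x + y)) (\<lambda>x. cnj (smear c f x)) = pairing (smear c (\<lambda>x. cnj (f x))) (\<lambda>x. f (x + y))"
      by (simp add: cnj_smear[OF c] pairing_commute)
    also have "\<dots> = (\<integral>z. c z * pairing (\<lambda>x. cnj (f (x + z))) (\<lambda>x. f (x + y)) \<partial>lborel)"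
      using smear_Minkowski(4)[OF cb cf fy] by simp
    finally show ?thesis using shift[of y] by (simp add: pairing_commute[of "\<lambda>x. f (x + y)"])
  qed
  have val: "pairing (smear a f) (\<lambda>x. cnj (smear c f x)) = (\<integral>y. a y * (\<integral>z. c z * \<Gamma> (y - z) \<partial>lborel) \<partial>lborel)"
    using smear_Minkowski(4)[OF ab f L2_cnj[OF smear_Minkowski(1)[OF cb f]]] by (simp add: inner)
  have "cnj (pairing (smear a f) (\<lambda>x. cnj (smear c f x))) = (\<integral>y. a y * (\<integral>z. c z * \<Gamma> (z - y) \<partial>lborel) \<partial>lborel)"
    unfolding val Bochner_Integration.integral_cnj[symmetric] complex_cnj_mult ra rc cG by simp
  also have "\<dots> = (\<integral>y. a y * (\<integral>z. c z * \<Gamma> (- y - z) \<partial>lborel) \<partial>lborel)"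
  proof -
    have "(\<integral>z. c z * \<Gamma> (z - y) \<partial>lborel) = (\<integral>z. c z * \<Gamma> (- y - z) \<partial>lborel)" for y
      using lborel_integral_reflect[of "\<lambda>z. c z * \<Gamma> (z - y)"] by (simp add: rc minus_diff_commute[of _ y])
    then show ?thesis by (simp only:)
  qed
  also have "\<dots> = (\<integral>y. a y * (\<integral>z. c z * \<Gamma> (y - z) \<partial>lborel) \<partial>lborel)"
    using lborel_integral_reflect[of "\<lambda>y. a y * (\<integral>z. c z * \<Gamma> (y - z) \<partial>lborel)"] by (simp add: ra)
  finally have "cnj (pairing (smear a f) (\<lambda>x. cnj (smear c f x))) = pairing (smear a f) (\<lambda>x. cnj (smear c f x))"
    unfolding val .
  then show ?thesis by (simp add: complex_eq_iff)
qed

definition laplacian :: "('a::euclidean_space \<Rightarrow> complex) \<Rightarrow> 'a \<Rightarrow> complex" where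
  "laplacian \<phi> x = (\<Sum>b\<in>Basis. iter_deriv [b, b] \<phi> x)"

lemma laplacian_bumps: "\<phi> \<in> bumps \<Longrightarrow> laplacian \<phi> \<in> bumps"
  unfolding laplacian_def[abs_def] by (intro bumps_sum bumps_iter_deriv)

lemma laplacian_translate: "laplacian (\<lambda>x. \<phi> (x + y)) = (\<lambda>x. laplacian \<phi> (x + y))"
  unfolding laplacian_def[abs_def] iter_deriv_translate ..

lemma bumps_has_vector_derivative:
  assumes "\<phi> \<in> bumps" shows "((\<lambda>s. \<phi> (x + s *\<^sub>R b)) has_vector_derivative dir_deriv b \<phi> x) (at 0)"
  using flat_algebra_has_derivative[OF bumps_flat_algebra[OF assms]] dir_deriv_eq by metis

lemma laplacian_symmetric_kernel:
  assumes a: "symmetric_kernel a" shows "symmetric_kernel (laplacian a)"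
proof -
  have ab: "a \<in> bumps" using a by (simp add: symmetric_kernel_def)
  have cn: "cnj (dir_deriv b \<phi> x) = dir_deriv b (\<lambda>x. cnj (\<phi> x)) x" if "\<phi> \<in> bumps" for \<phi> b x
    unfolding dir_deriv_def[of b "\<lambda>x. cnj (\<phi> x)"]
    using bounded_linear.has_vector_derivative[OF bounded_linear_cnj bumps_has_vector_derivative[OF that, of x b]]
    by (simp add: vector_derivative_at)
  have rf: "dir_deriv b \<phi> (- x) = - dir_deriv b (\<lambda>x. \<phi> (- x)) x" if "\<phi> \<in> bumps" for \<phi> b x
  proof -
    have u: "(uminus has_vector_derivative - 1) (at (0::real))" by (auto intro!: derivative_eq_intros)
    have h0: "((\<lambda>s. \<phi> (- x + s *\<^sub>R b)) has_vector_derivative dir_deriv b \<phi> (- x)) (at (- 0))"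
      using bumps_has_vector_derivative[OF that, of "- x" b] by (simp only: minus_zero)
    have "((\<lambda>s. (\<lambda>x. \<phi> (- x)) (x + s *\<^sub>R b)) has_vector_derivative - dir_deriv b \<phi> (- x)) (at 0)"
      using vector_diff_chain_at[OF u h0]
      by (simp only: o_def minus_add_distrib scaleR_minus_left scaleR_minus1_left scaleR_one)
    then show ?thesis unfolding dir_deriv_def[of b "\<lambda>x. \<phi> (- x)"] by (simp only: vector_derivative_at) simp
  qed
  have sc: "dir_deriv b (\<lambda>x. - \<phi> x) x = - dir_deriv b \<phi> x" if "\<phi> \<in> bumps" for \<phi> b x
    unfolding dir_deriv_def[of b "\<lambda>x. - \<phi> x"]
    using has_vector_derivative_minus[OF bumps_has_vector_derivative[OF that]] by (simp add: vector_derivative_at)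
  have even: "(\<lambda>x. a (- x)) = a" and real: "(\<lambda>x. cnj (a x)) = a" using a by (auto simp: symmetric_kernel_def)
  have 1: "(\<lambda>x. dir_deriv b a (- x)) = (\<lambda>x. - dir_deriv b a x)" for b
    using rf[OF ab, unfolded even] by (simp add: fun_eq_iff)
  have 2: "iter_deriv [b, b] a (- x) = iter_deriv [b, b] a x" for b x
    using rf[OF bumps_dir_deriv[OF ab], unfolded 1] sc[OF bumps_dir_deriv[OF ab]] by simp
  have 3: "(\<lambda>x. cnj (dir_deriv b a x)) = dir_deriv b a" for b
    using cn[OF ab, unfolded real] by (simp add: fun_eq_iff)
  have 4: "cnj (iter_deriv [b, b] a x) = iter_deriv [b, b] a x" for b x
    using cn[OF bumps_dir_deriv[OF ab], unfolded 3] by simp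
  show ?thesis using 2 4 laplacian_bumps[OF ab] by (simp add: symmetric_kernel_def laplacian_def)
qed

definition moll_bump :: "real \<Rightarrow> 'a::euclidean_space \<Rightarrow> real" where
  "moll_bump \<delta> = box_bump (1 / \<delta>) (- (\<delta> *\<^sub>R One)) (\<delta> *\<^sub>R One)"

definition mollifier :: "real \<Rightarrow> 'a::euclidean_space \<Rightarrow> complex" where
  "mollifier \<delta> x = of_real (moll_bump \<delta> x / (\<integral>y. moll_bump \<delta> (y::'a) \<partial>lborel))"

text \<open>On the concentric box of half the size all factors of the product of flat functions are evaluated at arguments that are at least
  \<open>1 / 2\<close>, so each of the \<open>2 * DIM('a)\<close> factors is at least \<open>exp (- 2)\<close>.\<close>

lemma moll_bump_integral:
  assumes d: "\<delta> > 0"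
  shows "integrable lborel (moll_bump \<delta> :: 'a::euclidean_space \<Rightarrow> real)"
    "exp (- 4 * real DIM('a)) * \<delta> ^ DIM('a) \<le> (\<integral>y. moll_bump \<delta> (y::'a) \<partial>lborel)"
proof -
  have "(\<lambda>x::'a. complex_of_real (moll_bump \<delta> x)) \<in> bumps"
    unfolding moll_bump_def using d by (intro box_bump_bumps) simp
  from integrable_Re[OF bumps_integrable[OF this]]
  show int: "integrable lborel (moll_bump \<delta> :: 'a \<Rightarrow> real)" by simp
  define S :: "'a set" where "S = cbox (- (\<delta> / 2) *\<^sub>R One) ((\<delta> / 2) *\<^sub>R One)"
  have low: "indicator S x * exp (- 4 * real DIM('a)) \<le> moll_bump \<delta> x" for x :: 'a
  proof (cases "x \<in> S")
    case True
    have e2: "exp (- 2) \<le> flat 1 s" if "1 / 2 \<le> s" for s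
      using that by (simp add: flat_def field_simps)
    have "(\<Prod>b\<in>(Basis::'a set). exp (- 2) * exp (- 2 :: real)) \<le> moll_bump \<delta> x"
      unfolding moll_bump_def box_bump_def
    proof (intro prod_mono conjI mult_mono e2)
      fix b :: 'a assume b: "b \<in> Basis"
      have "- (\<delta> / 2) \<le> x \<bullet> b" "x \<bullet> b \<le> \<delta> / 2" using True b by (auto simp: S_def mem_box)
      then show "1 / 2 \<le> 1 / \<delta> * (x \<bullet> b - - (\<delta> *\<^sub>R One) \<bullet> b)" "1 / 2 \<le> 1 / \<delta> * (\<delta> *\<^sub>R One \<bullet> b - x \<bullet> b)"
        using d b by (auto simp: field_simps)
    qed (auto simp: flat_1_bounds)
    then show ?thesis using True by (simp add: exp_add[symmetric] exp_of_nat_mult[symmetric] mult.commute)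
  next
    case False
    then show ?thesis by (simp add: moll_bump_def box_bump_nonneg)
  qed
  have mS: "measure lborel S = \<delta> ^ DIM('a)"
  proof -
    have "measure lborel S = (\<Prod>b\<in>Basis. ((\<delta> / 2) *\<^sub>R One - (- (\<delta> / 2) *\<^sub>R One)) \<bullet> (b::'a))"
      unfolding S_def by (rule measure_lborel_cbox) (use d in auto)
    also have "\<dots> = (\<Prod>b\<in>(Basis::'a set). \<delta>)"
      by (rule prod.cong) (auto simp: inner_add_left)
    finally show ?thesis by simp
  qed
  have fS: "emeasure lborel S < \<infinity>" by (simp add: S_def emeasure_lborel_cbox_eq)
  have iS: "integrable lborel (\<lambda>x. indicator S x * exp (- 4 * real DIM('a)))"
    using fS by (intro integrable_mult_left integrable_real_indicator) (auto simp: S_def)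
  have "(\<integral>x. indicator S x * exp (- 4 * real DIM('a)) \<partial>lborel) \<le> (\<integral>y. moll_bump \<delta> (y::'a) \<partial>lborel)"
    by (rule integral_mono[OF iS int low])
  then show "exp (- 4 * real DIM('a)) * \<delta> ^ DIM('a) \<le> (\<integral>y. moll_bump \<delta> (y::'a) \<partial>lborel)"
    by (simp add: mS mult.commute)
qed

lemma mollifier_symmetric:
  assumes d: "\<delta> > 0" shows "symmetric_kernel (mollifier \<delta> :: 'a::euclidean_space \<Rightarrow> complex)"
proof -
  have "(\<lambda>x::'a. complex_of_real (1 / (\<integral>y. moll_bump \<delta> (y::'a) \<partial>lborel)) * of_real (moll_bump \<delta> x)) \<in> bumps"
    unfolding moll_bump_def using d by (intro bumps_scale box_bump_bumps) simp
  moreover have "moll_bump \<delta> (- x) = moll_bump \<delta> x" for x :: 'a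
    unfolding moll_bump_def box_bump_def by (rule prod.cong) (auto simp: algebra_simps)
  ultimately show ?thesis by (simp add: symmetric_kernel_def mollifier_def[abs_def])
qed

lemma mollifier_bumps: "\<delta> > 0 \<Longrightarrow> mollifier \<delta> \<in> bumps"
  using mollifier_symmetric by (auto simp: symmetric_kernel_def)

lemma mollifier_properties:
  fixes x :: "'a::euclidean_space"
  assumes d: "\<delta> > 0"
  shows "(\<integral>x. mollifier \<delta> (x::'a) \<partial>lborel) = 1" "(\<integral>x. cmod (mollifier \<delta> (x::'a)) \<partial>lborel) = 1"
    "mollifier \<delta> x \<noteq> 0 \<Longrightarrow> norm x \<le> real DIM('a) * \<delta>"
    "(L2_norm (mollifier \<delta> :: 'a \<Rightarrow> complex))\<^sup>2 \<le> exp (4 * real DIM('a)) / \<delta> ^ DIM('a)"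
proof -
  define Z where "Z = (\<integral>y. moll_bump \<delta> (y::'a) \<partial>lborel)"
  have Z0: "exp (- 4 * real DIM('a)) * \<delta> ^ DIM('a) \<le> Z" unfolding Z_def by (rule moll_bump_integral[OF d])
  have "0 < exp (- 4 * real DIM('a)) * \<delta> ^ DIM('a)" using d by simp
  with Z0 have Z: "0 < Z" by linarith
  have nn: "0 \<le> moll_bump \<delta> y" "moll_bump \<delta> y \<le> 1" for y :: 'a
    by (simp_all add: moll_bump_def box_bump_nonneg box_bump_le_1)
  have m: "mollifier \<delta> y = of_real (moll_bump \<delta> y / Z)" for y :: 'a by (simp add: mollifier_def Z_def)
  have cm: "cmod (mollifier \<delta> y) = moll_bump \<delta> y / Z" for y :: 'a
    unfolding m norm_of_real using nn[of y] Z by simp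
  show 2: "(\<integral>x. cmod (mollifier \<delta> (x::'a)) \<partial>lborel) = 1" unfolding cm using Z by (simp add: Z_def)
  show "(\<integral>x. mollifier \<delta> (x::'a) \<partial>lborel) = 1"
  proof -
    have "(\<integral>x. mollifier \<delta> (x::'a) \<partial>lborel) = of_real (\<integral>x. moll_bump \<delta> (x::'a) / Z \<partial>lborel)"
      unfolding m by (rule integral_complex_of_real)
    then show ?thesis using 2 unfolding cm by simp
  qed
  show "mollifier \<delta> x \<noteq> 0 \<Longrightarrow> norm x \<le> real DIM('a) * \<delta>"
  proof -
    assume "mollifier \<delta> x \<noteq> 0"
    then have "box_bump (1 / \<delta>) (- (\<delta> *\<^sub>R One)) (\<delta> *\<^sub>R One) x \<noteq> 0" by (auto simp: m moll_bump_def)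
    then have "x \<in> box (- (\<delta> *\<^sub>R One)) (\<delta> *\<^sub>R One)" using box_bump_outside[of "1 / \<delta>" x] d by fastforce
    then have "\<bar>x \<bullet> b\<bar> \<le> \<delta>" if "b \<in> Basis" for b using that by (auto simp: mem_box abs_le_iff)
    then have "(\<Sum>b\<in>Basis. \<bar>x \<bullet> b\<bar>) \<le> (\<Sum>b\<in>(Basis::'a set). \<delta>)" by (intro sum_mono)
    then show "norm x \<le> real DIM('a) * \<delta>" using norm_le_l1[of x] by simp
  qed
  have "(L2_norm (mollifier \<delta> :: 'a \<Rightarrow> complex))\<^sup>2 = (\<integral>y. (moll_bump \<delta> (y::'a) / Z)\<^sup>2 \<partial>lborel)"
    by (simp add: L2_norm_square cm)
  also have "\<dots> \<le> (\<integral>y. moll_bump \<delta> (y::'a) / Z\<^sup>2 \<partial>lborel)"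
  proof (rule integral_mono)
    show "integrable lborel (\<lambda>y::'a. (moll_bump \<delta> y / Z)\<^sup>2)"
      using L2_integrable[OF bumps_L2[OF mollifier_bumps[OF d, where 'a='a]]] by (simp only: cm)
    show "integrable lborel (\<lambda>y::'a. moll_bump \<delta> y / Z\<^sup>2)" by (rule integrable_divide) (rule moll_bump_integral(1)[OF d])
    show "(moll_bump \<delta> y / Z)\<^sup>2 \<le> moll_bump \<delta> y / Z\<^sup>2" for y :: 'a
      unfolding power_divide using nn[of y] by (intro divide_right_mono) (auto simp: power2_eq_square mult_left_le)
  qed
  also have "\<dots> = 1 / Z" using Z by (simp add: Z_def[symmetric] power2_eq_square)
  also have "\<dots> \<le> 1 / (exp (- 4 * real DIM('a)) * \<delta> ^ DIM('a))"
    using Z0 Z d by (intro divide_left_mono mult_pos_pos) auto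
  finally show "(L2_norm (mollifier \<delta> :: 'a \<Rightarrow> complex))\<^sup>2 \<le> exp (4 * real DIM('a)) / \<delta> ^ DIM('a)"
    by (simp add: exp_minus field_simps)
qed

lemma smear_mollifier_bound:
  assumes "\<delta> > 0" "f \<in> L2"
  shows "smear (mollifier \<delta>) f \<in> L2" "L2_norm (smear (mollifier \<delta>) f) \<le> L2_norm f"
  using smear_Minkowski(1,2)[OF mollifier_bumps[OF assms(1)] assms(2)] by (simp_all add: mollifier_properties(2)[OF assms(1)])

text \<open>The mollification is an average of translates by vectors of norm at most \<open>real DIM('a) * \<delta>\<close>.\<close>

lemma smear_mollifier_close:
  fixes v :: "'a::euclidean_space \<Rightarrow> complex"
  assumes d: "\<delta> > 0" and v: "translation_Lipschitz v M"
  shows "L2_norm (\<lambda>x. smear (mollifier \<delta>) v x - v x) \<le> real DIM('a) * \<delta> * M"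
proof -
  let ?\<rho> = "mollifier \<delta> :: 'a \<Rightarrow> complex"
  have v2: "v \<in> L2" and lip: "L2_norm (\<lambda>x. v (x + y) - v x) \<le> norm y * M" for y
    using v by (auto simp: translation_Lipschitz_def)
  have M: "0 \<le> M"
  proof -
    obtain b :: 'a where "b \<in> Basis" using nonempty_Basis by blast
    then show ?thesis using lip[of b] L2_norm_nonneg[of "\<lambda>x. v (x + b) - v x"] by (simp del: L2_norm_nonneg)
  qed
  have \<rho>: "?\<rho> \<in> bumps" by (rule mollifier_bumps[OF d])
  note [measurable] = bumps_measurable[OF \<rho>] L2_measurable[OF v2]
  have m: "(\<lambda>(y, x). ?\<rho> y * (v (x + y) - v x)) \<in> borel_measurable borel"
    unfolding borel_prod[symmetric] by measurable
  have b: "AE y in lborel. (\<lambda>x. ?\<rho> y * (v (x + y) - v x)) \<in> L2 \<and>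
      L2_norm (\<lambda>x. ?\<rho> y * (v (x + y) - v x)) \<le> cmod (?\<rho> y) * (real DIM('a) * \<delta> * M)"
  proof (intro AE_I2 conjI L2_scale L2_diff L2_translate v2)
    fix y :: 'a
    show "L2_norm (\<lambda>x. ?\<rho> y * (v (x + y) - v x)) \<le> cmod (?\<rho> y) * (real DIM('a) * \<delta> * M)"
    proof (cases "?\<rho> y = 0")
      case False
      have "norm y * M \<le> real DIM('a) * \<delta> * M"
        by (rule mult_right_mono[OF mollifier_properties(3)[OF d False] M])
      then show ?thesis using lip[of y] unfolding L2_norm_scale by (intro mult_left_mono) auto
    qed simp
  qed
  have i: "integrable lborel (\<lambda>y. cmod (?\<rho> y) * (real DIM('a) * \<delta> * M))"
    using bumps_integrable[OF \<rho>] by simp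
  note MK = Minkowski_integral[OF m b i]
  have "AE x in lborel. smear ?\<rho> v x - v x = (\<integral>y. ?\<rho> y * (v (x + y) - v x) \<partial>lborel)"
    using smear_Minkowski(5)[OF \<rho> v2]
  proof eventually_elim
    fix x assume i: "integrable lborel (\<lambda>y. ?\<rho> y * v (x + y))"
    have "integrable lborel (\<lambda>y. ?\<rho> y * v x)" using bumps_integrable[OF \<rho>] by simp
    from Bochner_Integration.integral_diff[OF i this]
    show "smear ?\<rho> v x - v x = (\<integral>y. ?\<rho> y * (v (x + y) - v x) \<partial>lborel)"
      using mollifier_properties(1)[OF d, where 'a='a] by (simp add: smear_def right_diff_distrib)
  qed
  then have "L2_norm (\<lambda>x. smear ?\<rho> v x - v x) = L2_norm (\<lambda>x. \<integral>y. ?\<rho> y * (v (x + y) - v x) \<partial>lborel)"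
    by (intro L2_norm_cong_AE) (use MK(1) smear_Minkowski(1)[OF \<rho> v2] v2 in \<open>auto dest: L2_measurable\<close>)
  then show ?thesis using MK(2) by (simp add: mollifier_properties(2)[OF d])
qed

text \<open>Cauchy--Schwarz with the \<open>L2\<close> norm of the mollifier, whose square is of order \<open>\<delta> powr (- DIM('a))\<close>.\<close>

lemma smear_mollifier_sup:
  fixes f :: "'a::euclidean_space \<Rightarrow> complex"
  assumes d: "\<delta> > 0" and f: "f \<in> L2"
  shows "(cmod (smear (mollifier \<delta>) f x))\<^sup>2 \<le> exp (4 * real DIM('a)) / \<delta> ^ DIM('a) * (L2_norm f)\<^sup>2"
proof -
  let ?\<rho> = "mollifier \<delta> :: 'a \<Rightarrow> complex"
  have \<rho>: "?\<rho> \<in> bumps" by (rule mollifier_bumps[OF d])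
  have t: "(\<lambda>y. ?\<rho> (y - x)) \<in> L2" "L2_norm (\<lambda>y. ?\<rho> (y - x)) = L2_norm ?\<rho>"
    using L2_translate[OF bumps_L2[OF \<rho>], of "- x"] by simp_all
  have "cmod (smear ?\<rho> f x) \<le> L2_norm f * L2_norm ?\<rho>"
    using pairing_Cauchy_Schwarz[OF f t(1)] t(2) by (simp add: smear_eq_pairing bumps_measurable[OF \<rho>] L2_measurable[OF f])
  then have "(cmod (smear ?\<rho> f x))\<^sup>2 \<le> (L2_norm f * L2_norm ?\<rho>)\<^sup>2" by (intro power_mono) auto
  also have "\<dots> \<le> (L2_norm f)\<^sup>2 * (exp (4 * real DIM('a)) / \<delta> ^ DIM('a))"
    unfolding power_mult_distrib by (intro mult_left_mono mollifier_properties(4)[OF d]) simp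
  finally show ?thesis by (simp add: mult.commute)
qed

section \<open>The equation tested in space\<close>

text \<open>Exceptional times are allowed because bounds in \<open>H\<^sup>2\<close>, and with them bounds of the nonlinearity, are known for almost
  all times only.\<close>

definition L2_bounded_on :: "real set \<Rightarrow> (real \<Rightarrow> 'a::euclidean_space \<Rightarrow> complex) \<Rightarrow> real \<Rightarrow> bool" where
  "L2_bounded_on I w K \<longleftrightarrow> (\<lambda>(t, x). w t x) \<in> borel_measurable borel \<and> 0 \<le> K \<and>
     (AE t in lborel. t \<in> I \<longrightarrow> w t \<in> L2 \<and> L2_norm (w t) \<le> K)"

lemma L2_bounded_onD:
  assumes "L2_bounded_on I w K"
  shows "(\<lambda>(t, x). w t x) \<in> borel_measurable borel" "(\<lambda>(t, x). w t x) \<in> borel_measurable (borel \<Otimes>\<^sub>M borel)" "0 \<le> K"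
    "AE t in lborel. t \<in> I \<longrightarrow> w t \<in> L2 \<and> L2_norm (w t) \<le> K"
  using assms by (auto simp: L2_bounded_on_def borel_prod)

lemma L2_bounded_on_mono: "L2_bounded_on I w K \<Longrightarrow> J \<subseteq> I \<Longrightarrow> K \<le> K' \<Longrightarrow> L2_bounded_on J w K'"
  unfolding L2_bounded_on_def by (auto elim!: eventually_mono)

lemma pairing_time_measurable:
  assumes w: "L2_bounded_on I w K" and g: "g \<in> borel_measurable borel"
  shows "(\<lambda>t. pairing (w t) g) \<in> borel_measurable borel"
proof -
  note [measurable] = L2_bounded_onD(2)[OF w] g
  show ?thesis unfolding pairing_def by measurable
qed

lemma pairing_set_integrable:
  assumes w: "L2_bounded_on {s..t} w K" and st: "s \<le> t" and g: "g \<in> L2"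
  shows "set_integrable lborel {s..t} (\<lambda>\<tau>. pairing (w \<tau>) g)"
  using Minkowski_interval(4)[OF L2_bounded_onD(1)[OF w] L2_bounded_onD(4)[OF w] st L2_bounded_onD(3)[OF w] g] .

lemma space_time_pairing:
  assumes w: "L2_bounded_on {s..t} w K" and st: "s \<le> t" and g: "g \<in> L2"
    and A: "A \<in> borel_measurable borel" "\<And>\<tau>. cmod (A \<tau>) \<le> B" "\<And>\<tau>. \<tau> \<notin> {s..t} \<Longrightarrow> A \<tau> = 0"
  shows "integrable lborel (\<lambda>(\<tau>, x). w \<tau> x * (A \<tau> * g x))"
    "(\<integral>(\<tau>, x). w \<tau> x * (A \<tau> * g x) \<partial>lborel) = (\<integral>\<tau>. A \<tau> * pairing (w \<tau>) g \<partial>lborel)"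
proof -
  note [measurable] = L2_bounded_onD(2)[OF w] A(1) L2_measurable[OF g]
  have m: "(\<lambda>(\<tau>, x). A \<tau> * w \<tau> x) \<in> borel_measurable borel"
    unfolding borel_prod[symmetric] by measurable
  have B: "0 \<le> B" using A(2)[of 0] norm_ge_zero[of "A 0"] by linarith
  have b: "AE \<tau> in lborel. (\<lambda>x. A \<tau> * w \<tau> x) \<in> L2 \<and> L2_norm (\<lambda>x. A \<tau> * w \<tau> x) \<le> indicator {s..t} \<tau> *\<^sub>R (B * K)"
    using L2_bounded_onD(4)[OF w]
  proof eventually_elim
    fix \<tau> assume *: "\<tau> \<in> {s..t} \<longrightarrow> w \<tau> \<in> L2 \<and> L2_norm (w \<tau>) \<le> K"
    show "(\<lambda>x. A \<tau> * w \<tau> x) \<in> L2 \<and> L2_norm (\<lambda>x. A \<tau> * w \<tau> x) \<le> indicator {s..t} \<tau> *\<^sub>R (B * K)"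
    proof (cases "\<tau> \<in> {s..t}")
      case True
      have "L2_norm (\<lambda>x. A \<tau> * w \<tau> x) \<le> B * K"
        unfolding L2_norm_scale using True * A(2) B by (intro mult_mono) auto
      then show ?thesis using True * by auto
    qed (simp add: A(3))
  qed
  have i: "integrable lborel (\<lambda>\<tau>. indicator {s..t} \<tau> *\<^sub>R (B * K))"
    using st by (intro integrable_scaleR_left integrable_real_indicator) simp_all
  have eq: "(\<lambda>(\<tau>, x). w \<tau> x * (A \<tau> * g x)) = (\<lambda>(\<tau>, x). A \<tau> * w \<tau> x * g x)"
    by (auto simp: fun_eq_iff)
  show int: "integrable lborel (\<lambda>(\<tau>, x). w \<tau> x * (A \<tau> * g x))"
    unfolding eq by (rule Minkowski_integral(4)[OF m b i g])
  then have "integrable (lborel \<Otimes>\<^sub>M lborel) (\<lambda>(\<tau>, x). w \<tau> x * (A \<tau> * g x))"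
    by (simp add: lborel_prod)
  from lborel_pair.integral_fst[OF this]
  have "(\<integral>\<tau>. (\<integral>x. w \<tau> x * (A \<tau> * g x) \<partial>lborel) \<partial>lborel) = (\<integral>(\<tau>, x). w \<tau> x * (A \<tau> * g x) \<partial>lborel)"
    by (simp add: lborel_prod)
  moreover have "(\<integral>x. w \<tau> x * (A \<tau> * g x) \<partial>lborel) = A \<tau> * pairing (w \<tau>) g" for \<tau>
    unfolding pairing_scale_right[symmetric] by (simp add: pairing_def)
  ultimately show "(\<integral>(\<tau>, x). w \<tau> x * (A \<tau> * g x) \<partial>lborel) = (\<integral>\<tau>. A \<tau> * pairing (w \<tau>) g \<partial>lborel)"
    by simp
qed

text \<open>The support in time is contained in \<open>{s..t}\<close> with \<open>s\<close> positive, as the equation demands.\<close>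

lemma tensor_test_function:
  fixes \<phi> :: "'a::euclidean_space \<Rightarrow> complex"
  assumes \<theta>: "\<theta> \<in> bumps" "\<And>\<tau>. \<tau> \<notin> {s..t} \<Longrightarrow> \<theta> \<tau> = 0" and s: "0 < s" and \<phi>: "\<phi> \<in> bumps"
  defines "\<psi> \<equiv> (\<lambda>z::real \<times> 'a. \<theta> (fst z) * \<phi> (snd z))"
  shows "\<psi> \<in> test_functions ({0<..} \<times> UNIV)"
    "dt \<psi> (\<tau>, x) = dir_deriv 1 \<theta> \<tau> * \<phi> x"
    "Laplacian_x \<psi> (\<tau>, x) = \<theta> \<tau> * laplacian \<phi> x"
proof -
  obtain a c where ac: "\<And>x. x \<notin> cbox a c \<Longrightarrow> \<phi> x = 0" using \<phi> by (auto simp: bumps_def)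
  have alg: "\<psi> \<in> flat_algebra"
    unfolding \<psi>_def using \<theta>(1) \<phi> by (intro flat_algebra_mult flat_algebra_fst flat_algebra_snd bumps_flat_algebra)
  have sub: "closure {z. \<psi> z \<noteq> 0} \<subseteq> {s..t} \<times> cbox a c"
  proof (intro closure_minimal closed_Times closed_cbox closed_atLeastAtMost subsetI)
    fix z assume "z \<in> {z. \<psi> z \<noteq> 0}"
    then have "fst z \<in> {s..t}" "snd z \<in> cbox a c"
      using \<theta>(2)[of "fst z"] ac[of "snd z"] by (auto simp: \<psi>_def)
    then show "z \<in> {s..t} \<times> cbox a c" by (simp add: mem_Times_iff)
  qed
  have "compact ({s..t} \<times> cbox a c)" by (intro compact_Times compact_cbox compact_Icc)
  then have "compact (closure {z. \<psi> z \<noteq> 0})"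
    using sub by (meson bounded_subset closed_closure compact_eq_bounded_closed)
  then show "\<psi> \<in> test_functions ({0<..} \<times> UNIV)"
    using sub s flat_algebra_smooth[OF alg] by (auto simp: test_functions_def)
  have "((\<lambda>r. \<theta> (\<tau> + r *\<^sub>R 1) * \<phi> x) has_vector_derivative dir_deriv 1 \<theta> \<tau> * \<phi> x) (at 0)"
    by (rule bounded_linear.has_vector_derivative[OF bounded_linear_mult_left bumps_has_vector_derivative[OF \<theta>(1)]])
  then show "dt \<psi> (\<tau>, x) = dir_deriv 1 \<theta> \<tau> * \<phi> x"
    by (simp add: dt_def dir_deriv_def[of "(1, 0)"] \<psi>_def vector_derivative_at)
  have d: "dir_deriv (0, b) (\<lambda>z::real \<times> 'a. \<theta> (fst z) * \<chi>' (snd z)) = (\<lambda>z. \<theta> (fst z) * dir_deriv b \<chi>' (snd z))"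
    if "\<chi>' \<in> bumps" for \<chi>' and b :: 'a
  proof
    fix z :: "real \<times> 'a"
    have "((\<lambda>r. \<theta> (fst z) * \<chi>' (snd z + r *\<^sub>R b)) has_vector_derivative \<theta> (fst z) * dir_deriv b \<chi>' (snd z)) (at 0)"
      by (rule bounded_linear.has_vector_derivative[OF bounded_linear_mult_right bumps_has_vector_derivative[OF that]])
    then show "dir_deriv (0, b) (\<lambda>z. \<theta> (fst z) * \<chi>' (snd z)) z = \<theta> (fst z) * dir_deriv b \<chi>' (snd z)"
      by (simp add: dir_deriv_def[of "(0, b)"] vector_derivative_at)
  qed
  show "Laplacian_x \<psi> (\<tau>, x) = \<theta> \<tau> * laplacian \<phi> x"
    by (simp add: Laplacian_x_def laplacian_def \<psi>_def d[OF \<phi>] d[OF bumps_dir_deriv[OF \<phi>]] sum_distrib_left)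
qed

definition flat_density :: "real \<Rightarrow> real" where
  "flat_density = flat (flat_deriv 1)"

lemma flat_density_nonneg: "0 \<le> flat_density y" and flat_density_outside: "y \<le> 0 \<Longrightarrow> flat_density y = 0"
  by (simp_all add: flat_density_def flat_def flat_deriv_def)

lemma flat_1_at_top: "(flat 1 \<longlongrightarrow> 1) at_top"
proof -
  have "((\<lambda>s::real. exp (- (inverse s))) \<longlongrightarrow> exp (- 0)) at_top"
    by (intro tendsto_intros tendsto_inverse_0_at_top filterlim_ident)
  then have "((\<lambda>s::real. exp (- (inverse s))) \<longlongrightarrow> 1) at_top" by simp
  then show ?thesis
    by (rule Lim_transform_eventually)
       (use eventually_gt_at_top[of 0] in \<open>auto elim!: eventually_mono simp: flat_def inverse_eq_divide\<close>)
qed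

lemma flat_measurable [measurable]: "flat p \<in> borel_measurable borel"
  by (intro borel_measurable_continuous_onI continuous_at_imp_continuous_on ballI DERIV_isCont[OF flat_has_derivative])

lemma flat_density_measurable [measurable]: "flat_density \<in> borel_measurable borel"
  by (simp add: flat_density_def)

lemma flat_density_integral: "integrable lborel flat_density" "(\<integral>y. flat_density y \<partial>lborel) = 1"
proof -
  have "(\<integral>\<^sup>+y. ennreal (flat_density y) * indicator {0..} y \<partial>lborel) = ennreal (1 - flat 1 0)"
    by (rule nn_integral_FTC_atLeast)
       (auto simp: flat_density_nonneg flat_density_def[symmetric] flat_1_at_top intro: flat_has_derivative[of 1, folded flat_density_def])
  also have "(\<integral>\<^sup>+y. ennreal (flat_density y) * indicator {0..} y \<partial>lborel) = (\<integral>\<^sup>+y. ennreal (flat_density y) \<partial>lborel)"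
    by (intro nn_integral_cong) (auto simp: indicator_def flat_density_outside)
  finally have n: "(\<integral>\<^sup>+y. ennreal (flat_density y) \<partial>lborel) = ennreal 1" by (simp add: flat_def)
  show "integrable lborel flat_density"
    by (rule integrableI_nonneg) (auto simp: n flat_density_nonneg)
  show "(\<integral>y. flat_density y \<partial>lborel) = 1"
    using n by (subst integral_eq_nn_integral) (auto simp: flat_density_nonneg)
qed

text \<open>The density is the derivative of a function rising from \<open>0\<close> to \<open>1\<close>, so its rescalings concentrate mass one immediately to the right of zero.
  The other factor is the opposite end of a temporal cutoff; it tends to one there.\<close>

lemma flat_density_approximate_unit:
  fixes m :: "real \<Rightarrow> complex"
  assumes meas: "m \<in> borel_measurable borel" and bound: "\<And>y. 0 < y \<Longrightarrow> y < L \<Longrightarrow> cmod (m y) \<le> B"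
    and lim: "(m \<longlongrightarrow> z) (at_right 0)" and L: "0 < L"
  shows "(\<lambda>n. \<integral>\<tau>. of_real (real n * flat_density (real n * \<tau>) * flat 1 (real n * (L - \<tau>))) * m \<tau> \<partial>lborel) \<longlonglongrightarrow> z"
proof -
  note [measurable] = meas
  have B: "0 \<le> B" using bound[of "L / 2"] L norm_ge_zero[of "m (L / 2)"] by linarith
  have "(\<lambda>n. \<integral>y. of_real (flat_density y * flat 1 (real n * L - y)) * m (inverse (real n) * y) \<partial>lborel)
      \<longlonglongrightarrow> (\<integral>y. of_real (flat_density y) * z \<partial>lborel)"
  proof (rule integral_dominated_convergence)
    show "integrable lborel (\<lambda>y. flat_density y * B)" using flat_density_integral(1) by simp
    show "AE y in lborel. (\<lambda>n. of_real (flat_density y * flat 1 (real n * L - y)) * m (inverse (real n) * y)) \<longlonglongrightarrow> of_real (flat_density y) * z"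
    proof (rule AE_I2)
      fix y :: real
      show "(\<lambda>n. of_real (flat_density y * flat 1 (real n * L - y)) * m (inverse (real n) * y)) \<longlonglongrightarrow> of_real (flat_density y) * z"
      proof (cases "0 < y")
        case True
        have "filterlim (\<lambda>n. real n * L - y) at_top sequentially"
          using L by real_asymp
        then have 1: "(\<lambda>n. flat 1 (real n * L - y)) \<longlonglongrightarrow> 1"
          by (rule filterlim_compose[OF flat_1_at_top])
        have "filterlim (\<lambda>n. inverse (real n) * y) (at_right 0) sequentially"
          using True by real_asymp
        then have 2: "(\<lambda>n. m (inverse (real n) * y)) \<longlonglongrightarrow> z"
          by (rule filterlim_compose[OF lim])
        have "(\<lambda>n. of_real (flat_density y * flat 1 (real n * L - y)) * m (inverse (real n) * y)) \<longlonglongrightarrow> of_real (flat_density y * 1) * z"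
          by (intro tendsto_intros 1 2)
        then show ?thesis by simp
      qed (simp add: flat_density_outside)
    qed
    show "AE y in lborel. norm (of_real (flat_density y * flat 1 (real n * L - y)) * m (inverse (real n) * y)) \<le> flat_density y * B" for n
    proof (rule AE_I2)
      fix y :: real
      show "norm (of_real (flat_density y * flat 1 (real n * L - y)) * m (inverse (real n) * y)) \<le> flat_density y * B"
      proof (cases "0 < y \<and> y < real n * L")
        case True
        then have n: "0 < real n" using L by (cases n) auto
        have "cmod (m (inverse (real n) * y)) \<le> B" using True n by (intro bound) (auto simp: field_simps)
        then have "flat_density y * flat 1 (real n * L - y) * cmod (m (inverse (real n) * y)) \<le> flat_density y * 1 * B"
          by (intro mult_mono mult_nonneg_nonneg) (auto simp: flat_density_nonneg flat_1_bounds B)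
        then show ?thesis by (simp add: norm_mult flat_density_nonneg flat_1_bounds abs_mult)
      next
        case False
        then have e: "flat_density y * flat 1 (real n * L - y) = 0"
          by (auto simp: flat_density_outside flat_1_bounds(4) not_less)
        show ?thesis unfolding e by (simp add: B flat_density_nonneg)
      qed
    qed
  qed measurable
  moreover have "(\<integral>y. of_real (flat_density y) * z \<partial>lborel) = z"
    using flat_density_integral integral_complex_of_real[of lborel flat_density] by simp
  moreover have "\<forall>\<^sub>F n in sequentially. (\<integral>y. of_real (flat_density y * flat 1 (real n * L - y)) * m (inverse (real n) * y) \<partial>lborel)
     = (\<integral>\<tau>. of_real (real n * flat_density (real n * \<tau>) * flat 1 (real n * (L - \<tau>))) * m \<tau> \<partial>lborel)"
  proof (rule eventually_sequentiallyI[of 1])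
    fix n :: nat assume n: "1 \<le> n"
    have "(\<integral>\<tau>. of_real (real n * flat_density (real n * \<tau>) * flat 1 (real n * (L - \<tau>))) * m \<tau> \<partial>lborel)
       = \<bar>inverse (real n)\<bar> *\<^sub>R (\<integral>y. of_real (real n * flat_density (real n * (0 + inverse (real n) * y)) * flat 1 (real n * (L - (0 + inverse (real n) * y)))) * m (0 + inverse (real n) * y) \<partial>lborel)"
      by (rule lborel_integral_real_affine) (use n in simp)
    also have "\<dots> = (\<integral>y. \<bar>inverse (real n)\<bar> *\<^sub>R (of_real (real n * flat_density (real n * (0 + inverse (real n) * y)) * flat 1 (real n * (L - (0 + inverse (real n) * y)))) * m (0 + inverse (real n) * y)) \<partial>lborel)"
      by simp
    also have "\<dots> = (\<integral>y. of_real (flat_density y * flat 1 (real n * L - y)) * m (inverse (real n) * y) \<partial>lborel)"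
    proof (rule Bochner_Integration.integral_cong[OF refl])
      fix y :: real
      have e: "real n * (inverse (real n) * y) = y" "real n * (L - inverse (real n) * y) = real n * L - y"
        using n by (auto simp: field_simps)
      show "\<bar>inverse (real n)\<bar> *\<^sub>R (of_real (real n * flat_density (real n * (0 + inverse (real n) * y)) * flat 1 (real n * (L - (0 + inverse (real n) * y)))) * m (0 + inverse (real n) * y))
        = of_real (flat_density y * flat 1 (real n * L - y)) * m (inverse (real n) * y)"
        unfolding add_0 e using n by (simp add: scaleR_conv_of_real)
    qed
    finally show "(\<integral>y. of_real (flat_density y * flat 1 (real n * L - y)) * m (inverse (real n) * y) \<partial>lborel)
     = (\<integral>\<tau>. of_real (real n * flat_density (real n * \<tau>) * flat 1 (real n * (L - \<tau>))) * m \<tau> \<partial>lborel)" by simp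
  qed
  ultimately show ?thesis using Lim_transform_eventually by fastforce
qed

lemma continuous_into_L2D:
  assumes "continuous_into_L2 {0..} u" "0 \<le> t"
  shows "u t \<in> L2" "((\<lambda>s. L2_norm (\<lambda>x. u s x - u t x)) \<longlongrightarrow> 0) (at t within {0..})"
  using assms by (auto simp: continuous_into_L2_def)

lemma pairing_continuous:
  assumes u: "continuous_into_L2 {0..} u" and g: "g \<in> L2"
  shows "continuous_on {0..} (\<lambda>t. pairing (u t) g)"
  unfolding continuous_on_def
proof
  fix t :: real assume t: "t \<in> {0..}"
  have "((\<lambda>s. pairing (u s) g - pairing (u t) g) \<longlongrightarrow> 0) (at t within {0..})"
  proof (rule Lim_null_comparison)
    show "\<forall>\<^sub>F s in at t within {0..}. norm (pairing (u s) g - pairing (u t) g) \<le> L2_norm (\<lambda>x. u s x - u t x) * L2_norm g"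
      unfolding eventually_at_filter
    proof (rule always_eventually, intro allI impI)
      fix s :: real assume "s \<in> {0..}"
      then have "u s \<in> L2" "u t \<in> L2" using t continuous_into_L2D(1)[OF u] by auto
      then show "norm (pairing (u s) g - pairing (u t) g) \<le> L2_norm (\<lambda>x. u s x - u t x) * L2_norm g"
        using pairing_Cauchy_Schwarz[OF L2_diff g, of "u s" "u t"] g by (simp add: pairing_diff_left)
    qed
    show "((\<lambda>s. L2_norm (\<lambda>x. u s x - u t x) * L2_norm g) \<longlongrightarrow> 0) (at t within {0..})"
      using tendsto_mult_right[OF continuous_into_L2D(2)[OF u], of t "L2_norm g"] t by simp
  qed
  then show "((\<lambda>t. pairing (u t) g) \<longlongrightarrow> pairing (u t) g) (at t within {0..})"
    by (rule LIM_zero_cancel)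
qed

lemma L2_norm_continuous:
  assumes u: "continuous_into_L2 {0..} u"
  shows "continuous_on {0..} (\<lambda>t. L2_norm (u t))"
  unfolding continuous_on_def
proof
  fix t :: real assume t: "t \<in> {0..}"
  have "((\<lambda>s. L2_norm (u s) - L2_norm (u t)) \<longlongrightarrow> 0) (at t within {0..})"
  proof (rule Lim_null_comparison)
    show "\<forall>\<^sub>F s in at t within {0..}. norm (L2_norm (u s) - L2_norm (u t)) \<le> L2_norm (\<lambda>x. u s x - u t x)"
      unfolding eventually_at_filter
      by (rule always_eventually) (use t continuous_into_L2D(1)[OF u] L2_norm_reverse_triangle in auto)
  qed (use continuous_into_L2D(2)[OF u] t in auto)
  then show "((\<lambda>t. L2_norm (u t)) \<longlongrightarrow> L2_norm (u t)) (at t within {0..})"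
    by (rule LIM_zero_cancel)
qed

lemma L2_bounded_on_of_continuous:
  assumes u: "continuous_into_L2 {0..} u" and m: "(\<lambda>(t, x). u t x) \<in> borel_measurable borel"
  obtains K where "L2_bounded_on {0..T} u K"
proof -
  have "continuous_on {0..T} (\<lambda>t. L2_norm (u t))"
    by (rule continuous_on_subset[OF L2_norm_continuous[OF u]]) auto
  from compact_continuous_image[OF this compact_Icc] have "bounded ((\<lambda>t. L2_norm (u t)) ` {0..T})"
    by (rule compact_imp_bounded)
  then obtain K where K: "0 < K" "\<And>t. t \<in> {0..T} \<Longrightarrow> L2_norm (u t) \<le> K" by (auto simp: bounded_pos)
  show ?thesis
    by (rule that[of K]) (use K m continuous_into_L2D(1)[OF u] in \<open>auto simp: L2_bounded_on_def\<close>)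
qed

text \<open>The equation \<open>\<i> w\<^sub>t + \<Delta> w = G\<close> integrated in time and tested with a bump in space.
  The time zero is excluded because the equation is posed for positive times; it is recovered by continuity.\<close>

definition evolves :: "real \<Rightarrow> (real \<Rightarrow> 'a::euclidean_space \<Rightarrow> complex) \<Rightarrow> (real \<Rightarrow> 'a \<Rightarrow> complex) \<Rightarrow> bool" where
  "evolves T w G \<longleftrightarrow> (\<forall>\<phi>\<in>bumps. \<forall>s t. 0 < s \<longrightarrow> s < t \<longrightarrow> t \<le> T \<longrightarrow>
     pairing (w t) \<phi> - pairing (w s) \<phi>
       = (LINT \<tau>:{s..t}|lborel. \<i> * pairing (w \<tau>) (laplacian \<phi>) - \<i> * pairing (G \<tau>) \<phi>))"

text \<open>Testing the space-time equation with the product of a bump in space and a temporal cutoff that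
  tends to the indicator of an interval. The derivative of the cutoff is an approximate unit at either end,
  and continuity in time identifies the limits.\<close>

lemma evolves_if_solves_NLS:
  fixes u :: "real \<Rightarrow> 'a::euclidean_space \<Rightarrow> complex"
  assumes sol: "solves_NLS F u" and cont: "continuous_into_L2 {0..} u"
    and bu: "\<And>T. \<exists>K. L2_bounded_on {0..T} u K"
    and bF: "\<And>T. \<exists>K. L2_bounded_on {0..T} (\<lambda>t x. F (u t x)) K"
  shows "evolves T u (\<lambda>t x. F (u t x))"
  unfolding evolves_def
proof (intro ballI allI impI)
  fix \<phi> :: "'a \<Rightarrow> complex" and s t :: real assume \<phi>: "\<phi> \<in> bumps" and s: "0 < s" and st: "s < t"
  define L where "L = t - s"
  have L: "0 < L" using st by (simp add: L_def)
  define p where "p \<tau> = pairing (u \<tau>) \<phi>" for \<tau>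
  define q where "q \<tau> = pairing (u \<tau>) (laplacian \<phi>)" for \<tau>
  define r where "r \<tau> = pairing (\<lambda>x. F (u \<tau> x)) \<phi>" for \<tau>
  have sub: "{s..t} \<subseteq> {0..t}" using s by auto
  obtain K1 where "L2_bounded_on {0..t} u K1" using bu by blast
  then have b1: "L2_bounded_on {s..t} u K1" by (rule L2_bounded_on_mono[OF _ sub order_refl])
  obtain K2 where "L2_bounded_on {0..t} (\<lambda>t x. F (u t x)) K2" using bF by blast
  then have b2: "L2_bounded_on {s..t} (\<lambda>t x. F (u t x)) K2" by (rule L2_bounded_on_mono[OF _ sub order_refl])
  have \<phi>2: "\<phi> \<in> L2" and l\<phi>2: "laplacian \<phi> \<in> L2" by (intro bumps_L2 laplacian_bumps \<phi>)+
  have pm [measurable]: "p \<in> borel_measurable borel" unfolding p_def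
    by (rule pairing_time_measurable[OF b1 bumps_measurable[OF \<phi>]])
  have pc: "continuous_on {0..} p" unfolding p_def by (rule pairing_continuous[OF cont \<phi>2])
  have qi: "set_integrable lborel {s..t} q" unfolding q_def
    by (rule pairing_set_integrable[OF b1 less_imp_le[OF st] l\<phi>2])
  have ri: "set_integrable lborel {s..t} r" unfolding r_def
    by (rule pairing_set_integrable[OF b2 less_imp_le[OF st] \<phi>2])
  obtain B where B: "0 < B" "\<And>\<tau>. \<tau> \<in> {s..t} \<Longrightarrow> cmod (p \<tau>) \<le> B"
  proof -
    have "compact (p ` {s..t})"
      by (rule compact_continuous_image[OF continuous_on_subset[OF pc] compact_Icc]) (use s in auto)
    from compact_imp_bounded[OF this] show ?thesis using that by (auto simp: bounded_pos)
  qed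
  define \<theta> where "\<theta> n \<tau> = complex_of_real (box_bump (real n) s t \<tau>)" for n \<tau>
  have bb: "box_bump k s t \<tau> = flat 1 (k * (\<tau> - s)) * flat 1 (k * (t - \<tau>))" for k \<tau>
    by (simp add: box_bump_def)
  have \<theta>b: "\<theta> n \<in> bumps" for n unfolding \<theta>_def[abs_def] by (rule box_bump_bumps) simp
  have \<theta>0: "\<theta> n \<tau> = 0" if "\<tau> \<notin> {s..t}" for n \<tau>
    unfolding \<theta>_def using that by (subst box_bump_outside) (auto simp: box_real)
  have \<theta>1: "cmod (\<theta> n \<tau>) \<le> 1" for n \<tau>
    using box_bump_nonneg[of n s t \<tau>] box_bump_le_1[of n s t \<tau>] by (simp add: \<theta>_def)
  define g1 where "g1 n \<tau> = complex_of_real (real n * flat_density (real n * (\<tau> - s)) * flat 1 (real n * (t - \<tau>)))" for n \<tau>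
  define g2 where "g2 n \<tau> = complex_of_real (real n * flat_density (real n * (t - \<tau>)) * flat 1 (real n * (\<tau> - s)))" for n \<tau>
  have d\<theta>: "dir_deriv 1 (\<theta> n) \<tau> = g1 n \<tau> - g2 n \<tau>" for n \<tau>
  proof -
    have f: "((\<lambda>x. flat 1 (real n * (x - s))) has_real_derivative flat_density (real n * (\<tau> - s)) * real n) (at \<tau>)"
      unfolding flat_density_def
      by (rule DERIV_chain2[OF flat_has_derivative]) (auto intro!: derivative_eq_intros)
    have g: "((\<lambda>x. flat 1 (real n * (t - x))) has_real_derivative flat_density (real n * (t - \<tau>)) * (- real n)) (at \<tau>)"
      unfolding flat_density_def
      by (rule DERIV_chain2[OF flat_has_derivative]) (auto intro!: derivative_eq_intros)
    have "((\<lambda>x. box_bump (real n) s t x) has_real_derivative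
        (flat_density (real n * (\<tau> - s)) * real n * flat 1 (real n * (t - \<tau>))
          + flat_density (real n * (t - \<tau>)) * (- real n) * flat 1 (real n * (\<tau> - s)))) (at \<tau>)"
      unfolding bb by (rule DERIV_mult'[OF f g, THEN DERIV_cong]) (simp add: algebra_simps)
    from bounded_linear.has_derivative[OF bounded_linear_of_real this[unfolded has_field_derivative_def]]
    have "(\<theta> n has_derivative (\<lambda>h. complex_of_real ((flat_density (real n * (\<tau> - s)) * real n * flat 1 (real n * (t - \<tau>))
          + flat_density (real n * (t - \<tau>)) * (- real n) * flat 1 (real n * (\<tau> - s))) * h))) (at \<tau>)"
      by (simp add: \<theta>_def[abs_def])
    from dir_deriv_eq(1)[OF this, of 1] show ?thesis
      by (simp add: g1_def g2_def algebra_simps)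
  qed
  have d\<theta>0: "dir_deriv 1 (\<theta> n) \<tau> = 0" if "\<tau> \<notin> {s..t}" for n \<tau>
    by (rule dir_deriv_zero_outside[of "{s..t}"]) (use that \<theta>0 in auto)
  have eqn: "- \<i> * (\<integral>\<tau>. dir_deriv 1 (\<theta> n) \<tau> * p \<tau> \<partial>lborel) + (\<integral>\<tau>. \<theta> n \<tau> * q \<tau> \<partial>lborel) = (\<integral>\<tau>. \<theta> n \<tau> * r \<tau> \<partial>lborel)" for n
  proof -
    obtain B' where B': "\<And>\<tau>. cmod (dir_deriv 1 (\<theta> n) \<tau>) \<le> B'" using bumps_bounded[OF bumps_dir_deriv[OF \<theta>b]] by blast
    have S1: "integrable lborel (\<lambda>(\<tau>, x). u \<tau> x * (dir_deriv 1 (\<theta> n) \<tau> * \<phi> x))"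
      "(\<integral>(\<tau>, x). u \<tau> x * (dir_deriv 1 (\<theta> n) \<tau> * \<phi> x) \<partial>lborel) = (\<integral>\<tau>. dir_deriv 1 (\<theta> n) \<tau> * p \<tau> \<partial>lborel)"
      unfolding p_def
      by (rule space_time_pairing[OF b1 less_imp_le[OF st] \<phi>2 bumps_measurable[OF bumps_dir_deriv[OF \<theta>b]] B'], rule d\<theta>0, assumption)+
    have S2: "integrable lborel (\<lambda>(\<tau>, x). u \<tau> x * (\<theta> n \<tau> * laplacian \<phi> x))"
      "(\<integral>(\<tau>, x). u \<tau> x * (\<theta> n \<tau> * laplacian \<phi> x) \<partial>lborel) = (\<integral>\<tau>. \<theta> n \<tau> * q \<tau> \<partial>lborel)"
      unfolding q_def
      by (rule space_time_pairing[OF b1 less_imp_le[OF st] l\<phi>2 bumps_measurable[OF \<theta>b] \<theta>1], rule \<theta>0, assumption)+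
    have S3: "(\<integral>(\<tau>, x). F (u \<tau> x) * (\<theta> n \<tau> * \<phi> x) \<partial>lborel) = (\<integral>\<tau>. \<theta> n \<tau> * r \<tau> \<partial>lborel)"
      unfolding r_def
      by (rule space_time_pairing(2)[OF b2 less_imp_le[OF st] \<phi>2 bumps_measurable[OF \<theta>b] \<theta>1], rule \<theta>0, assumption)
    have S1': "integrable lborel (\<lambda>z. (- \<i>) * (case z of (\<tau>, x) \<Rightarrow> u \<tau> x * (dir_deriv 1 (\<theta> n) \<tau> * \<phi> x)))"
      using S1(1) by (intro integrable_mult_right)
    let ?\<psi> = "\<lambda>z::real \<times> 'a. \<theta> n (fst z) * \<phi> (snd z)"
    note T = tensor_test_function[OF \<theta>b[of n] \<theta>0 s \<phi>]
    have "(\<integral>(\<tau>, x). u \<tau> x * (- \<i> * dt ?\<psi> (\<tau>, x) + Laplacian_x ?\<psi> (\<tau>, x)) \<partial>lborel)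
       = (\<integral>z. (- \<i>) * (case z of (\<tau>, x) \<Rightarrow> u \<tau> x * (dir_deriv 1 (\<theta> n) \<tau> * \<phi> x)) + (case z of (\<tau>, x) \<Rightarrow> u \<tau> x * (\<theta> n \<tau> * laplacian \<phi> x)) \<partial>lborel)"
      by (rule Bochner_Integration.integral_cong[OF refl]) (simp only: split_paired_all prod.case T(2,3), simp add: algebra_simps)
    also have "\<dots> = - \<i> * (\<integral>\<tau>. dir_deriv 1 (\<theta> n) \<tau> * p \<tau> \<partial>lborel) + (\<integral>\<tau>. \<theta> n \<tau> * q \<tau> \<partial>lborel)"
      by (subst Bochner_Integration.integral_add[OF S1' S2(1)]) (simp only: integral_mult_right_zero S1(2) S2(2))
    finally have "- \<i> * (\<integral>\<tau>. dir_deriv 1 (\<theta> n) \<tau> * p \<tau> \<partial>lborel) + (\<integral>\<tau>. \<theta> n \<tau> * q \<tau> \<partial>lborel)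
       = (\<integral>(\<tau>, x). F (u \<tau> x) * ?\<psi> (\<tau>, x) \<partial>lborel)"
      using sol T(1) unfolding solves_NLS_def by force
    also have "\<dots> = (\<integral>\<tau>. \<theta> n \<tau> * r \<tau> \<partial>lborel)"
      using S3 by simp
    finally show ?thesis .
  qed
  have limq: "(\<lambda>n. \<integral>\<tau>. \<theta> n \<tau> * h \<tau> \<partial>lborel) \<longlonglongrightarrow> (LINT \<tau>:{s..t}|lborel. h \<tau>)"
    if h: "set_integrable lborel {s..t} h" for h :: "real \<Rightarrow> complex"
  proof -
    have [measurable]: "(\<lambda>\<tau>. indicator {s..t} \<tau> *\<^sub>R h \<tau>) \<in> borel_measurable borel"
      using h by (auto simp: set_integrable_def dest: borel_measurable_integrable)
    have eq: "\<theta> n \<tau> * h \<tau> = \<theta> n \<tau> * (indicator {s..t} \<tau> *\<^sub>R h \<tau>)" for n \<tau>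
      using \<theta>0[of \<tau> n] by (auto simp: indicator_def)
    show ?thesis unfolding set_lebesgue_integral_def eq
    proof (rule integral_dominated_convergence)
      show "integrable lborel (\<lambda>\<tau>. cmod (indicator {s..t} \<tau> *\<^sub>R h \<tau>))"
        by (rule integrable_norm[OF h[unfolded set_integrable_def]])
      show "(\<lambda>\<tau>. \<theta> n \<tau> * (indicator {s..t} \<tau> *\<^sub>R h \<tau>)) \<in> borel_measurable lborel" for n
        using bumps_measurable[OF \<theta>b[of n]] by measurable
      have "AE \<tau> in lborel. \<tau> \<notin> {s, t}"
        by (rule AE_not_in) (simp add: finite_imp_null_set_lborel)
      then show "AE \<tau> in lborel. (\<lambda>n. \<theta> n \<tau> * (indicator {s..t} \<tau> *\<^sub>R h \<tau>)) \<longlonglongrightarrow> indicator {s..t} \<tau> *\<^sub>R h \<tau>"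
      proof eventually_elim
        fix \<tau> assume \<tau>: "\<tau> \<notin> {s, t}"
        have "(\<lambda>n. \<theta> n \<tau> * (indicator {s..t} \<tau> *\<^sub>R h \<tau>)) \<longlonglongrightarrow> of_real (indicator (box s t) \<tau>) * (indicator {s..t} \<tau> *\<^sub>R h \<tau>)"
          unfolding \<theta>_def by (intro tendsto_intros box_bump_tendsto_indicator)
        moreover have "of_real (indicator (box s t) \<tau>) * (indicator {s..t} \<tau> *\<^sub>R h \<tau>) = indicator {s..t} \<tau> *\<^sub>R h \<tau>"
          using \<tau> by (auto simp: indicator_def box_real)
        ultimately show "(\<lambda>n. \<theta> n \<tau> * (indicator {s..t} \<tau> *\<^sub>R h \<tau>)) \<longlonglongrightarrow> indicator {s..t} \<tau> *\<^sub>R h \<tau>" by (simp only:)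
      qed
      show "AE \<tau> in lborel. norm (\<theta> n \<tau> * (indicator {s..t} \<tau> *\<^sub>R h \<tau>)) \<le> cmod (indicator {s..t} \<tau> *\<^sub>R h \<tau>)" for n
      proof (rule AE_I2)
        fix \<tau>
        show "norm (\<theta> n \<tau> * (indicator {s..t} \<tau> *\<^sub>R h \<tau>)) \<le> cmod (indicator {s..t} \<tau> *\<^sub>R h \<tau>)"
          unfolding norm_mult by (rule mult_left_le_one_le[OF norm_ge_zero norm_ge_zero \<theta>1])
      qed
    qed measurable
  qed
  have limp: "(\<lambda>n. \<integral>\<tau>. dir_deriv 1 (\<theta> n) \<tau> * p \<tau> \<partial>lborel) \<longlonglongrightarrow> p s - p t"
  proof -
    have c1: "continuous_on {s..t} (\<lambda>\<tau>. g1 n \<tau> * p \<tau>)" and c2: "continuous_on {s..t} (\<lambda>\<tau>. g2 n \<tau> * p \<tau>)" for n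
    proof -
      have cf: "continuous_on A (\<lambda>\<tau>. flat q (f \<tau>))" if "continuous_on A f" for A q and f :: "real \<Rightarrow> real"
        by (rule continuous_on_compose2[OF _ that subset_UNIV]) (auto intro: continuous_at_imp_continuous_on DERIV_isCont[OF flat_has_derivative])
      have "continuous_on {s..t} p" by (rule continuous_on_subset[OF pc]) (use s in auto)
      note ci = this
      show "continuous_on {s..t} (\<lambda>\<tau>. g1 n \<tau> * p \<tau>)"
        unfolding g1_def flat_density_def by (intro continuous_intros cf ci)
      show "continuous_on {s..t} (\<lambda>\<tau>. g2 n \<tau> * p \<tau>)"
        unfolding g2_def flat_density_def by (intro continuous_intros cf ci)
    qed
    have z: "indicator {s..t} \<tau> *\<^sub>R (g1 n \<tau> * p \<tau>) = g1 n \<tau> * p \<tau>" "indicator {s..t} \<tau> *\<^sub>R (g2 n \<tau> * p \<tau>) = g2 n \<tau> * p \<tau>" for n \<tau>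
    proof -
      have "flat_density (real n * (\<tau> - s)) * flat 1 (real n * (t - \<tau>)) = 0 \<and> flat_density (real n * (t - \<tau>)) * flat 1 (real n * (\<tau> - s)) = 0"
        if "\<tau> \<notin> {s..t}"
        using that by (auto simp: flat_density_outside flat_1_bounds(4) not_le mult_nonneg_nonpos)
      then show "indicator {s..t} \<tau> *\<^sub>R (g1 n \<tau> * p \<tau>) = g1 n \<tau> * p \<tau>" "indicator {s..t} \<tau> *\<^sub>R (g2 n \<tau> * p \<tau>) = g2 n \<tau> * p \<tau>"
        unfolding g1_def g2_def mult.assoc by (cases "\<tau> \<in> {s..t}"; simp)+
    qed
    have i: "integrable lborel (\<lambda>\<tau>. g1 n \<tau> * p \<tau>)" "integrable lborel (\<lambda>\<tau>. g2 n \<tau> * p \<tau>)" for n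
      using borel_integrable_atLeastAtMost'[OF c1] borel_integrable_atLeastAtMost'[OF c2]
      by (simp_all add: set_integrable_def z)
    have e1: "(\<integral>\<tau>. g1 n \<tau> * p \<tau> \<partial>lborel) = (\<integral>\<tau>. of_real (real n * flat_density (real n * \<tau>) * flat 1 (real n * (L - \<tau>))) * p (s + \<tau>) \<partial>lborel)" for n
      by (subst lborel_integral_real_affine[where c=1 and t=s]) (auto simp: g1_def L_def algebra_simps)
    have e2: "(\<integral>\<tau>. g2 n \<tau> * p \<tau> \<partial>lborel) = (\<integral>\<tau>. of_real (real n * flat_density (real n * \<tau>) * flat 1 (real n * (L - \<tau>))) * p (t - \<tau>) \<partial>lborel)" for n
      by (subst lborel_integral_real_affine[where c="-1" and t=t]) (auto simp: g2_def L_def algebra_simps)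
    have cat: "isCont p \<tau>" if "0 < \<tau>" for \<tau>
      using continuous_on_interior[OF pc, of \<tau>] that by simp
    have l1: "((\<lambda>\<tau>. p (s + \<tau>)) \<longlongrightarrow> p s) (at_right 0)"
    proof -
      have "isCont (\<lambda>\<tau>. p (s + \<tau>)) 0"
        by (rule isCont_o2[where g=p]) (use cat[OF s] in simp_all)
      then have "((\<lambda>\<tau>. p (s + \<tau>)) \<longlongrightarrow> p s) (at 0)" by (simp add: isCont_def)
      then show ?thesis by (rule tendsto_within_subset[OF _ subset_UNIV])
    qed
    have l2: "((\<lambda>\<tau>. p (t - \<tau>)) \<longlongrightarrow> p t) (at_right 0)"
    proof -
      have "isCont (\<lambda>\<tau>. p (t - \<tau>)) 0"
        by (rule isCont_o2[where g=p]) (use cat[of t] s st in simp_all)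
      then have "((\<lambda>\<tau>. p (t - \<tau>)) \<longlongrightarrow> p t) (at 0)" by (simp add: isCont_def)
      then show ?thesis by (rule tendsto_within_subset[OF _ subset_UNIV])
    qed
    have "(\<lambda>n. \<integral>\<tau>. g1 n \<tau> * p \<tau> \<partial>lborel) \<longlonglongrightarrow> p s"
      unfolding e1 by (rule flat_density_approximate_unit[OF _ _ l1 L, of B]) (use B(2) in \<open>auto simp: L_def\<close>)
    moreover have "(\<lambda>n. \<integral>\<tau>. g2 n \<tau> * p \<tau> \<partial>lborel) \<longlonglongrightarrow> p t"
      unfolding e2 by (rule flat_density_approximate_unit[OF _ _ l2 L, of B]) (use B(2) in \<open>auto simp: L_def\<close>)
    ultimately have "(\<lambda>n. (\<integral>\<tau>. g1 n \<tau> * p \<tau> \<partial>lborel) - (\<integral>\<tau>. g2 n \<tau> * p \<tau> \<partial>lborel)) \<longlonglongrightarrow> p s - p t"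
      by (rule tendsto_diff)
    then show ?thesis unfolding d\<theta> left_diff_distrib by (simp add: i)
  qed
  have "(\<lambda>n. \<integral>\<tau>. \<theta> n \<tau> * r \<tau> \<partial>lborel) \<longlonglongrightarrow> - \<i> * (p s - p t) + (LINT \<tau>:{s..t}|lborel. q \<tau>)"
    unfolding eqn[symmetric] by (intro tendsto_intros limp limq qi)
  from LIMSEQ_unique[OF this limq[OF ri]]
  have lim: "- \<i> * (p s - p t) + (LINT \<tau>:{s..t}|lborel. q \<tau>) = (LINT \<tau>:{s..t}|lborel. r \<tau>)" .
  have "p t - p s = \<i> * (LINT \<tau>:{s..t}|lborel. q \<tau>) - \<i> * (LINT \<tau>:{s..t}|lborel. r \<tau>)"
    unfolding lim[symmetric] by (simp add: algebra_simps)
  also have "\<dots> = (LINT \<tau>:{s..t}|lborel. \<i> * q \<tau> - \<i> * r \<tau>)"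
    using set_integral_diff(2)[OF set_integrable_mult_right[OF qi, of \<i>] set_integrable_mult_right[OF ri, of \<i>]] by simp
  finally show "pairing (u t) \<phi> - pairing (u s) \<phi>
       = (LINT \<tau>:{s..t}|lborel. \<i> * pairing (u \<tau>) (laplacian \<phi>) - \<i> * pairing (\<lambda>x. F (u \<tau> x)) \<phi>)"
    by (simp add: p_def q_def r_def)
qed

section \<open>Energy identity and regularity in time\<close>

lemma set_integral_combine:
  fixes f :: "real \<Rightarrow> complex"
  assumes "set_integrable lborel {a..c} f" "a \<le> b" "b \<le> c"
  shows "set_integrable lborel {a..b} f" "set_integrable lborel {b..c} f"
    "(LINT x:{a..c}|lborel. f x) = (LINT x:{a..b}|lborel. f x) + (LINT x:{b..c}|lborel. f x)"
proof -
  show i: "set_integrable lborel {a..b} f" "set_integrable lborel {b..c} f"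
    by (rule set_integrable_subset[OF assms(1)]; use assms in auto)+
  have "AE x in lborel. x \<noteq> b" by (rule AE_lborel_singleton)
  then have "AE x in lborel. \<not> (x \<in> {a..b} \<and> x \<in> {b..c})" by eventually_elim auto
  from set_integral_Un_AE[OF this _ _ i] show "(LINT x:{a..c}|lborel. f x) = (LINT x:{a..b}|lborel. f x) + (LINT x:{b..c}|lborel. f x)"
    using ivl_disj_un_two_touch(4)[OF assms(2,3)] by simp
qed

lemma set_integral_bound:
  fixes F :: "real \<Rightarrow> complex"
  assumes "set_integrable lborel {a..c} F" "AE s in lborel. s \<in> {a..c} \<longrightarrow> cmod (F s) \<le> K" "a \<le> c"
  shows "cmod (LINT s:{a..c}|lborel. F s) \<le> (c - a) * K"
  using set_integral_near_const[of a c F 0 K] assms by simp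

text \<open>Subdivision into \<open>n\<close> equal steps bounds the increment by a multiple of \<open>1 / n\<close>.\<close>

lemma constant_if_quadratic:
  fixes N :: "real \<Rightarrow> real"
  assumes N: "\<And>s t. a \<le> s \<Longrightarrow> s \<le> t \<Longrightarrow> t \<le> b \<Longrightarrow> \<bar>N t - N s\<bar> \<le> C * (t - s)\<^sup>2" and ab: "a \<le> b"
  shows "N b = N a"
proof -
  have step: "\<bar>N b - N a\<bar> \<le> C * (b - a)\<^sup>2 / real n" if n: "0 < n" for n :: nat
  proof -
    define h where "h = (b - a) / real n"
    have h: "0 \<le> h" "real n * h = b - a" using ab n by (auto simp: h_def)
    have "\<bar>N (a + real k * h) - N a\<bar> \<le> real k * (C * h\<^sup>2)" if "k \<le> n" for k
      using that
    proof (induction k)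
      case (Suc k)
      have "real (Suc k) * h \<le> real n * h" using Suc.prems h by (intro mult_right_mono) auto
      then have "\<bar>N (a + real (Suc k) * h) - N (a + real k * h)\<bar> \<le> C * ((a + real (Suc k) * h) - (a + real k * h))\<^sup>2"
        using h by (intro N) (auto simp: algebra_simps)
      also have "(a + real (Suc k) * h) - (a + real k * h) = h" by (simp add: algebra_simps)
      finally have "\<bar>N (a + real (Suc k) * h) - N (a + real k * h)\<bar> \<le> C * h\<^sup>2" .
      moreover have "\<bar>N (a + real k * h) - N a\<bar> \<le> real k * (C * h\<^sup>2)" using Suc by simp
      moreover have "real (Suc k) * (C * h\<^sup>2) = real k * (C * h\<^sup>2) + C * h\<^sup>2" by (simp add: algebra_simps)
      ultimately show ?case by linarith
    qed simp
    from this[of n] have "\<bar>N b - N a\<bar> \<le> real n * (C * h\<^sup>2)" using h by simp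
    also have "\<dots> = C * (b - a)\<^sup>2 / real n" using n by (simp add: h_def power_divide power2_eq_square)
    finally show ?thesis .
  qed
  have "(\<lambda>n. C * (b - a)\<^sup>2 / real n) \<longlonglongrightarrow> 0" by (rule lim_const_over_n)
  then have "\<bar>N b - N a\<bar> \<le> 0"
    by (rule LIMSEQ_le_const) (use step in \<open>auto intro!: exI[of _ 1]\<close>)
  then show ?thesis by simp
qed

lemma le_if_AE_le_continuous:
  fixes f :: "real \<Rightarrow> real"
  assumes c: "continuous_on {a..b} f" and ae: "AE t in lborel. t \<in> {a<..<b} \<longrightarrow> f t \<le> k" and ab: "a < b" and t: "t \<in> {a..b}"
  shows "f t \<le> k"
proof (rule ccontr)
  assume "\<not> f t \<le> k"
  then obtain d where d: "d > 0" "\<And>s. s \<in> {a..b} \<Longrightarrow> dist s t < d \<Longrightarrow> dist (f s) (f t) < f t - k"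
    using c t unfolding continuous_on_iff by (metis diff_gt_0_iff_gt not_le)
  define l r where "l = max a (t - d)" and "r = min b (t + d)"
  have lr: "l < r" using d(1) ab t by (auto simp: l_def r_def)
  have "AE s in lborel. s \<notin> {l<..<r}"
    using ae
  proof eventually_elim
    fix s assume s: "s \<in> {a<..<b} \<longrightarrow> f s \<le> k"
    show "s \<notin> {l<..<r}"
    proof
      assume "s \<in> {l<..<r}"
      then have "s \<in> {a<..<b}" "dist s t < d" by (auto simp: l_def r_def dist_real_def abs_less_iff)
      then show False using s d(2)[of s] by (auto simp: dist_real_def)
    qed
  qed
  then have "emeasure lborel {l<..<r} = 0"
    by (subst (asm) AE_iff_measurable[of "{l<..<r}"]) auto
  then show False using lr by simp
qed

lemma smear_jointly_measurable:
  fixes w :: "real \<Rightarrow> 'a::euclidean_space \<Rightarrow> complex"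
  assumes a: "a \<in> borel_measurable borel" and w: "(\<lambda>(t, x). w t x) \<in> borel_measurable borel"
  shows "(\<lambda>(t, x). smear a (w t) x) \<in> borel_measurable borel"
proof -
  have [measurable]: "(\<lambda>(t, x). w t x) \<in> borel_measurable (borel \<Otimes>\<^sub>M borel)" using w by (simp add: borel_prod)
  note [measurable] = a
  show ?thesis unfolding smear_def borel_prod[symmetric] by measurable
qed

lemma smear_L2_bounded_on:
  assumes a: "a \<in> bumps" and w: "L2_bounded_on I w K"
  shows "L2_bounded_on I (\<lambda>t. smear a (w t)) ((\<integral>y. cmod (a y) \<partial>lborel) * K)"
  unfolding L2_bounded_on_def
proof (intro conjI)
  show "(\<lambda>(t, x). smear a (w t) x) \<in> borel_measurable borel"
    by (rule smear_jointly_measurable[OF bumps_measurable[OF a] L2_bounded_onD(1)[OF w]])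
  show "0 \<le> (\<integral>y. cmod (a y) \<partial>lborel) * K" using L2_bounded_onD(3)[OF w] by simp
  show "AE t in lborel. t \<in> I \<longrightarrow> smear a (w t) \<in> L2 \<and> L2_norm (smear a (w t)) \<le> (\<integral>y. cmod (a y) \<partial>lborel) * K"
    using L2_bounded_onD(4)[OF w]
  proof eventually_elim
    fix t assume *: "t \<in> I \<longrightarrow> w t \<in> L2 \<and> L2_norm (w t) \<le> K"
    show "t \<in> I \<longrightarrow> smear a (w t) \<in> L2 \<and> L2_norm (smear a (w t)) \<le> (\<integral>y. cmod (a y) \<partial>lborel) * K"
    proof
      assume t: "t \<in> I"
      then have "(\<integral>y. cmod (a y) \<partial>lborel) * L2_norm (w t) \<le> (\<integral>y. cmod (a y) \<partial>lborel) * K"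
        using * by (intro mult_left_mono) auto
      then show "smear a (w t) \<in> L2 \<and> L2_norm (smear a (w t)) \<le> (\<integral>y. cmod (a y) \<partial>lborel) * K"
        using smear_Minkowski(1,2)[OF a, of "w t"] * t by auto
    qed
  qed
qed

lemma pairing_cnj_set_integrable:
  assumes v: "L2_bounded_on {s..t} v K" and w: "L2_bounded_on {s..t} w K'"
  shows "set_integrable lborel {s..t} (\<lambda>\<tau>. pairing (v \<tau>) (\<lambda>x. cnj (w \<tau> x)))"
    "AE \<tau> in lborel. \<tau> \<in> {s..t} \<longrightarrow> cmod (pairing (v \<tau>) (\<lambda>x. cnj (w \<tau> x))) \<le> K * K'"
proof -
  note [measurable] = L2_bounded_onD(2)[OF v] L2_bounded_onD(2)[OF w]
  show b: "AE \<tau> in lborel. \<tau> \<in> {s..t} \<longrightarrow> cmod (pairing (v \<tau>) (\<lambda>x. cnj (w \<tau> x))) \<le> K * K'"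
    using L2_bounded_onD(4)[OF v] L2_bounded_onD(4)[OF w]
  proof eventually_elim
    fix \<tau> assume *: "\<tau> \<in> {s..t} \<longrightarrow> v \<tau> \<in> L2 \<and> L2_norm (v \<tau>) \<le> K" "\<tau> \<in> {s..t} \<longrightarrow> w \<tau> \<in> L2 \<and> L2_norm (w \<tau>) \<le> K'"
    show "\<tau> \<in> {s..t} \<longrightarrow> cmod (pairing (v \<tau>) (\<lambda>x. cnj (w \<tau> x))) \<le> K * K'"
    proof
      assume t: "\<tau> \<in> {s..t}"
      have "cmod (pairing (v \<tau>) (\<lambda>x. cnj (w \<tau> x))) \<le> L2_norm (v \<tau>) * L2_norm (w \<tau>)"
        using pairing_Cauchy_Schwarz[of "v \<tau>" "\<lambda>x. cnj (w \<tau> x)"] * t by (auto simp: L2_cnj)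
      also have "\<dots> \<le> K * K'" using * t L2_bounded_onD(3)[OF v] by (intro mult_mono) auto
      finally show "cmod (pairing (v \<tau>) (\<lambda>x. cnj (w \<tau> x))) \<le> K * K'" .
    qed
  qed
  have [measurable]: "(\<lambda>\<tau>. pairing (v \<tau>) (\<lambda>x. cnj (w \<tau> x))) \<in> borel_measurable borel"
    unfolding pairing_def by measurable
  have i: "integrable lborel (\<lambda>\<tau>. indicator {s..t} \<tau> *\<^sub>R (K * K'))"
    by (intro integrable_scaleR_left integrable_real_indicator) (auto simp: emeasure_lborel_Icc_eq)
  show "set_integrable lborel {s..t} (\<lambda>\<tau>. pairing (v \<tau>) (\<lambda>x. cnj (w \<tau> x)))"
    unfolding set_integrable_def
  proof (rule Bochner_Integration.integrable_bound[OF i])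
    show "AE \<tau> in lborel. norm (indicator {s..t} \<tau> *\<^sub>R pairing (v \<tau>) (\<lambda>x. cnj (w \<tau> x))) \<le> norm (indicator {s..t} \<tau> *\<^sub>R (K * K'))"
      using b by eventually_elim (auto simp: indicator_def)
  qed measurable
qed

text \<open>For a fixed translation the norm of the increment depends continuously on time, so a bound at almost all times holds always.\<close>

lemma translation_Lipschitz_everywhere:
  assumes w: "continuous_into_L2 {0..} w" and ae: "AE \<tau> in lborel. \<tau> \<in> {0<..<T} \<longrightarrow> translation_Lipschitz (w \<tau>) M"
    and T: "0 < T" and t: "t \<in> {0..T}"
  shows "translation_Lipschitz (w t) M"
  unfolding translation_Lipschitz_def
proof (intro conjI allI)
  show "w t \<in> L2" using continuous_into_L2D(1)[OF w] t by auto
  fix y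
  have c: "continuous_into_L2 {0..} (\<lambda>t x. w t (x + y) - w t x)"
    unfolding continuous_into_L2_def
  proof (intro conjI ballI)
    fix t :: real assume t: "t \<in> {0..}"
    note wt = continuous_into_L2D(1)[OF w]
    show "(\<lambda>x. w t (x + y) - w t x) \<in> L2" using t wt by (auto intro!: L2_diff L2_translate)
    show "((\<lambda>s. L2_norm (\<lambda>x. w s (x + y) - w s x - (w t (x + y) - w t x))) \<longlongrightarrow> 0) (at t within {0..})"
    proof (rule Lim_null_comparison)
      show "\<forall>\<^sub>F s in at t within {0..}. norm (L2_norm (\<lambda>x. w s (x + y) - w s x - (w t (x + y) - w t x))) \<le> 2 * L2_norm (\<lambda>x. w s x - w t x)"
        unfolding eventually_at_filter
      proof (rule always_eventually, intro allI impI)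
        fix s :: real assume s: "s \<in> {0..}"
        have d: "(\<lambda>x. w s x - w t x) \<in> L2" using wt s t by auto
        have "L2_norm (\<lambda>x. (w s (x + y) - w t (x + y)) - (w s x - w t x)) \<le> L2_norm (\<lambda>x. w s (x + y) - w t (x + y)) + L2_norm (\<lambda>x. w s x - w t x)"
          by (rule L2_norm_triangle_diff[OF L2_translate(1)[OF d] d])
        then show "norm (L2_norm (\<lambda>x. w s (x + y) - w s x - (w t (x + y) - w t x))) \<le> 2 * L2_norm (\<lambda>x. w s x - w t x)"
          using L2_translate(2)[OF d, of y] by (simp add: algebra_simps)
      qed
      show "((\<lambda>s. 2 * L2_norm (\<lambda>x. w s x - w t x)) \<longlongrightarrow> 0) (at t within {0..})"
        using tendsto_mult_left[OF continuous_into_L2D(2)[OF w], of t 2] t by simp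
    qed
  qed
  have "AE \<tau> in lborel. \<tau> \<in> {0<..<T} \<longrightarrow> L2_norm (\<lambda>x. w \<tau> (x + y) - w \<tau> x) \<le> norm y * M"
    using ae by eventually_elim (auto simp: translation_Lipschitz_def)
  from le_if_AE_le_continuous[OF continuous_on_subset[OF L2_norm_continuous[OF c]] this T t]
  show "L2_norm (\<lambda>x. w t (x + y) - w t x) \<le> norm y * M" by auto
qed

lemma evolvesD:
  fixes w :: "real \<Rightarrow> 'a::euclidean_space \<Rightarrow> complex"
  assumes ev: "evolves T w G" and cont: "continuous_into_L2 {0..} w"
    and bw: "L2_bounded_on {0..T} w Kw" and bG: "L2_bounded_on {0..T} G KG"
    and \<phi>: "\<phi> \<in> bumps" and s: "0 \<le> s" and st: "s \<le> t" and tT: "t \<le> T"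
  shows "set_integrable lborel {s..t} (\<lambda>\<tau>. \<i> * pairing (w \<tau>) (laplacian \<phi>) - \<i> * pairing (G \<tau>) \<phi>)"
    and "pairing (w t) \<phi> - pairing (w s) \<phi>
       = (LINT \<tau>:{s..t}|lborel. \<i> * pairing (w \<tau>) (laplacian \<phi>) - \<i> * pairing (G \<tau>) \<phi>)"
proof -
  have \<phi>2: "\<phi> \<in> L2" and l\<phi>2: "laplacian \<phi> \<in> L2" by (intro bumps_L2 laplacian_bumps \<phi>)+
  define F where "F \<tau> = \<i> * pairing (w \<tau>) (laplacian \<phi>) - \<i> * pairing (G \<tau>) \<phi>" for \<tau>
  have T0: "0 \<le> T" using s st tT by linarith
  have iT: "set_integrable lborel {0..T} F"
    unfolding F_def using pairing_set_integrable[OF bw T0 l\<phi>2] pairing_set_integrable[OF bG T0 \<phi>2]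
    by (intro set_integral_diff(1) set_integrable_mult_right) auto
  have iF: "set_integrable lborel {a..b} F" if "0 \<le> a" "b \<le> T" for a b
    by (rule set_integrable_subset[OF iT]) (use that in auto)
  then show "set_integrable lborel {s..t} (\<lambda>\<tau>. \<i> * pairing (w \<tau>) (laplacian \<phi>) - \<i> * pairing (G \<tau>) \<phi>)"
    using s tT unfolding F_def by blast
  define C where "C = Kw * L2_norm (laplacian \<phi>) + KG * L2_norm \<phi>"
  have bF: "AE \<tau> in lborel. \<tau> \<in> {0..T} \<longrightarrow> cmod (F \<tau>) \<le> C"
    using L2_bounded_onD(4)[OF bw] L2_bounded_onD(4)[OF bG]
  proof eventually_elim
    fix \<tau> assume *: "\<tau> \<in> {0..T} \<longrightarrow> w \<tau> \<in> L2 \<and> L2_norm (w \<tau>) \<le> Kw" "\<tau> \<in> {0..T} \<longrightarrow> G \<tau> \<in> L2 \<and> L2_norm (G \<tau>) \<le> KG"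
    show "\<tau> \<in> {0..T} \<longrightarrow> cmod (F \<tau>) \<le> C"
    proof
      assume t: "\<tau> \<in> {0..T}"
      have "cmod (F \<tau>) \<le> cmod (pairing (w \<tau>) (laplacian \<phi>)) + cmod (pairing (G \<tau>) \<phi>)"
        unfolding F_def using norm_triangle_ineq4[of "\<i> * pairing (w \<tau>) (laplacian \<phi>)" "\<i> * pairing (G \<tau>) \<phi>"] by (simp add: norm_mult)
      also have "\<dots> \<le> L2_norm (w \<tau>) * L2_norm (laplacian \<phi>) + L2_norm (G \<tau>) * L2_norm \<phi>"
        using * t by (intro add_mono pairing_Cauchy_Schwarz \<phi>2 l\<phi>2) auto
      also have "\<dots> \<le> C" unfolding C_def using * t by (intro add_mono mult_right_mono) auto
      finally show "cmod (F \<tau>) \<le> C" .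
    qed
  qed
  have pos: "pairing (w t) \<phi> - pairing (w \<sigma>) \<phi> = (LINT \<tau>:{\<sigma>..t}|lborel. F \<tau>)" if "0 < \<sigma>" "\<sigma> < t" for \<sigma>
    using ev \<phi> that tT unfolding evolves_def F_def by blast
  consider "s = t" | "0 < s" "s < t" | "s = 0" "0 < t" using s st by linarith
  then show "pairing (w t) \<phi> - pairing (w s) \<phi>
       = (LINT \<tau>:{s..t}|lborel. \<i> * pairing (w \<tau>) (laplacian \<phi>) - \<i> * pairing (G \<tau>) \<phi>)"
    unfolding F_def[symmetric]
  proof cases
    case 1
    have "AE \<tau> in lborel. \<tau> \<noteq> t" by (rule AE_lborel_singleton)
    then have "AE \<tau> in lborel. indicator {s..t} \<tau> *\<^sub>R F \<tau> = 0" by eventually_elim (use 1 in auto)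
    then have "(LINT \<tau>:{s..t}|lborel. F \<tau>) = 0"
      unfolding set_lebesgue_integral_def by (rule integral_eq_zero_AE)
    then show "pairing (w t) \<phi> - pairing (w s) \<phi> = (LINT \<tau>:{s..t}|lborel. F \<tau>)" using 1 by simp
  next
    case 2
    then show "pairing (w t) \<phi> - pairing (w s) \<phi> = (LINT \<tau>:{s..t}|lborel. F \<tau>)" by (rule pos)
  next
    case 3
    define z where "z = pairing (w t) \<phi> - pairing (w 0) \<phi> - (LINT \<tau>:{0..t}|lborel. F \<tau>)"
    have "\<forall>\<^sub>F \<sigma> in at_right 0. cmod z \<le> cmod (pairing (w \<sigma>) \<phi> - pairing (w 0) \<phi>) + \<sigma> * C"
      using eventually_at_right_real[OF 3(2)]
    proof eventually_elim
      fix \<sigma> assume \<sigma>: "\<sigma> \<in> {0<..<t}"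
      have "(LINT \<tau>:{0..t}|lborel. F \<tau>) = (LINT \<tau>:{0..\<sigma>}|lborel. F \<tau>) + (LINT \<tau>:{\<sigma>..t}|lborel. F \<tau>)"
        by (rule set_integral_combine(3)) (use \<sigma> tT in \<open>auto intro: iF\<close>)
      then have "z = (pairing (w \<sigma>) \<phi> - pairing (w 0) \<phi>) - (LINT \<tau>:{0..\<sigma>}|lborel. F \<tau>)"
        using pos[of \<sigma>] \<sigma> by (simp add: z_def algebra_simps)
      then have "cmod z \<le> cmod (pairing (w \<sigma>) \<phi> - pairing (w 0) \<phi>) + cmod (LINT \<tau>:{0..\<sigma>}|lborel. F \<tau>)"
        by (simp add: norm_triangle_ineq4)
      moreover have "cmod (LINT \<tau>:{0..\<sigma>}|lborel. F \<tau>) \<le> (\<sigma> - 0) * C"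
      proof (rule set_integral_bound)
        show "set_integrable lborel {0..\<sigma>} F" by (rule iF) (use \<sigma> tT in auto)
        show "AE \<tau> in lborel. \<tau> \<in> {0..\<sigma>} \<longrightarrow> cmod (F \<tau>) \<le> C" using bF by eventually_elim (use \<sigma> tT in auto)
      qed (use \<sigma> in auto)
      ultimately show "cmod z \<le> cmod (pairing (w \<sigma>) \<phi> - pairing (w 0) \<phi>) + \<sigma> * C" by simp
    qed
    moreover have "((\<lambda>\<sigma>. cmod (pairing (w \<sigma>) \<phi> - pairing (w 0) \<phi>) + \<sigma> * C) \<longlongrightarrow> cmod (pairing (w 0) \<phi> - pairing (w 0) \<phi>) + 0 * C) (at_right 0)"
    proof (intro tendsto_intros)
      have "((\<lambda>\<sigma>. pairing (w \<sigma>) \<phi>) \<longlongrightarrow> pairing (w 0) \<phi>) (at 0 within {0..})"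
        using pairing_continuous[OF cont \<phi>2] by (simp add: continuous_on_def)
      then show "((\<lambda>\<sigma>. pairing (w \<sigma>) \<phi>) \<longlongrightarrow> pairing (w 0) \<phi>) (at_right 0)"
        by (rule tendsto_within_subset) auto
    qed
    ultimately have "cmod z \<le> 0"
      using tendsto_lowerbound[of "\<lambda>\<sigma>. cmod (pairing (w \<sigma>) \<phi> - pairing (w 0) \<phi>) + \<sigma> * C" 0 "at_right 0" "cmod z"] by simp
    then show "pairing (w t) \<phi> - pairing (w s) \<phi> = (LINT \<tau>:{s..t}|lborel. F \<tau>)" using 3 by (simp add: z_def)
  qed
qed

definition has_laplacian :: "('a::euclidean_space \<Rightarrow> complex) \<Rightarrow> ('a \<Rightarrow> complex) \<Rightarrow> bool" where
  "has_laplacian v g \<longleftrightarrow> v \<in> L2 \<and> g \<in> L2 \<and> (\<forall>\<phi>\<in>bumps. pairing v (laplacian \<phi>) = pairing g \<phi>)"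

lemma smear_laplacian:
  assumes "has_laplacian v g" "a \<in> bumps"
  shows "smear (laplacian a) v x = smear a g x"
proof -
  have v: "v \<in> L2" "g \<in> L2" and p: "pairing v (laplacian \<phi>) = pairing g \<phi>" if "\<phi> \<in> bumps" for \<phi>
    using assms(1) that by (auto simp: has_laplacian_def)
  have t: "(\<lambda>y. a (y - x)) \<in> bumps" using bumps_translate[OF assms(2), of "- x"] by simp
  show ?thesis
    using p[OF t] laplacian_translate[of a "- x"] v[OF assms(2)]
    by (simp add: smear_eq_pairing bumps_measurable laplacian_bumps assms(2) L2_measurable)
qed

text \<open>A function with \<open>\<i> w\<^sub>t + \<Delta> w = G\<close> on a time interval, continuous in \<open>L2\<close>, with one derivative in space and bounded forcing.
  It will be the difference of two solutions as well as a single one.\<close>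

locale forced_evolution =
  fixes w G :: "real \<Rightarrow> 'a::euclidean_space \<Rightarrow> complex" and T Kw KG M :: real
  assumes evolves: "evolves T w G" and continuous: "continuous_into_L2 {0..} w"
    and bounded: "L2_bounded_on {0..T} w Kw" and forcing_bounded: "L2_bounded_on {0..T} G KG"
    and T_pos: "0 < T" and Lipschitz: "\<And>t. t \<in> {0..T} \<Longrightarrow> translation_Lipschitz (w t) M"
begin

lemma w_L2: "0 \<le> t \<Longrightarrow> w t \<in> L2"
  by (rule continuous_into_L2D(1)[OF continuous])

text \<open>The time derivative of the function \<open>w\<close> smeared with \<open>a\<close>: the smearing moves the Laplacian to the kernel, and so the derivative exists
  in \<open>L2\<close>.\<close>

definition velocity :: "('a \<Rightarrow> complex) \<Rightarrow> real \<Rightarrow> 'a \<Rightarrow> complex" where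
  "velocity a \<tau> x = \<i> * smear (laplacian a) (w \<tau>) x - \<i> * smear a (G \<tau>) x"

lemma velocity_measurable:
  assumes a: "a \<in> bumps"
  shows "(\<lambda>(\<tau>, x). velocity a \<tau> x) \<in> borel_measurable borel"
proof -
  have [measurable]: "(\<lambda>(\<tau>, x). smear (laplacian a) (w \<tau>) x) \<in> borel_measurable (borel \<Otimes>\<^sub>M borel)"
    "(\<lambda>(\<tau>, x). smear a (G \<tau>) x) \<in> borel_measurable (borel \<Otimes>\<^sub>M borel)"
    unfolding borel_prod
    by (intro smear_jointly_measurable bumps_measurable laplacian_bumps a
        L2_bounded_onD(1)[OF bounded] L2_bounded_onD(1)[OF forcing_bounded])+
  show ?thesis unfolding velocity_def borel_prod[symmetric] by measurable
qed

lemma velocity_bounded: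
  assumes a: "a \<in> bumps"
  obtains Q where "L2_bounded_on {0..T} (velocity a) Q"
proof
  let ?l = "(\<integral>y. cmod (laplacian a y) \<partial>lborel) * Kw" and ?k = "(\<integral>y. cmod (a y) \<partial>lborel) * KG"
  note l = smear_L2_bounded_on[OF laplacian_bumps[OF a] bounded] and k = smear_L2_bounded_on[OF a forcing_bounded]
  show "L2_bounded_on {0..T} (velocity a) (?l + ?k)"
    unfolding L2_bounded_on_def
  proof (intro conjI velocity_measurable a)
    show "0 \<le> ?l + ?k" using L2_bounded_onD(3)[OF l] L2_bounded_onD(3)[OF k] by simp
    show "AE t in lborel. t \<in> {0..T} \<longrightarrow> velocity a t \<in> L2 \<and> L2_norm (velocity a t) \<le> ?l + ?k"
      using L2_bounded_onD(4)[OF l] L2_bounded_onD(4)[OF k]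
    proof eventually_elim
      fix t assume *: "t \<in> {0..T} \<longrightarrow> smear (laplacian a) (w t) \<in> L2 \<and> L2_norm (smear (laplacian a) (w t)) \<le> ?l"
        "t \<in> {0..T} \<longrightarrow> smear a (G t) \<in> L2 \<and> L2_norm (smear a (G t)) \<le> ?k"
      show "t \<in> {0..T} \<longrightarrow> velocity a t \<in> L2 \<and> L2_norm (velocity a t) \<le> ?l + ?k"
      proof
        assume "t \<in> {0..T}"
        then have 1: "smear (laplacian a) (w t) \<in> L2" "L2_norm (smear (laplacian a) (w t)) \<le> ?l"
          and 2: "smear a (G t) \<in> L2" "L2_norm (smear a (G t)) \<le> ?k" using * by auto
        show "velocity a t \<in> L2 \<and> L2_norm (velocity a t) \<le> ?l + ?k"
          unfolding velocity_def[abs_def]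
          using L2_diff[OF L2_scale[OF 1(1), of \<i>] L2_scale[OF 2(1), of \<i>]]
            L2_norm_triangle_diff[OF L2_scale[OF 1(1), of \<i>] L2_scale[OF 2(1), of \<i>]] 1(2) 2(2)
          by (simp add: L2_norm_scale)
      qed
    qed
  qed
qed

lemma smear_increment:
  assumes a: "a \<in> bumps" and s: "0 \<le> s" and st: "s \<le> t" and tT: "t \<le> T"
  shows "smear a (w t) x - smear a (w s) x = (LINT \<tau>:{s..t}|lborel. velocity a \<tau> x)"
proof -
  have t: "(\<lambda>y. a (y - x)) \<in> bumps" using bumps_translate[OF a, of "- x"] by simp
  have mw: "w \<tau> \<in> borel_measurable borel" "G \<tau> \<in> borel_measurable borel" for \<tau>
    using measurable_compose[OF measurable_Pair[OF measurable_const measurable_ident] L2_bounded_onD(2)[OF bounded], of \<tau>]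
      measurable_compose[OF measurable_Pair[OF measurable_const measurable_ident] L2_bounded_onD(2)[OF forcing_bounded], of \<tau>]
    by simp_all
  have "laplacian (\<lambda>y. a (y - x)) = (\<lambda>y. laplacian a (y - x))"
    using laplacian_translate[of a "- x"] by simp
  then show ?thesis
    using evolvesD(2)[OF evolves continuous bounded forcing_bounded t s st tT]
    by (simp add: velocity_def smear_eq_pairing bumps_measurable a laplacian_bumps mw)
qed

lemma smear_increment_bound:
  assumes a: "a \<in> bumps" and Q: "L2_bounded_on {0..T} (velocity a) Q" and s: "0 \<le> s" and st: "s \<le> t" and tT: "t \<le> T"
  shows "L2_norm (\<lambda>x. smear a (w t) x - smear a (w s) x) \<le> (t - s) * Q"
    "g \<in> L2 \<Longrightarrow> set_integrable lborel {s..t} (\<lambda>\<tau>. pairing (velocity a \<tau>) g)"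
    "g \<in> L2 \<Longrightarrow> pairing (\<lambda>x. smear a (w t) x - smear a (w s) x) g = (LINT \<tau>:{s..t}|lborel. pairing (velocity a \<tau>) g)"
proof -
  have "L2_bounded_on {s..t} (velocity a) Q" by (rule L2_bounded_on_mono[OF Q _ order_refl]) (use s tT in auto)
  note B = L2_bounded_onD[OF this]
  note MK = Minkowski_interval[OF B(1) B(4) st B(3)]
  show "L2_norm (\<lambda>x. smear a (w t) x - smear a (w s) x) \<le> (t - s) * Q"
    "g \<in> L2 \<Longrightarrow> set_integrable lborel {s..t} (\<lambda>\<tau>. pairing (velocity a \<tau>) g)"
    "g \<in> L2 \<Longrightarrow> pairing (\<lambda>x. smear a (w t) x - smear a (w s) x) g = (LINT \<tau>:{s..t}|lborel. pairing (velocity a \<tau>) g)"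
    unfolding smear_increment[OF a s st tT] using MK(2,4,5) by auto
qed

text \<open>The Laplacian contributes the real number of \<open>smear_pairing_real\<close> times \<open>\<i>\<close>, which has no real part.\<close>

lemma AE_velocity_pairing:
  assumes a: "symmetric_kernel a"
  shows "AE \<tau> in lborel. \<tau> \<in> {0..T} \<longrightarrow> Re (pairing (velocity a \<tau>) (\<lambda>x. cnj (smear a (w \<tau>) x)))
     = Im (pairing (smear a (G \<tau>)) (\<lambda>x. cnj (smear a (w \<tau>) x)))"
  using L2_bounded_onD(4)[OF bounded] L2_bounded_onD(4)[OF forcing_bounded]
proof eventually_elim
  fix \<tau> assume *: "\<tau> \<in> {0..T} \<longrightarrow> w \<tau> \<in> L2 \<and> L2_norm (w \<tau>) \<le> Kw" "\<tau> \<in> {0..T} \<longrightarrow> G \<tau> \<in> L2 \<and> L2_norm (G \<tau>) \<le> KG"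
  have ab: "a \<in> bumps" using a by (simp add: symmetric_kernel_def)
  show "\<tau> \<in> {0..T} \<longrightarrow> Re (pairing (velocity a \<tau>) (\<lambda>x. cnj (smear a (w \<tau>) x)))
     = Im (pairing (smear a (G \<tau>)) (\<lambda>x. cnj (smear a (w \<tau>) x)))"
  proof
    assume "\<tau> \<in> {0..T}"
    then have w: "w \<tau> \<in> L2" and G: "G \<tau> \<in> L2" using * by auto
    note m = smear_Minkowski(1)[OF ab w] smear_Minkowski(1)[OF laplacian_bumps[OF ab] w] smear_Minkowski(1)[OF ab G]
    have "pairing (velocity a \<tau>) (\<lambda>x. cnj (smear a (w \<tau>) x)) =
      \<i> * pairing (smear (laplacian a) (w \<tau>)) (\<lambda>x. cnj (smear a (w \<tau>) x)) - \<i> * pairing (smear a (G \<tau>)) (\<lambda>x. cnj (smear a (w \<tau>) x))"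
      unfolding velocity_def[abs_def] using m by (subst pairing_diff_left) (auto simp: pairing_scale_left)
    then show "Re (pairing (velocity a \<tau>) (\<lambda>x. cnj (smear a (w \<tau>) x)))
     = Im (pairing (smear a (G \<tau>)) (\<lambda>x. cnj (smear a (w \<tau>) x)))"
      using smear_pairing_real[OF laplacian_symmetric_kernel[OF a] a w] by simp
  qed
qed

text \<open>For the mollified function, whose time derivative is an honest \<open>L2\<close> function, the difference between the
  increment of the squared norm and the time integral is quadratic in the length of the time step,
  hence vanishes.\<close>

lemma mollified_energy:
  assumes a: "symmetric_kernel a" and s: "0 \<le> s" and st: "s \<le> t" and tT: "t \<le> T"
  shows "(L2_norm (smear a (w t)))\<^sup>2 - (L2_norm (smear a (w s)))\<^sup>2
    = 2 * Re (LINT \<tau>:{s..t}|lborel. pairing (velocity a \<tau>) (\<lambda>x. cnj (smear a (w \<tau>) x)))"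
proof -
  have ab: "a \<in> bumps" using a by (simp add: symmetric_kernel_def)
  obtain Q where Q: "L2_bounded_on {0..T} (velocity a) Q" using velocity_bounded[OF ab] by blast
  have Q0: "0 \<le> Q" by (rule L2_bounded_onD(3)[OF Q])
  define m where "m \<tau> = smear a (w \<tau>)" for \<tau>
  have m2: "m \<tau> \<in> L2" if "0 \<le> \<tau>" for \<tau> unfolding m_def by (rule smear_Minkowski(1)[OF ab w_L2[OF that]])
  define P where "P \<tau> = pairing (velocity a \<tau>) (\<lambda>x. cnj (m \<tau> x))" for \<tau>
  have iT: "set_integrable lborel {0..T} P"
    unfolding P_def m_def by (rule pairing_cnj_set_integrable(1)[OF Q smear_L2_bounded_on[OF ab bounded]])
  have iP: "set_integrable lborel {\<alpha>..\<beta>} P" if "0 \<le> \<alpha>" "\<beta> \<le> T" for \<alpha> \<beta>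
    by (rule set_integrable_subset[OF iT]) (use that in auto)
  \<comment> \<open>The increment of \<open>N\<close> over a step pairs the velocity at an intermediate time with \<open>(m \<beta> - m \<tau>) - (m \<tau> - m \<alpha>)\<close>, and both factors of the time
    step come from the Lipschitz continuity of \<open>m\<close> and from the length of the interval.\<close>
  define N where "N \<tau> = (L2_norm (m \<tau>))\<^sup>2 - 2 * Re (LINT \<tau>':{s..\<tau>}|lborel. P \<tau>')" for \<tau>
  have "N t = N s"
  proof (rule constant_if_quadratic[OF _ st, where C="2 * Q\<^sup>2"])
    fix \<alpha> \<beta> assume ord: "s \<le> \<alpha>" "\<alpha> \<le> \<beta>" "\<beta> \<le> t"
    have \<alpha>: "0 \<le> \<alpha>" "0 \<le> \<beta>" "\<beta> \<le> T" using ord s tT by auto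
    define c where "c x = cnj (m \<beta> x + m \<alpha> x)" for x
    have c: "c \<in> L2" unfolding c_def[abs_def] by (intro L2_cnj L2_add m2 \<alpha>)
    note I = smear_increment_bound[OF ab Q \<alpha>(1) ord(2) \<alpha>(3), folded m_def]
    have split: "(LINT \<tau>:{s..\<beta>}|lborel. P \<tau>) = (LINT \<tau>:{s..\<alpha>}|lborel. P \<tau>) + (LINT \<tau>:{\<alpha>..\<beta>}|lborel. P \<tau>)"
      by (rule set_integral_combine(3)) (use ord iP s \<alpha> in auto)
    have cm: "(\<lambda>x. cnj (m \<alpha> x)) \<in> L2" "(\<lambda>x. cnj (m \<beta> x)) \<in> L2" by (intro L2_cnj m2 \<alpha>)+
    have "pairing (\<lambda>x. m \<beta> x - m \<alpha> x) c = (of_real ((L2_norm (m \<beta>))\<^sup>2) - of_real ((L2_norm (m \<alpha>))\<^sup>2))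
       + (pairing (m \<beta>) (\<lambda>x. cnj (m \<alpha> x)) - cnj (pairing (m \<beta>) (\<lambda>x. cnj (m \<alpha> x))))"
      unfolding c_def[abs_def] complex_cnj_add
      by (simp add: pairing_diff_left pairing_add_right m2 \<alpha> cm L2_add pairing_cnj_self cnj_pairing pairing_commute)
    then have "(L2_norm (m \<beta>))\<^sup>2 - (L2_norm (m \<alpha>))\<^sup>2 = Re (pairing (\<lambda>x. m \<beta> x - m \<alpha> x) c)" by simp
    then have "N \<beta> - N \<alpha> = Re ((LINT \<tau>:{\<alpha>..\<beta>}|lborel. pairing (velocity a \<tau>) c) - 2 * (LINT \<tau>:{\<alpha>..\<beta>}|lborel. P \<tau>))"
      unfolding N_def split I(3)[OF c] by simp
    also have "(LINT \<tau>:{\<alpha>..\<beta>}|lborel. pairing (velocity a \<tau>) c) - 2 * (LINT \<tau>:{\<alpha>..\<beta>}|lborel. P \<tau>)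
        = (LINT \<tau>:{\<alpha>..\<beta>}|lborel. pairing (velocity a \<tau>) c - 2 * P \<tau>)"
      using set_integral_diff(2)[OF I(2)[OF c] set_integrable_mult_right[OF iP[OF \<alpha>(1,3)], of 2]] by simp
    finally have eq: "N \<beta> - N \<alpha> = Re (LINT \<tau>:{\<alpha>..\<beta>}|lborel. pairing (velocity a \<tau>) c - 2 * P \<tau>)" .
    have "cmod (LINT \<tau>:{\<alpha>..\<beta>}|lborel. pairing (velocity a \<tau>) c - 2 * P \<tau>) \<le> (\<beta> - \<alpha>) * (2 * Q\<^sup>2 * (\<beta> - \<alpha>))"
    proof (rule set_integral_bound[OF _ _ ord(2)])
      show "set_integrable lborel {\<alpha>..\<beta>} (\<lambda>\<tau>. pairing (velocity a \<tau>) c - 2 * P \<tau>)"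
        by (intro set_integral_diff(1)[OF I(2)[OF c]] set_integrable_mult_right iP[OF \<alpha>(1,3)])
      show "AE \<tau> in lborel. \<tau> \<in> {\<alpha>..\<beta>} \<longrightarrow> cmod (pairing (velocity a \<tau>) c - 2 * P \<tau>) \<le> 2 * Q\<^sup>2 * (\<beta> - \<alpha>)"
        using L2_bounded_onD(4)[OF Q]
      proof eventually_elim
        fix \<tau> assume *: "\<tau> \<in> {0..T} \<longrightarrow> velocity a \<tau> \<in> L2 \<and> L2_norm (velocity a \<tau>) \<le> Q"
        show "\<tau> \<in> {\<alpha>..\<beta>} \<longrightarrow> cmod (pairing (velocity a \<tau>) c - 2 * P \<tau>) \<le> 2 * Q\<^sup>2 * (\<beta> - \<alpha>)"
        proof
          assume \<tau>: "\<tau> \<in> {\<alpha>..\<beta>}"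
          then have t0: "0 \<le> \<tau>" "\<tau> \<le> T" using \<alpha> by auto
          then have v: "velocity a \<tau> \<in> L2" "L2_norm (velocity a \<tau>) \<le> Q" using * by auto
          define r where "r x = (m \<beta> x - m \<tau> x) - (m \<tau> x - m \<alpha> x)" for x
          have r: "r \<in> L2" unfolding r_def[abs_def] by (intro L2_diff m2 \<alpha> t0)
          have n1: "L2_norm (\<lambda>x. m \<beta> x - m \<tau> x) \<le> (\<beta> - \<tau>) * Q"
            using smear_increment_bound(1)[OF ab Q t0(1) _ \<alpha>(3)] \<tau> by (simp add: m_def)
          have n2: "L2_norm (\<lambda>x. m \<tau> x - m \<alpha> x) \<le> (\<tau> - \<alpha>) * Q"
            using smear_increment_bound(1)[OF ab Q \<alpha>(1) _ t0(2)] \<tau> by (simp add: m_def)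
          have "L2_norm r \<le> L2_norm (\<lambda>x. m \<beta> x - m \<tau> x) + L2_norm (\<lambda>x. m \<tau> x - m \<alpha> x)"
            unfolding r_def[abs_def] by (intro L2_norm_triangle_diff L2_diff m2 \<alpha> t0)
          also have "\<dots> \<le> (\<beta> - \<alpha>) * Q" using n1 n2 by (simp add: algebra_simps)
          finally have rn: "L2_norm r \<le> (\<beta> - \<alpha>) * Q" .
          have ct: "(\<lambda>x. cnj (m \<tau> x)) \<in> L2" by (intro L2_cnj m2 t0)
          have "pairing (velocity a \<tau>) (\<lambda>x. cnj (r x)) = pairing (velocity a \<tau>) (\<lambda>x. c x - 2 * cnj (m \<tau> x))"
            by (rule arg_cong[where f="pairing (velocity a \<tau>)"]) (simp add: r_def c_def fun_eq_iff)
          also have "\<dots> = pairing (velocity a \<tau>) c - 2 * P \<tau>"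
            by (simp add: pairing_diff_right pairing_scale_right v(1) c ct L2_scale P_def)
          finally have "cmod (pairing (velocity a \<tau>) c - 2 * P \<tau>) \<le> L2_norm (velocity a \<tau>) * L2_norm r"
            using pairing_Cauchy_Schwarz[OF v(1) L2_cnj[OF r]] by simp
          also have "\<dots> \<le> Q * ((\<beta> - \<alpha>) * Q)" by (intro mult_mono v rn Q0) simp
          also have "\<dots> \<le> 2 * Q\<^sup>2 * (\<beta> - \<alpha>)" using mult_nonneg_nonneg[of "Q * Q" "\<beta> - \<alpha>"] ord Q0 by (simp add: power2_eq_square algebra_simps)
          finally show "cmod (pairing (velocity a \<tau>) c - 2 * P \<tau>) \<le> 2 * Q\<^sup>2 * (\<beta> - \<alpha>)" .
        qed
      qed
    qed
    then show "\<bar>N \<beta> - N \<alpha>\<bar> \<le> 2 * Q\<^sup>2 * (\<beta> - \<alpha>)\<^sup>2"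
      unfolding eq using abs_Re_le_cmod[of "LINT \<tau>:{\<alpha>..\<beta>}|lborel. pairing (velocity a \<tau>) c - 2 * P \<tau>"]
      by (simp add: power2_eq_square algebra_simps)
  qed
  moreover have "(LINT \<tau>:{s..s}|lborel. P \<tau>) = 0"
    using set_integral_bound[OF iP, of s s 0] s st tT set_integral_combine(3)[OF iP, of s s s] by simp
  ultimately show ?thesis by (simp add: N_def P_def m_def)
qed

lemma smear_w_close:
  assumes "0 < \<delta>" "t \<in> {0..T}"
  shows "L2_norm (\<lambda>x. smear (mollifier \<delta>) (w t) x - w t x) \<le> real DIM('a) * \<delta> * M"
  by (rule smear_mollifier_close[OF assms(1) Lipschitz[OF assms(2)]])

end

lemma set_integral_Re_Im:
  fixes f :: "real \<Rightarrow> complex"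
  assumes "set_integrable lborel S f"
  shows "Re (LINT x:S|lborel. f x) = (LINT x:S|lborel. Re (f x))" "Im (LINT x:S|lborel. f x) = (LINT x:S|lborel. Im (f x))"
  using integral_Re[OF assms[unfolded set_integrable_def]] integral_Im[OF assms[unfolded set_integrable_def]]
  by (simp_all add: set_lebesgue_integral_def)

lemma L2_norm_square_diff_le:
  assumes "f \<in> L2" "g \<in> L2" "L2_norm f \<le> L2_norm g"
  shows "\<bar>(L2_norm f)\<^sup>2 - (L2_norm g)\<^sup>2\<bar> \<le> L2_norm (\<lambda>x. f x - g x) * (2 * L2_norm g)"
proof -
  have "\<bar>(L2_norm f)\<^sup>2 - (L2_norm g)\<^sup>2\<bar> = \<bar>L2_norm f - L2_norm g\<bar> * (L2_norm f + L2_norm g)"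
    by (simp add: power2_eq_square square_diff_square_factored abs_mult mult.commute)
  also have "\<dots> \<le> L2_norm (\<lambda>x. f x - g x) * (2 * L2_norm g)"
    by (intro mult_mono L2_norm_reverse_triangle assms(1,2)) (use assms(3) in auto)
  finally show ?thesis .
qed

lemma eq_if_close:
  fixes z :: "'b::real_normed_vector"
  assumes "\<And>\<delta>. 0 < \<delta> \<Longrightarrow> norm z \<le> \<delta> * C" shows "z = 0"
proof -
  have "norm z \<le> 0"
  proof (rule tendsto_lowerbound)
    have "((\<lambda>\<delta>. \<delta> * C) \<longlongrightarrow> 0 * C) (at_right 0)" by (intro tendsto_intros)
    then show "((\<lambda>\<delta>. \<delta> * C) \<longlongrightarrow> 0) (at_right 0)" by simp
    show "\<forall>\<^sub>F \<delta> in at_right 0. norm z \<le> \<delta> * C"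
      using eventually_at_right_less[of 0] by eventually_elim (rule assms)
  qed simp
  then show ?thesis by simp
qed

lemma le_if_close:
  fixes x y :: real
  assumes "\<And>\<delta>. 0 < \<delta> \<Longrightarrow> x \<le> y + \<delta> * C" shows "x \<le> y"
proof (rule tendsto_lowerbound)
  have "((\<lambda>\<delta>. y + \<delta> * C) \<longlongrightarrow> y + 0 * C) (at_right 0)" by (intro tendsto_intros)
  then show "((\<lambda>\<delta>. y + \<delta> * C) \<longlongrightarrow> y) (at_right 0)" by simp
  show "\<forall>\<^sub>F \<delta> in at_right 0. x \<le> y + \<delta> * C"
    using eventually_at_right_less[of 0] by eventually_elim (rule assms)
qed simp

context forced_evolution
begin

lemma interval_bounds:
  assumes "0 \<le> s" "t \<le> T"
  shows "L2_bounded_on {s..t} w Kw" "L2_bounded_on {s..t} G KG"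
  by (rule L2_bounded_on_mono[OF bounded], use assms in auto)
     (rule L2_bounded_on_mono[OF forcing_bounded], use assms in auto)

lemma M_nonneg: "0 \<le> M"
proof -
  obtain b :: 'a where "b \<in> Basis" using nonempty_Basis by blast
  have "0 \<le> L2_norm (\<lambda>x. w 0 (x + b) - w 0 x)" by simp
  also have "\<dots> \<le> norm b * M" using Lipschitz[of 0] T_pos by (auto simp: translation_Lipschitz_def)
  finally show ?thesis using \<open>b \<in> Basis\<close> by simp
qed

text \<open>Self-adjointness moves the mollification from the forcing to \<open>w\<close>, which is regular, so that it is close to the identity there.\<close>

lemma pairing_smear_close:
  assumes \<delta>: "0 < \<delta>" and \<tau>: "\<tau> \<in> {0..T}" and G: "G \<tau> \<in> L2" "L2_norm (G \<tau>) \<le> KG"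
  shows "cmod (pairing (smear (mollifier \<delta>) (G \<tau>)) (\<lambda>x. cnj (smear (mollifier \<delta>) (w \<tau>) x))
      - pairing (G \<tau>) (\<lambda>x. cnj (w \<tau> x))) \<le> \<delta> * (2 * KG * (real DIM('a) * M))"
proof -
  let ?a = "mollifier \<delta> :: 'a \<Rightarrow> complex"
  have w: "w \<tau> \<in> L2" using \<tau> by (intro w_L2) simp
  define r where "r x = smear ?a (w \<tau>) x - w \<tau> x" for x
  note m = smear_mollifier_bound[OF \<delta> w] and mG = smear_mollifier_bound[OF \<delta> G(1)]
  have r: "r \<in> L2" unfolding r_def[abs_def] by (intro L2_diff m w)
  have rn: "L2_norm r \<le> real DIM('a) * \<delta> * M" unfolding r_def[abs_def] by (rule smear_w_close[OF \<delta> \<tau>])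
  have cr: "(\<lambda>x. cnj (r x)) \<in> L2" "(\<lambda>x. cnj (w \<tau> x)) \<in> L2" "(\<lambda>x. cnj (smear ?a (w \<tau>) x)) \<in> L2"
    by (intro L2_cnj r w m)+
  have "pairing (smear ?a (G \<tau>)) (\<lambda>x. cnj (w \<tau> x)) = pairing (G \<tau>) (\<lambda>x. cnj (smear ?a (w \<tau>) x))"
    using smear_adjoint[OF mollifier_symmetric[OF \<delta>] G(1) cr(2)] cnj_smear[OF mollifier_symmetric[OF \<delta>], of "w \<tau>"]
    by (simp add: fun_eq_iff[symmetric])
  then have "pairing (smear ?a (G \<tau>)) (\<lambda>x. cnj (smear ?a (w \<tau>) x)) - pairing (G \<tau>) (\<lambda>x. cnj (w \<tau> x))
     = pairing (smear ?a (G \<tau>)) (\<lambda>x. cnj (r x)) + pairing (G \<tau>) (\<lambda>x. cnj (r x))"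
    unfolding r_def complex_cnj_diff by (simp add: pairing_diff_right mG G cr)
  then have "cmod (pairing (smear ?a (G \<tau>)) (\<lambda>x. cnj (smear ?a (w \<tau>) x)) - pairing (G \<tau>) (\<lambda>x. cnj (w \<tau> x)))
     \<le> cmod (pairing (smear ?a (G \<tau>)) (\<lambda>x. cnj (r x))) + cmod (pairing (G \<tau>) (\<lambda>x. cnj (r x)))"
    by (simp only: norm_triangle_ineq)
  also have "\<dots> \<le> L2_norm (smear ?a (G \<tau>)) * L2_norm r + L2_norm (G \<tau>) * L2_norm r"
    using pairing_Cauchy_Schwarz[OF mG(1) cr(1)] pairing_Cauchy_Schwarz[OF G(1) cr(1)] by simp
  also have "\<dots> \<le> KG * (real DIM('a) * \<delta> * M) + KG * (real DIM('a) * \<delta> * M)"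
    using mG(2) G(2) L2_bounded_onD(3)[OF forcing_bounded] by (intro add_mono mult_mono rn) auto
  finally show ?thesis by (simp add: algebra_simps)
qed

text \<open>The identity for mollified functions, in the limit of vanishing mollification scale.\<close>

lemma energy_identity:
  assumes s: "0 \<le> s" and st: "s \<le> t" and tT: "t \<le> T"
  shows "(L2_norm (w t))\<^sup>2 - (L2_norm (w s))\<^sup>2 = 2 * Im (LINT \<tau>:{s..t}|lborel. pairing (G \<tau>) (\<lambda>x. cnj (w \<tau> x)))"
proof -
  define B where "B = (LINT \<tau>:{s..t}|lborel. pairing (G \<tau>) (\<lambda>x. cnj (w \<tau> x)))"
  define D where "D = real DIM('a) * M"
  have D: "0 \<le> D" using M_nonneg by (simp add: D_def)
  note KG0 = L2_bounded_onD(3)[OF forcing_bounded]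
  note bd = interval_bounds[OF s tT]
  have ts: "t \<in> {0..T}" "s \<in> {0..T}" using s st tT by auto
  have wt: "w t \<in> L2" "w s \<in> L2" using ts by (auto intro: w_L2)
  define C where "C = D * (2 * L2_norm (w t)) + D * (2 * L2_norm (w s)) + 2 * ((t - s) * (2 * KG * D))"
  have "(L2_norm (w t))\<^sup>2 - (L2_norm (w s))\<^sup>2 - 2 * Im B = 0"
  proof (rule eq_if_close[where C=C])
    fix \<delta> :: real assume \<delta>: "0 < \<delta>"
    let ?a = "mollifier \<delta> :: 'a \<Rightarrow> complex"
    have a: "symmetric_kernel ?a" and ab: "?a \<in> bumps" using mollifier_symmetric[OF \<delta>] mollifier_bumps[OF \<delta>] by auto
    define P where "P \<tau> = pairing (velocity ?a \<tau>) (\<lambda>x. cnj (smear ?a (w \<tau>) x))" for \<tau>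
    define R where "R \<tau> = pairing (smear ?a (G \<tau>)) (\<lambda>x. cnj (smear ?a (w \<tau>) x))" for \<tau>
    define b where "b \<tau> = pairing (G \<tau>) (\<lambda>x. cnj (w \<tau> x))" for \<tau>
    obtain Q where "L2_bounded_on {0..T} (velocity ?a) Q" using velocity_bounded[OF ab] by blast
    then have Q: "L2_bounded_on {s..t} (velocity ?a) Q" by (rule L2_bounded_on_mono) (use s tT in auto)
    note sw = smear_L2_bounded_on[OF ab bd(1)] and sG = smear_L2_bounded_on[OF ab bd(2)]
    have iP: "set_integrable lborel {s..t} P" unfolding P_def by (rule pairing_cnj_set_integrable(1)[OF Q sw])
    have iR: "set_integrable lborel {s..t} R" unfolding R_def by (rule pairing_cnj_set_integrable(1)[OF sG sw])
    have ib: "set_integrable lborel {s..t} b" unfolding b_def by (rule pairing_cnj_set_integrable(1)[OF bd(2) bd(1)])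
    have PR: "Re (LINT \<tau>:{s..t}|lborel. P \<tau>) = Im (LINT \<tau>:{s..t}|lborel. R \<tau>)"
    proof -
      have "(LINT \<tau>:{s..t}|lborel. Re (P \<tau>)) = (LINT \<tau>:{s..t}|lborel. Im (R \<tau>))"
        unfolding set_lebesgue_integral_def
      proof (rule integral_cong_AE)
        show "(\<lambda>\<tau>. indicator {s..t} \<tau> *\<^sub>R Re (P \<tau>)) \<in> borel_measurable lborel"
          using borel_measurable_integrable[OF integrable_Re[OF iP[unfolded set_integrable_def]]] by simp
        show "(\<lambda>\<tau>. indicator {s..t} \<tau> *\<^sub>R Im (R \<tau>)) \<in> borel_measurable lborel"
          using borel_measurable_integrable[OF integrable_Im[OF iR[unfolded set_integrable_def]]] by simp
        show "AE \<tau> in lborel. indicator {s..t} \<tau> *\<^sub>R Re (P \<tau>) = indicator {s..t} \<tau> *\<^sub>R Im (R \<tau>)"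
          using AE_velocity_pairing[OF a] by eventually_elim (use s tT in \<open>auto simp: P_def R_def indicator_def\<close>)
      qed
      then show ?thesis unfolding set_integral_Re_Im(1)[OF iP] set_integral_Re_Im(2)[OF iR] .
    qed
    have "cmod (LINT \<tau>:{s..t}|lborel. R \<tau> - b \<tau>) \<le> (t - s) * (\<delta> * (2 * KG * D))"
    proof (rule set_integral_bound[OF set_integral_diff(1)[OF iR ib] _ st])
      show "AE \<tau> in lborel. \<tau> \<in> {s..t} \<longrightarrow> cmod (R \<tau> - b \<tau>) \<le> \<delta> * (2 * KG * D)"
        using L2_bounded_onD(4)[OF bd(2)]
        by eventually_elim (use pairing_smear_close[OF \<delta>] s tT in \<open>auto simp: R_def b_def D_def\<close>)
    qed
    then have RB: "\<bar>Im (LINT \<tau>:{s..t}|lborel. R \<tau>) - Im B\<bar> \<le> (t - s) * (\<delta> * (2 * KG * D))"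
      using set_integral_diff(2)[OF iR ib] abs_Im_le_cmod[of "LINT \<tau>:{s..t}|lborel. R \<tau> - b \<tau>"]
      by (simp add: B_def b_def)
    have E: "(L2_norm (smear ?a (w t)))\<^sup>2 - (L2_norm (smear ?a (w s)))\<^sup>2 = 2 * Im (LINT \<tau>:{s..t}|lborel. R \<tau>)"
      using mollified_energy[OF a s st tT] PR by (simp add: P_def)
    have near: "\<bar>(L2_norm (smear ?a (w r)))\<^sup>2 - (L2_norm (w r))\<^sup>2\<bar> \<le> \<delta> * (D * (2 * L2_norm (w r)))" if r: "r \<in> {0..T}" for r
    proof -
      have wr: "w r \<in> L2" using r by (auto intro: w_L2)
      note m = smear_mollifier_bound[OF \<delta> wr]
      have "\<bar>(L2_norm (smear ?a (w r)))\<^sup>2 - (L2_norm (w r))\<^sup>2\<bar> \<le> L2_norm (\<lambda>x. smear ?a (w r) x - w r x) * (2 * L2_norm (w r))"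
        by (rule L2_norm_square_diff_le[OF m(1) wr m(2)])
      also have "\<dots> \<le> (real DIM('a) * \<delta> * M) * (2 * L2_norm (w r))"
        by (intro mult_right_mono smear_w_close[OF \<delta> r]) simp
      finally show ?thesis by (simp add: D_def algebra_simps)
    qed
    have "\<delta> * C = \<delta> * (D * (2 * L2_norm (w t))) + \<delta> * (D * (2 * L2_norm (w s))) + 2 * ((t - s) * (\<delta> * (2 * KG * D)))"
      by (simp add: C_def algebra_simps)
    then show "norm ((L2_norm (w t))\<^sup>2 - (L2_norm (w s))\<^sup>2 - 2 * Im B) \<le> \<delta> * C"
      using near[OF ts(1)] near[OF ts(2)] RB E unfolding real_norm_def by linarith
  qed
  then show ?thesis by (simp add: B_def)
qed

text \<open>If the Laplacian of \<open>w\<close> is bounded in \<open>L2\<close>, so is the mollified velocity, uniformly in the mollification.\<close>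

lemma time_Lipschitz:
  assumes lap: "AE \<tau> in lborel. \<tau> \<in> {0..T} \<longrightarrow> (\<exists>g. has_laplacian (w \<tau>) g \<and> L2_norm g \<le> KL)" and KL: "0 \<le> KL"
    and s: "0 \<le> s" and st: "s \<le> t" and tT: "t \<le> T"
  shows "L2_norm (\<lambda>x. w t x - w s x) \<le> (t - s) * (KL + KG)"
proof (rule le_if_close[where C="2 * (real DIM('a) * M)"])
  fix \<delta> :: real assume \<delta>: "0 < \<delta>"
  let ?a = "mollifier \<delta> :: 'a \<Rightarrow> complex"
  have ab: "?a \<in> bumps" using mollifier_bumps[OF \<delta>] by auto
  note KG0 = L2_bounded_onD(3)[OF forcing_bounded]
  have Q: "L2_bounded_on {0..T} (velocity ?a) (KL + KG)"
    unfolding L2_bounded_on_def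
  proof (intro conjI velocity_measurable ab)
    show "0 \<le> KL + KG" using KL KG0 by simp
    show "AE \<tau> in lborel. \<tau> \<in> {0..T} \<longrightarrow> velocity ?a \<tau> \<in> L2 \<and> L2_norm (velocity ?a \<tau>) \<le> KL + KG"
      using lap L2_bounded_onD(4)[OF forcing_bounded]
    proof eventually_elim
      fix \<tau> assume *: "\<tau> \<in> {0..T} \<longrightarrow> (\<exists>g. has_laplacian (w \<tau>) g \<and> L2_norm g \<le> KL)"
        "\<tau> \<in> {0..T} \<longrightarrow> G \<tau> \<in> L2 \<and> L2_norm (G \<tau>) \<le> KG"
      show "\<tau> \<in> {0..T} \<longrightarrow> velocity ?a \<tau> \<in> L2 \<and> L2_norm (velocity ?a \<tau>) \<le> KL + KG"
      proof
        assume "\<tau> \<in> {0..T}"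
        with * obtain g where g: "has_laplacian (w \<tau>) g" "L2_norm g \<le> KL" and G: "G \<tau> \<in> L2" "L2_norm (G \<tau>) \<le> KG" by blast
        have g2: "g \<in> L2" using g(1) by (simp add: has_laplacian_def)
        note 1 = smear_mollifier_bound[OF \<delta> g2] and 2 = smear_mollifier_bound[OF \<delta> G(1)]
        have "velocity ?a \<tau> = (\<lambda>x. \<i> * smear ?a g x - \<i> * smear ?a (G \<tau>) x)"
          by (simp add: velocity_def fun_eq_iff smear_laplacian[OF g(1) ab])
        then show "velocity ?a \<tau> \<in> L2 \<and> L2_norm (velocity ?a \<tau>) \<le> KL + KG"
          using L2_diff[OF L2_scale[OF 1(1), of \<i>] L2_scale[OF 2(1), of \<i>]]
            L2_norm_triangle_diff[OF L2_scale[OF 1(1), of \<i>] L2_scale[OF 2(1), of \<i>]] 1(2) 2(2) g(2) G(2)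
          by (simp add: L2_norm_scale)
      qed
    qed
  qed
  have ts: "t \<in> {0..T}" "s \<in> {0..T}" using s st tT by auto
  have wt: "w t \<in> L2" "w s \<in> L2" using ts by (auto intro: w_L2)
  note mt = smear_mollifier_bound(1)[OF \<delta> wt(1)] and ms = smear_mollifier_bound(1)[OF \<delta> wt(2)]
  have "L2_norm (\<lambda>x. w t x - w s x) \<le> L2_norm (\<lambda>x. w t x - smear ?a (w t) x) + L2_norm (\<lambda>x. smear ?a (w t) x - w s x)"
    by (rule L2_norm_diff_triangle[OF wt(1) mt wt(2)])
  also have "L2_norm (\<lambda>x. smear ?a (w t) x - w s x) \<le> L2_norm (\<lambda>x. smear ?a (w t) x - smear ?a (w s) x) + L2_norm (\<lambda>x. smear ?a (w s) x - w s x)"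
    by (rule L2_norm_diff_triangle[OF mt ms wt(2)])
  finally show "L2_norm (\<lambda>x. w t x - w s x) \<le> (t - s) * (KL + KG) + \<delta> * (2 * (real DIM('a) * M))"
    using smear_increment_bound(1)[OF ab Q s st tT] smear_w_close[OF \<delta> ts(1)] smear_w_close[OF \<delta> ts(2)]
    by (simp add: L2_norm_minus_commute[of "w t"] algebra_simps)
qed

text \<open>The equation may be tested with functions whose Laplacian is in \<open>L2\<close>. Since \<open>w\<close> need not have
  weak derivatives depending measurably on time, the Laplacian is moved to the test function, through the mollifier.\<close>

lemma pairing_identity:
  assumes \<Phi>: "translation_Lipschitz \<Phi> M'" and lap: "has_laplacian \<Phi> g"
    and s: "0 \<le> s" and st: "s \<le> t" and tT: "t \<le> T"
  shows "set_integrable lborel {s..t} (\<lambda>\<tau>. \<i> * pairing (w \<tau>) (\<lambda>x. cnj (g x)) - \<i> * pairing (G \<tau>) (\<lambda>x. cnj (\<Phi> x)))"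
    "pairing (w t) (\<lambda>x. cnj (\<Phi> x)) - pairing (w s) (\<lambda>x. cnj (\<Phi> x))
      = (LINT \<tau>:{s..t}|lborel. \<i> * pairing (w \<tau>) (\<lambda>x. cnj (g x)) - \<i> * pairing (G \<tau>) (\<lambda>x. cnj (\<Phi> x)))"
proof -
  have \<Phi>2: "\<Phi> \<in> L2" and g2: "g \<in> L2" using lap by (auto simp: has_laplacian_def)
  have c\<Phi>: "(\<lambda>x. cnj (\<Phi> x)) \<in> L2" and cg: "(\<lambda>x. cnj (g x)) \<in> L2" by (intro L2_cnj \<Phi>2 g2)+
  note bd = interval_bounds[OF s tT]
  note KG0 = L2_bounded_onD(3)[OF forcing_bounded]
  define F where "F \<tau> = \<i> * pairing (w \<tau>) (\<lambda>x. cnj (g x)) - \<i> * pairing (G \<tau>) (\<lambda>x. cnj (\<Phi> x))" for \<tau>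
  show iF: "set_integrable lborel {s..t} F"
    unfolding F_def using pairing_set_integrable[OF bd(1) st cg] pairing_set_integrable[OF bd(2) st c\<Phi>]
    by (intro set_integral_diff(1) set_integrable_mult_right) auto
  define D where "D = real DIM('a) * M" define D' where "D' = real DIM('a) * M'"
  define C where "C = 2 * D * L2_norm \<Phi> + (t - s) * (D * L2_norm g + KG * D')"
  have ts: "t \<in> {0..T}" "s \<in> {0..T}" using s st tT by auto
  have wt: "w t \<in> L2" "w s \<in> L2" using ts by (auto intro: w_L2)
  have "pairing (w t) (\<lambda>x. cnj (\<Phi> x)) - pairing (w s) (\<lambda>x. cnj (\<Phi> x)) - (LINT \<tau>:{s..t}|lborel. F \<tau>) = 0"
  proof (rule eq_if_close[where C=C])
    fix \<delta> :: real assume \<delta>: "0 < \<delta>"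
    let ?a = "mollifier \<delta> :: 'a \<Rightarrow> complex"
    have a: "symmetric_kernel ?a" and ab: "?a \<in> bumps" using mollifier_symmetric[OF \<delta>] mollifier_bumps[OF \<delta>] by auto
    obtain Q where Q: "L2_bounded_on {0..T} (velocity ?a) Q" using velocity_bounded[OF ab] by blast
    note I = smear_increment_bound(2,3)[OF ab Q s st tT c\<Phi>]
    note mt = smear_mollifier_bound(1)[OF \<delta> wt(1)] and ms = smear_mollifier_bound(1)[OF \<delta> wt(2)]
    have near: "cmod (pairing (smear ?a (w r)) (\<lambda>x. cnj (\<Phi> x)) - pairing (w r) (\<lambda>x. cnj (\<Phi> x))) \<le> (real DIM('a) * \<delta> * M) * L2_norm \<Phi>"
      if r: "r \<in> {0..T}" for r
    proof -
      have wr: "w r \<in> L2" using r by (auto intro: w_L2)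
      note m = smear_mollifier_bound(1)[OF \<delta> wr]
      have "cmod (pairing (\<lambda>x. smear ?a (w r) x - w r x) (\<lambda>x. cnj (\<Phi> x))) \<le> L2_norm (\<lambda>x. smear ?a (w r) x - w r x) * L2_norm \<Phi>"
        using pairing_Cauchy_Schwarz[OF L2_diff[OF m wr] c\<Phi>] by simp
      also have "\<dots> \<le> (real DIM('a) * \<delta> * M) * L2_norm \<Phi>"
        by (intro mult_right_mono smear_w_close[OF \<delta> r]) simp
      finally show ?thesis by (simp add: pairing_diff_left m wr c\<Phi>)
    qed
    have "cmod (LINT \<tau>:{s..t}|lborel. pairing (velocity ?a \<tau>) (\<lambda>x. cnj (\<Phi> x)) - F \<tau>) \<le> (t - s) * (\<delta> * (D * L2_norm g + KG * D'))"
    proof (rule set_integral_bound[OF set_integral_diff(1)[OF I(1) iF] _ st])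
      show "AE \<tau> in lborel. \<tau> \<in> {s..t} \<longrightarrow> cmod (pairing (velocity ?a \<tau>) (\<lambda>x. cnj (\<Phi> x)) - F \<tau>) \<le> \<delta> * (D * L2_norm g + KG * D')"
        using L2_bounded_onD(4)[OF bd(2)]
      proof (eventually_elim, intro impI)
        fix \<tau> assume *: "\<tau> \<in> {s..t} \<longrightarrow> G \<tau> \<in> L2 \<and> L2_norm (G \<tau>) \<le> KG" and \<tau>: "\<tau> \<in> {s..t}"
        then have G: "G \<tau> \<in> L2" "L2_norm (G \<tau>) \<le> KG" and t0: "\<tau> \<in> {0..T}" using s tT by auto
        have w: "w \<tau> \<in> L2" using t0 by (intro w_L2) simp
        note m = smear_mollifier_bound(1)[OF \<delta> w] smear_mollifier_bound(1)[OF \<delta> G(1)] smear_Minkowski(1)[OF laplacian_bumps[OF ab] w]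
          smear_mollifier_bound(1)[OF \<delta> g2] smear_mollifier_bound(1)[OF \<delta> \<Phi>2]
        have "pairing (smear (laplacian ?a) (w \<tau>)) (\<lambda>x. cnj (\<Phi> x)) = pairing (w \<tau>) (\<lambda>x. cnj (smear (laplacian ?a) \<Phi> x))"
          unfolding smear_adjoint[OF laplacian_symmetric_kernel[OF a] w c\<Phi>] cnj_smear[OF laplacian_symmetric_kernel[OF a]] ..
        also have "\<dots> = pairing (w \<tau>) (smear ?a (\<lambda>x. cnj (g x)))"
          unfolding smear_laplacian[OF lap ab] cnj_smear[OF a] ..
        also have "\<dots> = pairing (smear ?a (w \<tau>)) (\<lambda>x. cnj (g x))"
          by (rule smear_adjoint[OF a w cg, symmetric])
        finally have e1: "pairing (smear (laplacian ?a) (w \<tau>)) (\<lambda>x. cnj (\<Phi> x)) = pairing (smear ?a (w \<tau>)) (\<lambda>x. cnj (g x))" .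
        have e2: "pairing (smear ?a (G \<tau>)) (\<lambda>x. cnj (\<Phi> x)) = pairing (G \<tau>) (\<lambda>x. cnj (smear ?a \<Phi> x))"
          unfolding smear_adjoint[OF a G(1) c\<Phi>] cnj_smear[OF a] ..
        have cs: "(\<lambda>x. cnj (smear ?a \<Phi> x)) \<in> L2" by (intro L2_cnj m)
        have "pairing (velocity ?a \<tau>) (\<lambda>x. cnj (\<Phi> x)) = \<i> * pairing (smear (laplacian ?a) (w \<tau>)) (\<lambda>x. cnj (\<Phi> x)) - \<i> * pairing (smear ?a (G \<tau>)) (\<lambda>x. cnj (\<Phi> x))"
          unfolding velocity_def[abs_def] using m c\<Phi> by (subst pairing_diff_left) (auto simp: pairing_scale_left)
        then have "pairing (velocity ?a \<tau>) (\<lambda>x. cnj (\<Phi> x)) - F \<tau> =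
           \<i> * pairing (\<lambda>x. smear ?a (w \<tau>) x - w \<tau> x) (\<lambda>x. cnj (g x)) - \<i> * pairing (G \<tau>) (\<lambda>x. cnj (smear ?a \<Phi> x - \<Phi> x))"
          unfolding e1 e2 F_def complex_cnj_diff using m w G cg c\<Phi> cs
          by (simp add: pairing_diff_left pairing_diff_right algebra_simps)
        then have "cmod (pairing (velocity ?a \<tau>) (\<lambda>x. cnj (\<Phi> x)) - F \<tau>) \<le>
           cmod (pairing (\<lambda>x. smear ?a (w \<tau>) x - w \<tau> x) (\<lambda>x. cnj (g x))) + cmod (pairing (G \<tau>) (\<lambda>x. cnj (smear ?a \<Phi> x - \<Phi> x)))"
          using norm_triangle_ineq4[of "\<i> * pairing (\<lambda>x. smear ?a (w \<tau>) x - w \<tau> x) (\<lambda>x. cnj (g x))" "\<i> * pairing (G \<tau>) (\<lambda>x. cnj (smear ?a \<Phi> x - \<Phi> x))"]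
          by (simp add: norm_mult)
        also have "\<dots> \<le> L2_norm (\<lambda>x. smear ?a (w \<tau>) x - w \<tau> x) * L2_norm g + L2_norm (G \<tau>) * L2_norm (\<lambda>x. smear ?a \<Phi> x - \<Phi> x)"
          using pairing_Cauchy_Schwarz[OF L2_diff[OF m(1) w] cg] pairing_Cauchy_Schwarz[OF G(1) L2_cnj[OF L2_diff[OF m(5) \<Phi>2]]]
          by (simp only: L2_norm_cnj add_mono)
        also have "\<dots> \<le> (real DIM('a) * \<delta> * M) * L2_norm g + KG * (real DIM('a) * \<delta> * M')"
          by (intro add_mono mult_mono smear_w_close[OF \<delta> t0] smear_mollifier_close[OF \<delta> \<Phi>] G(2) KG0)
             (use M_nonneg \<delta> in auto)
        finally show "cmod (pairing (velocity ?a \<tau>) (\<lambda>x. cnj (\<Phi> x)) - F \<tau>) \<le> \<delta> * (D * L2_norm g + KG * D')"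
          by (simp add: D_def D'_def algebra_simps)
      qed
    qed
    then have 1: "cmod (pairing (\<lambda>x. smear ?a (w t) x - smear ?a (w s) x) (\<lambda>x. cnj (\<Phi> x)) - (LINT \<tau>:{s..t}|lborel. F \<tau>)) \<le> (t - s) * (\<delta> * (D * L2_norm g + KG * D'))"
      unfolding I(2) set_integral_diff(2)[OF I(1) iF] .
    define p where "p r = pairing (smear ?a (w r)) (\<lambda>x. cnj (\<Phi> x))" for r
    define q where "q r = pairing (w r) (\<lambda>x. cnj (\<Phi> x))" for r
    have 2: "cmod ((p t - p s) - (LINT \<tau>:{s..t}|lborel. F \<tau>)) \<le> (t - s) * (\<delta> * (D * L2_norm g + KG * D'))"
      using 1 by (simp add: p_def pairing_diff_left mt ms c\<Phi>)
    have "q t - q s - (LINT \<tau>:{s..t}|lborel. F \<tau>) = ((p t - p s) - (LINT \<tau>:{s..t}|lborel. F \<tau>)) - (p t - q t) + (p s - q s)"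
      by simp
    then have "cmod (q t - q s - (LINT \<tau>:{s..t}|lborel. F \<tau>)) \<le> cmod ((p t - p s) - (LINT \<tau>:{s..t}|lborel. F \<tau>)) + cmod (p t - q t) + cmod (p s - q s)"
      by (metis norm_triangle_ineq norm_triangle_ineq4 add_right_mono order_trans)
    also have "\<dots> \<le> (t - s) * (\<delta> * (D * L2_norm g + KG * D')) + (real DIM('a) * \<delta> * M) * L2_norm \<Phi> + (real DIM('a) * \<delta> * M) * L2_norm \<Phi>"
      using 2 near[OF ts(1)] near[OF ts(2)] by (intro add_mono) (auto simp: p_def q_def)
    also have "\<dots> = \<delta> * C" by (simp add: C_def D_def algebra_simps)
    finally show "norm (pairing (w t) (\<lambda>x. cnj (\<Phi> x)) - pairing (w s) (\<lambda>x. cnj (\<Phi> x)) - (LINT \<tau>:{s..t}|lborel. F \<tau>)) \<le> \<delta> * C"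
      by (simp add: q_def)
  qed
  then show "pairing (w t) (\<lambda>x. cnj (\<Phi> x)) - pairing (w s) (\<lambda>x. cnj (\<Phi> x))
      = (LINT \<tau>:{s..t}|lborel. \<i> * pairing (w \<tau>) (\<lambda>x. cnj (g x)) - \<i> * pairing (G \<tau>) (\<lambda>x. cnj (\<Phi> x)))"
    by (simp add: F_def)
qed

end

section \<open>Pointwise estimates for the nonlinearity\<close>

lemma log_nonlin_eq: "log_nonlin lam = reg_log_nonlin lam 0"
  by (simp add: log_nonlin_def reg_log_nonlin_def fun_eq_iff)

lemma reg_log_nonlin_measurable [measurable]: "reg_log_nonlin lam \<epsilon> \<in> borel_measurable borel"
  unfolding reg_log_nonlin_def by measurable

lemma ln_square_pos: "0 < y \<Longrightarrow> ln (y\<^sup>2) = 2 * ln (y::real)"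
  by (simp add: ln_realpow)

lemma ln_ratio_bound:
  fixes \<epsilon> a b :: real
  assumes "0 < \<epsilon>" "0 \<le> a" "a \<le> b"
  shows "0 \<le> ln (\<epsilon> + b) - ln (\<epsilon> + a)" "a * (ln (\<epsilon> + b) - ln (\<epsilon> + a)) \<le> b - a"
proof -
  have pos: "0 < \<epsilon> + a" using assms by simp
  show 1: "0 \<le> ln (\<epsilon> + b) - ln (\<epsilon> + a)" using assms by simp
  have "ln (\<epsilon> + b) - ln (\<epsilon> + a) \<le> (\<epsilon> + b - (\<epsilon> + a)) / (\<epsilon> + a)"
    by (rule ln_diff_le) (use assms in auto)
  then have "ln (\<epsilon> + b) - ln (\<epsilon> + a) \<le> (b - a) / (\<epsilon> + a)" by simp
  then have "a * (ln (\<epsilon> + b) - ln (\<epsilon> + a)) \<le> a * ((b - a) / (\<epsilon> + a))"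
    using assms by (intro mult_left_mono) auto
  also have "\<dots> = (a / (\<epsilon> + a)) * (b - a)" by simp
  also have "\<dots> \<le> 1 * (b - a)" using assms pos by (intro mult_right_mono) auto
  finally show "a * (ln (\<epsilon> + b) - ln (\<epsilon> + a)) \<le> b - a" by simp
qed

text \<open>The regularised nonlinearity is one-sided Lipschitz with a constant that does not depend on \<open>\<epsilon>\<close>,
  because only the difference of two logarithms survives in the imaginary part.\<close>

lemma reg_log_nonlin_Im:
  assumes \<epsilon>: "0 < \<epsilon>"
  shows "\<bar>Im ((reg_log_nonlin lam \<epsilon> z - reg_log_nonlin lam \<epsilon> y) * cnj (z - y))\<bar> \<le> 2 * \<bar>lam\<bar> * (cmod (z - y))\<^sup>2"
proof -
  define A where "A = ln (\<epsilon> + cmod z)" define B where "B = ln (\<epsilon> + cmod y)"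
  have pos: "0 < \<epsilon> + cmod z" "0 < \<epsilon> + cmod y" using \<epsilon> by (auto intro: add_pos_nonneg)
  have eq: "(reg_log_nonlin lam \<epsilon> z - reg_log_nonlin lam \<epsilon> y) * cnj (z - y) =
     of_real (2 * lam) * (of_real A * (z * cnj z) + of_real B * (y * cnj y) - of_real A * (z * cnj y) - of_real B * (y * cnj z))"
    using pos by (simp add: reg_log_nonlin_def A_def B_def ln_square_pos algebra_simps)
  have im: "Im ((reg_log_nonlin lam \<epsilon> z - reg_log_nonlin lam \<epsilon> y) * cnj (z - y)) = 2 * lam * ((B - A) * Im (z * cnj y))"
    unfolding eq by (simp add: algebra_simps)
  have i1: "\<bar>Im (z * cnj y)\<bar> \<le> cmod (z - y) * cmod y"
  proof -
    have "Im (z * cnj y) = Im ((z - y) * cnj y)" by (simp add: algebra_simps)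
    then show ?thesis using abs_Im_le_cmod[of "(z - y) * cnj y"] by (simp add: norm_mult)
  qed
  have i2: "\<bar>Im (z * cnj y)\<bar> \<le> cmod (z - y) * cmod z"
  proof -
    have "Im (z * cnj y) = - Im (z * cnj (z - y))" by (simp add: algebra_simps)
    then have "\<bar>Im (z * cnj y)\<bar> = \<bar>Im (z * cnj (z - y))\<bar>" by (simp only: abs_minus_cancel)
    also have "\<dots> \<le> cmod (z * cnj (z - y))" by (rule abs_Im_le_cmod)
    finally show ?thesis by (simp only: norm_mult complex_mod_cnj mult.commute)
  qed
  have tri: "\<bar>cmod z - cmod y\<bar> \<le> cmod (z - y)" by (rule norm_triangle_ineq3)
  have "\<bar>B - A\<bar> * \<bar>Im (z * cnj y)\<bar> \<le> (cmod (z - y))\<^sup>2"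
  proof (cases "cmod y \<le> cmod z")
    case True
    note L = ln_ratio_bound[OF \<epsilon> norm_ge_zero True, folded A_def B_def]
    have "\<bar>B - A\<bar> * \<bar>Im (z * cnj y)\<bar> \<le> (A - B) * (cmod (z - y) * cmod y)"
      using L(1) i1 by (intro mult_mono) auto
    also have "\<dots> = cmod (z - y) * (cmod y * (A - B))" by simp
    also have "\<dots> \<le> cmod (z - y) * cmod (z - y)" using L(2) tri True by (intro mult_left_mono) auto
    finally show ?thesis by (simp add: power2_eq_square)
  next
    case False
    then have le: "cmod z \<le> cmod y" by simp
    note L = ln_ratio_bound[OF \<epsilon> norm_ge_zero le, folded A_def B_def]
    have "\<bar>B - A\<bar> * \<bar>Im (z * cnj y)\<bar> \<le> (B - A) * (cmod (z - y) * cmod z)"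
      using L(1) i2 by (intro mult_mono) auto
    also have "\<dots> = cmod (z - y) * (cmod z * (B - A))" by simp
    also have "\<dots> \<le> cmod (z - y) * cmod (z - y)" using L(2) tri le by (intro mult_left_mono) auto
    finally show ?thesis by (simp add: power2_eq_square)
  qed
  then have "2 * \<bar>lam\<bar> * (\<bar>B - A\<bar> * \<bar>Im (z * cnj y)\<bar>) \<le> 2 * \<bar>lam\<bar> * (cmod (z - y))\<^sup>2"
    by (intro mult_left_mono) auto
  then show ?thesis unfolding im by (simp add: abs_mult)
qed

lemma ln_1_plus_le_sqrt:
  fixes y :: real assumes "0 \<le> y" shows "ln (1 + y) \<le> 2 * sqrt y"
proof -
  have "1 + y \<le> (1 + sqrt y)\<^sup>2" using assms by (simp add: power2_sum)
  then have "ln (1 + y) \<le> ln ((1 + sqrt y)\<^sup>2)" using assms by (intro ln_mono) auto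
  also have "\<dots> = 2 * ln (1 + sqrt y)" using assms by (intro ln_square_pos) (auto intro: add_pos_nonneg)
  also have "\<dots> \<le> 2 * sqrt y" using assms ln_add_one_self_le_self[of "sqrt y"] by simp
  finally show ?thesis .
qed

text \<open>The error is \<open>2 * lam * z * ln (1 + \<epsilon> / cmod z)\<close>, and \<open>ln (1 + y)\<close> is at most \<open>y\<close> and at most \<open>2 * sqrt y\<close>. The
  second bound makes the error square integrable on the whole space as soon as \<open>z\<close> is integrable.\<close>

lemma regularisation_error:
  assumes \<epsilon>: "0 < \<epsilon>"
  shows "cmod (reg_log_nonlin lam \<epsilon> z - reg_log_nonlin lam 0 z) \<le> 2 * \<bar>lam\<bar> * \<epsilon>"
    "cmod (reg_log_nonlin lam \<epsilon> z - reg_log_nonlin lam 0 z) \<le> 4 * \<bar>lam\<bar> * sqrt (\<epsilon> * cmod z)"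
proof -
  have "cmod (reg_log_nonlin lam \<epsilon> z - reg_log_nonlin lam 0 z) \<le> 2 * \<bar>lam\<bar> * \<epsilon> \<and>
    cmod (reg_log_nonlin lam \<epsilon> z - reg_log_nonlin lam 0 z) \<le> 4 * \<bar>lam\<bar> * sqrt (\<epsilon> * cmod z)"
  proof (cases "z = 0")
    case True
    then show ?thesis using \<epsilon> by (simp add: reg_log_nonlin_def)
  next
    case False
    define r where "r = cmod z"
    have r: "0 < r" using False by (simp add: r_def)
    have l: "ln (\<epsilon> + r) - ln r = ln (1 + \<epsilon> / r)"
    proof -
      have "1 + \<epsilon> / r = (\<epsilon> + r) / r" using r by (simp add: field_simps)
      then show ?thesis using r \<epsilon> by (simp add: ln_div)
    qed
    have "reg_log_nonlin lam \<epsilon> z - reg_log_nonlin lam 0 z = of_real (2 * lam * ln (1 + \<epsilon> / r)) * z"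
      using r \<epsilon> unfolding l[symmetric] by (simp add: reg_log_nonlin_def r_def[symmetric] ln_square_pos algebra_simps)
    then have c: "cmod (reg_log_nonlin lam \<epsilon> z - reg_log_nonlin lam 0 z) = 2 * \<bar>lam\<bar> * (r * ln (1 + \<epsilon> / r))"
      using r \<epsilon> by (simp add: norm_mult r_def[symmetric] abs_mult)
    have a: "r * ln (1 + \<epsilon> / r) \<le> r * (\<epsilon> / r)"
      using r \<epsilon> by (intro mult_left_mono ln_add_one_self_le_self) auto
    have "r * ln (1 + \<epsilon> / r) \<le> r * (2 * sqrt (\<epsilon> / r))"
      using r \<epsilon> by (intro mult_left_mono ln_1_plus_le_sqrt) auto
    also have "\<dots> = 2 * sqrt (\<epsilon> * r)"
      using r \<epsilon> by (simp add: real_sqrt_divide real_sqrt_mult real_div_sqrt field_simps)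
    finally have b: "r * ln (1 + \<epsilon> / r) \<le> 2 * sqrt (\<epsilon> * r)" .
    have "2 * \<bar>lam\<bar> * (r * ln (1 + \<epsilon> / r)) \<le> 2 * \<bar>lam\<bar> * \<epsilon>" using a r by (intro mult_left_mono) auto
    moreover have "2 * \<bar>lam\<bar> * (r * ln (1 + \<epsilon> / r)) \<le> 2 * \<bar>lam\<bar> * (2 * sqrt (\<epsilon> * r))" using b by (intro mult_left_mono) auto
    ultimately show ?thesis unfolding c by (simp add: r_def)
  qed
  then show "cmod (reg_log_nonlin lam \<epsilon> z - reg_log_nonlin lam 0 z) \<le> 2 * \<bar>lam\<bar> * \<epsilon>"
    "cmod (reg_log_nonlin lam \<epsilon> z - reg_log_nonlin lam 0 z) \<le> 4 * \<bar>lam\<bar> * sqrt (\<epsilon> * cmod z)" by auto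
qed

text \<open>Up to constants this is \<open>cmod z * ln (cmod z)\<close> for large \<open>z\<close>, but it is quadratic near zero, so it maps into \<open>L2\<close> without any decay
  assumption. The factor two absorbs sums: \<open>1 + (r + s)\<close> is at most \<open>1 + 2 * max r s\<close>.\<close>

definition times_log :: "complex \<Rightarrow> real" where
  "times_log z = cmod z * ln (1 + 2 * cmod z)"

lemma times_log_nonneg: "0 \<le> times_log z"
  by (simp add: times_log_def)

lemma times_log_measurable [measurable]: "times_log \<in> borel_measurable borel"
  unfolding times_log_def by measurable

text \<open>Large values of \<open>z\<close> are covered by the first term; for small ones \<open>r * \<bar>ln r\<bar>\<close> is at most \<open>2 * sqrt r\<close>.\<close>

lemma reg_log_nonlin_bound:
  assumes \<epsilon>: "0 \<le> \<epsilon>"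
  shows "cmod (reg_log_nonlin lam \<epsilon> z) \<le> 2 * \<bar>lam\<bar> * times_log z + 4 * \<bar>lam\<bar> * (1 + sqrt \<epsilon>) * sqrt (cmod z)"
proof -
  have 0: "cmod (reg_log_nonlin lam 0 z) \<le> 2 * \<bar>lam\<bar> * times_log z + 4 * \<bar>lam\<bar> * sqrt (cmod z)"
  proof (cases "z = 0")
    case True
    then show ?thesis by (simp add: reg_log_nonlin_def times_log_def)
  next
    case False
    define r where "r = cmod z"
    have r: "0 < r" using False by (simp add: r_def)
    have "r * \<bar>ln r\<bar> \<le> r * ln (1 + 2 * r) + 2 * sqrt r"
    proof (cases "1 \<le> r")
      case True
      then have "r * \<bar>ln r\<bar> \<le> r * ln (1 + 2 * r)" using r by (intro mult_left_mono) auto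
      then show ?thesis using r by (simp add: add_increasing2)
    next
      case False
      have "- ln r = 2 * ln (1 / sqrt r)" using r by (simp add: ln_div ln_sqrt)
      also have "\<dots> \<le> 2 * (1 / sqrt r)" using r ln_le_minus_one[of "1 / sqrt r"] by simp
      finally have "r * (- ln r) \<le> r * (2 * (1 / sqrt r))" using r by (intro mult_left_mono) auto
      also have "\<dots> = 2 * (r / sqrt r)" by simp
      also have "\<dots> = 2 * sqrt r" using r by (simp only: real_div_sqrt less_imp_le)
      finally show ?thesis using False r by (simp add: add_increasing)
    qed
    then have "2 * \<bar>lam\<bar> * (r * \<bar>ln r\<bar>) \<le> 2 * \<bar>lam\<bar> * (r * ln (1 + 2 * r) + 2 * sqrt r)" by (intro mult_left_mono) auto
    moreover have "cmod (reg_log_nonlin lam 0 z) = 2 * \<bar>lam\<bar> * (r * \<bar>ln r\<bar>)"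
      using r by (simp add: reg_log_nonlin_def norm_mult r_def[symmetric] ln_square_pos abs_mult)
    ultimately show ?thesis by (simp add: times_log_def r_def[symmetric] algebra_simps)
  qed
  show ?thesis
  proof (cases "\<epsilon> = 0")
    case True
    then show ?thesis using 0 by simp
  next
    case False
    then have "cmod (reg_log_nonlin lam \<epsilon> z - reg_log_nonlin lam 0 z) \<le> 4 * \<bar>lam\<bar> * sqrt (\<epsilon> * cmod z)"
      using \<epsilon> by (intro regularisation_error) simp
    then have "cmod (reg_log_nonlin lam \<epsilon> z) \<le> cmod (reg_log_nonlin lam 0 z) + 4 * \<bar>lam\<bar> * sqrt (\<epsilon> * cmod z)"
      using norm_triangle_ineq[of "reg_log_nonlin lam 0 z" "reg_log_nonlin lam \<epsilon> z - reg_log_nonlin lam 0 z"] by simp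
    then show ?thesis using 0 by (simp add: real_sqrt_mult algebra_simps)
  qed
qed

text \<open>The logarithm of \<open>\<epsilon> + m\<close>, for \<open>m\<close> the larger of the two moduli, is at least \<open>ln \<epsilon>\<close> and at most \<open>ln (1 + (cmod y + cmod e))\<close>. The
  difference of the logarithms at the two moduli costs only \<open>cmod e\<close> by concavity.\<close>

lemma reg_log_nonlin_diff:
  assumes \<epsilon>: "0 < \<epsilon>" "\<epsilon> \<le> 1"
  shows "cmod (reg_log_nonlin lam \<epsilon> (y + e) - reg_log_nonlin lam \<epsilon> y)
    \<le> 2 * \<bar>lam\<bar> * ((1 + ln (1 / \<epsilon>)) * cmod e + times_log y + times_log e)"
proof -
  have *: "cmod (reg_log_nonlin lam \<epsilon> z - reg_log_nonlin lam \<epsilon> y) \<le> 2 * \<bar>lam\<bar> * (cmod (z - y) * (1 + \<bar>ln (\<epsilon> + cmod z)\<bar>))"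
    if le: "cmod y \<le> cmod z" for y z
  proof -
    define A where "A = ln (\<epsilon> + cmod z)" define B where "B = ln (\<epsilon> + cmod y)"
    note L = ln_ratio_bound[OF \<epsilon>(1) norm_ge_zero le, folded A_def B_def]
    have pos: "0 < \<epsilon> + cmod z" "0 < \<epsilon> + cmod y" using \<epsilon> by (auto intro: add_pos_nonneg)
    have "reg_log_nonlin lam \<epsilon> z - reg_log_nonlin lam \<epsilon> y = of_real (2 * lam) * ((z - y) * of_real A + y * of_real (A - B))"
      using pos by (simp add: reg_log_nonlin_def A_def B_def ln_square_pos algebra_simps)
    then have eq: "cmod (reg_log_nonlin lam \<epsilon> z - reg_log_nonlin lam \<epsilon> y) = 2 * \<bar>lam\<bar> * cmod ((z - y) * of_real A + y * of_real (A - B))"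
      by (simp only: norm_mult norm_of_real abs_mult abs_numeral)
    have "cmod ((z - y) * of_real A + y * of_real (A - B)) \<le> cmod (z - y) * \<bar>A\<bar> + cmod y * (A - B)"
      using norm_triangle_ineq[of "(z - y) * of_real A" "y * of_real (A - B)"] L(1) by (simp only: norm_mult norm_of_real abs_of_nonneg)
    also have "\<dots> \<le> cmod (z - y) * \<bar>A\<bar> + cmod (z - y)"
      using L(2) norm_triangle_ineq3[of z y] by (intro add_left_mono) linarith
    finally have "2 * \<bar>lam\<bar> * cmod ((z - y) * of_real A + y * of_real (A - B)) \<le> 2 * \<bar>lam\<bar> * (cmod (z - y) * (1 + \<bar>A\<bar>))"
      by (intro mult_left_mono) (simp_all add: algebra_simps)
    then show ?thesis using eq by (simp only: A_def)
  qed
  define m where "m = max (cmod (y + e)) (cmod y)"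
  have d: "cmod (reg_log_nonlin lam \<epsilon> (y + e) - reg_log_nonlin lam \<epsilon> y) \<le> 2 * \<bar>lam\<bar> * (cmod e * (1 + \<bar>ln (\<epsilon> + m)\<bar>))"
  proof (cases "cmod y \<le> cmod (y + e)")
    case True
    then show ?thesis using *[OF True] by (simp add: m_def max_def)
  next
    case False
    then have "cmod (y + e) \<le> cmod y" by simp
    from *[OF this] show ?thesis using False by (simp add: m_def max_def norm_minus_commute)
  qed
  have m: "0 \<le> m" "m \<le> cmod y + cmod e" using norm_triangle_ineq[of y e] by (auto simp: m_def max_def)
  have ln: "\<bar>ln (\<epsilon> + m)\<bar> \<le> ln (1 / \<epsilon>) + ln (1 + (cmod y + cmod e))"
  proof (cases "1 \<le> \<epsilon> + m")
    case True
    have "ln (\<epsilon> + m) \<le> ln (1 + (cmod y + cmod e))" using m \<epsilon> by (intro ln_mono) auto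
    moreover have "0 \<le> ln (1 / \<epsilon>)" using \<epsilon> by simp
    ultimately show ?thesis using True by simp
  next
    case False
    have "- ln (\<epsilon> + m) \<le> - ln \<epsilon>" using m \<epsilon> by simp
    moreover have "ln (\<epsilon> + m) \<le> 0" using False m \<epsilon> by simp
    moreover have "0 \<le> ln (1 + (cmod y + cmod e))" by simp
    moreover have "ln (1 / \<epsilon>) = - ln \<epsilon>" using \<epsilon> by (simp add: ln_div)
    ultimately show ?thesis by linarith
  qed
  have "cmod e * ln (1 + (cmod y + cmod e)) \<le> times_log y + times_log e"
  proof (cases "cmod e \<le> cmod y")
    case True
    have "cmod e * ln (1 + (cmod y + cmod e)) \<le> cmod y * ln (1 + 2 * cmod y)"
      using True by (intro mult_mono ln_mono) (auto intro: add_pos_nonneg)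
    then show ?thesis using times_log_nonneg[of e] unfolding times_log_def by linarith
  next
    case False
    have "cmod e * ln (1 + (cmod y + cmod e)) \<le> cmod e * ln (1 + 2 * cmod e)"
      using False by (intro mult_mono ln_mono) (auto intro: add_pos_nonneg)
    then show ?thesis using times_log_nonneg[of y] unfolding times_log_def by linarith
  qed
  then have "cmod e * (1 + \<bar>ln (\<epsilon> + m)\<bar>) \<le> (1 + ln (1 / \<epsilon>)) * cmod e + times_log y + times_log e"
    using mult_left_mono[OF ln norm_ge_zero[of e]] by (simp add: algebra_simps)
  then have "2 * \<bar>lam\<bar> * (cmod e * (1 + \<bar>ln (\<epsilon> + m)\<bar>)) \<le> 2 * \<bar>lam\<bar> * ((1 + ln (1 / \<epsilon>)) * cmod e + times_log y + times_log e)"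
    by (intro mult_left_mono) auto
  then show ?thesis using d by linarith
qed

section \<open>A logarithmic Sobolev inequality\<close>

text \<open>By the assumption on \<open>\<sigma>\<close> the mollification of \<open>f\<close> is at most \<open>\<sigma> / 2\<close> everywhere. Where \<open>f\<close> exceeds \<open>\<sigma>\<close>, at least half of it is
  therefore mollification error.\<close>

lemma level_set_bound:
  fixes f :: "'a::euclidean_space \<Rightarrow> complex"
  assumes f: "translation_Lipschitz f M" and \<delta>: "0 < \<delta>" and \<sigma>: "0 \<le> \<sigma>"
    and small: "exp (4 * real DIM('a)) / \<delta> ^ DIM('a) * (L2_norm f)\<^sup>2 \<le> (\<sigma> / 2)\<^sup>2"
  shows "(\<integral>\<^sup>+x. ennreal ((cmod (f x))\<^sup>2) * indicator {x. \<sigma> < cmod (f x)} x \<partial>lborel) \<le> ennreal (4 * (real DIM('a) * \<delta> * M)\<^sup>2)"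
proof -
  have f2: "f \<in> L2" using f by (simp add: translation_Lipschitz_def)
  note [measurable] = L2_measurable[OF f2]
  define r where "r x = smear (mollifier \<delta>) f x - f x" for x
  have r: "r \<in> L2" unfolding r_def[abs_def] by (intro L2_diff smear_mollifier_bound \<delta> f2)
  have rn: "L2_norm r \<le> real DIM('a) * \<delta> * M" unfolding r_def[abs_def] by (rule smear_mollifier_close[OF \<delta> f])
  have pt: "(cmod (f x))\<^sup>2 \<le> 4 * (cmod (r x))\<^sup>2" if "\<sigma> < cmod (f x)" for x
  proof -
    have "(cmod (smear (mollifier \<delta>) f x))\<^sup>2 \<le> (\<sigma> / 2)\<^sup>2" using smear_mollifier_sup[OF \<delta> f2, of x] small by linarith
    then have "cmod (smear (mollifier \<delta>) f x) \<le> \<sigma> / 2" by (rule power2_le_imp_le) (use \<sigma> in simp)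
    moreover have "cmod (f x) \<le> cmod (smear (mollifier \<delta>) f x) + cmod (r x)"
      unfolding r_def using norm_triangle_ineq4[of "smear (mollifier \<delta>) f x" "smear (mollifier \<delta>) f x - f x"] by simp
    ultimately have "cmod (f x) \<le> 2 * cmod (r x)" using that by simp
    then have "(cmod (f x))\<^sup>2 \<le> (2 * cmod (r x))\<^sup>2" by (intro power_mono) auto
    then show ?thesis by (simp add: power_mult_distrib)
  qed
  have "(\<integral>\<^sup>+x. ennreal ((cmod (f x))\<^sup>2) * indicator {x. \<sigma> < cmod (f x)} x \<partial>lborel) \<le> (\<integral>\<^sup>+x. 4 * (ennreal (cmod (r x)))\<^sup>2 \<partial>lborel)"
  proof (rule nn_integral_mono)
    fix x
    show "ennreal ((cmod (f x))\<^sup>2) * indicator {x. \<sigma> < cmod (f x)} x \<le> 4 * (ennreal (cmod (r x)))\<^sup>2"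
    proof (cases "\<sigma> < cmod (f x)")
      case True
      have "ennreal ((cmod (f x))\<^sup>2) \<le> ennreal (4 * (cmod (r x))\<^sup>2)" by (rule ennreal_leI[OF pt[OF True]])
      then show ?thesis using True by (simp add: ennreal_mult ennreal_power)
    qed simp
  qed
  also have "\<dots> = 4 * ennreal ((L2_norm r)\<^sup>2)"
    using L2_measurable[OF r] L2_norm_nn_integral[OF r] by (simp add: nn_integral_cmult)
  also have "\<dots> \<le> 4 * ennreal ((real DIM('a) * \<delta> * M)\<^sup>2)"
    by (intro mult_left_mono ennreal_leI power_mono rn) auto
  finally show ?thesis by (simp add: ennreal_mult)
qed

text \<open>The square of \<open>n\<close> is the sum of the first \<open>n\<close> odd numbers; here \<open>n\<close> is the rounded logarithm, and all levels \<open>k < n\<close> are exceeded.\<close>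

lemma ln_square_le_sum:
  fixes y :: real
  assumes "0 \<le> y"
  shows "ennreal ((max 0 (ln y))\<^sup>2) \<le> (\<Sum>k. ennreal (2 * real k + 1) * indicator {y. exp (real k) < y} y)"
proof (cases "1 < y")
  case True
  define n where "n = nat \<lceil>ln y\<rceil>"
  have l: "0 < ln y" using True by simp
  have n: "ln y \<le> real n" unfolding n_def using l by linarith
  have lt: "exp (real k) < y" if "k < n" for k
  proof -
    have "real k < ln y" using that l unfolding n_def by linarith
    then show ?thesis using True by (metis exp_less_mono exp_ln less_trans zero_less_one)
  qed
  have sq: "(\<Sum>k<n. 2 * real k + 1) = (real n)\<^sup>2"
    by (induction n) (auto simp: power2_eq_square algebra_simps)
  have "ennreal ((max 0 (ln y))\<^sup>2) \<le> ennreal ((real n)\<^sup>2)" using l n by (intro ennreal_leI power_mono) auto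
  also have "\<dots> = (\<Sum>k<n. ennreal (2 * real k + 1))" unfolding sq[symmetric] by (rule sum_ennreal[symmetric]) simp
  also have "\<dots> = (\<Sum>k<n. ennreal (2 * real k + 1) * indicator {y. exp (real k) < y} y)"
    using lt by (intro sum.cong) auto
  also have "\<dots> \<le> (\<Sum>k. ennreal (2 * real k + 1) * indicator {y. exp (real k) < y} y)"
    by (rule sum_le_suminf) auto
  finally show ?thesis .
next
  case False
  then have "max 0 (ln y) = 0" using assms by (cases "y = 0") auto
  then show ?thesis by simp
qed

text \<open>In at most three dimensions the level sets \<open>cmod f > exp k\<close> carry a mass that decays geometrically in
  \<open>k\<close> for mollification at scale \<open>exp (- 2 * k / 3)\<close>, so squares of logarithms can be summed.\<close>

lemma log_Sobolev:
  assumes dim: "DIM('a::euclidean_space) \<le> 3" and B: "1 \<le> B"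
  obtains C where "0 \<le> C" "\<And>(f :: 'a \<Rightarrow> complex) M. translation_Lipschitz f M \<Longrightarrow> 0 \<le> M \<Longrightarrow> L2_norm f \<le> B \<Longrightarrow>
      (\<lambda>x. of_real (times_log (f x))) \<in> L2 \<and> L2_norm (\<lambda>x. of_real (times_log (f x))) \<le> C * (1 + M)"
proof -
  \<comment> \<open>With the mollification scale \<open>A * exp (- 2 * k / 3)\<close> the mollification of \<open>f\<close> stays below \<open>exp k / 2\<close> in all dimensions up to three,
    because \<open>exp (4 * DIM('a))\<close> is at most \<open>exp 12\<close>.\<close>
  define A where "A = 4 * exp 12 * B\<^sup>2"
  have "1 \<le> B\<^sup>2" using B by (simp add: one_le_power)
  moreover have "1 \<le> exp (12::real)" by simp
  ultimately have A: "1 \<le> A" unfolding A_def using mult_mono[of 1 "exp 12" 1 "B\<^sup>2"] by simp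
  define q where "q = exp (- 1 / 3 :: real)"
  have q: "0 < q" "q < 1" by (auto simp: q_def)
  define S where "S = 72 * A\<^sup>2 * (1 / (1 - q))"
  have S: "0 \<le> S" using A q by (simp add: S_def)
  define C where "C = sqrt (8 * B\<^sup>2 + 2 * S)"
  have C: "0 \<le> C" "C\<^sup>2 = 8 * B\<^sup>2 + 2 * S" using S by (auto simp: C_def)
  show ?thesis
  proof (rule that[OF C(1)])
    fix f :: "'a \<Rightarrow> complex" and M
    assume f: "translation_Lipschitz f M" and M: "0 \<le> M" and fB: "L2_norm f \<le> B"
    have f2: "f \<in> L2" using f by (simp add: translation_Lipschitz_def)
    note [measurable] = L2_measurable[OF f2]
    have level: "(\<integral>\<^sup>+x. ennreal ((cmod (f x))\<^sup>2) * indicator {x. exp (real k) < cmod (f x)} x \<partial>lborel) \<le> ennreal (36 * A\<^sup>2 * M\<^sup>2 * exp (- 4 * real k / 3))" for k :: nat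
    proof -
      define \<delta> where "\<delta> = A * exp (- 2 * real k / 3)"
      have \<delta>: "0 < \<delta>" using A by (simp add: \<delta>_def)
      have d1: "1 \<le> DIM('a)" using DIM_positive[where 'a='a] by linarith
      have e1: "exp (- 2 * real k) \<le> exp (- 2 * real k / 3) ^ DIM('a)"
      proof -
        have "exp (- 2 * real k / 3) ^ DIM('a) = exp (real DIM('a) * (- 2 * real k / 3))" by (rule exp_of_nat_mult[symmetric])
        moreover have "real DIM('a) * (2 * real k / 3) \<le> 3 * (2 * real k / 3)" using dim by (intro mult_right_mono) auto
        ultimately show ?thesis by simp
      qed
      have e2: "A \<le> A ^ DIM('a)" using A d1 by (simp add: self_le_power)
      have e3: "exp (4 * real DIM('a)) \<le> exp 12" using dim by simp
      have \<delta>n: "A * exp (- 2 * real k) \<le> \<delta> ^ DIM('a)"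
        unfolding \<delta>_def power_mult_distrib using e1 e2 A by (intro mult_mono) auto
      have "exp (4 * real DIM('a)) * (L2_norm f)\<^sup>2 \<le> exp 12 * B\<^sup>2"
        by (intro mult_mono e3 power_mono fB) auto
      also have "\<dots> = (exp (real k) / 2)\<^sup>2 * (A * exp (- 2 * real k))"
        by (simp add: A_def power2_eq_square exp_add[symmetric] field_simps)
      also have "\<dots> \<le> (exp (real k) / 2)\<^sup>2 * \<delta> ^ DIM('a)" by (intro mult_left_mono \<delta>n) simp
      finally have "exp (4 * real DIM('a)) / \<delta> ^ DIM('a) * (L2_norm f)\<^sup>2 \<le> (exp (real k) / 2)\<^sup>2"
        using \<delta> by (simp add: field_simps)
      from level_set_bound[OF f \<delta> _ this]
      have "(\<integral>\<^sup>+x. ennreal ((cmod (f x))\<^sup>2) * indicator {x. exp (real k) < cmod (f x)} x \<partial>lborel) \<le> ennreal (4 * (real DIM('a) * \<delta> * M)\<^sup>2)" by simp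
      also have "\<dots> \<le> ennreal (4 * (3 * \<delta> * M)\<^sup>2)" using dim \<delta> M by (intro ennreal_leI mult_left_mono power_mono mult_right_mono) auto
      also have "4 * (3 * \<delta> * M)\<^sup>2 = 36 * A\<^sup>2 * M\<^sup>2 * exp (- 4 * real k / 3)"
        by (simp add: \<delta>_def power_mult_distrib power2_eq_square exp_add[symmetric] mult.assoc mult.left_commute)
      finally show ?thesis .
    qed
    have tm: "ennreal (2 * real k + 1) * ennreal (36 * A\<^sup>2 * M\<^sup>2 * exp (- 4 * real k / 3)) \<le> ennreal (72 * A\<^sup>2 * M\<^sup>2 * q ^ k)" for k :: nat
    proof -
      have "2 * real k + 1 \<le> 2 * exp (real k)" using exp_ge_add_one_self[of "real k"] by linarith
      then have "(2 * real k + 1) * (36 * A\<^sup>2 * M\<^sup>2 * exp (- 4 * real k / 3)) \<le> (2 * exp (real k)) * (36 * A\<^sup>2 * M\<^sup>2 * exp (- 4 * real k / 3))"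
        by (intro mult_right_mono) auto
      also have "\<dots> = 72 * A\<^sup>2 * M\<^sup>2 * (exp (real k) * exp (- 4 * real k / 3))" by simp
      also have "exp (real k) * exp (- 4 * real k / 3) = q ^ k"
        by (simp add: q_def exp_add[symmetric] exp_of_nat_mult[symmetric])
      finally have "(2 * real k + 1) * (36 * A\<^sup>2 * M\<^sup>2 * exp (- 4 * real k / 3)) \<le> 72 * A\<^sup>2 * M\<^sup>2 * q ^ k" .
      then show ?thesis by (subst ennreal_mult[symmetric]) (auto intro: ennreal_leI)
    qed
    have sm: "summable (\<lambda>k. 72 * A\<^sup>2 * M\<^sup>2 * q ^ k)" using q by (intro summable_mult summable_geometric) simp
    have "(\<integral>\<^sup>+x. ennreal ((cmod (f x))\<^sup>2) * ennreal ((max 0 (ln (cmod (f x))))\<^sup>2) \<partial>lborel)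
        \<le> (\<integral>\<^sup>+x. (\<Sum>k. ennreal (2 * real k + 1) * (ennreal ((cmod (f x))\<^sup>2) * indicator {x. exp (real k) < cmod (f x)} x)) \<partial>lborel)"
    proof (rule nn_integral_mono)
      fix x
      have "ennreal ((cmod (f x))\<^sup>2) * ennreal ((max 0 (ln (cmod (f x))))\<^sup>2)
        \<le> ennreal ((cmod (f x))\<^sup>2) * (\<Sum>k. ennreal (2 * real k + 1) * indicator {y. exp (real k) < y} (cmod (f x)))"
        by (intro mult_left_mono ln_square_le_sum) auto
      also have "\<dots> = (\<Sum>k. ennreal (2 * real k + 1) * (ennreal ((cmod (f x))\<^sup>2) * indicator {x. exp (real k) < cmod (f x)} x))"
        unfolding ennreal_suminf_cmult[symmetric] by (intro suminf_cong) (auto simp: indicator_def mult.commute)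
      finally show "ennreal ((cmod (f x))\<^sup>2) * ennreal ((max 0 (ln (cmod (f x))))\<^sup>2)
        \<le> (\<Sum>k. ennreal (2 * real k + 1) * (ennreal ((cmod (f x))\<^sup>2) * indicator {x. exp (real k) < cmod (f x)} x))" .
    qed
    also have "\<dots> = (\<Sum>k. ennreal (2 * real k + 1) * (\<integral>\<^sup>+x. ennreal ((cmod (f x))\<^sup>2) * indicator {x. exp (real k) < cmod (f x)} x \<partial>lborel))"
      by (subst nn_integral_suminf) (auto simp: nn_integral_cmult)
    also have "\<dots> \<le> (\<Sum>k. ennreal (72 * A\<^sup>2 * M\<^sup>2 * q ^ k))"
      by (intro suminf_le order_trans[OF mult_left_mono[OF level] tm]) auto
    also have "\<dots> = ennreal (\<Sum>k. 72 * A\<^sup>2 * M\<^sup>2 * q ^ k)"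
      by (rule suminf_ennreal2[OF _ sm]) (use q in auto)
    also have "(\<Sum>k. 72 * A\<^sup>2 * M\<^sup>2 * q ^ k) = S * M\<^sup>2"
    proof -
      have "(\<lambda>k. 72 * A\<^sup>2 * M\<^sup>2 * q ^ k) sums (72 * A\<^sup>2 * M\<^sup>2 * (1 / (1 - q)))"
        using q by (intro sums_mult geometric_sums) simp
      then show ?thesis by (simp add: sums_iff S_def algebra_simps)
    qed
    finally have big: "(\<integral>\<^sup>+x. ennreal ((cmod (f x))\<^sup>2) * ennreal ((max 0 (ln (cmod (f x))))\<^sup>2) \<partial>lborel) \<le> ennreal (S * M\<^sup>2)" .
    have pt: "(ennreal (cmod (of_real (times_log z))))\<^sup>2 \<le> 8 * (ennreal (cmod z))\<^sup>2 + 2 * (ennreal ((cmod z)\<^sup>2) * ennreal ((max 0 (ln (cmod z)))\<^sup>2))" for z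
    proof -
      have l: "0 \<le> ln (1 + 2 * cmod z)" "ln (1 + 2 * cmod z) \<le> 2 + max 0 (ln (cmod z))"
      proof -
        show "0 \<le> ln (1 + 2 * cmod z)" by simp
        show "ln (1 + 2 * cmod z) \<le> 2 + max 0 (ln (cmod z))"
        proof (cases "1 \<le> cmod z")
          case True
          have "ln (1 + 2 * cmod z) \<le> ln (3 * cmod z)" using True by (intro ln_mono) auto
          also have "\<dots> = ln 3 + ln (cmod z)" using True by (intro ln_mult_pos) auto
          also have "ln 3 \<le> (2::real)" using ln_le_minus_one[of 3] by simp
          finally show ?thesis by simp
        next
          case False
          then have "ln (1 + 2 * cmod z) \<le> ln 3" by (intro ln_mono) (auto intro: add_pos_nonneg)
          also have "ln 3 \<le> (2::real)" using ln_le_minus_one[of 3] by simp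
          finally show ?thesis by simp
        qed
      qed
      define L where "L = max 0 (ln (cmod z))"
      have "(ln (1 + 2 * cmod z))\<^sup>2 \<le> (2 + L)\<^sup>2" unfolding L_def by (rule power_mono[OF l(2,1)])
      also have "\<dots> \<le> 8 + 2 * L\<^sup>2" using sum_squares_bound[of 2 L] by (simp add: power2_sum)
      finally have "(cmod z)\<^sup>2 * (ln (1 + 2 * cmod z))\<^sup>2 \<le> (cmod z)\<^sup>2 * (8 + 2 * L\<^sup>2)" by (intro mult_left_mono) auto
      then have "(times_log z)\<^sup>2 \<le> 8 * (cmod z)\<^sup>2 + 2 * ((cmod z)\<^sup>2 * L\<^sup>2)" by (simp add: times_log_def power_mult_distrib algebra_simps)
      then have "ennreal ((times_log z)\<^sup>2) \<le> ennreal (8 * (cmod z)\<^sup>2 + 2 * ((cmod z)\<^sup>2 * L\<^sup>2))" by (rule ennreal_leI)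
      also have "\<dots> = 8 * (ennreal (cmod z))\<^sup>2 + 2 * (ennreal ((cmod z)\<^sup>2) * ennreal (L\<^sup>2))"
        by (simp add: ennreal_plus ennreal_mult ennreal_power)
      finally show ?thesis by (simp add: ennreal_power times_log_nonneg L_def)
    qed
    have "(\<integral>\<^sup>+x. (ennreal (cmod (complex_of_real (times_log (f x)))))\<^sup>2 \<partial>lborel)
       \<le> (\<integral>\<^sup>+x. 8 * (ennreal (cmod (f x)))\<^sup>2 + 2 * (ennreal ((cmod (f x))\<^sup>2) * ennreal ((max 0 (ln (cmod (f x))))\<^sup>2)) \<partial>lborel)"
      by (intro nn_integral_mono pt)
    also have "\<dots> = 8 * ennreal ((L2_norm f)\<^sup>2) + 2 * (\<integral>\<^sup>+x. ennreal ((cmod (f x))\<^sup>2) * ennreal ((max 0 (ln (cmod (f x))))\<^sup>2) \<partial>lborel)"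
      by (simp add: nn_integral_add nn_integral_cmult flip: L2_norm_nn_integral[OF f2])
    also have "\<dots> \<le> 8 * ennreal (B\<^sup>2) + 2 * ennreal (S * M\<^sup>2)"
      by (intro add_mono mult_left_mono big ennreal_leI power_mono fB) auto
    also have "\<dots> = ennreal (8 * B\<^sup>2 + 2 * (S * M\<^sup>2))"
      using S by (simp add: ennreal_plus ennreal_mult)
    also have "\<dots> \<le> ennreal ((C * (1 + M))\<^sup>2)"
    proof (rule ennreal_leI)
      have "1 \<le> (1 + M)\<^sup>2" "M\<^sup>2 \<le> (1 + M)\<^sup>2" using M by (auto simp: power2_sum one_le_power)
      then have "8 * B\<^sup>2 * 1 + 2 * S * M\<^sup>2 \<le> 8 * B\<^sup>2 * (1 + M)\<^sup>2 + 2 * S * (1 + M)\<^sup>2"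
        using S by (intro add_mono mult_left_mono) auto
      moreover have "(C * (1 + M))\<^sup>2 = 8 * B\<^sup>2 * (1 + M)\<^sup>2 + 2 * S * (1 + M)\<^sup>2"
        by (simp only: power_mult_distrib C(2) distrib_right)
      ultimately show "8 * B\<^sup>2 + 2 * (S * M\<^sup>2) \<le> (C * (1 + M))\<^sup>2" by simp
    qed
    finally have fin: "(\<integral>\<^sup>+x. (ennreal (cmod (complex_of_real (times_log (f x)))))\<^sup>2 \<partial>lborel) \<le> ennreal ((C * (1 + M))\<^sup>2)" .
    have m: "(\<lambda>x. complex_of_real (times_log (f x))) \<in> borel_measurable borel" by measurable
    show "(\<lambda>x. of_real (times_log (f x))) \<in> L2 \<and> L2_norm (\<lambda>x. of_real (times_log (f x))) \<le> C * (1 + M)"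
      using L2I_nn_integral[OF m fin] C(1) M by auto
  qed
qed

section \<open>Weights and the size of the regularisation error\<close>

lemma integral_weight_1:
  assumes R: "0 < R"
  shows "(\<integral>\<^sup>+s. ennreal ((1 + \<bar>s\<bar> / R) powr (- 4 / 3)) \<partial>lborel) = ennreal (6 * R)"
proof -
  let ?f = "\<lambda>s. (1 + s / R) powr (- 4 / 3)"
  have half: "(\<integral>\<^sup>+s. ennreal (?f s) * indicator {0..} s \<partial>lborel) = ennreal (0 - (- 3 * R * (1 + 0 / R) powr (- 1 / 3)))"
  proof (rule nn_integral_FTC_atLeast)
    show "?f \<in> borel_measurable borel" by measurable
    show "((\<lambda>s. - 3 * R * (1 + s / R) powr (- 1 / 3)) has_real_derivative ?f s) (at s)" if "0 \<le> s" for s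
    proof -
      have pos: "0 < 1 + s / R" using that R by (simp add: add_pos_nonneg)
      have "((\<lambda>s. 1 + s / R) has_real_derivative 1 / R) (at s)" using R by (auto intro!: derivative_eq_intros)
      from DERIV_cmult[OF DERIV_chain2[OF has_real_derivative_powr[OF pos, of "- 1 / 3"] this], of "- 3 * R"]
      show ?thesis using R by simp
    qed
    show "((\<lambda>s. - 3 * R * (1 + s / R) powr (- 1 / 3)) \<longlongrightarrow> 0) at_top"
      using R by real_asymp
  qed simp
  then have h: "(\<integral>\<^sup>+s. ennreal (?f s) * indicator {0..} s \<partial>lborel) = ennreal (3 * R)" by simp
  have h': "(\<integral>\<^sup>+s. ennreal (?f (- s)) * indicator {..0} s \<partial>lborel) = ennreal (3 * R)"
    unfolding h[symmetric]
    by (subst nn_integral_real_affine[where c="-1" and t=0]) (auto intro!: nn_integral_cong simp: indicator_def)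
  have "(\<integral>\<^sup>+s. ennreal ((1 + \<bar>s\<bar> / R) powr (- 4 / 3)) \<partial>lborel)
     = (\<integral>\<^sup>+s. ennreal (?f s) * indicator {0..} s + ennreal (?f (- s)) * indicator {..0} s \<partial>lborel)"
  proof (rule nn_integral_cong_AE)
    have "AE s in lborel. s \<noteq> (0::real)" by (rule AE_lborel_singleton)
    then show "AE s in lborel. ennreal ((1 + \<bar>s\<bar> / R) powr (- 4 / 3)) = ennreal (?f s) * indicator {0..} s + ennreal (?f (- s)) * indicator {..0} s"
      by eventually_elim (auto simp: indicator_def)
  qed
  also have "\<dots> = (\<integral>\<^sup>+s. ennreal (?f s) * indicator {0..} s \<partial>lborel) + (\<integral>\<^sup>+s. ennreal (?f (- s)) * indicator {..0} s \<partial>lborel)"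
    by (rule nn_integral_add) measurable
  also have "\<dots> = ennreal (3 * R) + ennreal (3 * R)"
    by (simp only: h h')
  also have "\<dots> = ennreal (6 * R)" using R by (simp add: ennreal_plus[symmetric])
  finally show ?thesis .
qed

text \<open>An integrable weight of total mass proportional to \<open>R ^ DIM('a)\<close> that is bounded below by the inverse fourth
  power of \<open>1 + norm x / R\<close>. The exponent \<open>4 / 3\<close> makes it integrable in every direction and
  spends at most the power four in at most three dimensions.\<close>

definition weight :: "real \<Rightarrow> 'a::euclidean_space \<Rightarrow> real" where
  "weight R x = (\<Prod>b\<in>Basis. (1 + \<bar>x \<bullet> b\<bar> / R) powr (- 4 / 3))"

lemma weight_pos: "0 < R \<Longrightarrow> 0 < weight R x"
  unfolding weight_def
proof (intro prod_pos ballI)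
  fix b assume R: "0 < R"
  have "0 < 1 + \<bar>x \<bullet> b\<bar> / R" using R by (intro add_pos_nonneg) auto
  then show "0 < (1 + \<bar>x \<bullet> b\<bar> / R) powr (- 4 / 3)" by simp
qed

lemma weight_measurable [measurable]: "weight R \<in> borel_measurable borel"
  unfolding weight_def by measurable

lemma integral_weight:
  assumes R: "0 < R"
  shows "integrable lborel (weight R :: 'a::euclidean_space \<Rightarrow> real)" "(\<integral>x. weight R (x::'a) \<partial>lborel) = (6 * R) ^ DIM('a)"
proof -
  have "(\<integral>\<^sup>+x. ennreal (weight R (x::'a)) \<partial>lborel) = (\<integral>\<^sup>+x. (\<Prod>b\<in>Basis. ennreal ((1 + \<bar>x \<bullet> b\<bar> / R) powr (- 4 / 3))) \<partial>(lborel :: 'a measure))"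
    unfolding weight_def by (intro nn_integral_cong) (auto simp: prod_ennreal)
  also have "\<dots> = (\<Prod>b\<in>(Basis::'a set). \<integral>\<^sup>+s. ennreal ((1 + \<bar>s\<bar> / R) powr (- 4 / 3)) \<partial>lborel)"
    by (rule nn_integral_lborel_prod) auto
  also have "\<dots> = ennreal ((6 * R) ^ DIM('a))"
    unfolding integral_weight_1[OF R] using R by (simp add: ennreal_power)
  finally have n: "(\<integral>\<^sup>+x. ennreal (weight R (x::'a)) \<partial>lborel) = ennreal ((6 * R) ^ DIM('a))" .
  have nn: "0 \<le> weight R x" for x :: 'a using weight_pos[OF R, of x] by simp
  show "integrable lborel (weight R :: 'a \<Rightarrow> real)"
    by (rule integrableI_nonneg) (auto simp: n nn)
  show "(\<integral>x. weight R (x::'a) \<partial>lborel) = (6 * R) ^ DIM('a)"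
    using n R by (subst integral_eq_nn_integral) (auto simp: nn)
qed

lemma inverse_weight_le:
  fixes x :: "'a::euclidean_space"
  assumes dim: "DIM('a) \<le> 3" and R: "0 < R"
  shows "1 / weight R x \<le> (1 + norm x / R) ^ 4"
proof -
  define y where "y = 1 + norm x / R"
  have y: "1 \<le> y" using R by (simp add: y_def)
  have "y powr (- 4) \<le> y powr (real DIM('a) * (- 4 / 3))"
    using y dim by (intro powr_mono) auto
  also have "\<dots> = (\<Prod>b\<in>(Basis::'a set). y powr (- 4 / 3))"
  proof -
    have "(\<Prod>b\<in>(Basis::'a set). y powr (- 4 / 3)) = (y powr (- 4 / 3)) powr real DIM('a)"
      using y by (simp add: powr_realpow)
    also have "\<dots> = y powr (- 4 / 3 * real DIM('a))" by (rule powr_powr)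
    finally show ?thesis by (simp only: mult.commute)
  qed
  also have "\<dots> \<le> weight R x"
    unfolding weight_def
  proof (intro prod_mono conjI)
    fix b :: 'a assume b: "b \<in> Basis"
    have "1 + \<bar>x \<bullet> b\<bar> / R \<le> y" unfolding y_def using Basis_le_norm[OF b, of x] R by (simp add: divide_right_mono)
    then show "y powr (- 4 / 3) \<le> (1 + \<bar>x \<bullet> b\<bar> / R) powr (- 4 / 3)"
      using R by (intro powr_mono2') (auto simp: add_pos_nonneg)
  qed simp
  finally have "1 / weight R x \<le> 1 / y powr (- 4)"
    using y weight_pos[OF R, of x] by (intro divide_left_mono) auto
  also have "\<dots> = y ^ 4" using y by (simp add: powr_minus field_simps)
  finally show ?thesis by (simp add: y_def)
qed

lemma jbracket_square: "(jbracket x)\<^sup>2 = 1 + (norm x)\<^sup>2"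
  by (simp add: jbracket_def)

lemma jbracket_measurable [measurable]: "jbracket \<in> borel_measurable borel"
  unfolding jbracket_def by measurable

lemma L22_integrable:
  assumes "v \<in> L22"
  shows "v \<in> L2" "integrable lborel (\<lambda>x. (jbracket x) ^ 4 * (cmod (v x))\<^sup>2)"
    "(\<integral>x. (jbracket x) ^ 4 * (cmod (v x))\<^sup>2 \<partial>lborel) = (L22_norm v)\<^sup>2"
proof -
  have eq: "(cmod (of_real ((jbracket x)\<^sup>2) * v x))\<^sup>2 = (jbracket x) ^ 4 * (cmod (v x))\<^sup>2" for x
  proof -
    have "cmod (of_real ((jbracket x)\<^sup>2) * v x) = (jbracket x)\<^sup>2 * cmod (v x)"
      by (simp only: norm_mult norm_of_real abs_power2)
    then show ?thesis by (simp add: power_mult_distrib flip: power_mult)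
  qed
  show "v \<in> L2" using assms by (simp add: L22_def)
  show "integrable lborel (\<lambda>x. (jbracket x) ^ 4 * (cmod (v x))\<^sup>2)"
    using L2_integrable[of "\<lambda>x. of_real ((jbracket x)\<^sup>2) * v x"] assms unfolding eq by (simp add: L22_def)
  show "(\<integral>x. (jbracket x) ^ 4 * (cmod (v x))\<^sup>2 \<partial>lborel) = (L22_norm v)\<^sup>2"
    unfolding L22_norm_def L2_norm_square eq ..
qed

text \<open>Young's inequality with the weight \<open>p\<close>: \<open>2 * cmod v\<close> is at most \<open>p + (cmod v)\<^sup>2 / p\<close>, where \<open>p\<close> is integrable and
  \<open>1 / p\<close> is bounded by a multiple of the weight of the norm of \<open>L22\<close>. This is where the dimension enters.\<close>

lemma L22_integrable_norm:
  fixes v :: "'a::euclidean_space \<Rightarrow> complex"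
  assumes dim: "DIM('a) \<le> 3" and v: "v \<in> L22"
  shows "integrable lborel (\<lambda>x. cmod (v x))" "(\<integral>x. cmod (v x) \<partial>lborel) \<le> 6 ^ DIM('a) + 4 * (L22_norm v)\<^sup>2"
proof -
  note L = L22_integrable[OF v]
  note [measurable] = L2_measurable[OF L(1)]
  have i: "integrable lborel (\<lambda>x. weight 1 x + 4 * ((jbracket x) ^ 4 * (cmod (v x))\<^sup>2))"
    using integral_weight(1)[of 1, where 'a='a] L(2) by simp
  have le: "cmod (v x) \<le> weight 1 x + 4 * ((jbracket x) ^ 4 * (cmod (v x))\<^sup>2)" for x
  proof -
    define p where "p = weight 1 x"
    have p: "0 < p" unfolding p_def by (rule weight_pos) simp
    have "1 / p \<le> (1 + norm x) ^ 4" using inverse_weight_le[OF dim, of 1 x] by (simp add: p_def)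
    also have "(1 + norm x) ^ 4 = ((1 + norm x)\<^sup>2)\<^sup>2" by (simp flip: power_mult)
    also have "\<dots> \<le> (2 * (1 + (norm x)\<^sup>2))\<^sup>2"
      using sum_squares_bound[of 1 "norm x"] by (intro power_mono) (auto simp: power2_sum)
    also have "\<dots> = 4 * (jbracket x) ^ 4"
      by (simp add: jbracket_square[symmetric] power_mult_distrib flip: power_mult)
    finally have w: "1 / p \<le> 4 * (jbracket x) ^ 4" .
    have "2 * cmod (v x) \<le> p + (cmod (v x))\<^sup>2 / p"
    proof -
      have "0 \<le> (p - cmod (v x))\<^sup>2 / p" using p by simp
      also have "\<dots> = p + (cmod (v x))\<^sup>2 / p - 2 * cmod (v x)" using p by (simp add: power2_diff field_simps power2_eq_square)
      finally show ?thesis by simp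
    qed
    moreover have "(cmod (v x))\<^sup>2 / p \<le> 4 * ((jbracket x) ^ 4 * (cmod (v x))\<^sup>2)"
      using mult_left_mono[OF w, of "(cmod (v x))\<^sup>2"] by (simp add: algebra_simps)
    ultimately show ?thesis unfolding p_def[symmetric] using norm_ge_zero[of "v x"] by linarith
  qed
  show ii: "integrable lborel (\<lambda>x. cmod (v x))"
    by (rule Bochner_Integration.integrable_bound[OF i]) (auto intro!: AE_I2 order_trans[OF le] abs_ge_self)
  have "(\<integral>x. cmod (v x) \<partial>lborel) \<le> (\<integral>x. weight 1 x + 4 * ((jbracket x) ^ 4 * (cmod (v x))\<^sup>2) \<partial>lborel)"
    by (rule integral_mono[OF ii i le])
  also have "\<dots> = 6 ^ DIM('a) + 4 * (L22_norm v)\<^sup>2"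
    using integral_weight[of 1, where 'a='a] L(2,3) by simp
  finally show "(\<integral>x. cmod (v x) \<partial>lborel) \<le> 6 ^ DIM('a) + 4 * (L22_norm v)\<^sup>2" .
qed

lemma sqrt_norm_L2:
  fixes v :: "'a::euclidean_space \<Rightarrow> complex"
  assumes dim: "DIM('a) \<le> 3" and v: "v \<in> L22"
  shows "(\<lambda>x. complex_of_real (sqrt (cmod (v x)))) \<in> L2"
    "(L2_norm (\<lambda>x. complex_of_real (sqrt (cmod (v x)))))\<^sup>2 \<le> 6 ^ DIM('a) + 4 * (L22_norm v)\<^sup>2"
proof -
  note [measurable] = L2_measurable[OF L22_integrable(1)[OF v]]
  have m: "(\<lambda>x. complex_of_real (sqrt (cmod (v x)))) \<in> borel_measurable borel" by measurable
  note I = L22_integrable_norm[OF dim v]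
  have "AE x in lborel. (cmod (complex_of_real (sqrt (cmod (v x)))))\<^sup>2 \<le> cmod (v x)" by simp
  from L2I_square_bound[OF m I(1) this] I(2)
  show "(\<lambda>x. complex_of_real (sqrt (cmod (v x)))) \<in> L2"
    "(L2_norm (\<lambda>x. complex_of_real (sqrt (cmod (v x)))))\<^sup>2 \<le> 6 ^ DIM('a) + 4 * (L22_norm v)\<^sup>2" by auto
qed

definition tail :: "real \<Rightarrow> ('a::euclidean_space \<Rightarrow> complex) \<Rightarrow> real" where
  "tail R v = (\<integral>x. indicator {x. R < norm x} x * ((jbracket x) ^ 4 * (cmod (v x))\<^sup>2) \<partial>lborel)"

lemma tail_bounds:
  assumes v: "v \<in> L22"
  shows "integrable lborel (\<lambda>x. indicator {x. R < norm x} x * ((jbracket x) ^ 4 * (cmod (v x))\<^sup>2))"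
    "0 \<le> tail R v" "tail R v \<le> (L22_norm v)\<^sup>2"
proof -
  note L = L22_integrable[OF v]
  note [measurable] = L2_measurable[OF L(1)]
  show i: "integrable lborel (\<lambda>x. indicator {x. R < norm x} x * ((jbracket x) ^ 4 * (cmod (v x))\<^sup>2))"
    by (rule Bochner_Integration.integrable_bound[OF L(2)]) (auto simp: indicator_def)
  show "0 \<le> tail R v" unfolding tail_def by (intro Bochner_Integration.integral_nonneg) auto
  show "tail R v \<le> (L22_norm v)\<^sup>2"
    unfolding tail_def L(3)[symmetric] by (rule integral_mono[OF i L(2)]) (auto simp: indicator_def)
qed

lemma tail_tendsto_0:
  assumes v: "v \<in> L22"
  shows "((\<lambda>R. tail R v) \<longlongrightarrow> 0) at_top"
proof -
  note L = L22_integrable[OF v]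
  note [measurable] = L2_measurable[OF L(1)]
  have "((\<lambda>R. tail R v) \<longlongrightarrow> (\<integral>x. 0 \<partial>(lborel :: 'a measure))) at_top"
    unfolding tail_def
  proof (rule integral_dominated_convergence_at_top[where w="\<lambda>x. (jbracket x) ^ 4 * (cmod (v x))\<^sup>2"])
    show "\<forall>\<^sub>F R in at_top. AE x in lborel. norm (indicator {x. R < norm x} x * ((jbracket x) ^ 4 * (cmod (v x))\<^sup>2)) \<le> (jbracket x) ^ 4 * (cmod (v x))\<^sup>2"
      by (intro always_eventually allI AE_I2) (auto simp: indicator_def)
    show "AE x in lborel. ((\<lambda>R. indicator {x. R < norm x} x * ((jbracket x) ^ 4 * (cmod (v x))\<^sup>2)) \<longlongrightarrow> 0) at_top"
    proof (rule AE_I2)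
      fix x :: 'a
      show "((\<lambda>R. indicator {x. R < norm x} x * ((jbracket x) ^ 4 * (cmod (v x))\<^sup>2)) \<longlongrightarrow> 0) at_top"
        by (rule tendsto_eventually) (use eventually_ge_at_top[of "norm x"] in eventually_elim, simp)
    qed
  qed (use L(2) in auto)
  then show ?thesis by simp
qed

text \<open>Balancing the two bounds for the error: inside the ball of radius \<open>R\<close> it is at most \<open>\<epsilon>\<close>,
  outside the smallness of \<open>v\<close> is used through the second weighted moment.\<close>

lemma regularisation_error_L2:
  fixes lam :: real and v :: "'a::euclidean_space \<Rightarrow> complex"
  assumes dim: "DIM('a) \<le> 3" and v: "v \<in> L22" and \<epsilon>: "0 < \<epsilon>" and R: "1 \<le> R"
  defines "S \<equiv> (\<lambda>x. reg_log_nonlin lam \<epsilon> (v x) - reg_log_nonlin lam 0 (v x))"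
  shows "S \<in> L2" "(L2_norm S)\<^sup>2 \<le> 16 * lam\<^sup>2 * (16 * \<epsilon>\<^sup>2 * (6 * R) ^ DIM('a) + 16 / R ^ 4 * tail R v)"
    "(L2_norm S)\<^sup>2 \<le> 16 * lam\<^sup>2 * \<epsilon> * (6 ^ DIM('a) + 4 * (L22_norm v)\<^sup>2)"
proof -
  have R0: "0 < R" using R by simp
  note [measurable] = L2_measurable[OF L22_integrable(1)[OF v]]
  have m: "S \<in> borel_measurable borel" unfolding S_def by measurable
  have S1: "(cmod (S x))\<^sup>2 \<le> 16 * lam\<^sup>2 * \<epsilon>\<^sup>2" for x
  proof -
    have "2 * \<bar>lam\<bar> * \<epsilon> \<le> 4 * \<bar>lam\<bar> * \<epsilon>" using \<epsilon> by (intro mult_right_mono) auto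
    then have "cmod (S x) \<le> 4 * \<bar>lam\<bar> * \<epsilon>" unfolding S_def using regularisation_error(1)[OF \<epsilon>, of lam "v x"] by linarith
    then have "(cmod (S x))\<^sup>2 \<le> (4 * \<bar>lam\<bar> * \<epsilon>)\<^sup>2" by (intro power_mono) auto
    then show ?thesis by (simp add: power_mult_distrib)
  qed
  have S2: "(cmod (S x))\<^sup>2 \<le> 16 * lam\<^sup>2 * (\<epsilon> * cmod (v x))" for x
  proof -
    have "(cmod (S x))\<^sup>2 \<le> (4 * \<bar>lam\<bar> * sqrt (\<epsilon> * cmod (v x)))\<^sup>2"
      unfolding S_def using regularisation_error(2)[OF \<epsilon>, of lam "v x"] by (intro power_mono) auto
    then show ?thesis using \<epsilon> by (simp add: power_mult_distrib)
  qed
  note I = L22_integrable_norm[OF dim v]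
  have iS2: "integrable lborel (\<lambda>x. 16 * lam\<^sup>2 * (\<epsilon> * cmod (v x)))" using I(1) by simp
  note B2 = L2I_square_bound[OF m iS2 AE_I2[OF S2]]
  show "S \<in> L2" by (rule B2(1))
  have "(L2_norm S)\<^sup>2 \<le> 16 * lam\<^sup>2 * (\<epsilon> * (\<integral>x. cmod (v x) \<partial>lborel))" using B2(2) by simp
  also have "\<dots> \<le> 16 * lam\<^sup>2 * (\<epsilon> * (6 ^ DIM('a) + 4 * (L22_norm v)\<^sup>2))"
    using I(2) \<epsilon> by (intro mult_left_mono) auto
  finally show "(L2_norm S)\<^sup>2 \<le> 16 * lam\<^sup>2 * \<epsilon> * (6 ^ DIM('a) + 4 * (L22_norm v)\<^sup>2)" by (simp add: mult.assoc)
  define t where "t x = indicator {x. R < norm x} x * ((jbracket x) ^ 4 * (cmod (v x))\<^sup>2)" for x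
  have it: "integrable lborel t" "(\<integral>x. t x \<partial>lborel) = tail R v"
    using tail_bounds(1)[OF v, of R] by (auto simp: t_def[abs_def] tail_def)
  have iS1: "integrable lborel (\<lambda>x. 16 * lam\<^sup>2 * (16 * \<epsilon>\<^sup>2 * weight R x + 16 / R ^ 4 * t x))"
    using integral_weight(1)[OF R0, where 'a='a] it(1) by simp
  have S3: "(cmod (S x))\<^sup>2 \<le> 16 * lam\<^sup>2 * (16 * \<epsilon>\<^sup>2 * weight R x + 16 / R ^ 4 * t x)" for x
  proof (cases "R < norm x")
    case False
    have "(1 + norm x / R) ^ 4 \<le> (1 + 1) ^ 4" using False R0 by (intro power_mono add_left_mono) auto
    with inverse_weight_le[OF dim R0, of x] have "1 / weight R x \<le> 16" by simp
    then have "1 \<le> 16 * weight R x" using weight_pos[OF R0, of x] by (simp add: field_simps)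
    then have "\<epsilon>\<^sup>2 * 1 \<le> \<epsilon>\<^sup>2 * (16 * weight R x)" by (intro mult_left_mono) auto
    then have "16 * lam\<^sup>2 * \<epsilon>\<^sup>2 \<le> 16 * lam\<^sup>2 * (16 * \<epsilon>\<^sup>2 * weight R x)"
      using mult_left_mono[of "\<epsilon>\<^sup>2 * 1" "\<epsilon>\<^sup>2 * (16 * weight R x)" "16 * lam\<^sup>2"] by (simp add: algebra_simps)
    moreover have t0: "t x = 0" using False by (simp add: t_def)
    ultimately show ?thesis using S1[of x] unfolding t0 mult_zero_right add_0_right by linarith
  next
    case True
    define p where "p = weight R x"
    have p: "0 < p" unfolding p_def by (rule weight_pos[OF R0])
    have "1 / p \<le> (1 + norm x / R) ^ 4" using inverse_weight_le[OF dim R0, of x] by (simp add: p_def)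
    also have "\<dots> \<le> (2 * (norm x / R)) ^ 4" using True R0 by (intro power_mono) (auto simp: field_simps)
    also have "\<dots> = 16 / R ^ 4 * ((norm x)\<^sup>2)\<^sup>2" by (simp add: power_mult_distrib power_divide flip: power_mult)
    also have "\<dots> \<le> 16 / R ^ 4 * (1 + (norm x)\<^sup>2)\<^sup>2" using R0 by (intro mult_left_mono power_mono) auto
    also have "\<dots> = 16 / R ^ 4 * (jbracket x) ^ 4" by (simp add: jbracket_square[symmetric] flip: power_mult)
    finally have w: "1 / p \<le> 16 / R ^ 4 * (jbracket x) ^ 4" .
    have "\<epsilon> * cmod (v x) \<le> \<epsilon>\<^sup>2 * p + (cmod (v x))\<^sup>2 * (1 / p)"
    proof -
      have "0 \<le> (\<epsilon> * p - cmod (v x))\<^sup>2 / p" using p by simp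
      also have "\<dots> = \<epsilon>\<^sup>2 * p + (cmod (v x))\<^sup>2 * (1 / p) - 2 * (\<epsilon> * cmod (v x))"
        using p by (simp add: power2_diff power_mult_distrib field_simps power2_eq_square)
      finally show ?thesis using mult_nonneg_nonneg[OF less_imp_le[OF \<epsilon>] norm_ge_zero[of "v x"]] by linarith
    qed
    also have "\<dots> \<le> 16 * \<epsilon>\<^sup>2 * p + 16 / R ^ 4 * t x"
    proof (intro add_mono)
      show "\<epsilon>\<^sup>2 * p \<le> 16 * \<epsilon>\<^sup>2 * p" using p by simp
      show "(cmod (v x))\<^sup>2 * (1 / p) \<le> 16 / R ^ 4 * t x"
        using mult_left_mono[OF w, of "(cmod (v x))\<^sup>2"] True by (simp add: t_def algebra_simps)
    qed
    finally have "\<epsilon> * cmod (v x) \<le> 16 * \<epsilon>\<^sup>2 * p + 16 / R ^ 4 * t x" .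
    then have "16 * lam\<^sup>2 * (\<epsilon> * cmod (v x)) \<le> 16 * lam\<^sup>2 * (16 * \<epsilon>\<^sup>2 * p + 16 / R ^ 4 * t x)"
      by (intro mult_left_mono) auto
    then show ?thesis using S2[of x] unfolding p_def by linarith
  qed
  have "(L2_norm S)\<^sup>2 \<le> (\<integral>x. 16 * lam\<^sup>2 * (16 * \<epsilon>\<^sup>2 * weight R x + 16 / R ^ 4 * t x) \<partial>lborel)"
    by (rule L2I_square_bound(2)[OF m iS1 AE_I2[OF S3]])
  also have "\<dots> = 16 * lam\<^sup>2 * (16 * \<epsilon>\<^sup>2 * (6 * R) ^ DIM('a) + 16 / R ^ 4 * tail R v)"
    using integral_weight[OF R0, where 'a='a] it by simp
  finally show "(L2_norm S)\<^sup>2 \<le> 16 * lam\<^sup>2 * (16 * \<epsilon>\<^sup>2 * (6 * R) ^ DIM('a) + 16 / R ^ 4 * tail R v)" .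
qed

text \<open>After integration in time the error is \<open>o\<close> of the claimed rate, not only \<open>O\<close>: with \<open>R\<close> a small
  multiple of \<open>\<epsilon>\<close> to the power \<open>- 2 / (4 + DIM('a))\<close>, the ball contributes a small
  multiple of the rate, and the tail of the fixed function \<open>u\<close> tends to zero.\<close>

lemma regularisation_error_small:
  fixes u :: "real \<Rightarrow> 'a::euclidean_space \<Rightarrow> complex"
  assumes dim: "DIM('a) \<le> 3" and T: "0 < T" and meas: "(\<lambda>(t, x). u t x) \<in> borel_measurable borel"
    and u: "AE t in lborel. t \<in> {0..T} \<longrightarrow> u t \<in> L22 \<and> L22_norm (u t) \<le> K" and K: "0 \<le> K" and \<eta>: "0 < \<eta>"
  shows "\<forall>\<^sub>F \<epsilon> in at_right 0. (LINT t:{0..T}|lborel. (L2_norm (\<lambda>x. reg_log_nonlin lam \<epsilon> (u t x) - reg_log_nonlin lam 0 (u t x)))\<^sup>2)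
      \<le> \<eta> * \<epsilon> powr (8 / (4 + real DIM('a)))"
proof -
  have mu [measurable]: "(\<lambda>(t, x). u t x) \<in> borel_measurable (borel \<Otimes>\<^sub>M borel)" using meas by (simp add: borel_prod)
  define d where "d = real DIM('a)"
  have d: "1 \<le> d" "d \<le> 3" using dim DIM_positive[where 'a='a] by (auto simp: d_def)
  define l where "l = 16 * lam\<^sup>2"
  have l: "0 \<le> l" by (simp add: l_def)
  define Tl where "Tl R = (\<integral>t. indicator {0..T} t * tail R (u t) \<partial>lborel)" for R
  have mtail [measurable]: "(\<lambda>t. tail R (u t)) \<in> borel_measurable borel" for R
    unfolding tail_def by measurable
  have iK: "integrable lborel (\<lambda>t. indicator {0..T} t * K\<^sup>2)"
    using T by (intro integrable_mult_left integrable_real_indicator) auto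
  have btail: "AE t in lborel. \<bar>indicator {0..T} t * tail R (u t)\<bar> \<le> indicator {0..T} t * K\<^sup>2" for R
    using u
  proof eventually_elim
    fix t assume *: "t \<in> {0..T} \<longrightarrow> u t \<in> L22 \<and> L22_norm (u t) \<le> K"
    show "\<bar>indicator {0..T} t * tail R (u t)\<bar> \<le> indicator {0..T} t * K\<^sup>2"
    proof (cases "t \<in> {0..T}")
      case True
      then have "u t \<in> L22" "L22_norm (u t) \<le> K" using * by auto
      then have "tail R (u t) \<le> K\<^sup>2" "0 \<le> tail R (u t)"
        using tail_bounds(2,3)[of "u t" R] power_mono[of "L22_norm (u t)" K 2] by (auto simp: L22_norm_def)
      then show ?thesis using True by simp
    qed simp
  qed
  have itail: "integrable lborel (\<lambda>t. indicator {0..T} t * tail R (u t))" for R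
    by (rule Bochner_Integration.integrable_bound[OF iK])
       (use btail[of R] in \<open>auto elim!: eventually_mono\<close>)
  have Tl0: "(Tl \<longlongrightarrow> 0) at_top"
  proof -
    have "((\<lambda>R. \<integral>t. indicator {0..T} t * tail R (u t) \<partial>lborel) \<longlongrightarrow> (\<integral>t. 0 \<partial>(lborel :: real measure))) at_top"
    proof (rule integral_dominated_convergence_at_top[where w="\<lambda>t. indicator {0..T} t * K\<^sup>2"])
      show "\<forall>\<^sub>F R in at_top. AE t in lborel. norm (indicator {0..T} t * tail R (u t)) \<le> indicator {0..T} t * K\<^sup>2"
        unfolding real_norm_def by (intro always_eventually allI btail)
      show "AE t in lborel. ((\<lambda>R. indicator {0..T} t * tail R (u t)) \<longlongrightarrow> 0) at_top"
        using u
      proof eventually_elim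
        fix t assume *: "t \<in> {0..T} \<longrightarrow> u t \<in> L22 \<and> L22_norm (u t) \<le> K"
        show "((\<lambda>R. indicator {0..T} t * tail R (u t)) \<longlongrightarrow> 0) at_top"
          using * tail_tendsto_0[of "u t"] by (cases "t \<in> {0..T}") auto
      qed
    qed (use iK in auto)
    then show ?thesis by (simp add: Tl_def[abs_def])
  qed
  \<comment> \<open>The ball of radius \<open>\<rho> \<epsilon> = \<theta> * \<epsilon> powr (- 2 / (4 + d))\<close> contributes at most \<open>A * \<theta>\<close> times the rate, its complement \<open>B\<close> times the rate times
    the tail \<open>Tl (\<rho> \<epsilon>)\<close>. First \<open>\<theta>\<close> is made small, then \<open>\<epsilon>\<close>.\<close>
  define A where "A = l * 16 * 6 ^ DIM('a) * T"
  have A: "0 \<le> A" using l T by (simp add: A_def)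
  obtain \<theta> where \<theta>: "0 < \<theta>" "\<theta> \<le> 1" "A * \<theta> \<le> \<eta> / 2"
  proof (rule that[of "min 1 (\<eta> / (2 * (A + 1)))"])
    have "A * min 1 (\<eta> / (2 * (A + 1))) \<le> (A + 1) * (\<eta> / (2 * (A + 1)))" using A \<eta> by (intro mult_mono) auto
    also have "\<dots> = \<eta> / 2" using A by (simp add: field_simps)
    finally show "A * min 1 (\<eta> / (2 * (A + 1))) \<le> \<eta> / 2" .
  qed (use A \<eta> in auto)
  define \<gamma> where "\<gamma> = 8 / (4 + d)"
  define \<rho> where "\<rho> \<epsilon> = \<theta> * \<epsilon> powr (- (2 / (4 + d)))" for \<epsilon>
  have \<rho>_top: "filterlim \<rho> at_top (at_right 0)"
    unfolding \<rho>_def using \<theta>(1) d by real_asymp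
  define B where "B = l * 16 / \<theta> ^ 4"
  have B: "0 \<le> B" using l \<theta> by (simp add: B_def)
  have "\<forall>\<^sub>F R in at_top. Tl R < \<eta> / (2 * (B + 1))"
    using Tl0 by (rule order_tendstoD) (use \<eta> B in simp)
  then have ev1: "\<forall>\<^sub>F \<epsilon> in at_right 0. Tl (\<rho> \<epsilon>) < \<eta> / (2 * (B + 1))"
    using \<rho>_top by (rule eventually_compose_filterlim)
  have ev2: "\<forall>\<^sub>F \<epsilon> in at_right 0. 1 \<le> \<rho> \<epsilon>"
    using \<rho>_top by (simp add: filterlim_at_top)
  show ?thesis
    using ev1 ev2 eventually_at_right_less[of 0]
  proof eventually_elim
    fix \<epsilon> :: real assume t1: "Tl (\<rho> \<epsilon>) < \<eta> / (2 * (B + 1))" and R: "1 \<le> \<rho> \<epsilon>" and \<epsilon>: "0 < \<epsilon>"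
    define S where "S t x = reg_log_nonlin lam \<epsilon> (u t x) - reg_log_nonlin lam 0 (u t x)" for t x
    have [measurable]: "(\<lambda>t. (L2_norm (S t))\<^sup>2) \<in> borel_measurable borel"
      unfolding L2_norm_square S_def by measurable
    define E1 where "E1 = l * (16 * \<epsilon>\<^sup>2 * (6 * \<rho> \<epsilon>) ^ DIM('a))"
    define E2 where "E2 = l * (16 / \<rho> \<epsilon> ^ 4)"
    have ib: "integrable lborel (\<lambda>t. indicator {0..T} t * E1 + E2 * (indicator {0..T} t * tail (\<rho> \<epsilon>) (u t)))"
      using T by (intro Bochner_Integration.integrable_add integrable_mult_left integrable_mult_right integrable_real_indicator itail) auto
    have le: "AE t in lborel. indicator {0..T} t *\<^sub>R (L2_norm (S t))\<^sup>2 \<le>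
        indicator {0..T} t * E1 + E2 * (indicator {0..T} t * tail (\<rho> \<epsilon>) (u t))"
      using u
    proof eventually_elim
      fix t assume *: "t \<in> {0..T} \<longrightarrow> u t \<in> L22 \<and> L22_norm (u t) \<le> K"
      show "indicator {0..T} t *\<^sub>R (L2_norm (S t))\<^sup>2 \<le>
        indicator {0..T} t * E1 + E2 * (indicator {0..T} t * tail (\<rho> \<epsilon>) (u t))"
      proof (cases "t \<in> {0..T}")
        case True
        then have "u t \<in> L22" using * by auto
        from regularisation_error_L2(2)[OF dim this \<epsilon> R, of lam]
        have "(L2_norm (S t))\<^sup>2 \<le> E1 + E2 * tail (\<rho> \<epsilon>) (u t)"
          unfolding S_def[abs_def] l_def[symmetric] E1_def E2_def by (simp only: distrib_left mult.assoc)
        then show ?thesis using True by simp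
      qed simp
    qed
    have "(LINT t:{0..T}|lborel. (L2_norm (S t))\<^sup>2) \<le> (\<integral>t. indicator {0..T} t * E1 + E2 * (indicator {0..T} t * tail (\<rho> \<epsilon>) (u t)) \<partial>lborel)"
      unfolding set_lebesgue_integral_def
    proof (rule integral_mono_AE[OF _ ib le])
      show "integrable lborel (\<lambda>t. indicator {0..T} t *\<^sub>R (L2_norm (S t))\<^sup>2)"
        by (rule Bochner_Integration.integrable_bound[OF ib]) (use le in \<open>auto elim!: eventually_mono intro: order_trans[OF _ abs_ge_self]\<close>)
    qed
    also have "\<dots> = T * E1 + E2 * Tl (\<rho> \<epsilon>)"
      using T itail by (subst Bochner_Integration.integral_add) (auto simp: Tl_def intro!: integrable_mult_left integrable_real_indicator)
    also have "T * E1 = A * \<theta> ^ DIM('a) * \<epsilon> powr \<gamma>"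
    proof -
      define p where "p = (\<epsilon> powr (- (2 / (4 + d)))) ^ DIM('a)"
      have "p = \<epsilon> powr (- (2 / (4 + d)) * d)"
        unfolding p_def using \<epsilon> by (simp add: d_def powr_powr flip: powr_realpow)
      moreover have "\<epsilon>\<^sup>2 = \<epsilon> powr 2" using \<epsilon> by simp
      moreover have "\<epsilon> powr 2 * \<epsilon> powr (- (2 / (4 + d)) * d) = \<epsilon> powr \<gamma>"
        unfolding powr_add[symmetric] \<gamma>_def using d by (intro arg_cong[where f="\<lambda>z. \<epsilon> powr z"]) (simp add: field_simps)
      ultimately have ep: "\<epsilon>\<^sup>2 * p = \<epsilon> powr \<gamma>" by (simp only:)
      have "(6 * \<rho> \<epsilon>) ^ DIM('a) = 6 ^ DIM('a) * \<theta> ^ DIM('a) * p" by (simp add: \<rho>_def p_def power_mult_distrib)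
      then have "\<epsilon>\<^sup>2 * (6 * \<rho> \<epsilon>) ^ DIM('a) = 6 ^ DIM('a) * \<theta> ^ DIM('a) * (\<epsilon>\<^sup>2 * p)" by simp
      then have "\<epsilon>\<^sup>2 * (6 * \<rho> \<epsilon>) ^ DIM('a) = 6 ^ DIM('a) * \<theta> ^ DIM('a) * \<epsilon> powr \<gamma>" unfolding ep .
      then have "T * (l * 16) * (\<epsilon>\<^sup>2 * (6 * \<rho> \<epsilon>) ^ DIM('a)) = T * (l * 16) * (6 ^ DIM('a) * \<theta> ^ DIM('a) * \<epsilon> powr \<gamma>)"
        by (simp only:)
      then show ?thesis by (simp only: A_def E1_def mult.assoc mult.commute mult.left_commute)
    qed
    also have "E2 = B * \<epsilon> powr \<gamma>"
    proof -
      have "(\<epsilon> powr (- (2 / (4 + d)))) ^ 4 = \<epsilon> powr (- \<gamma>)"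
        using \<epsilon> d by (simp add: powr_powr \<gamma>_def flip: powr_realpow)
      then have "1 / \<rho> \<epsilon> ^ 4 = \<epsilon> powr \<gamma> / \<theta> ^ 4" by (simp add: \<rho>_def power_mult_distrib powr_minus field_simps)
      then have "l * 16 * (1 / \<rho> \<epsilon> ^ 4) = l * 16 * (\<epsilon> powr \<gamma> / \<theta> ^ 4)" by (simp only:)
      then show ?thesis by (simp add: B_def E2_def)
    qed
    also have "A * \<theta> ^ DIM('a) * \<epsilon> powr \<gamma> + B * \<epsilon> powr \<gamma> * Tl (\<rho> \<epsilon>) \<le> \<eta> / 2 * \<epsilon> powr \<gamma> + \<eta> / 2 * \<epsilon> powr \<gamma>"
    proof (intro add_mono)
      have "\<theta> ^ DIM('a) \<le> \<theta>" using \<theta> DIM_positive[where 'a='a] power_decreasing[of 1 "DIM('a)" \<theta>] by simp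
      then have "A * \<theta> ^ DIM('a) \<le> A * \<theta>" using A by (intro mult_left_mono)
      then show "A * \<theta> ^ DIM('a) * \<epsilon> powr \<gamma> \<le> \<eta> / 2 * \<epsilon> powr \<gamma>" using \<theta>(3) by (intro mult_right_mono) auto
      have "B * Tl (\<rho> \<epsilon>) \<le> B * (\<eta> / (2 * (B + 1)))" using t1 B by (intro mult_left_mono) auto
      also have "\<dots> \<le> (B + 1) * (\<eta> / (2 * (B + 1)))" using \<eta> B by (intro mult_right_mono) auto
      also have "\<dots> = \<eta> / 2" using B by (simp add: field_simps)
      finally have "B * Tl (\<rho> \<epsilon>) * \<epsilon> powr \<gamma> \<le> \<eta> / 2 * \<epsilon> powr \<gamma>" by (intro mult_right_mono) auto
      then show "B * \<epsilon> powr \<gamma> * Tl (\<rho> \<epsilon>) \<le> \<eta> / 2 * \<epsilon> powr \<gamma>" by (simp add: mult.assoc mult.commute mult.left_commute)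
    qed
    finally show "(LINT t:{0..T}|lborel. (L2_norm (\<lambda>x. reg_log_nonlin lam \<epsilon> (u t x) - reg_log_nonlin lam 0 (u t x)))\<^sup>2)
      \<le> \<eta> * \<epsilon> powr (8 / (4 + real DIM('a)))"
      by (simp add: S_def[abs_def] \<gamma>_def d_def algebra_simps)
  qed
qed

section \<open>Solutions of the logarithmic equations\<close>

lemma finite_deriv_lists: "finite (deriv_lists k :: 'a::euclidean_space list set)"
  using finite_lists_length_le[OF finite_Basis, of k] by (simp add: deriv_lists_def lists_eq_set Collect_conj_eq Int_commute)

lemma weak_derivD:
  assumes "v \<in> Sobolev k" "bs \<in> deriv_lists k"
  shows "weak_deriv bs v \<in> L2" "has_weak_deriv v bs (weak_deriv bs v)" "L2_norm (weak_deriv bs v) \<le> Sobolev_norm k v"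
proof -
  have "\<exists>g. g \<in> L2 \<and> has_weak_deriv v bs g" using assms by (auto simp: Sobolev_def)
  from someI_ex[OF this] show "weak_deriv bs v \<in> L2" "has_weak_deriv v bs (weak_deriv bs v)"
    by (auto simp: weak_deriv_def)
  have "(L2_norm (weak_deriv bs v))\<^sup>2 \<le> (\<Sum>bs\<in>deriv_lists k. (L2_norm (weak_deriv bs v))\<^sup>2)"
    by (rule member_le_sum[OF assms(2)]) (auto simp: finite_deriv_lists)
  then show "L2_norm (weak_deriv bs v) \<le> Sobolev_norm k v"
    unfolding Sobolev_norm_def by (rule real_le_rsqrt)
qed

lemma translation_Lipschitz_mono: "translation_Lipschitz v M \<Longrightarrow> M \<le> M' \<Longrightarrow> translation_Lipschitz v M'"
  unfolding translation_Lipschitz_def by (meson mult_left_mono norm_ge_zero order_trans)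

lemma Sobolev_2_regularity:
  fixes v :: "'a::euclidean_space \<Rightarrow> complex"
  assumes v: "v \<in> Sobolev 2"
  shows "b \<in> Basis \<Longrightarrow> has_partial v b (weak_deriv [b] v)"
    "b \<in> Basis \<Longrightarrow> has_partial (weak_deriv [b] v) b (weak_deriv [b, b] v)"
    "has_laplacian v (\<lambda>x. \<Sum>b\<in>Basis. weak_deriv [b, b] v x)"
    "L2_norm (\<lambda>x. \<Sum>b\<in>Basis. weak_deriv [b, b] v x) \<le> real DIM('a) * Sobolev_norm 2 v"
    "translation_Lipschitz v (real DIM('a) * Sobolev_norm 2 v)"
proof -
  have v2: "v \<in> L2" using v by (simp add: Sobolev_def)
  have in1: "[b] \<in> deriv_lists 2" "[b, b] \<in> deriv_lists 2" if "b \<in> Basis" for b :: 'a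
    using that by (auto simp: deriv_lists_def)
  note d1 = weak_derivD[OF v in1(1)] and d2 = weak_derivD[OF v in1(2)]
  show p1: "has_partial v b (weak_deriv [b] v)" if "b \<in> Basis" for b
    by (rule has_partial_of_weak_deriv[OF v2 d1(1,2)[OF that]])
  show "has_partial (weak_deriv [b] v) b (weak_deriv [b, b] v)" if "b \<in> Basis" for b
    by (rule has_partial_of_second_weak_deriv[OF p1[OF that] d2(1,2)[OF that]])
  have L: "(\<lambda>x. \<Sum>b\<in>Basis. weak_deriv [b, b] v x) \<in> L2" by (intro L2_sum d2(1))
  have "pairing v (laplacian \<phi>) = pairing (\<lambda>x. \<Sum>b\<in>Basis. weak_deriv [b, b] v x) \<phi>" if \<phi>: "\<phi> \<in> bumps" for \<phi>
  proof -
    have "pairing v (laplacian \<phi>) = (\<Sum>b\<in>Basis. pairing v (iter_deriv [b, b] \<phi>))"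
      unfolding pairing_commute[of v] laplacian_def[abs_def]
      by (rule pairing_sum_left[OF _ v2]) (rule bumps_L2[OF bumps_iter_deriv[OF \<phi>]])
    also have "\<dots> = (\<Sum>b\<in>Basis. pairing (weak_deriv [b, b] v) \<phi>)"
      using has_weak_deriv_pairing[OF d2(2) \<phi>] by (intro sum.cong) simp_all
    finally show ?thesis using pairing_sum_left[of Basis "\<lambda>b. weak_deriv [b, b] v" \<phi>] d2(1) bumps_L2[OF \<phi>] by simp
  qed
  then show "has_laplacian v (\<lambda>x. \<Sum>b\<in>Basis. weak_deriv [b, b] v x)" using v2 L by (simp add: has_laplacian_def)
  have sn: "L2_norm (\<lambda>x. \<Sum>b\<in>B. weak_deriv [b, b] v x) \<le> (\<Sum>b\<in>B. L2_norm (weak_deriv [b, b] v))" if "B \<subseteq> Basis" for B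
    using finite_subset[OF that finite_Basis] that
  proof (induction B)
    case (insert b B)
    have "L2_norm (\<lambda>x. weak_deriv [b, b] v x + (\<Sum>b\<in>B. weak_deriv [b, b] v x)) \<le> L2_norm (weak_deriv [b, b] v) + L2_norm (\<lambda>x. \<Sum>b\<in>B. weak_deriv [b, b] v x)"
      using insert.prems by (intro L2_norm_triangle L2_sum d2(1)) auto
    then show ?case using insert by simp
  qed simp
  have "(\<Sum>b\<in>Basis. L2_norm (weak_deriv [b, b] v)) \<le> (\<Sum>b\<in>(Basis::'a set). Sobolev_norm 2 v)"
    by (intro sum_mono d2(3))
  then show "L2_norm (\<lambda>x. \<Sum>b\<in>Basis. weak_deriv [b, b] v x) \<le> real DIM('a) * Sobolev_norm 2 v"
    using sn[OF order_refl] by simp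
  have "(\<Sum>b\<in>Basis. L2_norm (weak_deriv [b] v)) \<le> (\<Sum>b\<in>(Basis::'a set). Sobolev_norm 2 v)"
    by (intro sum_mono d1(3))
  then have le: "(\<Sum>b\<in>Basis. L2_norm (weak_deriv [b] v)) \<le> real DIM('a) * Sobolev_norm 2 v" by simp
  have "translation_Lipschitz v (\<Sum>b\<in>Basis. L2_norm (weak_deriv [b] v))"
    by (rule translation_Lipschitz_of_partials) (rule p1)
  then show "translation_Lipschitz v (real DIM('a) * Sobolev_norm 2 v)"
    by (rule translation_Lipschitz_mono[OF _ le])
qed

lemma translation_Lipschitz_diff:
  assumes v: "translation_Lipschitz v M" and u: "translation_Lipschitz u M'"
  shows "translation_Lipschitz (\<lambda>x. v x - u x) (M + M')"
  unfolding translation_Lipschitz_def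
proof (intro conjI allI)
  have v2: "v \<in> L2" "u \<in> L2" using v u by (auto simp: translation_Lipschitz_def)
  then show "(\<lambda>x. v x - u x) \<in> L2" by (intro L2_diff)
  fix y
  have "L2_norm (\<lambda>x. (v (x + y) - v x) - (u (x + y) - u x)) \<le> L2_norm (\<lambda>x. v (x + y) - v x) + L2_norm (\<lambda>x. u (x + y) - u x)"
    by (intro L2_norm_triangle_diff L2_diff L2_translate v2)
  also have "\<dots> \<le> norm y * M + norm y * M'"
    using v u by (intro add_mono) (auto simp: translation_Lipschitz_def)
  finally show "L2_norm (\<lambda>x. v (x + y) - u (x + y) - (v x - u x)) \<le> norm y * (M + M')"
    by (simp add: algebra_simps)
qed

definition regular_slice :: "real \<Rightarrow> ('a::euclidean_space \<Rightarrow> complex) \<Rightarrow> bool" where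
  "regular_slice K v \<longleftrightarrow> v \<in> Sobolev 2 \<and> v \<in> L22 \<and> Sobolev_norm 2 v \<le> K \<and> L22_norm v \<le> K"

lemma L22_norm_nonneg: "0 \<le> L22_norm v"
  by (simp add: L22_norm_def)

lemma Sobolev_norm_nonneg: "0 \<le> Sobolev_norm k v"
  by (simp add: Sobolev_norm_def sum_nonneg)

lemma AE_regular_slice:
  fixes v :: "real \<Rightarrow> 'a::euclidean_space \<Rightarrow> complex"
  assumes v: "Linf_loc_H2_L22 v" and T: "0 < T"
  obtains K where "0 \<le> K" "AE t in lborel. t \<in> {0..T} \<longrightarrow> regular_slice K (v t)"
proof -
  define I where "I = {- (T + 1)<..<T + 1}"
  define N where "N w = Sobolev_norm 2 w + L22_norm w" for w :: "'a \<Rightarrow> complex"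
  have T1: "0 < T + 1" using T by simp
  have fin: "Linf_norm I (Sobolev 2 \<inter> L22) N v < \<infinity>"
    using v[unfolded Linf_loc_H2_L22_def, THEN conjunct2, rule_format, OF T1] unfolding I_def N_def[abs_def] .
  then have ae: "AE t in lebesgue_on I. v t \<in> Sobolev 2 \<inter> L22"
    by (auto simp: Linf_norm_def split: if_splits)
  then have "esssup (lebesgue_on I) (\<lambda>t. ereal (N (v t))) < \<infinity>" using fin by (simp add: Linf_norm_def)
  then obtain n :: nat where n: "esssup (lebesgue_on I) (\<lambda>t. ereal (N (v t))) < ereal (real n)"
    using less_PInf_Ex_of_nat by auto
  have "AE t in lebesgue_on I. v t \<in> Sobolev 2 \<inter> L22 \<and> ereal (N (v t)) \<le> ereal (real n)"
    using ae esssup_AE[of "\<lambda>t. ereal (N (v t))" "lebesgue_on I"]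
  proof eventually_elim
    fix t assume "v t \<in> Sobolev 2 \<inter> L22" and le: "ereal (N (v t)) \<le> esssup (lebesgue_on I) (\<lambda>t. ereal (N (v t)))"
    then show "v t \<in> Sobolev 2 \<inter> L22 \<and> ereal (N (v t)) \<le> ereal (real n)"
      using less_imp_le[OF le_less_trans[OF le n]] by blast
  qed
  then have "AE t in lebesgue. t \<in> I \<longrightarrow> v t \<in> Sobolev 2 \<inter> L22 \<and> N (v t) \<le> real n"
    by (subst (asm) AE_restrict_space_iff) (auto simp: I_def)
  then have a: "AE t in lborel. t \<in> I \<longrightarrow> v t \<in> Sobolev 2 \<inter> L22 \<and> N (v t) \<le> real n"
    by (simp add: AE_completion_iff)
  show ?thesis
  proof (rule that[of "real n"])
    show "AE t in lborel. t \<in> {0..T} \<longrightarrow> regular_slice (real n) (v t)"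
      using a
    proof eventually_elim
      fix t assume *: "t \<in> I \<longrightarrow> v t \<in> Sobolev 2 \<inter> L22 \<and> N (v t) \<le> real n"
      show "t \<in> {0..T} \<longrightarrow> regular_slice (real n) (v t)"
        using * Sobolev_norm_nonneg[of 2 "v t"] L22_norm_nonneg[of "v t"]
        by (auto simp: regular_slice_def I_def N_def)
    qed
  qed simp
qed

text \<open>Of the two terms of \<open>reg_log_nonlin_bound\<close>, the first one is in \<open>L2\<close> by the logarithmic Sobolev inequality, and the second one because
  functions in \<open>L22\<close> are integrable, so that their square roots are in \<open>L2\<close>.\<close>

lemma reg_log_nonlin_L2:
  assumes dim: "DIM('a::euclidean_space) \<le> 3" and K: "0 \<le> K" and \<epsilon>: "0 \<le> \<epsilon>"
  obtains C where "0 \<le> C" "\<And>v :: 'a \<Rightarrow> complex. regular_slice K v \<Longrightarrow> L2_norm v \<le> K \<Longrightarrow>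
    (\<lambda>x. reg_log_nonlin lam \<epsilon> (v x)) \<in> L2 \<and> L2_norm (\<lambda>x. reg_log_nonlin lam \<epsilon> (v x)) \<le> C"
proof -
  have K1: "1 \<le> max 1 K" by simp
  obtain C1 where C1: "0 \<le> C1" "\<And>(f :: 'a \<Rightarrow> complex) M. translation_Lipschitz f M \<Longrightarrow> 0 \<le> M \<Longrightarrow> L2_norm f \<le> max 1 K \<Longrightarrow>
      (\<lambda>x. of_real (times_log (f x))) \<in> L2 \<and> L2_norm (\<lambda>x. of_real (times_log (f x))) \<le> C1 * (1 + M)"
    using log_Sobolev[OF dim K1] by blast
  define a where "a = 2 * \<bar>lam\<bar>" define b where "b = 4 * \<bar>lam\<bar> * (1 + sqrt \<epsilon>)"
  have ab: "0 \<le> a" "0 \<le> b" using \<epsilon> by (auto simp: a_def b_def)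
  define D where "D = sqrt (6 ^ DIM('a) + 4 * K\<^sup>2)"
  define C where "C = a * (C1 * (1 + real DIM('a) * K)) + b * D"
  have D: "0 \<le> D" by (simp add: D_def)
  show ?thesis
  proof (rule that[of C])
    show "0 \<le> C" using ab C1(1) K D by (simp add: C_def)
    fix v :: "'a \<Rightarrow> complex" assume v: "regular_slice K v" and vK: "L2_norm v \<le> K"
    have vS: "v \<in> Sobolev 2" and vL: "v \<in> L22" and n: "Sobolev_norm 2 v \<le> K" "L22_norm v \<le> K"
      using v by (auto simp: regular_slice_def)
    have "translation_Lipschitz v (real DIM('a) * K)"
      by (rule translation_Lipschitz_mono[OF Sobolev_2_regularity(5)[OF vS]]) (intro mult_left_mono n, simp)
    from C1(2)[OF this] K vK
    have t: "(\<lambda>x. complex_of_real (times_log (v x))) \<in> L2" "L2_norm (\<lambda>x. complex_of_real (times_log (v x))) \<le> C1 * (1 + real DIM('a) * K)" by auto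
    have s: "(\<lambda>x. complex_of_real (sqrt (cmod (v x)))) \<in> L2" "L2_norm (\<lambda>x. complex_of_real (sqrt (cmod (v x)))) \<le> D"
    proof -
      show "(\<lambda>x. complex_of_real (sqrt (cmod (v x)))) \<in> L2" by (rule sqrt_norm_L2(1)[OF dim vL])
      have "(L22_norm v)\<^sup>2 \<le> K\<^sup>2" using n(2) by (intro power_mono) (auto simp: L22_norm_def)
      then have "(L2_norm (\<lambda>x. complex_of_real (sqrt (cmod (v x)))))\<^sup>2 \<le> 6 ^ DIM('a) + 4 * K\<^sup>2"
        using sqrt_norm_L2(2)[OF dim vL] by linarith
      then show "L2_norm (\<lambda>x. complex_of_real (sqrt (cmod (v x)))) \<le> D" unfolding D_def by (rule real_le_rsqrt)
    qed
    define g where "g x = of_real a * complex_of_real (times_log (v x)) + of_real b * complex_of_real (sqrt (cmod (v x)))" for x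
    have g: "g \<in> L2" unfolding g_def[abs_def] by (intro L2_add L2_scale t s)
    have "L2_norm g \<le> a * L2_norm (\<lambda>x. complex_of_real (times_log (v x))) + b * L2_norm (\<lambda>x. complex_of_real (sqrt (cmod (v x))))"
      unfolding g_def[abs_def] using L2_norm_triangle[OF L2_scale[OF t(1), of "of_real a"] L2_scale[OF s(1), of "of_real b"]] ab
      by (simp add: L2_norm_scale)
    also have "\<dots> \<le> C" unfolding C_def by (intro add_mono mult_left_mono t s ab)
    finally have gC: "L2_norm g \<le> C" .
    have le: "cmod (reg_log_nonlin lam \<epsilon> (v x)) \<le> cmod (g x)" for x
    proof -
      have "g x = of_real (a * times_log (v x) + b * sqrt (cmod (v x)))" by (simp add: g_def)
      then have "cmod (g x) = a * times_log (v x) + b * sqrt (cmod (v x))"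
        using ab times_log_nonneg[of "v x"] by (simp only: norm_of_real) simp
      then show ?thesis using reg_log_nonlin_bound[OF \<epsilon>, of lam "v x"] by (simp add: a_def b_def)
    qed
    note [measurable] = L2_measurable[OF L22_integrable(1)[OF vL]]
    have m: "(\<lambda>x. reg_log_nonlin lam \<epsilon> (v x)) \<in> borel_measurable borel" by measurable
    from L2I_bound[OF m g AE_I2[OF le]] gC
    show "(\<lambda>x. reg_log_nonlin lam \<epsilon> (v x)) \<in> L2 \<and> L2_norm (\<lambda>x. reg_log_nonlin lam \<epsilon> (v x)) \<le> C" by auto
  qed
qed

text \<open>The facts about a solution that the estimates use. A single constant serves for all bounds; for the regularised solutions it may
  depend on \<open>\<epsilon>\<close>.\<close>

definition NLS_on :: "real \<Rightarrow> real \<Rightarrow> real \<Rightarrow> real \<Rightarrow> (real \<Rightarrow> 'a::euclidean_space \<Rightarrow> complex) \<Rightarrow> bool" where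
  "NLS_on lam \<epsilon> T K v \<longleftrightarrow> continuous_into_L2 {0..} v \<and> evolves T v (\<lambda>t x. reg_log_nonlin lam \<epsilon> (v t x)) \<and>
     L2_bounded_on {0..T} v K \<and> L2_bounded_on {0..T} (\<lambda>t x. reg_log_nonlin lam \<epsilon> (v t x)) K \<and>
     (\<forall>t\<in>{0..T}. translation_Lipschitz (v t) K) \<and>
     (AE t in lborel. t \<in> {0..T} \<longrightarrow> regular_slice K (v t))"

text \<open>The nonlinearity is bounded in \<open>L2\<close> on every bounded time interval, which admits the passage from the distributional equation to its
  integrated form. The Lipschitz dependence on translations extends from almost all times to all times by continuity.\<close>

lemma NLS_on_if_NLS_solution:
  fixes v :: "real \<Rightarrow> 'a::euclidean_space \<Rightarrow> complex"
  assumes dim: "DIM('a) \<le> 3" and \<epsilon>: "0 \<le> \<epsilon>" and sol: "NLS_solution (reg_log_nonlin lam \<epsilon>) u0 v" and T: "0 < T"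
  obtains K where "NLS_on lam \<epsilon> T K v"
proof -
  have loc: "Linf_loc_H2_L22 v" and cont: "continuous_into_L2 {0..} v" and solves: "solves_NLS (reg_log_nonlin lam \<epsilon>) v"
    using sol by (auto simp: NLS_solution_def)
  have mv: "(\<lambda>(t, x). v t x) \<in> borel_measurable borel" using loc by (simp add: Linf_loc_H2_L22_def)
  have mF: "(\<lambda>(t, x). reg_log_nonlin lam \<epsilon> (v t x)) \<in> borel_measurable borel"
    using measurable_compose[OF mv reg_log_nonlin_measurable[of lam \<epsilon>]] by (simp add: split_beta')
  have b: "\<exists>K. 0 \<le> K \<and> L2_bounded_on {0..S} v K \<and> L2_bounded_on {0..S} (\<lambda>t x. reg_log_nonlin lam \<epsilon> (v t x)) K \<and>
      (AE t in lborel. t \<in> {0..S} \<longrightarrow> regular_slice K (v t))" if S: "0 < S" for S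
  proof -
    obtain K1 where K1: "L2_bounded_on {0..S} v K1" using L2_bounded_on_of_continuous[OF cont mv] by blast
    obtain K2 where K2: "0 \<le> K2" "AE t in lborel. t \<in> {0..S} \<longrightarrow> regular_slice K2 (v t)"
      using AE_regular_slice[OF loc S] by blast
    define K3 where "K3 = max K1 K2"
    have K3: "0 \<le> K3" using K2(1) by (simp add: K3_def)
    obtain C where C: "0 \<le> C" "\<And>v :: 'a \<Rightarrow> complex. regular_slice K3 v \<Longrightarrow> L2_norm v \<le> K3 \<Longrightarrow>
      (\<lambda>x. reg_log_nonlin lam \<epsilon> (v x)) \<in> L2 \<and> L2_norm (\<lambda>x. reg_log_nonlin lam \<epsilon> (v x)) \<le> C"
      using reg_log_nonlin_L2[OF dim K3 \<epsilon>] by blast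
    have k3: "K2 \<le> K3" by (simp add: K3_def)
    have slice: "AE t in lborel. t \<in> {0..S} \<longrightarrow> regular_slice K (v t)" if "K2 \<le> K" for K
      using K2(2) by eventually_elim (use that in \<open>auto simp: regular_slice_def\<close>)
    have "L2_bounded_on {0..S} (\<lambda>t x. reg_log_nonlin lam \<epsilon> (v t x)) C"
      unfolding L2_bounded_on_def
    proof (intro conjI mF C(1))
      show "AE t in lborel. t \<in> {0..S} \<longrightarrow> (\<lambda>x. reg_log_nonlin lam \<epsilon> (v t x)) \<in> L2 \<and> L2_norm (\<lambda>x. reg_log_nonlin lam \<epsilon> (v t x)) \<le> C"
        using slice[OF k3] L2_bounded_onD(4)[OF K1]
        by eventually_elim (use C(2) in \<open>auto simp: K3_def intro: order_trans\<close>)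
    qed
    then show ?thesis
      using K1 slice[OF order_trans[OF k3 max.cobounded1], of C] K3
      by (intro exI[of _ "max K3 C"]) (auto simp: K3_def intro: L2_bounded_on_mono)
  qed
  have b': "\<exists>K. L2_bounded_on {0..S} v K" "\<exists>K. L2_bounded_on {0..S} (\<lambda>t x. reg_log_nonlin lam \<epsilon> (v t x)) K" for S
    using b[of "max S 1"] L2_bounded_on_mono[of "{0..max S 1}" _ _ "{0..S}"] by fastforce+
  have ev: "evolves T v (\<lambda>t x. reg_log_nonlin lam \<epsilon> (v t x))"
    by (rule evolves_if_solves_NLS[OF solves cont b'])
  obtain K where K: "0 \<le> K" "L2_bounded_on {0..T} v K" "L2_bounded_on {0..T} (\<lambda>t x. reg_log_nonlin lam \<epsilon> (v t x)) K"
      "AE t in lborel. t \<in> {0..T} \<longrightarrow> regular_slice K (v t)" using b[OF T] by blast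
  define K' where "K' = real DIM('a) * K"
  have "1 \<le> real DIM('a)" using DIM_positive[where 'a='a] by linarith
  then have KK: "K \<le> K'" unfolding K'_def using K(1) mult_right_mono[of 1 "real DIM('a)" K] by simp
  have "AE t in lborel. t \<in> {0<..<T} \<longrightarrow> translation_Lipschitz (v t) K'"
    using K(4)
  proof eventually_elim
    fix t assume *: "t \<in> {0..T} \<longrightarrow> regular_slice K (v t)"
    show "t \<in> {0<..<T} \<longrightarrow> translation_Lipschitz (v t) K'"
    proof
      assume "t \<in> {0<..<T}"
      then have "v t \<in> Sobolev 2" "Sobolev_norm 2 (v t) \<le> K" using * by (auto simp: regular_slice_def)
      then show "translation_Lipschitz (v t) K'" unfolding K'_def
        by (intro translation_Lipschitz_mono[OF Sobolev_2_regularity(5)] mult_left_mono) auto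
    qed
  qed
  then have lip: "translation_Lipschitz (v t) K'" if "t \<in> {0..T}" for t
    by (rule translation_Lipschitz_everywhere[OF cont _ T that])
  have "AE t in lborel. t \<in> {0..T} \<longrightarrow> regular_slice K' (v t)"
    using K(4) by eventually_elim (use KK in \<open>auto simp: regular_slice_def\<close>)
  then have "NLS_on lam \<epsilon> T K' v"
    unfolding NLS_on_def using cont ev lip L2_bounded_on_mono[OF K(2) order_refl KK] L2_bounded_on_mono[OF K(3) order_refl KK] by blast
  then show ?thesis by (rule that)
qed

lemma continuous_into_L2_diff:
  assumes v: "continuous_into_L2 {0..} v" and u: "continuous_into_L2 {0..} u"
  shows "continuous_into_L2 {0..} (\<lambda>t x. v t x - u t x)"
  unfolding continuous_into_L2_def
proof (intro conjI ballI)
  fix t :: real assume t: "t \<in> {0..}"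
  show "(\<lambda>x. v t x - u t x) \<in> L2" using t continuous_into_L2D(1)[OF v] continuous_into_L2D(1)[OF u] by auto
  show "((\<lambda>s. L2_norm (\<lambda>x. v s x - u s x - (v t x - u t x))) \<longlongrightarrow> 0) (at t within {0..})"
  proof (rule Lim_null_comparison)
    show "\<forall>\<^sub>F s in at t within {0..}. norm (L2_norm (\<lambda>x. v s x - u s x - (v t x - u t x))) \<le> L2_norm (\<lambda>x. v s x - v t x) + L2_norm (\<lambda>x. u s x - u t x)"
      unfolding eventually_at_filter
    proof (rule always_eventually, intro allI impI)
      fix s :: real assume s: "s \<in> {0..}"
      have "L2_norm (\<lambda>x. (v s x - v t x) - (u s x - u t x)) \<le> L2_norm (\<lambda>x. v s x - v t x) + L2_norm (\<lambda>x. u s x - u t x)"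
        using s t by (intro L2_norm_triangle_diff L2_diff continuous_into_L2D(1)[OF v] continuous_into_L2D(1)[OF u]) auto
      then show "norm (L2_norm (\<lambda>x. v s x - u s x - (v t x - u t x))) \<le> L2_norm (\<lambda>x. v s x - v t x) + L2_norm (\<lambda>x. u s x - u t x)"
        by (simp add: algebra_simps)
    qed
    show "((\<lambda>s. L2_norm (\<lambda>x. v s x - v t x) + L2_norm (\<lambda>x. u s x - u t x)) \<longlongrightarrow> 0) (at t within {0..})"
    proof -
      have t0: "0 \<le> t" using t by simp
      show ?thesis using tendsto_add[OF continuous_into_L2D(2)[OF v t0] continuous_into_L2D(2)[OF u t0]] by simp
    qed
  qed
qed

lemma L2_bounded_on_diff:
  assumes v: "L2_bounded_on I v K" and u: "L2_bounded_on I u K'"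
  shows "L2_bounded_on I (\<lambda>t x. v t x - u t x) (K + K')"
  unfolding L2_bounded_on_def
proof (intro conjI)
  note [measurable] = L2_bounded_onD(2)[OF v] L2_bounded_onD(2)[OF u]
  show "(\<lambda>(t, x). v t x - u t x) \<in> borel_measurable borel" unfolding borel_prod[symmetric] by measurable
  show "0 \<le> K + K'" using L2_bounded_onD(3)[OF v] L2_bounded_onD(3)[OF u] by simp
  show "AE t in lborel. t \<in> I \<longrightarrow> (\<lambda>x. v t x - u t x) \<in> L2 \<and> L2_norm (\<lambda>x. v t x - u t x) \<le> K + K'"
    using L2_bounded_onD(4)[OF v] L2_bounded_onD(4)[OF u]
  proof eventually_elim
    fix t assume *: "t \<in> I \<longrightarrow> v t \<in> L2 \<and> L2_norm (v t) \<le> K" "t \<in> I \<longrightarrow> u t \<in> L2 \<and> L2_norm (u t) \<le> K'"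
    show "t \<in> I \<longrightarrow> (\<lambda>x. v t x - u t x) \<in> L2 \<and> L2_norm (\<lambda>x. v t x - u t x) \<le> K + K'"
      using * L2_norm_triangle_diff[of "v t" "u t"] by auto
  qed
qed

lemma evolves_diff:
  fixes v u :: "real \<Rightarrow> 'a::euclidean_space \<Rightarrow> complex"
  assumes v: "evolves T v G" "continuous_into_L2 {0..} v" "L2_bounded_on {0..T} v K" "L2_bounded_on {0..T} G L"
    and u: "evolves T u G'" "continuous_into_L2 {0..} u" "L2_bounded_on {0..T} u K'" "L2_bounded_on {0..T} G' L'"
  shows "evolves T (\<lambda>t x. v t x - u t x) (\<lambda>t x. G t x - G' t x)"
  unfolding evolves_def
proof (intro ballI allI impI)
  fix \<phi> :: "'a \<Rightarrow> complex" and s t :: real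
  assume \<phi>: "\<phi> \<in> bumps" and s: "0 < s" and st: "s < t" and tT: "t \<le> T"
  have \<phi>2: "\<phi> \<in> L2" and l\<phi>2: "laplacian \<phi> \<in> L2" by (intro bumps_L2 laplacian_bumps \<phi>)+
  note V = evolvesD[OF v \<phi> less_imp_le[OF s] less_imp_le[OF st] tT] and U = evolvesD[OF u \<phi> less_imp_le[OF s] less_imp_le[OF st] tT]
  have st0: "0 \<le> s" "0 \<le> t" using s st by auto
  have sub: "{s..t} \<subseteq> {0..T}" using s tT by auto
  define D where "D \<tau> = \<i> * pairing (\<lambda>x. v \<tau> x - u \<tau> x) (laplacian \<phi>) - \<i> * pairing (\<lambda>x. G \<tau> x - G' \<tau> x) \<phi>" for \<tau>
  define E where "E \<tau> = (\<i> * pairing (v \<tau>) (laplacian \<phi>) - \<i> * pairing (G \<tau>) \<phi>) - (\<i> * pairing (u \<tau>) (laplacian \<phi>) - \<i> * pairing (G' \<tau>) \<phi>)" for \<tau>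
  have iE: "set_integrable lborel {s..t} E" unfolding E_def by (rule set_integral_diff(1)[OF V(1) U(1)])
  note bd = L2_bounded_on_mono[OF L2_bounded_on_diff[OF v(3) u(3)] sub order_refl] L2_bounded_on_mono[OF L2_bounded_on_diff[OF v(4) u(4)] sub order_refl]
  have iD: "set_integrable lborel {s..t} D" unfolding D_def
    using pairing_set_integrable[OF bd(1) less_imp_le[OF st] l\<phi>2] pairing_set_integrable[OF bd(2) less_imp_le[OF st] \<phi>2]
    by (intro set_integral_diff(1) set_integrable_mult_right) auto
  have "(LINT \<tau>:{s..t}|lborel. D \<tau>) = (LINT \<tau>:{s..t}|lborel. E \<tau>)"
    unfolding set_lebesgue_integral_def
  proof (rule integral_cong_AE)
    show "(\<lambda>\<tau>. indicator {s..t} \<tau> *\<^sub>R D \<tau>) \<in> borel_measurable lborel" "(\<lambda>\<tau>. indicator {s..t} \<tau> *\<^sub>R E \<tau>) \<in> borel_measurable lborel"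
      using iD iE by (auto simp: set_integrable_def dest: borel_measurable_integrable)
    show "AE \<tau> in lborel. indicator {s..t} \<tau> *\<^sub>R D \<tau> = indicator {s..t} \<tau> *\<^sub>R E \<tau>"
      using L2_bounded_onD(4)[OF v(4)] L2_bounded_onD(4)[OF u(4)]
    proof eventually_elim
      fix \<tau> assume *: "\<tau> \<in> {0..T} \<longrightarrow> G \<tau> \<in> L2 \<and> L2_norm (G \<tau>) \<le> L" "\<tau> \<in> {0..T} \<longrightarrow> G' \<tau> \<in> L2 \<and> L2_norm (G' \<tau>) \<le> L'"
      show "indicator {s..t} \<tau> *\<^sub>R D \<tau> = indicator {s..t} \<tau> *\<^sub>R E \<tau>"
      proof (cases "\<tau> \<in> {s..t}")
        case True
        then have "\<tau> \<in> {0..T}" using sub by auto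
        then have L2: "G \<tau> \<in> L2" "G' \<tau> \<in> L2" "v \<tau> \<in> L2" "u \<tau> \<in> L2"
          using * continuous_into_L2D(1)[OF v(2)] continuous_into_L2D(1)[OF u(2)] by auto
        show ?thesis unfolding D_def E_def by (simp add: pairing_diff_left L2 \<phi>2 l\<phi>2 algebra_simps)
      qed simp
    qed
  qed
  also have "\<dots> = (pairing (v t) \<phi> - pairing (v s) \<phi>) - (pairing (u t) \<phi> - pairing (u s) \<phi>)"
    unfolding E_def V(2) U(2) by (rule set_integral_diff(2)[OF V(1) U(1)])
  also have "\<dots> = pairing (\<lambda>x. v t x - u t x) \<phi> - pairing (\<lambda>x. v s x - u s x) \<phi>"
    using continuous_into_L2D(1)[OF v(2)] continuous_into_L2D(1)[OF u(2)] st0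
    by (simp add: pairing_diff_left \<phi>2)
  finally show "pairing (\<lambda>x. v t x - u t x) \<phi> - pairing (\<lambda>x. v s x - u s x) \<phi>
       = (LINT \<tau>:{s..t}|lborel. \<i> * pairing (\<lambda>x. v \<tau> x - u \<tau> x) (laplacian \<phi>) - \<i> * pairing (\<lambda>x. G \<tau> x - G' \<tau> x) \<phi>)"
    by (simp add: D_def)
qed

text \<open>Lebesgue measure is translation invariant.\<close>

lemma AE_shift:
  assumes "AE t in lborel. P (t::real)" shows "AE t in lborel. P (t + h)"
proof -
  have "AE t in distr lborel borel ((+) h). P t" by (subst lborel_distr_plus) (rule assms)
  then have "AE t in lborel. P (h + t)" by (rule AE_distrD[rotated]) measurable
  then show ?thesis by (simp add: add.commute)
qed

lemma NLS_on_shift: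
  fixes v :: "real \<Rightarrow> 'a::euclidean_space \<Rightarrow> complex"
  assumes v: "NLS_on lam \<epsilon> (T + h) K v" and h: "0 \<le> h"
  shows "NLS_on lam \<epsilon> T K (\<lambda>t. v (t + h))"
proof -
  have c: "continuous_into_L2 {0..} v" and e: "evolves (T + h) v (\<lambda>t x. reg_log_nonlin lam \<epsilon> (v t x))"
    and b: "L2_bounded_on {0..T + h} v K" "L2_bounded_on {0..T + h} (\<lambda>t x. reg_log_nonlin lam \<epsilon> (v t x)) K"
    and l: "\<forall>t\<in>{0..T + h}. translation_Lipschitz (v t) K" and a: "AE t in lborel. t \<in> {0..T + h} \<longrightarrow> regular_slice K (v t)"
    using v by (auto simp: NLS_on_def)
  have sb: "L2_bounded_on {0..T} (\<lambda>t. w (t + h)) K" if w: "L2_bounded_on {0..T + h} w K" for w :: "real \<Rightarrow> 'a \<Rightarrow> complex"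
    unfolding L2_bounded_on_def
  proof (intro conjI)
    note [measurable] = L2_bounded_onD(2)[OF w]
    show "(\<lambda>(t, x). w (t + h) x) \<in> borel_measurable borel" unfolding borel_prod[symmetric] by measurable
    show "0 \<le> K" by (rule L2_bounded_onD(3)[OF w])
    show "AE t in lborel. t \<in> {0..T} \<longrightarrow> w (t + h) \<in> L2 \<and> L2_norm (w (t + h)) \<le> K"
      using AE_shift[OF L2_bounded_onD(4)[OF w], of h] by eventually_elim (use h in auto)
  qed
  have "continuous_into_L2 {0..} (\<lambda>t. v (t + h))"
    unfolding continuous_into_L2_def
  proof (intro conjI ballI)
    fix t :: real assume t: "t \<in> {0..}"
    show "v (t + h) \<in> L2" using t h continuous_into_L2D(1)[OF c] by auto
    have "((\<lambda>s. L2_norm (\<lambda>x. v s x - v (t + h) x)) \<longlongrightarrow> 0) (at (t + h) within {0..})"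
      using continuous_into_L2D(2)[OF c, of "t + h"] t h by simp
    then show "((\<lambda>s. L2_norm (\<lambda>x. v (s + h) x - v (t + h) x)) \<longlongrightarrow> 0) (at t within {0..})"
    proof (rule filterlim_compose)
      show "filterlim (\<lambda>s. s + h) (at (t + h) within {0..}) (at t within {0..})"
        unfolding filterlim_at using h by (auto intro!: tendsto_intros simp: eventually_at_filter)
    qed
  qed
  moreover have "evolves T (\<lambda>t. v (t + h)) (\<lambda>t x. reg_log_nonlin lam \<epsilon> (v (t + h) x))"
    unfolding evolves_def
  proof (intro ballI allI impI)
    fix \<phi> :: "'a \<Rightarrow> complex" and s t :: real
    assume \<phi>: "\<phi> \<in> bumps" and s: "0 < s" and st: "s < t" and tT: "t \<le> T"
    define F where "F \<tau> = \<i> * pairing (v \<tau>) (laplacian \<phi>) - \<i> * pairing (\<lambda>x. reg_log_nonlin lam \<epsilon> (v \<tau> x)) \<phi>" for \<tau>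
    have "pairing (v (t + h)) \<phi> - pairing (v (s + h)) \<phi> = (LINT \<tau>:{s + h..t + h}|lborel. F \<tau>)"
      using e \<phi> s st tT h unfolding evolves_def F_def by simp
    also have "\<dots> = (LINT \<tau>:{s..t}|lborel. F (\<tau> + h))"
      unfolding set_lebesgue_integral_def
      by (subst lborel_integral_real_affine[where c=1 and t=h])
         (auto simp: add.commute indicator_def intro!: Bochner_Integration.integral_cong)
    finally show "pairing (v (t + h)) \<phi> - pairing (v (s + h)) \<phi> =
        (LINT \<tau>:{s..t}|lborel. \<i> * pairing (v (\<tau> + h)) (laplacian \<phi>) - \<i> * pairing (\<lambda>x. reg_log_nonlin lam \<epsilon> (v (\<tau> + h) x)) \<phi>)"
      by (simp add: F_def)
  qed
  moreover have "AE t in lborel. t \<in> {0..T} \<longrightarrow> regular_slice K (v (t + h))"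
    using AE_shift[OF a, of h] by eventually_elim (use h in auto)
  ultimately show ?thesis unfolding NLS_on_def using sb[OF b(1)] sb[OF b(2)] l h by auto
qed

lemma NLS_on_mono: "NLS_on lam \<epsilon> T K v \<Longrightarrow> S \<le> T \<Longrightarrow> NLS_on lam \<epsilon> S K v"
  unfolding NLS_on_def evolves_def by (auto intro: L2_bounded_on_mono elim!: eventually_mono)

lemma forced_evolution_diff:
  fixes v u :: "real \<Rightarrow> 'a::euclidean_space \<Rightarrow> complex"
  assumes v: "NLS_on lam \<epsilon> T K v" and u: "NLS_on lam \<epsilon>' T K' u" and T: "0 < T"
  shows "forced_evolution (\<lambda>t x. v t x - u t x) (\<lambda>t x. reg_log_nonlin lam \<epsilon> (v t x) - reg_log_nonlin lam \<epsilon>' (u t x)) T (K + K') (K + K') (K + K')"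
proof
  note V = v[unfolded NLS_on_def] and U = u[unfolded NLS_on_def]
  show "evolves T (\<lambda>t x. v t x - u t x) (\<lambda>t x. reg_log_nonlin lam \<epsilon> (v t x) - reg_log_nonlin lam \<epsilon>' (u t x))"
    using evolves_diff[of T v "\<lambda>t x. reg_log_nonlin lam \<epsilon> (v t x)" K K u "\<lambda>t x. reg_log_nonlin lam \<epsilon>' (u t x)" K' K'] V U by blast
  show "continuous_into_L2 {0..} (\<lambda>t x. v t x - u t x)" using V U by (intro continuous_into_L2_diff) auto
  show "L2_bounded_on {0..T} (\<lambda>t x. v t x - u t x) (K + K')" using V U by (intro L2_bounded_on_diff) auto
  show "L2_bounded_on {0..T} (\<lambda>t x. reg_log_nonlin lam \<epsilon> (v t x) - reg_log_nonlin lam \<epsilon>' (u t x)) (K + K')"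
    using V U by (intro L2_bounded_on_diff) auto
  show "0 < T" by (rule T)
  show "translation_Lipschitz (\<lambda>x. v t x - u t x) (K + K')" if "t \<in> {0..T}" for t
    using V U that by (intro translation_Lipschitz_diff) auto
qed

section \<open>The error in \<open>L2\<close>\<close>

lemma Gronwall:
  fixes \<phi> :: "real \<Rightarrow> real"
  assumes c: "continuous_on {0..T} \<phi>" and a: "0 \<le> a"
    and le: "\<And>t. t \<in> {0..T} \<Longrightarrow> \<phi> t \<le> D + a * integral {0..t} \<phi>" and t: "t \<in> {0..T}"
  shows "\<phi> t \<le> D * exp (a * t)"
proof -
  define J where "J r = integral {0..r} \<phi>" for r
  define \<psi> where "\<psi> r = (D + a * J r) * exp (- (a * r))" for r
  have dJ: "(J has_real_derivative \<phi> r) (at r within {0..T})" if "r \<in> {0..T}" for r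
    unfolding J_def by (rule integral_has_real_derivative[OF c that])
  have cJ: "continuous_on {0..T} J"
    unfolding continuous_on_eq_continuous_within by (intro ballI DERIV_continuous[OF dJ])
  have "\<psi> t \<le> \<psi> 0"
  proof (rule DERIV_nonpos_imp_decreasing_open[of 0 t \<psi>])
    show "0 \<le> t" using t by simp
    show "continuous_on {0..t} \<psi>" unfolding \<psi>_def
      by (intro continuous_intros continuous_on_subset[OF cJ]) (use t in auto)
    fix r assume r: "0 < r" "r < t"
    then have rT: "r \<in> {0..T}" using t by auto
    have "(J has_real_derivative \<phi> r) (at r)" using dJ[OF rT] r t by (simp add: at_within_Icc_at)
    then have "(\<psi> has_real_derivative (a * \<phi> r * exp (- (a * r)) - (D + a * J r) * (a * exp (- (a * r))))) (at r)"
      unfolding \<psi>_def by (auto intro!: derivative_eq_intros)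
    moreover have "a * \<phi> r * exp (- (a * r)) - (D + a * J r) * (a * exp (- (a * r))) = a * exp (- (a * r)) * (\<phi> r - (D + a * J r))"
      by (simp add: algebra_simps)
    moreover have "a * exp (- (a * r)) * (\<phi> r - (D + a * J r)) \<le> 0"
      using le[OF rT] a by (intro mult_nonneg_nonpos) (auto simp: J_def)
    ultimately show "\<exists>y. DERIV \<psi> r :> y \<and> y \<le> 0" by metis
  qed
  then have "(D + a * J t) * exp (- (a * t)) \<le> D" by (simp add: \<psi>_def J_def)
  then have "(D + a * J t) * exp (- (a * t)) * exp (a * t) \<le> D * exp (a * t)" by (intro mult_right_mono) auto
  then have "D + a * J t \<le> D * exp (a * t)" by (simp add: mult.assoc flip: exp_add)
  then show ?thesis using le[OF t] by (simp add: J_def)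
qed

context forced_evolution
begin

text \<open>The energy identity and Gronwall's lemma.\<close>

lemma energy_bound:
  assumes ae: "AE \<tau> in lborel. \<tau> \<in> {0..T} \<longrightarrow> 2 * Im (pairing (G \<tau>) (\<lambda>x. cnj (w \<tau> x))) \<le> a * (L2_norm (w \<tau>))\<^sup>2 + \<sigma> \<tau>"
    and a: "0 \<le> a" and i\<sigma>: "set_integrable lborel {0..T} \<sigma>" and \<sigma>: "\<And>\<tau>. 0 \<le> \<sigma> \<tau>" and t: "t \<in> {0..T}"
  shows "(L2_norm (w t))\<^sup>2 \<le> ((L2_norm (w 0))\<^sup>2 + (LINT \<tau>:{0..T}|lborel. \<sigma> \<tau>)) * exp (a * t)"
proof -
  define \<phi> where "\<phi> \<tau> = (L2_norm (w \<tau>))\<^sup>2" for \<tau>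
  have c: "continuous_on {0..T} \<phi>" unfolding \<phi>_def
    by (intro continuous_intros continuous_on_subset[OF L2_norm_continuous[OF continuous]]) auto
  have le: "\<phi> r \<le> ((L2_norm (w 0))\<^sup>2 + (LINT \<tau>:{0..T}|lborel. \<sigma> \<tau>)) + a * integral {0..r} \<phi>" if r: "r \<in> {0..T}" for r
  proof -
    define P where "P \<tau> = pairing (G \<tau>) (\<lambda>x. cnj (w \<tau> x))" for \<tau>
    have r0: "0 \<le> r" "r \<le> T" using r by auto
    note bd = interval_bounds[OF order_refl r0(2)]
    have iP: "set_integrable lborel {0..r} P" unfolding P_def by (rule pairing_cnj_set_integrable(1)[OF bd(2,1)])
    have i\<phi>: "set_integrable lborel {0..r} \<phi>"
      by (rule borel_integrable_atLeastAtMost'[OF continuous_on_subset[OF c]]) (use r in auto)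
    have i\<sigma>r: "set_integrable lborel {0..r} \<sigma>" by (rule set_integrable_subset[OF i\<sigma>]) (use r in auto)
    have "\<phi> r - \<phi> 0 = 2 * (LINT \<tau>:{0..r}|lborel. Im (P \<tau>))"
      using energy_identity[OF order_refl r0] set_integral_Re_Im(2)[OF iP] by (simp add: \<phi>_def P_def)
    also have "\<dots> = (LINT \<tau>:{0..r}|lborel. 2 * Im (P \<tau>))" by simp
    also have "\<dots> \<le> (LINT \<tau>:{0..r}|lborel. a * \<phi> \<tau> + \<sigma> \<tau>)"
      unfolding set_lebesgue_integral_def
    proof (rule integral_mono_AE)
      show "integrable lborel (\<lambda>\<tau>. indicator {0..r} \<tau> *\<^sub>R (2 * Im (P \<tau>)))"
        using integrable_mult_right[OF integrable_Im[OF iP[unfolded set_integrable_def]], of 2] by (simp add: mult.left_commute)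
      show "integrable lborel (\<lambda>\<tau>. indicator {0..r} \<tau> *\<^sub>R (a * \<phi> \<tau> + \<sigma> \<tau>))"
        using set_integral_add(1)[OF set_integrable_mult_right[OF i\<phi>] i\<sigma>r, of a] by (simp add: set_integrable_def)
      show "AE \<tau> in lborel. indicator {0..r} \<tau> *\<^sub>R (2 * Im (P \<tau>)) \<le> indicator {0..r} \<tau> *\<^sub>R (a * \<phi> \<tau> + \<sigma> \<tau>)"
        using ae by eventually_elim (use r in \<open>auto simp: indicator_def P_def \<phi>_def\<close>)
    qed
    also have "\<dots> = a * (LINT \<tau>:{0..r}|lborel. \<phi> \<tau>) + (LINT \<tau>:{0..r}|lborel. \<sigma> \<tau>)"
      using set_integral_add(2)[OF set_integrable_mult_right[OF i\<phi>] i\<sigma>r, of a] by simp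
    also have "(LINT \<tau>:{0..r}|lborel. \<phi> \<tau>) = integral {0..r} \<phi>" by (rule set_borel_integral_eq_integral(2)[OF i\<phi>])
    also have "(LINT \<tau>:{0..r}|lborel. \<sigma> \<tau>) \<le> (LINT \<tau>:{0..T}|lborel. \<sigma> \<tau>)"
      unfolding set_lebesgue_integral_def
      by (rule integral_mono) (use i\<sigma>r i\<sigma> \<sigma> r in \<open>auto simp: set_integrable_def indicator_def\<close>)
    finally show ?thesis by (simp add: \<phi>_def[of r] \<phi>_def[of 0])
  qed
  from Gronwall[OF c a le t] show ?thesis by (simp add: \<phi>_def)
qed

end

lemma Im_pairing_reg_log_nonlin:
  fixes v u :: "'a::euclidean_space \<Rightarrow> complex"
  assumes \<epsilon>: "0 < \<epsilon>" and v: "v \<in> L2" and u: "u \<in> L2"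
    and F: "(\<lambda>x. reg_log_nonlin lam \<epsilon> (v x) - reg_log_nonlin lam \<epsilon> (u x)) \<in> L2"
  shows "Im (pairing (\<lambda>x. reg_log_nonlin lam \<epsilon> (v x) - reg_log_nonlin lam \<epsilon> (u x)) (\<lambda>x. cnj (v x - u x)))
    \<le> 2 * \<bar>lam\<bar> * (L2_norm (\<lambda>x. v x - u x))\<^sup>2"
proof -
  let ?f = "\<lambda>x. (reg_log_nonlin lam \<epsilon> (v x) - reg_log_nonlin lam \<epsilon> (u x)) * cnj (v x - u x)"
  have d: "(\<lambda>x. v x - u x) \<in> L2" by (intro L2_diff v u)
  have i: "integrable lborel ?f" by (rule integrable_mult_L2(1)[OF F L2_cnj[OF d]])
  have "Im (integral\<^sup>L lborel ?f) = (\<integral>x. Im (?f x) \<partial>lborel)" by (rule integral_Im[OF i, symmetric])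
  also have "\<dots> \<le> (\<integral>x. 2 * \<bar>lam\<bar> * (cmod (v x - u x))\<^sup>2 \<partial>lborel)"
  proof (rule integral_mono)
    show "integrable lborel (\<lambda>x. Im (?f x))" by (rule integrable_Im[OF i])
    show "integrable lborel (\<lambda>x. 2 * \<bar>lam\<bar> * (cmod (v x - u x))\<^sup>2)" using L2_integrable[OF d] by simp
    show "Im (?f x) \<le> 2 * \<bar>lam\<bar> * (cmod (v x - u x))\<^sup>2" for x
      using reg_log_nonlin_Im[OF \<epsilon>, of lam "v x" "u x"] by (rule order_trans[OF abs_ge_self])
  qed
  finally show ?thesis by (simp add: pairing_def L2_norm_square)
qed

lemma NLS_onD:
  assumes "NLS_on lam \<epsilon> T K v"
  shows "continuous_into_L2 {0..} v" "L2_bounded_on {0..T} v K" "L2_bounded_on {0..T} (\<lambda>t x. reg_log_nonlin lam \<epsilon> (v t x)) K"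
    "t \<in> {0..T} \<Longrightarrow> translation_Lipschitz (v t) K" "AE t in lborel. t \<in> {0..T} \<longrightarrow> regular_slice K (v t)" "0 \<le> K"
    "evolves T v (\<lambda>t x. reg_log_nonlin lam \<epsilon> (v t x))"
  using assms L2_bounded_onD(3) unfolding NLS_on_def by blast+

text \<open>Both functions solve the same equation, so the energy estimate has no source term.\<close>

lemma NLS_on_stability:
  fixes v u :: "real \<Rightarrow> 'a::euclidean_space \<Rightarrow> complex"
  assumes \<epsilon>: "0 < \<epsilon>" and v: "NLS_on lam \<epsilon> T K v" and u: "NLS_on lam \<epsilon> T K' u" and T: "0 < T" and t: "t \<in> {0..T}"
  shows "(L2_norm (\<lambda>x. v t x - u t x))\<^sup>2 \<le> (L2_norm (\<lambda>x. v 0 x - u 0 x))\<^sup>2 * exp (4 * \<bar>lam\<bar> * t)"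
proof -
  interpret forced_evolution "\<lambda>t x. v t x - u t x" "\<lambda>t x. reg_log_nonlin lam \<epsilon> (v t x) - reg_log_nonlin lam \<epsilon> (u t x)" T "K + K'" "K + K'" "K + K'"
    by (rule forced_evolution_diff[OF v u T])
  have "(L2_norm (\<lambda>x. v t x - u t x))\<^sup>2 \<le> ((L2_norm (\<lambda>x. v 0 x - u 0 x))\<^sup>2 + (LINT \<tau>:{0..T}|lborel. 0)) * exp ((4 * \<bar>lam\<bar>) * t)"
  proof (rule energy_bound[OF _ _ _ _ t])
    show "AE \<tau> in lborel. \<tau> \<in> {0..T} \<longrightarrow> 2 * Im (pairing (\<lambda>x. reg_log_nonlin lam \<epsilon> (v \<tau> x) - reg_log_nonlin lam \<epsilon> (u \<tau> x)) (\<lambda>x. cnj (v \<tau> x - u \<tau> x)))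
        \<le> 4 * \<bar>lam\<bar> * (L2_norm (\<lambda>x. v \<tau> x - u \<tau> x))\<^sup>2 + 0"
      using L2_bounded_onD(4)[OF forcing_bounded]
    proof (eventually_elim, intro impI)
      fix \<tau> assume *: "\<tau> \<in> {0..T} \<longrightarrow> (\<lambda>x. reg_log_nonlin lam \<epsilon> (v \<tau> x) - reg_log_nonlin lam \<epsilon> (u \<tau> x)) \<in> L2 \<and>
          L2_norm (\<lambda>x. reg_log_nonlin lam \<epsilon> (v \<tau> x) - reg_log_nonlin lam \<epsilon> (u \<tau> x)) \<le> K + K'" and \<tau>: "\<tau> \<in> {0..T}"
      have "v \<tau> \<in> L2" "u \<tau> \<in> L2" using continuous_into_L2D(1)[OF NLS_onD(1)[OF v]] continuous_into_L2D(1)[OF NLS_onD(1)[OF u]] \<tau> by auto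
      from Im_pairing_reg_log_nonlin[OF \<epsilon> this, of lam] * \<tau>
      show "2 * Im (pairing (\<lambda>x. reg_log_nonlin lam \<epsilon> (v \<tau> x) - reg_log_nonlin lam \<epsilon> (u \<tau> x)) (\<lambda>x. cnj (v \<tau> x - u \<tau> x)))
        \<le> 4 * \<bar>lam\<bar> * (L2_norm (\<lambda>x. v \<tau> x - u \<tau> x))\<^sup>2 + 0" by auto
    qed
  qed (auto simp: set_integrable_def)
  then show ?thesis by simp
qed

definition error_norm :: "real \<Rightarrow> real \<Rightarrow> ('a::euclidean_space \<Rightarrow> complex) \<Rightarrow> real" where
  "error_norm lam \<epsilon> u = L2_norm (\<lambda>x. reg_log_nonlin lam \<epsilon> (u x) - reg_log_nonlin lam 0 (u x))"

definition error_bound :: "real \<Rightarrow> real \<Rightarrow> nat \<Rightarrow> real" where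
  "error_bound lam K d = 16 * lam\<^sup>2 * (6 ^ d + 4 * K\<^sup>2)"

lemma error_bound_nonneg: "0 \<le> error_bound lam K d"
  by (simp add: error_bound_def)

text \<open>A crude bound, uniform in \<open>\<epsilon>\<close>; it suffices for the time derivative of the error.\<close>

lemma error_norm_le:
  fixes u :: "'a::euclidean_space \<Rightarrow> complex"
  assumes dim: "DIM('a) \<le> 3" and \<epsilon>: "0 < \<epsilon>" "\<epsilon> \<le> 1" and u: "regular_slice K u"
  shows "(\<lambda>x. reg_log_nonlin lam \<epsilon> (u x) - reg_log_nonlin lam 0 (u x)) \<in> L2"
    "(error_norm lam \<epsilon> u)\<^sup>2 \<le> error_bound lam K DIM('a)"
proof -
  have L: "u \<in> L22" "L22_norm u \<le> K" using u by (auto simp: regular_slice_def)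
  show "(\<lambda>x. reg_log_nonlin lam \<epsilon> (u x) - reg_log_nonlin lam 0 (u x)) \<in> L2"
    by (rule regularisation_error_L2(1)[OF dim L(1) \<epsilon>(1) order_refl])
  have "(error_norm lam \<epsilon> u)\<^sup>2 \<le> 16 * lam\<^sup>2 * \<epsilon> * (6 ^ DIM('a) + 4 * (L22_norm u)\<^sup>2)"
    unfolding error_norm_def by (rule regularisation_error_L2(3)[OF dim L(1) \<epsilon>(1) order_refl])
  also have "\<dots> \<le> 16 * lam\<^sup>2 * 1 * (6 ^ DIM('a) + 4 * K\<^sup>2)"
    using \<epsilon> L(2) by (intro mult_mono add_left_mono mult_left_mono power_mono) (auto simp: L22_norm_nonneg)
  finally show "(error_norm lam \<epsilon> u)\<^sup>2 \<le> error_bound lam K DIM('a)" by (simp add: error_bound_def)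
qed

lemma error_norm_set_integrable:
  fixes u :: "real \<Rightarrow> 'a::euclidean_space \<Rightarrow> complex"
  assumes dim: "DIM('a) \<le> 3" and \<epsilon>: "0 < \<epsilon>" "\<epsilon> \<le> 1" and u: "NLS_on lam 0 T K u"
  shows "set_integrable lborel {0..T} (\<lambda>\<tau>. (error_norm lam \<epsilon> (u \<tau>))\<^sup>2)"
  unfolding set_integrable_def
proof (rule Bochner_Integration.integrable_bound)
  note [measurable] = L2_bounded_onD(2)[OF NLS_onD(2)[OF u]]
  show "integrable lborel (\<lambda>\<tau>. indicator {0..T} \<tau> *\<^sub>R error_bound lam K DIM('a))"
    by (intro integrable_scaleR_left integrable_real_indicator) (auto simp: emeasure_lborel_Icc_eq)
  show "(\<lambda>\<tau>. indicator {0..T} \<tau> *\<^sub>R (error_norm lam \<epsilon> (u \<tau>))\<^sup>2) \<in> borel_measurable lborel"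
    unfolding error_norm_def L2_norm_square by measurable
  show "AE \<tau> in lborel. norm (indicator {0..T} \<tau> *\<^sub>R (error_norm lam \<epsilon> (u \<tau>))\<^sup>2) \<le> norm (indicator {0..T} \<tau> *\<^sub>R error_bound lam K DIM('a))"
    using NLS_onD(5)[OF u]
    by eventually_elim (use error_norm_le(2)[OF dim \<epsilon>, of K _ lam] error_bound_nonneg[of lam K "DIM('a)"] in \<open>auto simp: indicator_def\<close>)
qed

text \<open>The difference of the two solutions is driven by the regularisation error of the unregularised one only, which makes the
  estimate uniform in \<open>\<epsilon>\<close> although \<open>K\<close> may depend on it. The parameter \<open>\<kappa>\<close>
  is the weight in Young's inequality: it is \<open>1\<close> for a fixed time interval, and the inverse of the length for short ones.\<close>

lemma NLS_on_comparison:
  fixes v u :: "real \<Rightarrow> 'a::euclidean_space \<Rightarrow> complex"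
  assumes dim: "DIM('a) \<le> 3" and \<epsilon>: "0 < \<epsilon>" "\<epsilon> \<le> 1" and v: "NLS_on lam \<epsilon> T K v" and u: "NLS_on lam 0 T K' u"
    and T: "0 < T" and t: "t \<in> {0..T}" and init: "AE x in lborel. v 0 x = u 0 x" and \<kappa>: "0 < \<kappa>"
  shows "(L2_norm (\<lambda>x. v t x - u t x))\<^sup>2 \<le> (LINT \<tau>:{0..T}|lborel. (error_norm lam \<epsilon> (u \<tau>))\<^sup>2) / \<kappa> * exp ((4 * \<bar>lam\<bar> + \<kappa>) * t)"
proof -
  interpret forced_evolution "\<lambda>t x. v t x - u t x" "\<lambda>t x. reg_log_nonlin lam \<epsilon> (v t x) - reg_log_nonlin lam 0 (u t x)" T "K + K'" "K + K'" "K + K'"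
    by (rule forced_evolution_diff[OF v u T])
  have L0: "L2_norm (\<lambda>x. v 0 x - u 0 x) = 0"
  proof -
    have "L2_norm (\<lambda>x. v 0 x - u 0 x) = L2_norm (\<lambda>x::'a. 0)"
    proof (rule L2_norm_cong_AE)
      show "AE x in lborel. v 0 x - u 0 x = 0" using init by eventually_elim simp
    qed (use w_L2[OF order_refl] in \<open>auto dest: L2_measurable\<close>)
    then show ?thesis by simp
  qed
  have "(L2_norm (\<lambda>x. v t x - u t x))\<^sup>2 \<le> ((L2_norm (\<lambda>x. v 0 x - u 0 x))\<^sup>2 + (LINT \<tau>:{0..T}|lborel. (error_norm lam \<epsilon> (u \<tau>))\<^sup>2 / \<kappa>)) * exp ((4 * \<bar>lam\<bar> + \<kappa>) * t)"
  proof (rule energy_bound[OF _ _ _ _ t])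
    show "AE \<tau> in lborel. \<tau> \<in> {0..T} \<longrightarrow> 2 * Im (pairing (\<lambda>x. reg_log_nonlin lam \<epsilon> (v \<tau> x) - reg_log_nonlin lam 0 (u \<tau> x)) (\<lambda>x. cnj (v \<tau> x - u \<tau> x)))
        \<le> (4 * \<bar>lam\<bar> + \<kappa>) * (L2_norm (\<lambda>x. v \<tau> x - u \<tau> x))\<^sup>2 + (error_norm lam \<epsilon> (u \<tau>))\<^sup>2 / \<kappa>"
      using L2_bounded_onD(4)[OF forcing_bounded] NLS_onD(5)[OF u]
    proof (eventually_elim, intro impI)
      fix \<tau> assume *: "\<tau> \<in> {0..T} \<longrightarrow> (\<lambda>x. reg_log_nonlin lam \<epsilon> (v \<tau> x) - reg_log_nonlin lam 0 (u \<tau> x)) \<in> L2 \<and>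
          L2_norm (\<lambda>x. reg_log_nonlin lam \<epsilon> (v \<tau> x) - reg_log_nonlin lam 0 (u \<tau> x)) \<le> K + K'"
        "\<tau> \<in> {0..T} \<longrightarrow> regular_slice K' (u \<tau>)" and \<tau>: "\<tau> \<in> {0..T}"
      define S where "S x = reg_log_nonlin lam \<epsilon> (u \<tau> x) - reg_log_nonlin lam 0 (u \<tau> x)" for x
      define N where "N x = reg_log_nonlin lam \<epsilon> (v \<tau> x) - reg_log_nonlin lam \<epsilon> (u \<tau> x)" for x
      define e where "e x = v \<tau> x - u \<tau> x" for x
      have vu: "v \<tau> \<in> L2" "u \<tau> \<in> L2" using continuous_into_L2D(1)[OF NLS_onD(1)[OF v]] continuous_into_L2D(1)[OF NLS_onD(1)[OF u]] \<tau> by auto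
      have e: "e \<in> L2" unfolding e_def[abs_def] by (intro L2_diff vu)
      have S: "S \<in> L2" unfolding S_def[abs_def] using error_norm_le(1)[OF dim \<epsilon>, of K' "u \<tau>" lam] * \<tau> by auto
      have G: "(\<lambda>x. reg_log_nonlin lam \<epsilon> (v \<tau> x) - reg_log_nonlin lam 0 (u \<tau> x)) \<in> L2" using * \<tau> by auto
      have N: "N \<in> L2" using L2_diff[OF G S] by (simp add: N_def[abs_def] S_def)
      have "(\<lambda>x. reg_log_nonlin lam \<epsilon> (v \<tau> x) - reg_log_nonlin lam 0 (u \<tau> x)) = (\<lambda>x. N x + S x)" by (simp add: N_def S_def)
      then have "pairing (\<lambda>x. reg_log_nonlin lam \<epsilon> (v \<tau> x) - reg_log_nonlin lam 0 (u \<tau> x)) (\<lambda>x. cnj (e x))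
         = pairing N (\<lambda>x. cnj (e x)) + pairing S (\<lambda>x. cnj (e x))"
        using pairing_add_left[OF N S L2_cnj[OF e]] by simp
      moreover have "Im (pairing N (\<lambda>x. cnj (e x))) \<le> 2 * \<bar>lam\<bar> * (L2_norm e)\<^sup>2"
        using Im_pairing_reg_log_nonlin[OF \<epsilon>(1) vu N[unfolded N_def[abs_def]]] by (simp add: N_def[abs_def] e_def[abs_def])
      moreover have "2 * Im (pairing S (\<lambda>x. cnj (e x))) \<le> \<kappa> * (L2_norm e)\<^sup>2 + (error_norm lam \<epsilon> (u \<tau>))\<^sup>2 / \<kappa>"
      proof -
        have n: "error_norm lam \<epsilon> (u \<tau>) = L2_norm S" by (simp add: error_norm_def S_def[abs_def])
        have "Im (pairing S (\<lambda>x. cnj (e x))) \<le> L2_norm S * L2_norm e"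
          using pairing_Cauchy_Schwarz[OF S L2_cnj[OF e]] abs_Im_le_cmod[of "pairing S (\<lambda>x. cnj (e x))"] by simp
        moreover have "0 \<le> (\<kappa> * L2_norm e - L2_norm S)\<^sup>2 / \<kappa>" using \<kappa> by simp
        then have "2 * (L2_norm S * L2_norm e) \<le> \<kappa> * (L2_norm e)\<^sup>2 + (L2_norm S)\<^sup>2 / \<kappa>"
          using \<kappa> by (simp add: power2_diff power_mult_distrib field_simps power2_eq_square)
        ultimately show ?thesis unfolding n by linarith
      qed
      ultimately show "2 * Im (pairing (\<lambda>x. reg_log_nonlin lam \<epsilon> (v \<tau> x) - reg_log_nonlin lam 0 (u \<tau> x)) (\<lambda>x. cnj (v \<tau> x - u \<tau> x)))
        \<le> (4 * \<bar>lam\<bar> + \<kappa>) * (L2_norm (\<lambda>x. v \<tau> x - u \<tau> x))\<^sup>2 + (error_norm lam \<epsilon> (u \<tau>))\<^sup>2 / \<kappa>"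
        unfolding e_def[symmetric] by (simp add: e_def[abs_def, symmetric] algebra_simps)
    qed
    show "set_integrable lborel {0..T} (\<lambda>\<tau>. (error_norm lam \<epsilon> (u \<tau>))\<^sup>2 / \<kappa>)"
      using set_integrable_mult_right[OF error_norm_set_integrable[OF dim \<epsilon> u], of "1 / \<kappa>"] by simp
  qed (use \<kappa> in auto)
  then show ?thesis using L0 by simp
qed

lemma NLS_on_time_Lipschitz:
  fixes u :: "real \<Rightarrow> 'a::euclidean_space \<Rightarrow> complex"
  assumes u: "NLS_on lam \<epsilon> T K u" and T: "0 < T" and s: "0 \<le> s" and st: "s \<le> t" and tT: "t \<le> T"
  shows "L2_norm (\<lambda>x. u t x - u s x) \<le> (t - s) * (real DIM('a) * K + K)"
proof -
  note N = NLS_onD[OF u]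
  interpret forced_evolution u "\<lambda>t x. reg_log_nonlin lam \<epsilon> (u t x)" T K K K
    by standard (use N T in auto)
  have "AE \<tau> in lborel. \<tau> \<in> {0..T} \<longrightarrow> (\<exists>g. has_laplacian (u \<tau>) g \<and> L2_norm g \<le> real DIM('a) * K)"
    using N(5)
  proof (eventually_elim, intro impI)
    fix \<tau> assume *: "\<tau> \<in> {0..T} \<longrightarrow> regular_slice K (u \<tau>)" and "\<tau> \<in> {0..T}"
    then have S: "u \<tau> \<in> Sobolev 2" "Sobolev_norm 2 (u \<tau>) \<le> K" by (auto simp: regular_slice_def)
    have "real DIM('a) * Sobolev_norm 2 (u \<tau>) \<le> real DIM('a) * K" by (intro mult_left_mono S) simp
    then show "\<exists>g. has_laplacian (u \<tau>) g \<and> L2_norm g \<le> real DIM('a) * K"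
      using Sobolev_2_regularity(3)[OF S(1)] order_trans[OF Sobolev_2_regularity(4)[OF S(1)]] by blast
  qed
  from time_Lipschitz[OF this _ s st tT] N(6) show ?thesis by simp
qed

definition Lipschitz_constant :: "real \<Rightarrow> real \<Rightarrow> real \<Rightarrow> nat \<Rightarrow> real" where
  "Lipschitz_constant lam T K d = (sqrt (error_bound lam K d * exp (4 * \<bar>lam\<bar> + 1)) + (real d * K + K)) * exp (2 * \<bar>lam\<bar> * T) + (real d * K + K)"

text \<open>By stability, the regularised solution and its shift by \<open>h\<close> are as close at time \<open>t\<close> as they are
  at time zero, up to a constant factor. At time zero the regularised solution moves during the time \<open>h\<close> by a
  multiple of \<open>h\<close> because the unregularised one does and because the two differ by a
  multiple of \<open>h\<close> at time \<open>h\<close>. The constant is independent of \<open>\<epsilon>\<close>.\<close>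

lemma difference_time_Lipschitz:
  fixes v u :: "real \<Rightarrow> 'a::euclidean_space \<Rightarrow> complex"
  assumes dim: "DIM('a) \<le> 3" and \<epsilon>: "0 < \<epsilon>" "\<epsilon> \<le> 1" and v: "NLS_on lam \<epsilon> (T + 1) Kv v" and u: "NLS_on lam 0 (T + 1) K u"
    and T: "0 < T" and init: "AE x in lborel. v 0 x = u 0 x" and t: "t \<in> {0..T}" and h: "0 < h" "h \<le> 1"
  shows "L2_norm (\<lambda>x. (v (t + h) x - u (t + h) x) - (v t x - u t x)) \<le> h * Lipschitz_constant lam T K DIM('a)"
proof -
  note K = NLS_onD(6)[OF u]
  define Ku where "Ku = real DIM('a) * K + K"
  define E where "E = sqrt (error_bound lam K DIM('a) * exp (4 * \<bar>lam\<bar> + 1))"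
  have v2: "v r \<in> L2" and u2: "u r \<in> L2" if "0 \<le> r" for r
    using continuous_into_L2D(1)[OF NLS_onD(1)[OF v] that] continuous_into_L2D(1)[OF NLS_onD(1)[OF u] that] by auto
  have h0: "0 \<le> h" using h by simp
  have vh: "NLS_on lam \<epsilon> h Kv v" and uh: "NLS_on lam 0 h K u"
    using NLS_on_mono[OF v] NLS_on_mono[OF u] h T by auto
  have "(LINT \<tau>:{0..h}|lborel. (error_norm lam \<epsilon> (u \<tau>))\<^sup>2) \<le> (\<integral>\<tau>. indicator {0..h} \<tau> *\<^sub>R error_bound lam K DIM('a) \<partial>lborel)"
    unfolding set_lebesgue_integral_def
  proof (rule integral_mono_AE)
    show "integrable lborel (\<lambda>\<tau>. indicator {0..h} \<tau> *\<^sub>R (error_norm lam \<epsilon> (u \<tau>))\<^sup>2)"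
      using error_norm_set_integrable[OF dim \<epsilon> uh] by (simp add: set_integrable_def)
    show "integrable lborel (\<lambda>\<tau>. indicator {0..h} \<tau> *\<^sub>R error_bound lam K DIM('a))"
      using h0 by (intro integrable_scaleR_left integrable_real_indicator) auto
    show "AE \<tau> in lborel. indicator {0..h} \<tau> *\<^sub>R (error_norm lam \<epsilon> (u \<tau>))\<^sup>2 \<le> indicator {0..h} \<tau> *\<^sub>R error_bound lam K DIM('a)"
      using NLS_onD(5)[OF uh]
      by eventually_elim (use error_norm_le(2)[OF dim \<epsilon>, of K _ lam] in \<open>auto simp: indicator_def\<close>)
  qed
  also have "\<dots> = h * error_bound lam K DIM('a)" using h0 by simp
  finally have I: "(LINT \<tau>:{0..h}|lborel. (error_norm lam \<epsilon> (u \<tau>))\<^sup>2) \<le> h * error_bound lam K DIM('a)" .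
  have "(L2_norm (\<lambda>x. v h x - u h x))\<^sup>2 \<le> (LINT \<tau>:{0..h}|lborel. (error_norm lam \<epsilon> (u \<tau>))\<^sup>2) / (1 / h) * exp ((4 * \<bar>lam\<bar> + 1 / h) * h)"
    by (rule NLS_on_comparison[OF dim \<epsilon> vh uh h(1) _ init]) (use h in auto)
  also have "(LINT \<tau>:{0..h}|lborel. (error_norm lam \<epsilon> (u \<tau>))\<^sup>2) / (1 / h) \<le> h\<^sup>2 * error_bound lam K DIM('a)"
    using mult_left_mono[OF I h0] by (simp add: power2_eq_square mult.assoc mult.commute)
  also have "exp ((4 * \<bar>lam\<bar> + 1 / h) * h) \<le> exp (4 * \<bar>lam\<bar> + 1)"
  proof -
    have "4 * \<bar>lam\<bar> * h \<le> 4 * \<bar>lam\<bar> * 1" by (intro mult_left_mono h) auto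
    then show ?thesis using h by (simp add: distrib_right)
  qed
  finally have "(L2_norm (\<lambda>x. v h x - u h x))\<^sup>2 \<le> h\<^sup>2 * error_bound lam K DIM('a) * exp (4 * \<bar>lam\<bar> + 1)"
    by (simp add: mult_right_mono mult_left_mono error_bound_nonneg)
  also have "\<dots> = (h * E)\<^sup>2" by (simp add: E_def power_mult_distrib error_bound_nonneg)
  finally have vu: "L2_norm (\<lambda>x. v h x - u h x) \<le> h * E"
    by (rule power2_le_imp_le) (use h0 in \<open>auto simp: E_def error_bound_nonneg\<close>)
  have T1: "0 < T + 1" using T by simp
  have ui: "L2_norm (\<lambda>x. u h x - u 0 x) \<le> h * Ku"
    using NLS_on_time_Lipschitz[OF u T1 order_refl h0] h T by (simp add: Ku_def)
  have v0: "L2_norm (\<lambda>x. v h x - v 0 x) = L2_norm (\<lambda>x. v h x - u 0 x)"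
  proof (rule L2_norm_cong_AE)
    show "AE x in lborel. v h x - v 0 x = v h x - u 0 x" using init by eventually_elim simp
  qed (use v2[OF h0] v2[OF order_refl] u2[OF order_refl] in \<open>auto dest: L2_measurable\<close>)
  have "L2_norm (\<lambda>x. v h x - u 0 x) \<le> L2_norm (\<lambda>x. v h x - u h x) + L2_norm (\<lambda>x. u h x - u 0 x)"
    by (rule L2_norm_diff_triangle) (intro v2 u2 h0 order_refl)+
  then have vi: "L2_norm (\<lambda>x. v h x - v 0 x) \<le> h * (E + Ku)" using vu ui v0 by (simp add: distrib_left)
  have sh: "NLS_on lam \<epsilon> T Kv (\<lambda>t. v (t + h))"
    by (rule NLS_on_shift[OF NLS_on_mono[OF v] h0]) (use h in auto)
  have vT: "NLS_on lam \<epsilon> T Kv v" by (rule NLS_on_mono[OF v]) simp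
  have "(L2_norm (\<lambda>x. v (t + h) x - v t x))\<^sup>2 \<le> (L2_norm (\<lambda>x. v (0 + h) x - v 0 x))\<^sup>2 * exp (4 * \<bar>lam\<bar> * t)"
    by (rule NLS_on_stability[OF \<epsilon>(1) sh vT T t])
  also have "\<dots> \<le> (h * (E + Ku))\<^sup>2 * exp (4 * \<bar>lam\<bar> * T)"
    using vi t by (intro mult_mono power_mono) (auto intro: mult_left_mono)
  also have "\<dots> = (h * (E + Ku) * exp (2 * \<bar>lam\<bar> * T))\<^sup>2"
    by (simp add: power_mult_distrib power2_eq_square[of "exp _"] flip: exp_add)
  finally have vt: "L2_norm (\<lambda>x. v (t + h) x - v t x) \<le> h * (E + Ku) * exp (2 * \<bar>lam\<bar> * T)"
    by (rule power2_le_imp_le) (use h0 K in \<open>auto simp: E_def Ku_def error_bound_nonneg\<close>)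
  have ut: "L2_norm (\<lambda>x. u (t + h) x - u t x) \<le> h * Ku"
    using NLS_on_time_Lipschitz[OF u T1, of t "t + h"] t h by (simp add: Ku_def)
  have t0: "0 \<le> t" "0 \<le> t + h" using t h by auto
  have "L2_norm (\<lambda>x. (v (t + h) x - v t x) - (u (t + h) x - u t x)) \<le> L2_norm (\<lambda>x. v (t + h) x - v t x) + L2_norm (\<lambda>x. u (t + h) x - u t x)"
    by (intro L2_norm_triangle_diff L2_diff v2 u2 t0)
  also have "\<dots> \<le> h * (E + Ku) * exp (2 * \<bar>lam\<bar> * T) + h * Ku" by (intro add_mono vt ut)
  also have "\<dots> = h * Lipschitz_constant lam T K DIM('a)"
    by (simp add: Lipschitz_constant_def E_def Ku_def algebra_simps)
  finally show ?thesis by (simp add: algebra_simps)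
qed

section \<open>The error in \<open>H\<^sup>1\<close>\<close>

text \<open>Testing the equation on a short time interval with the slice at its left end: the time derivative is controlled by
  the Lipschitz constant and the forcing, which is known at almost all times only, by its bound.\<close>

lemma (in forced_evolution) laplacian_pairing_bound:
  assumes lap: "has_laplacian (w t) g" and t: "0 \<le> t" "t < T" and h0: "0 < h0"
    and L: "\<And>h. 0 < h \<Longrightarrow> h \<le> h0 \<Longrightarrow> t + h \<le> T \<Longrightarrow> L2_norm (\<lambda>x. w (t + h) x - w t x) \<le> h * L" and L0: "0 \<le> L"
    and \<Gamma>: "AE \<tau> in lborel. \<tau> \<in> {0..T} \<longrightarrow> G \<tau> \<in> L2 \<and> L2_norm (G \<tau>) \<le> \<Gamma>" and \<Gamma>0: "0 \<le> \<Gamma>"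
  shows "cmod (pairing g (\<lambda>x. cnj (w t x))) \<le> (L + \<Gamma>) * L2_norm (w t)"
proof (rule le_if_close[where C="L * L2_norm g"])
  fix \<delta> :: real assume \<delta>: "0 < \<delta>"
  \<comment> \<open>Over a step of length \<open>h\<close> the replacement of \<open>w \<tau>\<close> by \<open>w t\<close> costs a multiple of \<open>h\<close>, which is at most \<open>\<delta>\<close>.\<close>
  define h where "h = min \<delta> (min h0 (T - t))"
  have h: "0 < h" "h \<le> \<delta>" "h \<le> h0" "t + h \<le> T" using \<delta> h0 t by (auto simp: h_def)
  have tT: "t \<in> {0..T}" using t by simp
  have w: "w t \<in> L2" "w (t + h) \<in> L2" using t h by (auto intro: w_L2)
  have g: "g \<in> L2" using lap by (simp add: has_laplacian_def)
  have cw: "(\<lambda>x. cnj (w t x)) \<in> L2" and cg: "(\<lambda>x. cnj (g x)) \<in> L2" by (intro L2_cnj w g)+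
  define z where "z = pairing (w t) (\<lambda>x. cnj (g x))"
  have zz: "cmod z = cmod (pairing g (\<lambda>x. cnj (w t x)))"
  proof -
    have "cnj z = pairing g (\<lambda>x. cnj (w t x))" by (simp add: z_def cnj_pairing pairing_commute)
    then show ?thesis by (metis complex_mod_cnj)
  qed
  have th: "t \<le> t + h" using h by simp
  note PI = pairing_identity[OF Lipschitz[OF tT] lap t(1) th h(4)]
  have "cmod ((LINT \<tau>:{t..t + h}|lborel. \<i> * pairing (w \<tau>) (\<lambda>x. cnj (g x)) - \<i> * pairing (G \<tau>) (\<lambda>x. cnj (w t x))) - of_real (t + h - t) * (\<i> * z))
     \<le> (t + h - t) * (h * L * L2_norm g + \<Gamma> * L2_norm (w t))"
  proof (rule set_integral_near_const[OF PI(1) _ th])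
    show "AE \<tau> in lborel. \<tau> \<in> {t..t + h} \<longrightarrow> cmod (\<i> * pairing (w \<tau>) (\<lambda>x. cnj (g x)) - \<i> * pairing (G \<tau>) (\<lambda>x. cnj (w t x)) - \<i> * z) \<le> h * L * L2_norm g + \<Gamma> * L2_norm (w t)"
      using \<Gamma>
    proof (eventually_elim, intro impI)
      fix \<tau> assume *: "\<tau> \<in> {0..T} \<longrightarrow> G \<tau> \<in> L2 \<and> L2_norm (G \<tau>) \<le> \<Gamma>" and \<tau>: "\<tau> \<in> {t..t + h}"
      have t0: "\<tau> \<in> {0..T}" using \<tau> t h by auto
      have G: "G \<tau> \<in> L2" "L2_norm (G \<tau>) \<le> \<Gamma>" using * t0 by auto
      have w\<tau>: "w \<tau> \<in> L2" using t0 by (auto intro: w_L2)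
      have d: "(\<lambda>x. w \<tau> x - w t x) \<in> L2" by (intro L2_diff w\<tau> w)
      have dn: "L2_norm (\<lambda>x. w \<tau> x - w t x) \<le> h * L"
      proof (cases "\<tau> = t")
        case False
        then have "L2_norm (\<lambda>x. w (t + (\<tau> - t)) x - w t x) \<le> (\<tau> - t) * L" using \<tau> h t by (intro L) auto
        also have "\<dots> \<le> h * L" using \<tau> L0 by (intro mult_right_mono) auto
        finally show ?thesis by simp
      qed (use h L0 in simp)
      have eq: "\<i> * pairing (w \<tau>) (\<lambda>x. cnj (g x)) - \<i> * pairing (G \<tau>) (\<lambda>x. cnj (w t x)) - \<i> * z
          = \<i> * pairing (\<lambda>x. w \<tau> x - w t x) (\<lambda>x. cnj (g x)) - \<i> * pairing (G \<tau>) (\<lambda>x. cnj (w t x))"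
        by (simp add: z_def pairing_diff_left w w\<tau> cg algebra_simps)
      have "cmod (\<i> * pairing (w \<tau>) (\<lambda>x. cnj (g x)) - \<i> * pairing (G \<tau>) (\<lambda>x. cnj (w t x)) - \<i> * z)
          \<le> cmod (pairing (\<lambda>x. w \<tau> x - w t x) (\<lambda>x. cnj (g x))) + cmod (pairing (G \<tau>) (\<lambda>x. cnj (w t x)))"
        unfolding eq
        by (rule order_trans[OF norm_triangle_ineq4]) (simp add: norm_mult)
      also have "\<dots> \<le> L2_norm (\<lambda>x. w \<tau> x - w t x) * L2_norm g + L2_norm (G \<tau>) * L2_norm (w t)"
        using pairing_Cauchy_Schwarz[OF d cg] pairing_Cauchy_Schwarz[OF G(1) cw] by simp
      also have "\<dots> \<le> h * L * L2_norm g + \<Gamma> * L2_norm (w t)" by (intro add_mono mult_right_mono dn G) auto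
      finally show "cmod (\<i> * pairing (w \<tau>) (\<lambda>x. cnj (g x)) - \<i> * pairing (G \<tau>) (\<lambda>x. cnj (w t x)) - \<i> * z) \<le> h * L * L2_norm g + \<Gamma> * L2_norm (w t)" .
    qed
  qed
  then have 1: "cmod (pairing (\<lambda>x. w (t + h) x - w t x) (\<lambda>x. cnj (w t x)) - of_real h * (\<i> * z)) \<le> h * (h * L * L2_norm g + \<Gamma> * L2_norm (w t))"
    unfolding PI(2)[symmetric] by (simp add: pairing_diff_left w cw)
  have 2: "cmod (pairing (\<lambda>x. w (t + h) x - w t x) (\<lambda>x. cnj (w t x))) \<le> h * L * L2_norm (w t)"
  proof -
    have "cmod (pairing (\<lambda>x. w (t + h) x - w t x) (\<lambda>x. cnj (w t x))) \<le> L2_norm (\<lambda>x. w (t + h) x - w t x) * L2_norm (w t)"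
      using pairing_Cauchy_Schwarz[OF L2_diff[OF w(2,1)] cw] by simp
    also have "\<dots> \<le> h * L * L2_norm (w t)" by (intro mult_right_mono L h) auto
    finally show ?thesis .
  qed
  have "cmod (of_real h * (\<i> * z)) \<le> cmod (pairing (\<lambda>x. w (t + h) x - w t x) (\<lambda>x. cnj (w t x)))
      + cmod (pairing (\<lambda>x. w (t + h) x - w t x) (\<lambda>x. cnj (w t x)) - of_real h * (\<i> * z))"
    using norm_triangle_ineq4[of "pairing (\<lambda>x. w (t + h) x - w t x) (\<lambda>x. cnj (w t x))" "pairing (\<lambda>x. w (t + h) x - w t x) (\<lambda>x. cnj (w t x)) - of_real h * (\<i> * z)"]
    by simp
  also have "\<dots> \<le> h * L * L2_norm (w t) + h * (h * L * L2_norm g + \<Gamma> * L2_norm (w t))" by (intro add_mono 1 2)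
  finally have "h * cmod z \<le> h * ((L + \<Gamma>) * L2_norm (w t) + h * (L * L2_norm g))"
    using h by (simp add: norm_mult algebra_simps)
  then have "cmod z \<le> (L + \<Gamma>) * L2_norm (w t) + h * (L * L2_norm g)" using h by simp
  also have "\<dots> \<le> (L + \<Gamma>) * L2_norm (w t) + \<delta> * (L * L2_norm g)" using h L0 by (intro add_left_mono mult_right_mono) auto
  finally show "cmod (pairing g (\<lambda>x. cnj (w t x))) \<le> (L + \<Gamma>) * L2_norm (w t) + \<delta> * (L * L2_norm g)" unfolding zz .
qed

text \<open>A general test function need not belong to the algebra of bumps; its derivatives are continuous and vanish outside of its compact support.\<close>

lemma test_function_iter_deriv_L2:
  fixes \<phi> :: "'a::euclidean_space \<Rightarrow> complex"
  assumes \<phi>: "\<phi> \<in> test_functions UNIV" and bs: "bs \<in> lists Basis"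
  shows "iter_deriv bs \<phi> \<in> L2"
proof -
  define C where "C = closure {x. \<phi> x \<noteq> 0}"
  have C: "compact C" "closed C" using \<phi> by (auto simp: test_functions_def C_def)
  have sm: "smooth \<phi>" using \<phi> by (simp add: test_functions_def)
  have zero: "iter_deriv cs \<phi> x = 0" if "x \<notin> C" for cs x
    using that
  proof (induction cs arbitrary: x)
    case Nil
    then show ?case unfolding C_def using closure_subset[of "{x. \<phi> x \<noteq> 0}"] by auto
  next
    case (Cons c cs)
    show ?case using dir_deriv_zero_outside[OF C(2) Cons.IH Cons.prems] by simp
  qed
  have c: "continuous_on UNIV (iter_deriv bs \<phi>)"
    using sm bs unfolding smooth_def
    by (intro continuous_at_imp_continuous_on ballI differentiable_imp_continuous_within) auto
  have m: "iter_deriv bs \<phi> \<in> borel_measurable borel" by (rule borel_measurable_continuous_onI[OF c])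
  have "bounded (iter_deriv bs \<phi> ` C)"
    by (intro compact_imp_bounded compact_continuous_image continuous_on_subset[OF c] C) auto
  then obtain B where B: "0 < B" "\<And>x. x \<in> C \<Longrightarrow> cmod (iter_deriv bs \<phi> x) \<le> B" by (auto simp: bounded_pos)
  have "integrable lborel (\<lambda>x. indicator C x *\<^sub>R B\<^sup>2)"
    using C emeasure_compact_finite[OF C(1)] by (intro integrable_scaleR_left integrable_real_indicator) auto
  then show ?thesis
  proof (rule L2I_square_bound(1)[OF m])
    show "AE x in lborel. (cmod (iter_deriv bs \<phi> x))\<^sup>2 \<le> indicator C x *\<^sub>R B\<^sup>2"
    proof (rule AE_I2)
      fix x
      show "(cmod (iter_deriv bs \<phi> x))\<^sup>2 \<le> indicator C x *\<^sub>R B\<^sup>2"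
        using B zero[of x bs] by (cases "x \<in> C") (auto intro: power_mono)
    qed
  qed
qed

lemma Sobolev_diff:
  assumes "v \<in> Sobolev k" "u \<in> Sobolev k"
  shows "(\<lambda>x. v x - u x) \<in> Sobolev k"
proof -
  have vu: "v \<in> L2" "u \<in> L2" using assms by (auto simp: Sobolev_def)
  have "\<exists>g\<in>L2. has_weak_deriv (\<lambda>x. v x - u x) bs g" if bs: "bs \<in> deriv_lists k" for bs
  proof -
    note g = weak_derivD(1,2)[OF assms(1) bs] and g' = weak_derivD(1,2)[OF assms(2) bs]
    let ?g = "weak_deriv bs v" and ?g' = "weak_deriv bs u"
    have "has_weak_deriv (\<lambda>x. v x - u x) bs (\<lambda>x. ?g x - ?g' x)"
      unfolding has_weak_deriv_def
    proof
      fix \<phi> :: "'a \<Rightarrow> complex" assume \<phi>: "\<phi> \<in> test_functions UNIV"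
      have L: "iter_deriv bs \<phi> \<in> L2" "\<phi> \<in> L2"
        using test_function_iter_deriv_L2[OF \<phi>, of bs] test_function_iter_deriv_L2[OF \<phi>, of "[]"] bs by (auto simp: deriv_lists_def)
      show "(\<integral>x. (v x - u x) * iter_deriv bs \<phi> x \<partial>lborel) = (- 1) ^ length bs * (\<integral>x. (?g x - ?g' x) * \<phi> x \<partial>lborel)"
        using g(2) g'(2) \<phi> pairing_diff_left[OF vu L(1)] pairing_diff_left[OF g(1) g'(1) L(2)]
        by (simp add: has_weak_deriv_def pairing_def right_diff_distrib)
    qed
    then show ?thesis using L2_diff[OF g(1) g'(1)] by blast
  qed
  then show ?thesis using L2_diff[OF vu] by (simp add: Sobolev_def)
qed

lemma Sobolev_mono: "v \<in> Sobolev k \<Longrightarrow> j \<le> k \<Longrightarrow> v \<in> Sobolev j"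
  by (auto simp: Sobolev_def deriv_lists_def)

definition grad_square :: "('a::euclidean_space \<Rightarrow> complex) \<Rightarrow> real" where
  "grad_square v = (\<Sum>b\<in>Basis. (L2_norm (weak_deriv [b] v))\<^sup>2)"

lemma Sobolev_norm_1:
  fixes v :: "'a::euclidean_space \<Rightarrow> complex"
  assumes v: "v \<in> Sobolev 1"
  shows "Sobolev_norm 1 v = sqrt ((L2_norm v)\<^sup>2 + grad_square v)"
proof -
  have e: "[] \<in> deriv_lists 1" by (simp add: deriv_lists_def)
  have v2: "v \<in> L2" using v by (simp add: Sobolev_def)
  note d = weak_derivD[OF v e]
  have "has_weak_deriv v [] v" by (simp add: has_weak_deriv_def)
  from L2_norm_cong_AE[OF L2_measurable[OF d(1)] L2_measurable[OF v2] weak_deriv_unique[OF d(1) v2 d(2) this]]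
  have n: "L2_norm (weak_deriv [] v) = L2_norm v" .
  have set: "deriv_lists 1 = insert [] ((\<lambda>b::'a. [b]) ` Basis)"
  proof -
    have "bs \<in> insert [] ((\<lambda>b::'a. [b]) ` Basis)" if "bs \<in> lists Basis" "length bs \<le> 1" for bs :: "'a list"
      using that by (cases bs) auto
    then show ?thesis by (auto simp: deriv_lists_def)
  qed
  have "(\<Sum>bs\<in>deriv_lists 1. (L2_norm (weak_deriv bs v))\<^sup>2) = (L2_norm v)\<^sup>2 + grad_square v"
    unfolding set grad_square_def by (subst sum.insert) (auto simp: n sum.reindex inj_on_def)
  then show ?thesis by (simp add: Sobolev_norm_def)
qed

lemma grad_square_eq:
  fixes v :: "'a::euclidean_space \<Rightarrow> complex"
  assumes v: "v \<in> Sobolev 2"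
  shows "pairing (\<lambda>x. \<Sum>b\<in>Basis. weak_deriv [b, b] v x) (\<lambda>x. cnj (v x)) = - of_real (grad_square v)"
proof -
  note S = Sobolev_2_regularity[OF v]
  have c: "(\<lambda>x. cnj (v x)) \<in> L2" using v by (auto simp: Sobolev_def)
  have "pairing (\<lambda>x. \<Sum>b\<in>Basis. weak_deriv [b, b] v x) (\<lambda>x. cnj (v x)) = (\<Sum>b\<in>Basis. pairing (weak_deriv [b, b] v) (\<lambda>x. cnj (v x)))"
    by (rule pairing_sum_left[OF _ c]) (rule has_partialD(2)[OF S(2)])
  also have "\<dots> = (\<Sum>b\<in>Basis. - of_real ((L2_norm (weak_deriv [b] v))\<^sup>2))"
    by (intro sum.cong refl) (rule Green_partial[OF S(1) S(2)])
  finally show ?thesis by (simp add: grad_square_def sum_negf)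
qed

lemma translation_Lipschitz_grad_square:
  fixes v :: "'a::euclidean_space \<Rightarrow> complex"
  assumes v: "v \<in> Sobolev 2" and A: "grad_square v \<le> A\<^sup>2" "0 \<le> A"
  shows "translation_Lipschitz v (real DIM('a) * A)"
proof -
  note S = Sobolev_2_regularity[OF v]
  have "L2_norm (weak_deriv [b] v) \<le> A" if "b \<in> Basis" for b
  proof (rule power2_le_imp_le[OF _ A(2)])
    have "(L2_norm (weak_deriv [b] v))\<^sup>2 \<le> grad_square v"
      unfolding grad_square_def by (rule member_le_sum[OF that]) auto
    then show "(L2_norm (weak_deriv [b] v))\<^sup>2 \<le> A\<^sup>2" using A(1) by linarith
  qed
  then have "(\<Sum>b\<in>Basis. L2_norm (weak_deriv [b] v)) \<le> (\<Sum>b\<in>(Basis::'a set). A)" by (intro sum_mono)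
  then show ?thesis
    by (intro translation_Lipschitz_mono[OF translation_Lipschitz_of_partials[of v "\<lambda>b. weak_deriv [b] v", OF S(1)]]) simp_all
qed

text \<open>Difference quotients converge to the weak derivative; this gives a bound for its norm, and it
  shows that the norm depends measurably on a parameter although the weak derivative is
  chosen arbitrarily for each value of the parameter.\<close>

lemma difference_quotient_tendsto:
  assumes vg: "has_partial v b g" and gg: "has_partial g b g2"
  shows "(\<lambda>n. real (Suc n) * L2_norm (\<lambda>x. v (x + (1 / real (Suc n)) *\<^sub>R b) - v x)) \<longlonglongrightarrow> L2_norm g"
proof (rule LIM_zero_cancel, rule Lim_null_comparison)
  have v: "v \<in> L2" and g: "g \<in> L2" using has_partialD[OF vg] by auto
  show "\<forall>\<^sub>F n in sequentially. norm (real (Suc n) * L2_norm (\<lambda>x. v (x + (1 / real (Suc n)) *\<^sub>R b) - v x) - L2_norm g) \<le> 1 / real (Suc n) * L2_norm g2"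
  proof (intro always_eventually allI)
    fix n
    define N where "N = real (Suc n)"
    define h where "h = 1 / N"
    have N: "0 < N" by (simp add: N_def)
    have h: "0 < h" "N * h = 1" using N by (auto simp: h_def)
    have d: "(\<lambda>x. v (x + h *\<^sub>R b) - v x) \<in> L2" by (intro L2_diff L2_translate v)
    define q where "q = L2_norm (\<lambda>x. v (x + h *\<^sub>R b) - v x)"
    have "\<bar>q - L2_norm (\<lambda>x. of_real h * g x)\<bar> \<le> L2_norm (\<lambda>x. v (x + h *\<^sub>R b) - v x - of_real h * g x)"
      unfolding q_def by (rule L2_norm_reverse_triangle[OF d L2_scale[OF g]])
    also have "\<dots> \<le> h\<^sup>2 * L2_norm g2" by (rule difference_quotient_bound[OF vg gg less_imp_le[OF h(1)]])
    also have "L2_norm (\<lambda>x. of_real h * g x) = h * L2_norm g" unfolding L2_norm_scale using h by simp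
    finally have "N * \<bar>q - h * L2_norm g\<bar> \<le> N * (h\<^sup>2 * L2_norm g2)"
      using N by (intro mult_left_mono) auto
    moreover have "N * \<bar>q - h * L2_norm g\<bar> = \<bar>N * q - L2_norm g\<bar>"
    proof -
      have "N * \<bar>q - h * L2_norm g\<bar> = \<bar>N * (q - h * L2_norm g)\<bar>" using N by (simp add: abs_mult)
      also have "N * (q - h * L2_norm g) = N * q - (N * h) * L2_norm g" by (simp add: algebra_simps)
      finally show ?thesis unfolding h(2) by simp
    qed
    moreover have "N * (h\<^sup>2 * L2_norm g2) = h * L2_norm g2"
      using h(2) by (simp add: power2_eq_square flip: mult.assoc)
    ultimately have "norm (N * q - L2_norm g) \<le> h * L2_norm g2" by simp
    then show "norm (real (Suc n) * L2_norm (\<lambda>x. v (x + (1 / real (Suc n)) *\<^sub>R b) - v x) - L2_norm g) \<le> 1 / real (Suc n) * L2_norm g2"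
      unfolding q_def h_def N_def .
  qed
  show "(\<lambda>n. 1 / real (Suc n) * L2_norm g2) \<longlonglongrightarrow> 0"
    using tendsto_mult_right[OF LIMSEQ_Suc[OF lim_const_over_n[of 1]], of "L2_norm g2"] by simp
qed

lemma grad_square_le:
  fixes v :: "'a::euclidean_space \<Rightarrow> complex"
  assumes v: "v \<in> Sobolev 2" and M: "translation_Lipschitz v M"
  shows "grad_square v \<le> real DIM('a) * M\<^sup>2"
proof -
  note S = Sobolev_2_regularity[OF v]
  have "(L2_norm (weak_deriv [b] v))\<^sup>2 \<le> M\<^sup>2" if b: "b \<in> Basis" for b
  proof -
    have "L2_norm (weak_deriv [b] v) \<le> M"
    proof (rule LIMSEQ_le_const2[OF difference_quotient_tendsto[OF S(1)[OF b] S(2)[OF b]]])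
      show "\<exists>N. \<forall>n\<ge>N. real (Suc n) * L2_norm (\<lambda>x. v (x + (1 / real (Suc n)) *\<^sub>R b) - v x) \<le> M"
      proof (intro exI allI impI)
        fix n
        define N where "N = real (Suc n)"
        have N: "0 < N" by (simp add: N_def)
        have "L2_norm (\<lambda>x. v (x + (1 / N) *\<^sub>R b) - v x) \<le> norm ((1 / N) *\<^sub>R b) * M"
          using M unfolding translation_Lipschitz_def by blast
        then have "N * L2_norm (\<lambda>x. v (x + (1 / N) *\<^sub>R b) - v x) \<le> M"
          using N norm_Basis[OF b] by (simp add: field_simps)
        then show "real (Suc n) * L2_norm (\<lambda>x. v (x + (1 / real (Suc n)) *\<^sub>R b) - v x) \<le> M"
          unfolding N_def .
      qed
    qed
    then show ?thesis by (intro power_mono) auto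
  qed
  then have "grad_square v \<le> (\<Sum>b\<in>(Basis::'a set). M\<^sup>2)" unfolding grad_square_def by (intro sum_mono)
  then show ?thesis by simp
qed

text \<open>Without measurability the essential supremum of the norm would carry no information. It is not immediate, because the weak derivatives are
  chosen separately for each time; their norms, however, are limits of norms of difference quotients.\<close>

lemma measurable_Sobolev_norm_1:
  fixes e :: "real \<Rightarrow> 'a::euclidean_space \<Rightarrow> complex"
  assumes meas: "(\<lambda>(t, x). e t x) \<in> borel_measurable borel" and S: "AE t in lborel. t \<in> {0<..<T} \<longrightarrow> e t \<in> Sobolev 2"
  shows "(\<lambda>t. Sobolev_norm 1 (e t)) \<in> borel_measurable (lebesgue_on {0<..<T})"
proof -
  have [measurable]: "(\<lambda>(t, x). e t x) \<in> borel_measurable (borel \<Otimes>\<^sub>M borel)" using meas by (simp add: borel_prod)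
  define D where "D b n t = real (Suc n) * L2_norm (\<lambda>x. e t (x + (1 / real (Suc n)) *\<^sub>R b) - e t x)" for b n t
  have mD [measurable]: "D b n \<in> borel_measurable borel" for b n
    unfolding D_def L2_norm_def by measurable
  define q where "q t = sqrt ((L2_norm (e t))\<^sup>2 + (\<Sum>b\<in>Basis. (lim (\<lambda>n. D b n t))\<^sup>2))" for t
  have ml: "(\<lambda>t. lim (\<lambda>n. D b n t)) \<in> borel_measurable borel" for b by measurable
  note [measurable] = ml
  have [measurable]: "q \<in> borel_measurable borel" unfolding q_def L2_norm_square by measurable
  have "AE t in lborel. (if t \<in> {0<..<T} then q t else 0) = (if t \<in> {0<..<T} then Sobolev_norm 1 (e t) else 0)"
    using S
  proof eventually_elim
    fix t assume *: "t \<in> {0<..<T} \<longrightarrow> e t \<in> Sobolev 2"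
    show "(if t \<in> {0<..<T} then q t else 0) = (if t \<in> {0<..<T} then Sobolev_norm 1 (e t) else 0)"
    proof (cases "t \<in> {0<..<T}")
      case True
      then have e: "e t \<in> Sobolev 2" using * by blast
      note F = Sobolev_2_regularity[OF e]
      have "lim (\<lambda>n. D b n t) = L2_norm (weak_deriv [b] (e t))" if "b \<in> Basis" for b
        unfolding D_def by (rule limI[OF difference_quotient_tendsto[OF F(1)[OF that] F(2)[OF that]]])
      then have "q t = Sobolev_norm 1 (e t)"
        unfolding q_def Sobolev_norm_1[OF Sobolev_mono[OF e one_le_numeral]] grad_square_def by simp
      then show ?thesis by (simp only:)
    next
      case False
      then show ?thesis by (simp only: if_False)
    qed
  qed
  then have ae: "AE t in lebesgue. (if t \<in> {0<..<T} then q t else 0) = (if t \<in> {0<..<T} then Sobolev_norm 1 (e t) else 0)"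
    by (rule AE_completion)
  have "(\<lambda>t. if t \<in> {0<..<T} then q t else 0) \<in> borel_measurable lborel" by measurable
  then have "(\<lambda>t. if t \<in> {0<..<T} then q t else 0) \<in> borel_measurable lebesgue" by (rule measurable_completion)
  from borel_measurable_AE[OF this ae]
  have "(\<lambda>t. if t \<in> {0<..<T} then Sobolev_norm 1 (e t) else 0) \<in> borel_measurable (lebesgue_on {0<..<T})"
    by (rule measurable_restrict_space1)
  then show ?thesis
    by (rule measurable_cong[THEN iffD1, rotated]) (simp add: space_restrict_space)
qed

text \<open>The forcing of the difference of \<open>y + e\<close> and \<open>y\<close> splits into a difference of values of the regularised nonlinearity, estimated with the logarithmic
  Sobolev inequality, and the regularisation error of \<open>y\<close>. The gradient of \<open>e\<close> enters linearly, through \<open>M\<close>.\<close>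

lemma forcing_bound:
  fixes y e :: "'a::euclidean_space \<Rightarrow> complex"
  assumes dim: "DIM('a) \<le> 3" and \<epsilon>: "0 < \<epsilon>" "\<epsilon> \<le> 1"
    and y: "regular_slice K y" "translation_Lipschitz y K" "0 \<le> K" "L2_norm y \<le> B"
    and e: "translation_Lipschitz e M" "0 \<le> M" "L2_norm e \<le> B"
    and C: "\<And>(f :: 'a \<Rightarrow> complex) M. translation_Lipschitz f M \<Longrightarrow> 0 \<le> M \<Longrightarrow> L2_norm f \<le> B \<Longrightarrow>
      (\<lambda>x. of_real (times_log (f x))) \<in> L2 \<and> L2_norm (\<lambda>x. of_real (times_log (f x))) \<le> C * (1 + M)"
  shows "(\<lambda>x. reg_log_nonlin lam \<epsilon> (y x + e x) - reg_log_nonlin lam 0 (y x)) \<in> L2"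
    "L2_norm (\<lambda>x. reg_log_nonlin lam \<epsilon> (y x + e x) - reg_log_nonlin lam 0 (y x))
      \<le> 2 * \<bar>lam\<bar> * ((1 + ln (1 / \<epsilon>)) * L2_norm e + C * (1 + K) + C * (1 + M)) + sqrt (error_bound lam K DIM('a))"
proof -
  define c where "c = 1 + ln (1 / \<epsilon>)"
  have c: "0 \<le> c" using \<epsilon> by (simp add: c_def)
  have y2: "y \<in> L2" and e2: "e \<in> L2" using y(2) e(1) by (auto simp: translation_Lipschitz_def)
  note [measurable] = L2_measurable[OF y2] L2_measurable[OF e2]
  define q where "q f x = complex_of_real (times_log (f x))" for f :: "'a \<Rightarrow> complex" and x
  have qy: "q y \<in> L2" "L2_norm (q y) \<le> C * (1 + K)" using C[OF y(2,3,4)] by (auto simp: q_def[abs_def])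
  have qe: "q e \<in> L2" "L2_norm (q e) \<le> C * (1 + M)" using C[OF e] by (auto simp: q_def[abs_def])
  define n where "n x = complex_of_real (cmod (e x))" for x
  have "n \<in> borel_measurable borel" unfolding n_def[abs_def] by measurable
  then have nE: "n \<in> L2" "L2_norm n = L2_norm e"
    using e2 by (auto simp: n_def L2_def L2_norm_def)
  define g where "g x = of_real (2 * \<bar>lam\<bar>) * ((of_real c * n x + q y x) + q e x)" for x
  have parts: "(\<lambda>x. of_real c * n x) \<in> L2" "(\<lambda>x. of_real c * n x + q y x) \<in> L2" "(\<lambda>x. (of_real c * n x + q y x) + q e x) \<in> L2"
    by (intro L2_add L2_scale nE qy qe)+
  have g: "g \<in> L2" unfolding g_def[abs_def] by (intro L2_scale parts)
  have "L2_norm (\<lambda>x. (of_real c * n x + q y x) + q e x) \<le> c * L2_norm e + C * (1 + K) + C * (1 + M)"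
    using L2_norm_triangle[OF parts(2) qe(1)] L2_norm_triangle[OF parts(1) qy(1)] qy(2) qe(2) c
    by (simp add: L2_norm_scale nE)
  then have gn: "L2_norm g \<le> 2 * \<bar>lam\<bar> * (c * L2_norm e + C * (1 + K) + C * (1 + M))"
    unfolding g_def[abs_def] L2_norm_scale by (simp add: mult_left_mono abs_mult)
  define N where "N x = reg_log_nonlin lam \<epsilon> (y x + e x) - reg_log_nonlin lam \<epsilon> (y x)" for x
  have Nb: "cmod (N x) \<le> cmod (g x)" for x
  proof -
    have "g x = complex_of_real (2 * \<bar>lam\<bar> * (c * cmod (e x) + times_log (y x) + times_log (e x)))"
      by (simp add: g_def n_def q_def)
    then have "cmod (g x) = 2 * \<bar>lam\<bar> * (c * cmod (e x) + times_log (y x) + times_log (e x))"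
      using c by (simp only: norm_of_real) (simp add: times_log_nonneg)
    then show ?thesis using reg_log_nonlin_diff[OF \<epsilon>, of lam "y x" "e x"] by (simp add: N_def c_def)
  qed
  have mN: "N \<in> borel_measurable borel" unfolding N_def[abs_def] by measurable
  note N = L2I_bound[OF mN g AE_I2[OF Nb]]
  define S where "S x = reg_log_nonlin lam \<epsilon> (y x) - reg_log_nonlin lam 0 (y x)" for x
  have S: "S \<in> L2" "L2_norm S \<le> sqrt (error_bound lam K DIM('a))"
    using error_norm_le[OF dim \<epsilon> y(1), of lam] by (auto simp: S_def[abs_def] error_norm_def intro: real_le_rsqrt)
  have eq: "(\<lambda>x. reg_log_nonlin lam \<epsilon> (y x + e x) - reg_log_nonlin lam 0 (y x)) = (\<lambda>x. N x + S x)"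
    by (simp add: N_def S_def)
  show "(\<lambda>x. reg_log_nonlin lam \<epsilon> (y x + e x) - reg_log_nonlin lam 0 (y x)) \<in> L2"
    unfolding eq by (intro L2_add N S)
  show "L2_norm (\<lambda>x. reg_log_nonlin lam \<epsilon> (y x + e x) - reg_log_nonlin lam 0 (y x))
      \<le> 2 * \<bar>lam\<bar> * ((1 + ln (1 / \<epsilon>)) * L2_norm e + C * (1 + K) + C * (1 + M)) + sqrt (error_bound lam K DIM('a))"
    using L2_norm_triangle[OF N(1) S(1)] N(2) gn S(2) unfolding eq c_def by linarith
qed

lemma grad_square_nonneg: "0 \<le> grad_square v"
  by (simp add: grad_square_def sum_nonneg)

lemma Lipschitz_constant_nonneg: "0 \<le> K \<Longrightarrow> 0 \<le> Lipschitz_constant lam T K d"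
  by (simp add: Lipschitz_constant_def error_bound_nonneg)

text \<open>If the gradient is bounded by \<open>A\<close> at almost all times, the forcing is bounded by a constant plus a multiple of \<open>A\<close>. Testing the equation with
  the error bounds the square of the gradient by \<open>(a + b * A) * X\<close>, which improves \<open>A\<close> as long as
  it is larger than the asserted bound.\<close>

lemma grad_square_error:
  fixes v u :: "real \<Rightarrow> 'a::euclidean_space \<Rightarrow> complex"
  assumes dim: "DIM('a) \<le> 3" and \<epsilon>: "0 < \<epsilon>" "\<epsilon> \<le> 1" and v: "NLS_on lam \<epsilon> (T + 1) Kv v" and u: "NLS_on lam 0 (T + 1) K u"
    and T: "0 < T" and init: "AE x in lborel. v 0 x = u 0 x"
    and B: "1 \<le> B" "K \<le> B" and C0: "0 \<le> C"
    and C: "\<And>(f :: 'a \<Rightarrow> complex) M. translation_Lipschitz f M \<Longrightarrow> 0 \<le> M \<Longrightarrow> L2_norm f \<le> B \<Longrightarrow>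
      (\<lambda>x. of_real (times_log (f x))) \<in> L2 \<and> L2_norm (\<lambda>x. of_real (times_log (f x))) \<le> C * (1 + M)"
    and X: "\<And>t. t \<in> {0..T} \<Longrightarrow> L2_norm (\<lambda>x. v t x - u t x) \<le> X" "X \<le> 1" "(1 + ln (1 / \<epsilon>)) * X \<le> 1"
    and a: "a = Lipschitz_constant lam T K DIM('a) + 2 * \<bar>lam\<bar> * (1 + C * (1 + K) + C) + sqrt (error_bound lam K DIM('a))"
    and b: "b = 2 * \<bar>lam\<bar> * C * real DIM('a)"
  shows "AE t in lborel. t \<in> {0<..<T} \<longrightarrow> (\<lambda>x. v t x - u t x) \<in> Sobolev 2 \<and> grad_square (\<lambda>x. v t x - u t x) \<le> 2 * a * X + b\<^sup>2 * X\<^sup>2"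
proof -
  define e where "e t = (\<lambda>x. v t x - u t x)" for t
  have K: "0 \<le> K" "0 \<le> Kv" using NLS_onD(6)[OF u] NLS_onD(6)[OF v] .
  have vT: "NLS_on lam \<epsilon> T Kv v" and uT: "NLS_on lam 0 T K u"
    using NLS_on_mono[OF v] NLS_on_mono[OF u] by auto
  interpret forced_evolution e "\<lambda>t x. reg_log_nonlin lam \<epsilon> (v t x) - reg_log_nonlin lam 0 (u t x)" T "Kv + K" "Kv + K" "Kv + K"
    unfolding e_def by (rule forced_evolution_diff[OF vT uT T])
  have X0: "0 \<le> X" using order_trans[OF L2_norm_nonneg X(1)[of 0]] T by simp
  have a0: "0 \<le> a" unfolding a using K C0 Lipschitz_constant_nonneg by (simp add: error_bound_nonneg)
  define L where "L = Lipschitz_constant lam T K DIM('a)"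
  have L0: "0 \<le> L" unfolding L_def by (rule Lipschitz_constant_nonneg[OF K(1)])
  have S2: "AE t in lborel. t \<in> {0..T} \<longrightarrow> e t \<in> Sobolev 2"
    using NLS_onD(5)[OF vT] NLS_onD(5)[OF uT]
    by eventually_elim (auto simp: regular_slice_def e_def intro: Sobolev_diff)
  have step: "AE t in lborel. t \<in> {0<..<T} \<longrightarrow> grad_square (e t) \<le> (a + b * A) * X"
    if A: "0 \<le> A" "AE t in lborel. t \<in> {0<..<T} \<longrightarrow> grad_square (e t) \<le> A\<^sup>2" for A
  proof -
    define \<Gamma> where "\<Gamma> = 2 * \<bar>lam\<bar> * (1 + C * (1 + K) + C * (1 + real DIM('a) * A)) + sqrt (error_bound lam K DIM('a))"
    have \<Gamma>0: "0 \<le> \<Gamma>" unfolding \<Gamma>_def using K C0 A(1) by (simp add: error_bound_nonneg)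
    have "AE t in lborel. t \<noteq> 0" "AE t in lborel. t \<noteq> T" by (rule AE_lborel_singleton)+
    then have F: "AE t in lborel. t \<in> {0..T} \<longrightarrow> (\<lambda>x. reg_log_nonlin lam \<epsilon> (v t x) - reg_log_nonlin lam 0 (u t x)) \<in> L2 \<and>
        L2_norm (\<lambda>x. reg_log_nonlin lam \<epsilon> (v t x) - reg_log_nonlin lam 0 (u t x)) \<le> \<Gamma>"
      using S2 A(2) NLS_onD(5)[OF uT] L2_bounded_onD(4)[OF NLS_onD(2)[OF uT]]
    proof (eventually_elim, intro impI)
      fix t assume "t \<noteq> 0" "t \<noteq> T" "t \<in> {0..T}" and *: "t \<in> {0..T} \<longrightarrow> e t \<in> Sobolev 2"
          "t \<in> {0<..<T} \<longrightarrow> grad_square (e t) \<le> A\<^sup>2" "t \<in> {0..T} \<longrightarrow> regular_slice K (u t)" "t \<in> {0..T} \<longrightarrow> u t \<in> L2 \<and> L2_norm (u t) \<le> K"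
      then have t: "t \<in> {0..T}" "t \<in> {0<..<T}" by auto
      have tl: "translation_Lipschitz (e t) (real DIM('a) * A)"
        by (rule translation_Lipschitz_grad_square) (use * t A(1) in auto)
      have un: "L2_norm (u t) \<le> B" using * t B(2) by auto
      have en: "L2_norm (e t) \<le> X" using X(1)[OF t(1)] by (simp add: e_def)
      have en': "L2_norm (e t) \<le> B" using en X(2) B(1) by linarith
      have dA: "0 \<le> real DIM('a) * A" using A(1) by simp
      have rs: "regular_slice K (u t)" using * t by blast
      note FB = forcing_bound[OF dim \<epsilon> rs NLS_onD(4)[OF uT t(1)] K(1) un tl dA en' C, of lam]
      have eq: "(\<lambda>x. reg_log_nonlin lam \<epsilon> (u t x + e t x) - reg_log_nonlin lam 0 (u t x)) = (\<lambda>x. reg_log_nonlin lam \<epsilon> (v t x) - reg_log_nonlin lam 0 (u t x))"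
        by (simp add: e_def)
      have "(1 + ln (1 / \<epsilon>)) * L2_norm (e t) \<le> (1 + ln (1 / \<epsilon>)) * X" using en \<epsilon> by (intro mult_left_mono) auto
      also have "\<dots> \<le> 1" by (rule X(3))
      finally have "2 * \<bar>lam\<bar> * ((1 + ln (1 / \<epsilon>)) * L2_norm (e t) + C * (1 + K) + C * (1 + real DIM('a) * A)) \<le> 2 * \<bar>lam\<bar> * (1 + C * (1 + K) + C * (1 + real DIM('a) * A))"
        by (intro mult_left_mono add_right_mono) auto
      then show "(\<lambda>x. reg_log_nonlin lam \<epsilon> (v t x) - reg_log_nonlin lam 0 (u t x)) \<in> L2 \<and>
        L2_norm (\<lambda>x. reg_log_nonlin lam \<epsilon> (v t x) - reg_log_nonlin lam 0 (u t x)) \<le> \<Gamma>"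
        using FB unfolding eq \<Gamma>_def by linarith
    qed
    show ?thesis
      using S2
    proof (eventually_elim, intro impI)
      fix t assume *: "t \<in> {0..T} \<longrightarrow> e t \<in> Sobolev 2" and t: "t \<in> {0<..<T}"
      then have e2: "e t \<in> Sobolev 2" and t0: "0 \<le> t" "t < T" by auto
      have "cmod (pairing (\<lambda>x. \<Sum>b\<in>Basis. weak_deriv [b, b] (e t) x) (\<lambda>x. cnj (e t x))) \<le> (L + \<Gamma>) * L2_norm (e t)"
      proof (rule laplacian_pairing_bound[OF Sobolev_2_regularity(3)[OF e2] t0 zero_less_one _ L0 F \<Gamma>0])
        fix h :: real assume h: "0 < h" "h \<le> 1"
        show "L2_norm (\<lambda>x. e (t + h) x - e t x) \<le> h * L"
          unfolding e_def L_def by (rule difference_time_Lipschitz[OF dim \<epsilon> v u T init _ h]) (use t in auto)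
      qed
      then have "grad_square (e t) \<le> (L + \<Gamma>) * L2_norm (e t)"
        unfolding grad_square_eq[OF e2] by (simp add: grad_square_nonneg)
      also have "\<dots> \<le> (L + \<Gamma>) * X"
        using X(1)[of t] t L0 \<Gamma>0 by (intro mult_left_mono) (auto simp: e_def)
      also have "L + \<Gamma> = a + b * A" unfolding \<Gamma>_def a b L_def by (simp add: algebra_simps)
      finally show "grad_square (e t) \<le> (a + b * A) * X" .
    qed
  qed
  define Q where "Q = 2 * a * X + b\<^sup>2 * X\<^sup>2"
  define R where "R = real DIM('a) * (Kv + K)\<^sup>2"
  have Q0: "0 \<le> Q" and R0: "0 \<le> R" using a0 X0 by (auto simp: Q_def R_def)
  \<comment> \<open>By Young's inequality the bound \<open>A\<^sup>2\<close> improves to \<open>(Q + A\<^sup>2) / 2\<close>; iteration drives it down to \<open>Q\<close>. The iteration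
    starts with a bound that depends on \<open>\<epsilon>\<close>, which is forgotten in the limit.\<close>
  have iter: "AE t in lborel. t \<in> {0<..<T} \<longrightarrow> grad_square (e t) \<le> Q + R / 2 ^ n" for n
  proof (induction n)
    case 0
    show ?case using S2
    proof (eventually_elim, intro impI)
      fix t assume *: "t \<in> {0..T} \<longrightarrow> e t \<in> Sobolev 2" and t: "t \<in> {0<..<T}"
      have "grad_square (e t) \<le> R" unfolding R_def
        by (rule grad_square_le) (use * t Lipschitz[of t] in auto)
      then show "grad_square (e t) \<le> Q + R / 2 ^ 0" using Q0 by simp
    qed
  next
    case (Suc n)
    define A where "A = sqrt (Q + R / 2 ^ n)"
    have A: "0 \<le> A" "A\<^sup>2 = Q + R / 2 ^ n" using Q0 R0 by (auto simp: A_def)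
    have "AE t in lborel. t \<in> {0<..<T} \<longrightarrow> grad_square (e t) \<le> (a + b * A) * X"
      by (rule step[OF A(1)]) (use Suc.IH in \<open>simp only: A(2)\<close>)
    moreover have "(a + b * A) * X \<le> Q + R / 2 ^ Suc n"
    proof -
      have "0 \<le> (b * X - A)\<^sup>2" by simp
      then have "2 * ((a + b * A) * X) \<le> Q + A\<^sup>2" unfolding Q_def by (simp add: power2_diff power_mult_distrib algebra_simps)
      then show ?thesis unfolding A(2) by simp
    qed
    ultimately show ?case by (elim eventually_mono) auto
  qed
  have "AE t in lborel. \<forall>n. t \<in> {0<..<T} \<longrightarrow> grad_square (e t) \<le> Q + R / 2 ^ n"
    unfolding AE_all_countable using iter by blast
  then show ?thesis
    using S2
  proof (eventually_elim, intro impI)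
    fix t assume *: "\<forall>n. t \<in> {0<..<T} \<longrightarrow> grad_square (e t) \<le> Q + R / 2 ^ n" "t \<in> {0..T} \<longrightarrow> e t \<in> Sobolev 2" and t: "t \<in> {0<..<T}"
    have "(\<lambda>n. Q + R / 2 ^ n) \<longlonglongrightarrow> Q + 0" by (intro tendsto_intros LIMSEQ_divide_realpow_zero) simp
    then have "grad_square (e t) \<le> Q + 0" by (rule LIMSEQ_le_const) (use * t in auto)
    then show "(\<lambda>x. v t x - u t x) \<in> Sobolev 2 \<and> grad_square (\<lambda>x. v t x - u t x) \<le> 2 * a * X + b\<^sup>2 * X\<^sup>2"
      using * t unfolding Q_def e_def by auto
  qed
qed

section \<open>Convergence rates\<close>

text \<open>The source is \<open>o\<close> of the rate, so the error \<open>X\<close> in \<open>L2\<close> is at most a prescribed small multiple of the rate; the multiple is chosen such that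
  the square of the norm in \<open>H\<^sup>1\<close>, which is of order \<open>X\<close>, is below the rate with constant one.\<close>

lemma solutions_close:
  fixes u :: "real \<Rightarrow> 'a::euclidean_space \<Rightarrow> complex"
  assumes dim: "DIM('a) \<le> 3" and T: "0 < T" and u: "NLS_solution (reg_log_nonlin lam 0) u0 u"
    and v: "\<And>\<epsilon>. 0 < \<epsilon> \<Longrightarrow> NLS_solution (reg_log_nonlin lam \<epsilon>) u0 (v \<epsilon>)"
    and \<alpha>_def: "\<alpha> = 4 / (4 + real DIM('a))"
  shows "\<forall>\<^sub>F \<epsilon> in at_right 0. (\<forall>t\<in>{0..T}. L2_norm (\<lambda>x. v \<epsilon> t x - u t x) \<le> \<epsilon> powr \<alpha>) \<and>
    (AE t in lborel. t \<in> {0<..<T} \<longrightarrow> (\<lambda>x. v \<epsilon> t x - u t x) \<in> Sobolev 2 \<and> Sobolev_norm 1 (\<lambda>x. v \<epsilon> t x - u t x) \<le> \<epsilon> powr (\<alpha> / 2))"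
proof -
  have \<alpha>: "0 < \<alpha>" by (simp add: \<alpha>_def)
  have T1: "0 < T + 1" using T by simp
  obtain K where K: "NLS_on lam 0 (T + 1) K u" by (rule NLS_on_if_NLS_solution[OF dim order_refl u T1])
  have uT: "NLS_on lam 0 T K u" by (rule NLS_on_mono[OF K]) simp
  note K0 = NLS_onD(6)[OF K]
  define B where "B = max 1 K"
  have B: "1 \<le> B" "K \<le> B" by (auto simp: B_def)
  obtain C where C0: "0 \<le> C" and C: "\<And>(f :: 'a \<Rightarrow> complex) M. translation_Lipschitz f M \<Longrightarrow> 0 \<le> M \<Longrightarrow> L2_norm f \<le> B \<Longrightarrow>
      (\<lambda>x. of_real (times_log (f x))) \<in> L2 \<and> L2_norm (\<lambda>x. of_real (times_log (f x))) \<le> C * (1 + M)"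
    using log_Sobolev[where 'a='a, OF dim B(1)] by blast
  define a where "a = Lipschitz_constant lam T K DIM('a) + 2 * \<bar>lam\<bar> * (1 + C * (1 + K) + C) + sqrt (error_bound lam K DIM('a))"
  define b where "b = 2 * \<bar>lam\<bar> * C * real DIM('a)"
  have a: "0 \<le> a" unfolding a_def using K0 C0 Lipschitz_constant_nonneg[OF K0] by (simp add: error_bound_nonneg)
  \<comment> \<open>A constant so small that the error \<open>X\<close> in \<open>L2\<close> satisfies \<open>X\<^sup>2 + (2 * a * X + b\<^sup>2 * X\<^sup>2) \<le> \<epsilon> powr \<alpha>\<close>.\<close>
  define \<eta> where "\<eta> = 1 / (1 + 2 * a + b\<^sup>2)"
  have den: "1 \<le> 1 + 2 * a + b\<^sup>2" using a by simp
  have \<eta>: "0 < \<eta>" "\<eta> \<le> 1" "\<eta> * (1 + 2 * a + b\<^sup>2) = 1" unfolding \<eta>_def using den by (auto simp: divide_le_eq)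
  define E where "E = exp ((4 * \<bar>lam\<bar> + 1) * T)"
  have \<eta>E: "0 < \<eta>\<^sup>2 / E" using \<eta>(1) by (simp add: E_def)
  have mu: "(\<lambda>(t, x). u t x) \<in> borel_measurable borel" by (rule L2_bounded_onD(1)[OF NLS_onD(2)[OF uT]])
  have u22: "AE t in lborel. t \<in> {0..T} \<longrightarrow> u t \<in> L22 \<and> L22_norm (u t) \<le> K"
    using NLS_onD(5)[OF uT] by eventually_elim (auto simp: regular_slice_def)
  have "((\<lambda>\<epsilon>. (1 + ln (1 / \<epsilon>)) * (\<eta> * \<epsilon> powr \<alpha>)) \<longlongrightarrow> 0) (at_right 0)" using \<alpha> \<eta>(1) by real_asymp
  from order_tendstoD(2)[OF this zero_less_one] have ev: "\<forall>\<^sub>F \<epsilon> in at_right 0. (1 + ln (1 / \<epsilon>)) * (\<eta> * \<epsilon> powr \<alpha>) < 1" .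
  have ev1: "\<forall>\<^sub>F \<epsilon> in at_right (0::real). \<epsilon> < 1" unfolding eventually_at_right_field by (intro exI[of _ 1]) simp
  show ?thesis
    using regularisation_error_small[OF dim T mu u22 K0 \<eta>E, of lam] ev ev1 eventually_at_right_less[of 0]
  proof eventually_elim
    fix \<epsilon> :: real
    assume I: "(LINT t:{0..T}|lborel. (L2_norm (\<lambda>x. reg_log_nonlin lam \<epsilon> (u t x) - reg_log_nonlin lam 0 (u t x)))\<^sup>2)
       \<le> \<eta>\<^sup>2 / E * \<epsilon> powr (8 / (4 + real DIM('a)))"
      and log: "(1 + ln (1 / \<epsilon>)) * (\<eta> * \<epsilon> powr \<alpha>) < 1" and \<epsilon>: "\<epsilon> < 1" "0 < \<epsilon>"
    have \<epsilon>1: "\<epsilon> \<le> 1" using \<epsilon> by simp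
    define X where "X = \<eta> * \<epsilon> powr \<alpha>"
    have pw: "0 < \<epsilon> powr \<alpha>" "\<epsilon> powr \<alpha> \<le> 1" using \<epsilon> \<alpha> by (auto intro: powr_le1)
    have X: "0 < X" "X \<le> \<epsilon> powr \<alpha>" "X \<le> 1"
    proof -
      show "0 < X" using \<eta> pw by (simp add: X_def)
      show "X \<le> \<epsilon> powr \<alpha>" unfolding X_def using \<eta> pw mult_right_mono[of \<eta> 1 "\<epsilon> powr \<alpha>"] by simp
      then show "X \<le> 1" using pw by linarith
    qed
    obtain Kv where Kv: "NLS_on lam \<epsilon> (T + 1) Kv (v \<epsilon>)"
      by (rule NLS_on_if_NLS_solution[OF dim less_imp_le[OF \<epsilon>(2)] v[OF \<epsilon>(2)] T1])
    have vT: "NLS_on lam \<epsilon> T Kv (v \<epsilon>)" by (rule NLS_on_mono[OF Kv]) simp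
    have "AE x in lborel. v \<epsilon> 0 x = u0 x" "AE x in lborel. u 0 x = u0 x"
      using v[OF \<epsilon>(2)] u by (auto simp: NLS_solution_def)
    then have init: "AE x in lborel. v \<epsilon> 0 x = u 0 x" by eventually_elim simp
    have XX: "\<eta>\<^sup>2 * \<epsilon> powr (8 / (4 + real DIM('a))) = X\<^sup>2"
    proof -
      have "8 / (4 + real DIM('a)) = \<alpha> + \<alpha>" by (simp add: \<alpha>_def)
      then show ?thesis by (simp only: powr_add X_def power2_eq_square mult.assoc mult.commute mult.left_commute)
    qed
    have le: "L2_norm (\<lambda>x. v \<epsilon> t x - u t x) \<le> X" if t: "t \<in> {0..T}" for t
    proof (rule power2_le_imp_le)
      have "(L2_norm (\<lambda>x. v \<epsilon> t x - u t x))\<^sup>2 \<le> (LINT \<tau>:{0..T}|lborel. (error_norm lam \<epsilon> (u \<tau>))\<^sup>2) / 1 * exp ((4 * \<bar>lam\<bar> + 1) * t)"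
        by (rule NLS_on_comparison[OF dim \<epsilon>(2) \<epsilon>1 vT uT T t init zero_less_one])
      also have "\<dots> \<le> \<eta>\<^sup>2 / E * \<epsilon> powr (8 / (4 + real DIM('a))) * E"
      proof (rule mult_mono)
        show "(LINT \<tau>:{0..T}|lborel. (error_norm lam \<epsilon> (u \<tau>))\<^sup>2) / 1 \<le> \<eta>\<^sup>2 / E * \<epsilon> powr (8 / (4 + real DIM('a)))"
          using I by (simp add: error_norm_def)
        show "exp ((4 * \<bar>lam\<bar> + 1) * t) \<le> E" unfolding E_def using t by (simp add: mult_left_mono)
      qed (use \<eta> in \<open>auto simp: E_def\<close>)
      also have "\<dots> = X\<^sup>2" unfolding XX[symmetric] by (simp add: E_def)
      finally show "(L2_norm (\<lambda>x. v \<epsilon> t x - u t x))\<^sup>2 \<le> X\<^sup>2" .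
    qed (use X in simp)
    have log': "(1 + ln (1 / \<epsilon>)) * X \<le> 1" using log by (simp add: X_def)
    have "AE t in lborel. t \<in> {0<..<T} \<longrightarrow> (\<lambda>x. v \<epsilon> t x - u t x) \<in> Sobolev 2 \<and> grad_square (\<lambda>x. v \<epsilon> t x - u t x) \<le> 2 * a * X + b\<^sup>2 * X\<^sup>2"
      by (rule grad_square_error[OF dim \<epsilon>(2) \<epsilon>1 Kv K T init B C0 C le X(3) log' a_def b_def])
    then have "AE t in lborel. t \<in> {0<..<T} \<longrightarrow> (\<lambda>x. v \<epsilon> t x - u t x) \<in> Sobolev 2 \<and> Sobolev_norm 1 (\<lambda>x. v \<epsilon> t x - u t x) \<le> \<epsilon> powr (\<alpha> / 2)"
    proof (eventually_elim, intro impI)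
      fix t assume *: "t \<in> {0<..<T} \<longrightarrow> (\<lambda>x. v \<epsilon> t x - u t x) \<in> Sobolev 2 \<and> grad_square (\<lambda>x. v \<epsilon> t x - u t x) \<le> 2 * a * X + b\<^sup>2 * X\<^sup>2"
        and t: "t \<in> {0<..<T}"
      have S: "(\<lambda>x. v \<epsilon> t x - u t x) \<in> Sobolev 2" and G: "grad_square (\<lambda>x. v \<epsilon> t x - u t x) \<le> 2 * a * X + b\<^sup>2 * X\<^sup>2" using * t by auto
      have "(L2_norm (\<lambda>x. v \<epsilon> t x - u t x))\<^sup>2 \<le> X\<^sup>2" using le[of t] t by (intro power_mono) auto
      then have "(L2_norm (\<lambda>x. v \<epsilon> t x - u t x))\<^sup>2 + grad_square (\<lambda>x. v \<epsilon> t x - u t x) \<le> X\<^sup>2 + (2 * a * X + b\<^sup>2 * X\<^sup>2)"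
        using G by linarith
      also have "\<dots> \<le> X + (2 * a * X + b\<^sup>2 * X)"
      proof -
        have "X\<^sup>2 \<le> X" using X by (simp add: power2_eq_square mult_left_le)
        then show ?thesis by (intro add_mono order_refl mult_left_mono[of "X\<^sup>2" X "b\<^sup>2"]) auto
      qed
      also have "\<dots> = \<epsilon> powr \<alpha> * (\<eta> * (1 + 2 * a + b\<^sup>2))" by (simp add: X_def distrib_left mult.assoc mult.commute mult.left_commute)
      also have "\<dots> = (\<epsilon> powr (\<alpha> / 2))\<^sup>2" unfolding \<eta>(3) by (simp add: power2_eq_square flip: powr_add)
      finally have "Sobolev_norm 1 (\<lambda>x. v \<epsilon> t x - u t x) \<le> sqrt ((\<epsilon> powr (\<alpha> / 2))\<^sup>2)"
        unfolding Sobolev_norm_1[OF Sobolev_mono[OF S one_le_numeral]] by (rule real_sqrt_le_mono)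
      then show "(\<lambda>x. v \<epsilon> t x - u t x) \<in> Sobolev 2 \<and> Sobolev_norm 1 (\<lambda>x. v \<epsilon> t x - u t x) \<le> \<epsilon> powr (\<alpha> / 2)" using S by simp
    qed
    then show "(\<forall>t\<in>{0..T}. L2_norm (\<lambda>x. v \<epsilon> t x - u t x) \<le> \<epsilon> powr \<alpha>) \<and>
      (AE t in lborel. t \<in> {0<..<T} \<longrightarrow> (\<lambda>x. v \<epsilon> t x - u t x) \<in> Sobolev 2 \<and> Sobolev_norm 1 (\<lambda>x. v \<epsilon> t x - u t x) \<le> \<epsilon> powr (\<alpha> / 2))"
      using le X(2) by (meson order_trans)
  qed
qed

lemma Linf_norm_le:
  assumes m: "(\<lambda>t. N (w t)) \<in> borel_measurable (lebesgue_on {a<..<b})"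
    and ae: "AE t in lborel. t \<in> {a<..<b} \<longrightarrow> w t \<in> X \<and> N (w t) \<le> B"
  shows "Linf_norm {a<..<b} X N w \<le> ereal B"
proof -
  have "AE t in lebesgue. t \<in> {a<..<b} \<longrightarrow> w t \<in> X \<and> N (w t) \<le> B" by (rule AE_completion[OF ae])
  then have AE: "AE t in lebesgue_on {a<..<b}. w t \<in> X \<and> N (w t) \<le> B" by (subst AE_restrict_space_iff) auto
  then have 1: "AE t in lebesgue_on {a<..<b}. w t \<in> X" by eventually_elim simp
  have "esssup (lebesgue_on {a<..<b}) (\<lambda>t. ereal (N (w t))) \<le> ereal B"
  proof (rule esssup_I)
    show "AE t in lebesgue_on {a<..<b}. ereal (N (w t)) \<le> ereal B" using AE by eventually_elim simp
  qed (use m in simp)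
  then show ?thesis using 1 by (simp add: Linf_norm_def)
qed

text \<open>The constants can be taken to be \<open>1\<close> because the estimates hold with an arbitrarily small
  factor once \<open>\<epsilon>\<close> is small enough.\<close>

theorem proposition2p7:
  assumes "CARD('n::finite) \<le> 3"
  shows "\<exists>(C1 :: real \<Rightarrow> real \<Rightarrow> real \<Rightarrow> real) (C2 :: real \<Rightarrow> real \<Rightarrow> real \<Rightarrow> real \<Rightarrow> real).
    (\<forall>a T m. 0 < C1 a T m) \<and> (\<forall>a T m k. 0 < C2 a T m k) \<and>
    (\<forall>(lam :: real) (u0 :: real ^ 'n \<Rightarrow> complex) (u :: real \<Rightarrow> real ^ 'n \<Rightarrow> complex)
       (ueps :: real \<Rightarrow> real \<Rightarrow> real ^ 'n \<Rightarrow> complex) (T :: real).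
      lam \<noteq> 0 \<longrightarrow>
      u0 \<in> Sobolev 2 \<inter> L22 \<longrightarrow>
      NLS_solution (log_nonlin lam) u0 u \<longrightarrow>
      (\<forall>\<epsilon>>0. NLS_solution (reg_log_nonlin lam \<epsilon>) u0 (ueps \<epsilon>)) \<longrightarrow>
      T > 0 \<longrightarrow>
      (\<forall>\<^sub>F \<epsilon> in at_right 0.
         Linf_norm {0<..<T} L2 L2_norm (\<lambda>t x. ueps \<epsilon> t x - u t x)
           \<le> ereal (C1 \<bar>lam\<bar> T (L22_norm u0) * \<epsilon> powr (4 / (4 + real CARD('n)))) \<and>
         Linf_norm {0<..<T} (Sobolev 1) (Sobolev_norm 1) (\<lambda>t x. ueps \<epsilon> t x - u t x)
           \<le> ereal (C2 \<bar>lam\<bar> T (L22_norm u0) (Sobolev_norm 2 u0)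
                     * \<epsilon> powr (2 / (4 + real CARD('n))))))"
proof (rule exI[of _ "\<lambda>_ _ _. 1 :: real"], rule exI[of _ "\<lambda>_ _ _ _. 1 :: real"], intro conjI allI impI)
  show "0 < (1 :: real)" "0 < (1 :: real)" by simp_all
next
  fix lam T :: real and u0 :: "real ^ 'n \<Rightarrow> complex" and u :: "real \<Rightarrow> real ^ 'n \<Rightarrow> complex"
    and ueps :: "real \<Rightarrow> real \<Rightarrow> real ^ 'n \<Rightarrow> complex"
  assume u: "NLS_solution (log_nonlin lam) u0 u" and ueps: "\<forall>\<epsilon>>0. NLS_solution (reg_log_nonlin lam \<epsilon>) u0 (ueps \<epsilon>)" and T: "T > 0"
  define \<alpha> where "\<alpha> = 4 / (4 + real DIM(real ^ 'n))"
  have dim: "DIM(real ^ 'n) \<le> 3" using assms by simp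
  have \<alpha>: "4 / (4 + real CARD('n)) = \<alpha>" "2 / (4 + real CARD('n)) = \<alpha> / 2" by (simp_all add: \<alpha>_def field_simps)
  have mu: "(\<lambda>(t, x). u t x) \<in> borel_measurable borel" using u by (simp add: NLS_solution_def Linf_loc_H2_L22_def)
  have ueps': "NLS_solution (reg_log_nonlin lam \<epsilon>) u0 (ueps \<epsilon>)" if "0 < \<epsilon>" for \<epsilon> using ueps that by blast
  have close: "\<forall>\<^sub>F \<epsilon> in at_right 0. (\<forall>t\<in>{0..T}. L2_norm (\<lambda>x. ueps \<epsilon> t x - u t x) \<le> \<epsilon> powr \<alpha>) \<and>
      (AE t in lborel. t \<in> {0<..<T} \<longrightarrow> (\<lambda>x. ueps \<epsilon> t x - u t x) \<in> Sobolev 2 \<and> Sobolev_norm 1 (\<lambda>x. ueps \<epsilon> t x - u t x) \<le> \<epsilon> powr (\<alpha> / 2))"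
    by (rule solutions_close[OF dim T u[unfolded log_nonlin_eq] ueps' \<alpha>_def])
  show "\<forall>\<^sub>F \<epsilon> in at_right 0.
         Linf_norm {0<..<T} L2 L2_norm (\<lambda>t x. ueps \<epsilon> t x - u t x) \<le> ereal (1 * \<epsilon> powr (4 / (4 + real CARD('n)))) \<and>
         Linf_norm {0<..<T} (Sobolev 1) (Sobolev_norm 1) (\<lambda>t x. ueps \<epsilon> t x - u t x) \<le> ereal (1 * \<epsilon> powr (2 / (4 + real CARD('n))))"
    unfolding \<alpha> mult_1
    using close eventually_at_right_less[of 0]
  proof eventually_elim
    fix \<epsilon> :: real
    assume *: "(\<forall>t\<in>{0..T}. L2_norm (\<lambda>x. ueps \<epsilon> t x - u t x) \<le> \<epsilon> powr \<alpha>) \<and>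
      (AE t in lborel. t \<in> {0<..<T} \<longrightarrow> (\<lambda>x. ueps \<epsilon> t x - u t x) \<in> Sobolev 2 \<and> Sobolev_norm 1 (\<lambda>x. ueps \<epsilon> t x - u t x) \<le> \<epsilon> powr (\<alpha> / 2))" and \<epsilon>: "0 < \<epsilon>"
    note sol = ueps'[OF \<epsilon>]
    have mv: "(\<lambda>(t, x). ueps \<epsilon> t x) \<in> borel_measurable borel" using sol by (simp add: NLS_solution_def Linf_loc_H2_L22_def)
    have [measurable]: "(\<lambda>(t, x). ueps \<epsilon> t x) \<in> borel_measurable (borel \<Otimes>\<^sub>M borel)" "(\<lambda>(t, x). u t x) \<in> borel_measurable (borel \<Otimes>\<^sub>M borel)"
      using mv mu by (simp_all add: borel_prod)
    have me: "(\<lambda>(t, x). ueps \<epsilon> t x - u t x) \<in> borel_measurable borel" unfolding borel_prod[symmetric] by measurable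
    have S: "AE t in lborel. t \<in> {0<..<T} \<longrightarrow> (\<lambda>x. ueps \<epsilon> t x - u t x) \<in> Sobolev 2"
      using conjunct2[OF *] by eventually_elim blast
    have L2: "(\<lambda>x. ueps \<epsilon> t x - u t x) \<in> L2" if "0 \<le> t" for t
      using u sol that continuous_into_L2D(1) by (intro L2_diff) (auto simp: NLS_solution_def)
    have "(\<lambda>t. L2_norm (\<lambda>x. ueps \<epsilon> t x - u t x)) \<in> borel_measurable lborel" unfolding L2_norm_def by measurable
    then have mL: "(\<lambda>t. L2_norm (\<lambda>x. ueps \<epsilon> t x - u t x)) \<in> borel_measurable (lebesgue_on {0<..<T})"
      by (intro measurable_restrict_space1 measurable_completion)
    have "Linf_norm {0<..<T} L2 L2_norm (\<lambda>t x. ueps \<epsilon> t x - u t x) \<le> ereal (\<epsilon> powr \<alpha>)"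
      by (rule Linf_norm_le[where N=L2_norm, OF mL]) (use * L2 in auto)
    moreover have "Linf_norm {0<..<T} (Sobolev 1) (Sobolev_norm 1) (\<lambda>t x. ueps \<epsilon> t x - u t x) \<le> ereal (\<epsilon> powr (\<alpha> / 2))"
    proof (rule Linf_norm_le[where N="Sobolev_norm 1", OF measurable_Sobolev_norm_1[OF me S]])
      show "AE t in lborel. t \<in> {0<..<T} \<longrightarrow> (\<lambda>x. ueps \<epsilon> t x - u t x) \<in> Sobolev 1 \<and> Sobolev_norm 1 (\<lambda>x. ueps \<epsilon> t x - u t x) \<le> \<epsilon> powr (\<alpha> / 2)"
        using conjunct2[OF *] by eventually_elim (blast intro: Sobolev_mono[OF _ one_le_numeral])
    qed
    ultimately show "Linf_norm {0<..<T} L2 L2_norm (\<lambda>t x. ueps \<epsilon> t x - u t x) \<le> ereal (\<epsilon> powr \<alpha>) \<and>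
         Linf_norm {0<..<T} (Sobolev 1) (Sobolev_norm 1) (\<lambda>t x. ueps \<epsilon> t x - u t x) \<le> ereal (\<epsilon> powr (\<alpha> / 2))" ..
  qed
qed

end
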